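(* For every integer $d>0$, $$\mathbb{E}_d(\mathrm{Vol}(\mathcal{A}))\le \frac{3}{2}\ln(d)^2+9\ln(d)+9.$$ Furthermore, $$\liminf_{d\to+\infty}\frac{\mathbb{E}_d(\mathrm{Vol}(\mathcal{A}))}{\ln(d)^2}\ge \frac{3}{4}.$$
   Context: For an integer $d\ge 1$, let $H^0(\mathbb{CP}^2,L^d)$ be the space of homogeneous complex polynomials of degree $d$ in $X_0,X_1,X_2$, of dimension $N_d=(d+1)(d+2)/2$, with the Hermitian product for which distinct monomials are orthogonal and $\|X_0^{i_0}X_1^{i_1}X_2^{i_2}\|^2=\frac{2\,i_0!\,i_1!\,i_2!}{(d+2)!}$ when $i_0+i_1+i_2=d$ (this is the $L^2$ Fubini-Study product normalized by the volume of $\mathbb{CP}^2$). It is equipped with the Gaussian probability measure $\mu$ of density $\pi^{-N_d}e^{-\|P\|^2}$ with respect to the associated Lebesgue measure; $\mathbb{E}_d$ is the expectation with respect to $\mu$. For $P\in H^0(\mathbb{CP}^2,L^d)$, $V_P=\{P=0\}\subset\mathbb{CP}^2$, and $\mathbb{C}^2$ is identified with $\{X_0\ne0\}$ by $(z_1,z_2)\mapsto[1:z_1:z_2]$. With $\mathrm{Log}:(z_1,z_2)\in(\mathbb{C}^\times)^2\mapsto(\ln|z_1|,\ln|z_2|)\in\mathbb{R}^2$, the amoeba of $P$ is $\mathcal{A}(P)=\mathrm{Log}(V_P\cap(\mathbb{C}^\times)^2)$, $\mathrm{Vol}(\mathcal{A}(P))$ is its Lebesgue area, and $\mathbb{E}_d(\mathrm{Vol}(\mathcal{A}))=\int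 \mathrm{Vol}(\mathcal{A}(P))\,d\mu(P)$. *)

theory Defs
  imports "HOL-Probability.Probability"
begin

text \<open>
  A homogeneous polynomial of degree \<open>d\<close> in \<open>X\<^sub>0, X\<^sub>1, X\<^sub>2\<close> is represented by its family of
  coefficients, indexed by the exponents \<open>(i\<^sub>0, i\<^sub>1, i\<^sub>2)\<close> with \<open>i\<^sub>0 + i\<^sub>1 + i\<^sub>2 = d\<close>; the space of
  such polynomials is the space of extensional functions on \<open>exponents d\<close>.
\<close>

definition exponents :: "nat \<Rightarrow> (nat \<times> nat \<times> nat) set" where
  "exponents d = {(i0, i1, i2). i0 + i1 + i2 = d}"

type_synonym hpoly = "nat \<times> nat \<times> nat \<Rightarrow> complex"

definition hpoly_dim :: "nat \<Rightarrow> nat" where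
  "hpoly_dim d = (d + 1) * (d + 2) div 2"

definition hpoly_eval :: "nat \<Rightarrow> hpoly \<Rightarrow> complex \<times> complex \<times> complex \<Rightarrow> complex" where
  "hpoly_eval d P = (\<lambda>(x0, x1, x2).
     \<Sum>(i0, i1, i2)\<in>exponents d. P (i0, i1, i2) * x0 ^ i0 * x1 ^ i1 * x2 ^ i2)"

definition monomial_norm2 :: "nat \<Rightarrow> nat \<times> nat \<times> nat \<Rightarrow> real" where
  "monomial_norm2 d = (\<lambda>(i0, i1, i2). 2 * fact i0 * fact i1 * fact i2 / fact (d + 2))"

text \<open>The Hermitian product for which distinct monomials are orthogonal.\<close>

definition hpoly_inner :: "nat \<Rightarrow> hpoly \<Rightarrow> hpoly \<Rightarrow> complex" where
  "hpoly_inner d P Q =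
     (\<Sum>i\<in>exponents d. P i * cnj (Q i) * complex_of_real (monomial_norm2 d i))"

definition hpoly_norm :: "nat \<Rightarrow> hpoly \<Rightarrow> real" where
  "hpoly_norm d P = sqrt (Re (hpoly_inner d P P))"

text \<open>
  The Lebesgue measure associated with the Hermitian product: the image of the standard Lebesgue
  measure on families \<open>a\<close> of complex numbers under the isometry that sends \<open>a\<close> to the sum of the
  \<open>a i\<close> times the monomial with exponent \<open>i\<close> divided by its norm.
\<close>

definition hpoly_lborel :: "nat \<Rightarrow> hpoly measure" where
  "hpoly_lborel d =
     distr (\<Pi>\<^sub>M i\<in>exponents d. lborel) (\<Pi>\<^sub>M i\<in>exponents d. borel)
       (\<lambda>a. \<lambda>i\<in>exponents d. a i / complex_of_real (sqrt (monomial_norm2 d i)))"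

definition hpoly_gaussian :: "nat \<Rightarrow> hpoly measure" where
  "hpoly_gaussian d =
     density (hpoly_lborel d)
       (\<lambda>P. ennreal (exp (- (hpoly_norm d P)\<^sup>2) / pi ^ hpoly_dim d))"

text \<open>A point of the projective plane is a line through the origin, with the origin removed.\<close>

definition proj_point :: "complex \<times> complex \<times> complex \<Rightarrow> (complex \<times> complex \<times> complex) set" where
  "proj_point = (\<lambda>(x0, x1, x2). {(t * x0, t * x1, t * x2) |t. t \<noteq> 0})"

definition CP2 :: "(complex \<times> complex \<times> complex) set set" where
  "CP2 = {proj_point x |x. x \<noteq> (0, 0, 0)}"

definition zero_locus :: "nat \<Rightarrow> hpoly \<Rightarrow> (complex \<times> complex \<times> complex) set set" where
  "zero_locus d P = {p \<in> CP2. \<forall>x\<in>p. hpoly_eval d P x = 0}"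

definition affine_chart :: "complex \<times> complex \<Rightarrow> (complex \<times> complex \<times> complex) set" where
  "affine_chart = (\<lambda>(z1, z2). proj_point (1, z1, z2))"

definition Log_map :: "complex \<times> complex \<Rightarrow> real \<times> real" where
  "Log_map = (\<lambda>(z1, z2). (ln (cmod z1), ln (cmod z2)))"

definition amoeba :: "nat \<Rightarrow> hpoly \<Rightarrow> (real \<times> real) set" where
  "amoeba d P =
     Log_map ` {(z1, z2). z1 \<noteq> 0 \<and> z2 \<noteq> 0 \<and> affine_chart (z1, z2) \<in> zero_locus d P}"

text \<open>
  The area is taken in the extended nonnegative reals, so that finiteness of the area and of its
  expectation are part of any upper bound (the area is infinite for the zero polynomial).
\<close>

definition amoeba_area :: "nat \<Rightarrow> hpoly \<Rightarrow> ennreal" where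
  "amoeba_area d P = emeasure lebesgue (amoeba d P)"

definition expected_amoeba_area :: "nat \<Rightarrow> ennreal" where
  "expected_amoeba_area d = (\<integral>\<^sup>+ P. amoeba_area d P \<partial>hpoly_gaussian d)"

end

theory Submission
  imports Defs "HOL-Complex_Analysis.Riemann_Mapping" "HOL-Real_Asymp.Real_Asymp"
begin

text \<open>
  Give the torus over a point \<open>x\<close> the weights \<open>t\<^sub>0, t\<^sub>1, t\<^sub>2\<close>, proportional to \<open>1\<close>, \<open>exp (2 * x\<^sub>1)\<close> and
  \<open>exp (2 * x\<^sub>2)\<close>, with sum 1. Up to a scalar, the random polynomial restricts to this torus as a
  stationary Gaussian field whose frequencies follow the trinomial distribution with these weights,
  and \<open>x\<close> lies in the amoeba iff the field has a zero. By Tonelli the expected area is the integral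
  over \<open>x\<close> of the probability of a zero.

  Upper bound: a map from the torus to the plane has degree zero, so generically it has no zero or at
  least two. The Kac-Rice formula bounds the expected number of zeros by
  \<open>2 * pi * d * sqrt (t\<^sub>0 * t\<^sub>1 * t\<^sub>2)\<close>, so a zero has probability at most half of this. The minimum of
  this bound and 1 is integrated separately over the three chambers on which one of
  the \<open>t\<^sub>j\<close> is the largest.

  Lower bound: on the hexagon where every \<open>d * t\<^sub>j\<close> is at least \<open>d\<^sup>e / 3\<close>, the field, in coordinates in which
  its derivatives have covariance one, has almost independent jets at any fixed number of suitable
  points, and each jet has a fixed positive chance of forcing a zero nearby, by Brouwer's theorem.
  Hence the probability of a zero tends to 1 uniformly on the hexagon, of area
  \<open>3 / 4 * (1 - e)\<^sup>2 * (ln d)\<^sup>2\<close>.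
\<close>

section \<open>The complex Gaussian measure\<close>

text \<open>The upper bound never counts zeros. It uses one half of Kac-Rice: if a field has two
  nondegenerate zeros, the normalized integrals of the Jacobian over \<open>|f| < epsilon\<close>
  have lower limit at least 2, and Fatou passes this to expectations. So it is enough to produce a
  second zero and to exclude degenerate zeros almost surely. The lower bound is shaped by a
  competition of powers. Brouwer's theorem on a disc of radius rho asks the value of the field to be
  of order rho, an event of probability of order rho^2, and the higher derivatives to stay below
  order 1/rho. About rho^-2 independent attempts are needed, and each may fail through large
  derivatives; fourth moments bound this by rho^4, so all failures together cost only rho^2. Second
  moments would lose exactly here. The number of points and all tolerances are fixed before the
  degree, because the estimates use only normalized covariances and one exponential moment.
  Decorrelation of distant jets comes from the characteristic function of the frequencies, which is
  exponentially small in d^e on the hexagon.\<close>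

lemma nn_integral_lborel_translate:
  fixes f :: "'a::euclidean_space \<Rightarrow> ennreal"
  assumes [measurable]: "f \<in> borel_measurable borel"
  shows "(\<integral>\<^sup>+x. f (c + x) \<partial>lborel) = (\<integral>\<^sup>+x. f x \<partial>lborel)"
proof -
  have "(\<integral>\<^sup>+x. f x \<partial>lborel) = (\<integral>\<^sup>+x. f x \<partial>distr lborel borel ((+) c))"
    by (simp add: lborel_distr_plus)
  also have "\<dots> = (\<integral>\<^sup>+x. f (c + x) \<partial>lborel)"
    by (subst nn_integral_distr) auto
  finally show ?thesis by simp
qed

text \<open>The abstract factor \<open>S\<close> treats the real line (\<open>|c|\<close>) and the
  complex plane (\<open>|c|^2\<close>) at once. The matrix is split into scalings and shears of one
  variable at a time, so the one-dimensional change of variables, translation invariance and Tonelli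
  suffice.\<close>

lemma nn_integral_linear2:
  fixes S :: "'a::{euclidean_space,real_normed_field} \<Rightarrow> ennreal" and g :: "'a \<times> 'a \<Rightarrow> ennreal"
  assumes S: "\<And>c f. c \<noteq> 0 \<Longrightarrow> f \<in> borel_measurable borel \<Longrightarrow>
      (\<integral>\<^sup>+x. f x \<partial>lborel) = S c * (\<integral>\<^sup>+x. f (c * x) \<partial>lborel)"
    and S_mult: "\<And>a b. S (a * b) = S a * S b" and S1: "S (-1) = 1"
    and g[measurable]: "g \<in> borel_measurable borel"
    and det: "a * d - b * c \<noteq> 0"
  shows "(\<integral>\<^sup>+x. \<integral>\<^sup>+y. g (x, y) \<partial>lborel \<partial>lborel) =
    S (a * d - b * c) * (\<integral>\<^sup>+x. \<integral>\<^sup>+y. g (a * x + b * y, c * x + d * y) \<partial>lborel \<partial>lborel)"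
proof -
  have gm[measurable]: "(\<lambda>z. g (F z, G z)) \<in> borel_measurable M"
    if [measurable]: "F \<in> borel_measurable M" "G \<in> borel_measurable M" for F G and M :: "'m measure"
  proof -
    have "(\<lambda>z. (F z, G z)) \<in> M \<rightarrow>\<^sub>M borel \<Otimes>\<^sub>M borel" by measurable
    then have "(\<lambda>z. (F z, G z)) \<in> M \<rightarrow>\<^sub>M borel" by (simp add: borel_prod)
    then show ?thesis by measurable
  qed
  have SA: "(\<integral>\<^sup>+x. f x \<partial>lborel) = S c * (\<integral>\<^sup>+x. f (t + c * x) \<partial>lborel)"
    if "c \<noteq> 0" and [measurable]: "f \<in> borel_measurable borel" for c t and f :: "'a \<Rightarrow> ennreal"
    using S[OF that(1), of "\<lambda>x. f (t + x)"] nn_integral_lborel_translate[of f t] by simp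
  show ?thesis
  proof (cases "a = 0")
    case False
    \<comment> \<open>Triangular factorization with pivot \<open>a\<close>: the inner substitution
      has slope \<open>det / a\<close>, and after exchanging the integrals the substitution
      \<open>x := b * y + a * x\<close> restores both rows of the matrix.\<close>
    have "(\<integral>\<^sup>+x. \<integral>\<^sup>+y. g (x, y) \<partial>lborel \<partial>lborel)
        = (\<integral>\<^sup>+x. S ((a * d - b * c) / a) * (\<integral>\<^sup>+y. g (x, (c / a) * x + ((a * d - b * c) / a) * y) \<partial>lborel) \<partial>lborel)"
      using det False by (intro nn_integral_cong SA) auto
    also have "\<dots> = S ((a * d - b * c) / a) * (\<integral>\<^sup>+x. (\<integral>\<^sup>+y. g (x, (c / a) * x + ((a * d - b * c) / a) * y) \<partial>lborel) \<partial>lborel)"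
      by (intro nn_integral_cmult) measurable
    also have "(\<integral>\<^sup>+x. (\<integral>\<^sup>+y. g (x, (c / a) * x + ((a * d - b * c) / a) * y) \<partial>lborel) \<partial>lborel)
       = (\<integral>\<^sup>+y. (\<integral>\<^sup>+x. g (x, (c / a) * x + ((a * d - b * c) / a) * y) \<partial>lborel) \<partial>lborel)"
      by (rule lborel_pair.Fubini') measurable
    also have "\<dots> = (\<integral>\<^sup>+y. S a * (\<integral>\<^sup>+x. g (b * y + a * x, (c / a) * (b * y + a * x) + ((a * d - b * c) / a) * y) \<partial>lborel) \<partial>lborel)"
      using False by (intro nn_integral_cong SA) auto
    also have "\<dots> = S a * (\<integral>\<^sup>+y. (\<integral>\<^sup>+x. g (b * y + a * x, (c / a) * (b * y + a * x) + ((a * d - b * c) / a) * y) \<partial>lborel) \<partial>lborel)"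
      by (intro nn_integral_cmult) measurable
    also have "(\<integral>\<^sup>+y. (\<integral>\<^sup>+x. g (b * y + a * x, (c / a) * (b * y + a * x) + ((a * d - b * c) / a) * y) \<partial>lborel) \<partial>lborel)
        = (\<integral>\<^sup>+y. (\<integral>\<^sup>+x. g (a * x + b * y, c * x + d * y) \<partial>lborel) \<partial>lborel)"
      using False by (intro nn_integral_cong arg_cong[where f=g]) (auto simp: field_simps)
    also have "\<dots> = (\<integral>\<^sup>+x. (\<integral>\<^sup>+y. g (a * x + b * y, c * x + d * y) \<partial>lborel) \<partial>lborel)"
      by (rule lborel_pair.Fubini') measurable
    finally show ?thesis
      using False by (simp add: mult.assoc[symmetric] S_mult[symmetric])
  next
    \<comment> \<open>Without the pivot the matrix is antitriangular: the two variables are scaled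
      by \<open>b\<close> and \<open>c\<close> and then exchanged, and \<open>S (-1) = 1\<close>
      absorbs the sign of the determinant \<open>- b * c\<close>.\<close>
    case True
    with det have nz: "b \<noteq> 0" "c \<noteq> 0" by auto
    have "(\<integral>\<^sup>+x. \<integral>\<^sup>+y. g (x, y) \<partial>lborel \<partial>lborel) = S b * (\<integral>\<^sup>+x. \<integral>\<^sup>+y. g (b * x, y) \<partial>lborel \<partial>lborel)"
      using S[of b "\<lambda>x. \<integral>\<^sup>+y. g (x, y) \<partial>lborel"] nz by simp
    also have "(\<integral>\<^sup>+x. \<integral>\<^sup>+y. g (b * x, y) \<partial>lborel \<partial>lborel) = (\<integral>\<^sup>+x. S c * (\<integral>\<^sup>+y. g (b * x, d * x + c * y) \<partial>lborel) \<partial>lborel)"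
      using nz by (intro nn_integral_cong SA) auto
    also have "\<dots> = S c * (\<integral>\<^sup>+x. (\<integral>\<^sup>+y. g (b * x, d * x + c * y) \<partial>lborel) \<partial>lborel)"
      by (intro nn_integral_cmult) measurable
    also have "(\<integral>\<^sup>+x. (\<integral>\<^sup>+y. g (b * x, d * x + c * y) \<partial>lborel) \<partial>lborel) = (\<integral>\<^sup>+y. (\<integral>\<^sup>+x. g (b * x, d * x + c * y) \<partial>lborel) \<partial>lborel)"
      by (rule lborel_pair.Fubini') measurable
    also have "\<dots> = (\<integral>\<^sup>+x. (\<integral>\<^sup>+y. g (b * y, c * x + d * y) \<partial>lborel) \<partial>lborel)"
      by (simp add: add.commute)
    finally have "(\<integral>\<^sup>+x. \<integral>\<^sup>+y. g (x, y) \<partial>lborel \<partial>lborel) =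
        S b * (S c * (\<integral>\<^sup>+x. (\<integral>\<^sup>+y. g (b * y, c * x + d * y) \<partial>lborel) \<partial>lborel))" .
    moreover have "S (a * d - b * c) = S b * S c"
      using True S1 S_mult[of "-1" "b*c"] S_mult[of b c] by simp
    ultimately show ?thesis using True by (simp add: mult.assoc)
  qed
qed

lemma nn_integral_linear2_real:
  fixes g :: "real \<times> real \<Rightarrow> ennreal"
  assumes g[measurable]: "g \<in> borel_measurable borel"
    and det: "a * d - b * c \<noteq> 0"
  shows "(\<integral>\<^sup>+x. \<integral>\<^sup>+y. g (x, y) \<partial>lborel \<partial>lborel) =
    ennreal \<bar>a * d - b * c\<bar> * (\<integral>\<^sup>+x. \<integral>\<^sup>+y. g (a * x + b * y, c * x + d * y) \<partial>lborel \<partial>lborel)"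
proof (rule nn_integral_linear2[where S="\<lambda>c. ennreal \<bar>c\<bar>"])
  fix c :: real and f :: "real \<Rightarrow> ennreal"
  assume "c \<noteq> 0" "f \<in> borel_measurable borel"
  then show "integral\<^sup>N lborel f = ennreal \<bar>c\<bar> * (\<integral>\<^sup>+ x. f (c * x) \<partial>lborel)"
    using nn_integral_real_affine[of f c 0] by simp
qed (use g det in \<open>simp_all add: abs_mult ennreal_mult\<close>)

lemma measurable_Complex[measurable (raw)]:
  assumes [measurable]: "f \<in> borel_measurable M" "g \<in> borel_measurable M"
  shows "(\<lambda>x. Complex (f x) (g x)) \<in> borel_measurable M"
proof -
  have "(\<lambda>x. Complex (f x) (g x)) = (\<lambda>x. complex_of_real (f x) + \<i> * complex_of_real (g x))"
    by (simp add: Complex_eq)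
  then show ?thesis by simp
qed

lemma lborel_complex: "lborel = distr (lborel \<Otimes>\<^sub>M lborel) borel (\<lambda>(x, y). Complex x y)"
proof (rule lborel_eqI)
  have [measurable]: "(\<lambda>(x, y). Complex x y) \<in> borel \<Otimes>\<^sub>M borel \<rightarrow>\<^sub>M borel"
    by measurable
  fix l u :: complex assume le: "\<And>b. b \<in> Basis \<Longrightarrow> l \<bullet> b \<le> u \<bullet> b"
  have "(\<lambda>(x, y). Complex x y) -` box l u = {Re l<..<Re u} \<times> {Im l<..<Im u}"
    by (auto simp: box_def Basis_complex_def)
  moreover have "Re l \<le> Re u" "Im l \<le> Im u" using le[of 1] le[of \<i>] by (auto simp: Basis_complex_def)
  ultimately show "emeasure (distr (lborel \<Otimes>\<^sub>M lborel) borel (\<lambda>(x, y). Complex x y)) (box l u) = (\<Prod>b\<in>Basis. (u - l) \<bullet> b)"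
    by (subst emeasure_distr)
       (auto simp: space_pair_measure Basis_complex_def lborel.emeasure_pair_measure_Times ennreal_mult)
qed simp

lemma nn_integral_lborel_complex:
  fixes f :: "complex \<Rightarrow> ennreal"
  assumes [measurable]: "f \<in> borel_measurable borel"
  shows "(\<integral>\<^sup>+z. f z \<partial>lborel) = (\<integral>\<^sup>+x. \<integral>\<^sup>+y. f (Complex x y) \<partial>lborel \<partial>lborel)"
proof -
  have [measurable]: "(\<lambda>(x, y). Complex x y) \<in> borel \<Otimes>\<^sub>M borel \<rightarrow>\<^sub>M borel"
    by measurable
  have "(\<integral>\<^sup>+z. f z \<partial>lborel) = (\<integral>\<^sup>+z. f (case z of (x, y) \<Rightarrow> Complex x y) \<partial>(lborel \<Otimes>\<^sub>M lborel))"
    by (subst lborel_complex, subst nn_integral_distr) simp_all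
  also have "\<dots> = (\<integral>\<^sup>+x. \<integral>\<^sup>+y. f (Complex x y) \<partial>lborel \<partial>lborel)"
    by (subst lborel.nn_integral_fst[symmetric]) auto
  finally show ?thesis .
qed

text \<open>Multiplication by \<open>c\<close> is the real matrix with rows (Re c, - Im c) and (Im
  c, Re c), of determinant |c|^2.\<close>

lemma nn_integral_complex_scale:
  fixes f :: "complex \<Rightarrow> ennreal"
  assumes f[measurable]: "f \<in> borel_measurable borel" and c: "c \<noteq> 0"
  shows "(\<integral>\<^sup>+z. f z \<partial>lborel) = ennreal ((cmod c)\<^sup>2) * (\<integral>\<^sup>+z. f (c * z) \<partial>lborel)"
proof -
  have d: "Re c * Re c - (- Im c) * Im c = (cmod c)\<^sup>2"
    by (simp add: cmod_power2 flip: power2_eq_square)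
  have fm: "(\<lambda>p. f (Complex (fst p) (snd p))) \<in> borel_measurable borel"
    unfolding borel_prod[symmetric] by measurable
  have "(\<integral>\<^sup>+z. f z \<partial>lborel) = (\<integral>\<^sup>+x. \<integral>\<^sup>+y. f (Complex x y) \<partial>lborel \<partial>lborel)"
    by (rule nn_integral_lborel_complex) simp
  also have "\<dots> = ennreal ((cmod c)\<^sup>2) * (\<integral>\<^sup>+x. \<integral>\<^sup>+y. f (Complex (Re c * x - Im c * y) (Im c * x + Re c * y)) \<partial>lborel \<partial>lborel)"
    using nn_integral_linear2_real[OF fm, of "Re c" "Re c" "- Im c" "Im c"] c unfolding d by simp
  also have "(\<integral>\<^sup>+x. \<integral>\<^sup>+y. f (Complex (Re c * x - Im c * y) (Im c * x + Re c * y)) \<partial>lborel \<partial>lborel)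
      = (\<integral>\<^sup>+x. \<integral>\<^sup>+y. f (c * Complex x y) \<partial>lborel \<partial>lborel)"
  proof -
    have "Complex (Re c * x - Im c * y) (Im c * x + Re c * y) = c * Complex x y" for x y
      by (auto simp: complex_eq_iff)
    then show ?thesis by simp
  qed
  also have "\<dots> = (\<integral>\<^sup>+z. f (c * z) \<partial>lborel)"
    by (rule nn_integral_lborel_complex[symmetric]) measurable
  finally show ?thesis .
qed

lemma nn_integral_linear2_complex:
  fixes g :: "complex \<times> complex \<Rightarrow> ennreal"
  assumes g[measurable]: "g \<in> borel_measurable borel"
    and det: "a * d - b * c \<noteq> 0"
  shows "(\<integral>\<^sup>+x. \<integral>\<^sup>+y. g (x, y) \<partial>lborel \<partial>lborel) =
    ennreal ((cmod (a * d - b * c))\<^sup>2) * (\<integral>\<^sup>+x. \<integral>\<^sup>+y. g (a * x + b * y, c * x + d * y) \<partial>lborel \<partial>lborel)"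
proof (rule nn_integral_linear2[where S="\<lambda>c. ennreal ((cmod c)\<^sup>2)"])
  fix c :: complex and f :: "complex \<Rightarrow> ennreal"
  assume "c \<noteq> 0" "f \<in> borel_measurable borel"
  then show "integral\<^sup>N lborel f = ennreal ((cmod c)\<^sup>2) * (\<integral>\<^sup>+ x. f (c * x) \<partial>lborel)"
    by (intro nn_integral_complex_scale)
qed (use g det in \<open>simp_all add: norm_mult power_mult_distrib ennreal_mult\<close>)

text \<open>Normalized by E |z|^2 = 1, so the real and imaginary parts have variance 1/2. A product
  of such laws is the Gaussian measure on polynomials in orthonormal coordinates.\<close>

definition cgauss :: "complex measure" where
  "cgauss = density lborel (\<lambda>z. ennreal (exp (- (cmod z)\<^sup>2) / pi))"

lemma sets_cgauss[simp, measurable_cong]: "sets cgauss = sets borel"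
  by (simp add: cgauss_def)

lemma space_cgauss[simp]: "space cgauss = UNIV"
  by (simp add: cgauss_def)

lemma nn_integral_cgauss:
  assumes [measurable]: "f \<in> borel_measurable borel"
  shows "(\<integral>\<^sup>+z. f z \<partial>cgauss) = (\<integral>\<^sup>+z. ennreal (exp (- (cmod z)\<^sup>2) / pi) * f z \<partial>lborel)"
  unfolding cgauss_def by (subst nn_integral_density) auto

lemma nn_integral_gauss_half:
  "(\<integral>\<^sup>+x. ennreal (exp (- x\<^sup>2)) \<partial>lborel) = ennreal (sqrt pi)"
proof -
  have "(\<integral>\<^sup>+x. ennreal (exp (- x\<^sup>2)) \<partial>lborel) = (\<integral>\<^sup>+x. ennreal (sqrt pi) * ennreal (normal_density 0 (1/sqrt 2) x) \<partial>lborel)"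
    by (intro nn_integral_cong)
       (simp add: normal_density_def ennreal_mult[symmetric] power_divide real_sqrt_mult field_simps)
  also have "\<dots> = ennreal (sqrt pi) * (\<integral>\<^sup>+x. ennreal (normal_density 0 (1/sqrt 2) x) \<partial>lborel)"
    by (intro nn_integral_cmult) simp
  also have "(\<integral>\<^sup>+x. ennreal (normal_density 0 (1/sqrt 2) x) \<partial>lborel) = 1"
    by (subst nn_integral_eq_integral) auto
  finally show ?thesis by simp
qed

lemma prob_space_cgauss: "prob_space cgauss"
proof
  have "emeasure cgauss (space cgauss) = (\<integral>\<^sup>+z. ennreal (exp (- (cmod z)\<^sup>2) / pi) \<partial>lborel)"
    using nn_integral_cgauss[of "\<lambda>_. 1"] by simp
  also have "\<dots> = (\<integral>\<^sup>+x. \<integral>\<^sup>+y. ennreal (exp (- x\<^sup>2) / pi) * ennreal (exp (- y\<^sup>2)) \<partial>lborel \<partial>lborel)"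
    by (subst nn_integral_lborel_complex)
       (auto simp: cmod_power2 exp_add[symmetric] ennreal_mult[symmetric] intro!: nn_integral_cong)
  also have "\<dots> = (\<integral>\<^sup>+x. ennreal (exp (- x\<^sup>2)) * ennreal (sqrt pi / pi) \<partial>lborel)"
    by (subst nn_integral_cmult) (auto simp: nn_integral_gauss_half ennreal_mult[symmetric] intro!: nn_integral_cong)
  also have "\<dots> = 1"
    by (subst nn_integral_multc) (auto simp: nn_integral_gauss_half ennreal_mult[symmetric])
  finally show "emeasure cgauss (space cgauss) = 1" .
qed

interpretation cgauss: prob_space cgauss by (rule prob_space_cgauss)

lemma nn_integral_cgauss_phase:
  fixes f :: "complex \<Rightarrow> ennreal"
  assumes f[measurable]: "f \<in> borel_measurable borel" and c: "cmod c = 1"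
  shows "(\<integral>\<^sup>+z. f (c * z) \<partial>cgauss) = (\<integral>\<^sup>+z. f z \<partial>cgauss)"
proof -
  have "c \<noteq> 0" using c by auto
  then show ?thesis
  unfolding nn_integral_cgauss[OF f] using c
  by (subst nn_integral_complex_scale[where c=c], simp, simp, subst nn_integral_cgauss)
     (auto simp: norm_mult)
qed

text \<open>The matrix with rows (a, b) and (- cnj b, cnj a) has determinant 1 and preserves |x|^2 +
  |y|^2; Lebesgue measure and the joint density are therefore both invariant.\<close>

lemma nn_integral_cgauss_unitary:
  fixes g :: "complex \<times> complex \<Rightarrow> ennreal"
  assumes g[measurable]: "g \<in> borel_measurable borel" and ab: "(cmod a)\<^sup>2 + (cmod b)\<^sup>2 = 1"
  shows "(\<integral>\<^sup>+x. \<integral>\<^sup>+y. g (a * x + b * y, - cnj b * x + cnj a * y) \<partial>cgauss \<partial>cgauss)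
    = (\<integral>\<^sup>+x. \<integral>\<^sup>+y. g (x, y) \<partial>cgauss \<partial>cgauss)"
proof -
  have gm[measurable]: "(\<lambda>z. g (F z, G z)) \<in> borel_measurable M"
    if [measurable]: "F \<in> borel_measurable M" "G \<in> borel_measurable M" for F G and M :: "'m measure"
  proof -
    have "(\<lambda>z. (F z, G z)) \<in> M \<rightarrow>\<^sub>M borel \<Otimes>\<^sub>M borel" by measurable
    then have "(\<lambda>z. (F z, G z)) \<in> M \<rightarrow>\<^sub>M borel" by (simp add: borel_prod)
    then show ?thesis by measurable
  qed
  have cg: "(\<integral>\<^sup>+x. \<integral>\<^sup>+y. h (x, y) \<partial>cgauss \<partial>cgauss)
      = (\<integral>\<^sup>+x. \<integral>\<^sup>+y. ennreal (exp (- ((cmod x)\<^sup>2 + (cmod y)\<^sup>2)) / pi^2) * h (x, y) \<partial>lborel \<partial>lborel)"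
    if h: "h \<in> borel_measurable (borel \<Otimes>\<^sub>M borel)" for h :: "complex \<times> complex \<Rightarrow> ennreal"
  proof -
    note h[measurable]
    have "(\<integral>\<^sup>+x. \<integral>\<^sup>+y. h (x, y) \<partial>cgauss \<partial>cgauss)
      = (\<integral>\<^sup>+x. ennreal (exp (- (cmod x)\<^sup>2) / pi) * (\<integral>\<^sup>+y. ennreal (exp (- (cmod y)\<^sup>2) / pi) * h (x, y) \<partial>lborel) \<partial>lborel)"
      by (subst nn_integral_cgauss) (auto simp: nn_integral_cgauss)
    also have "\<dots> = (\<integral>\<^sup>+x. (\<integral>\<^sup>+y. ennreal (exp (- (cmod x)\<^sup>2) / pi) * (ennreal (exp (- (cmod y)\<^sup>2) / pi) * h (x, y)) \<partial>lborel) \<partial>lborel)"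
      by (intro nn_integral_cong nn_integral_cmult[symmetric]) measurable
    also have "\<dots> = (\<integral>\<^sup>+x. \<integral>\<^sup>+y. ennreal (exp (- ((cmod x)\<^sup>2 + (cmod y)\<^sup>2)) / pi^2) * h (x, y) \<partial>lborel \<partial>lborel)"
      by (intro nn_integral_cong)
         (simp add: mult.assoc[symmetric] ennreal_mult[symmetric] exp_add[symmetric] power2_eq_square)
    finally show ?thesis .
  qed
  have ab': "a * cnj a + b * cnj b = 1"
    by (simp only: complex_norm_square[symmetric] of_real_add[symmetric] ab) simp
  have nrm: "(cmod (a * x + b * y))\<^sup>2 + (cmod (- cnj b * x + cnj a * y))\<^sup>2 = (cmod x)\<^sup>2 + (cmod y)\<^sup>2" for x y
  proof -
    have "(a * x + b * y) * cnj (a * x + b * y) + (- cnj b * x + cnj a * y) * cnj (- cnj b * x + cnj a * y)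
       = (a * cnj a + b * cnj b) * (x * cnj x + y * cnj y)"
      by (simp add: algebra_simps)
    also have "\<dots> = x * cnj x + y * cnj y" by (simp only: ab') simp
    finally show ?thesis
      by (simp only: complex_norm_square[symmetric] of_real_add[symmetric] of_real_eq_iff)
  qed
  have m: "(\<lambda>p. g (a * fst p + b * snd p, - cnj b * fst p + cnj a * snd p)) \<in> borel_measurable (borel \<Otimes>\<^sub>M borel)"
    by measurable
  have m2: "(\<lambda>p. ennreal (exp (- ((cmod (fst p))\<^sup>2 + (cmod (snd p))\<^sup>2)) / pi^2) * g p) \<in> borel_measurable borel"
    unfolding borel_prod[symmetric] by (measurable, simp add: borel_prod)
  have det: "a * cnj a - b * (- cnj b) = 1" using ab' by simp
  show ?thesis
    using cg[OF m, simplified] cg[of g, OF g[unfolded borel_prod[symmetric]]]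
      nn_integral_linear2_complex[OF m2, of a "cnj a" b "- cnj b"] det
    by (simp add: nrm[simplified])
qed

section \<open>Independent complex Gaussians\<close>

abbreviation gauss_PiM :: "'i set \<Rightarrow> ('i \<Rightarrow> complex) measure" where
  "gauss_PiM I \<equiv> PiM I (\<lambda>_. cgauss)"

interpretation gauss_PiM: product_prob_space "\<lambda>_. cgauss" UNIV
  by unfold_locales

lemma prob_space_gauss_PiM: "prob_space (gauss_PiM I)"
  by (intro prob_space_PiM prob_space_cgauss)

text \<open>Tonelli isolates the two rotated coordinates; with all others frozen, the invariance of
  a pair of Gaussians applies.\<close>

lemma gauss_PiM_rotate:
  fixes F :: "('i \<Rightarrow> complex) \<Rightarrow> ennreal"
  assumes I: "finite I" "i \<in> I" "j \<in> I" "i \<noteq> j"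
    and F[measurable]: "F \<in> borel_measurable (gauss_PiM I)"
    and ab: "(cmod a)\<^sup>2 + (cmod b)\<^sup>2 = 1"
  shows "(\<integral>\<^sup>+x. F (x(j := - cnj b * x i + cnj a * x j, i := a * x i + b * x j)) \<partial>gauss_PiM I) = (\<integral>\<^sup>+x. F x \<partial>gauss_PiM I)"
proof -
  define K where "K = I - {i, j}"
  have K: "finite K" "j \<notin> K" "i \<notin> insert j K" "I = insert i (insert j K)" "finite (insert j K)"
    using I by (auto simp: K_def)
  define R where "R = (\<lambda>x :: 'i \<Rightarrow> complex. x(j := - cnj b * x i + cnj a * x j, i := a * x i + b * x j))"
  have upd: "(\<lambda>x. x(k := h x)) \<in> gauss_PiM I \<rightarrow>\<^sub>M gauss_PiM I" if "k \<in> I" "h \<in> borel_measurable (gauss_PiM I)" for k h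
    using that by (intro measurable_fun_upd[where J=I]) (auto simp: insert_absorb)
  have [measurable]: "(\<lambda>x. x i) \<in> borel_measurable (gauss_PiM I)" "(\<lambda>x. x j) \<in> borel_measurable (gauss_PiM I)"
    using I by measurable
  have R: "R \<in> gauss_PiM I \<rightarrow>\<^sub>M gauss_PiM I"
  proof -
    have "(\<lambda>x. (x(j := - cnj b * x i + cnj a * x j))(i := a * x i + b * x j)) \<in> gauss_PiM I \<rightarrow>\<^sub>M gauss_PiM I"
      using I by (intro measurable_fun_upd[where J=I] upd) (auto simp: insert_absorb)
    then show ?thesis by (simp add: R_def)
  qed
  have int: "(\<integral>\<^sup>+x. G x \<partial>gauss_PiM I) = (\<integral>\<^sup>+x. (\<integral>\<^sup>+z. \<integral>\<^sup>+y. G (x(j := z, i := y)) \<partial>cgauss \<partial>cgauss) \<partial>gauss_PiM K)"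
    if G: "G \<in> borel_measurable (gauss_PiM I)" for G :: "('i \<Rightarrow> complex) \<Rightarrow> ennreal"
  proof -
    note G'[measurable] = G[unfolded K(4)]
    have "(\<integral>\<^sup>+x. G x \<partial>gauss_PiM I) = (\<integral>\<^sup>+x. (\<integral>\<^sup>+y. G (x(i := y)) \<partial>cgauss) \<partial>gauss_PiM (insert j K))"
      unfolding K(4) using K by (intro gauss_PiM.product_nn_integral_insert G') auto
    also have "\<dots> = (\<integral>\<^sup>+x. (\<integral>\<^sup>+z. \<integral>\<^sup>+y. G (x(j := z, i := y)) \<partial>cgauss \<partial>cgauss) \<partial>gauss_PiM K)"
      using K by (intro gauss_PiM.product_nn_integral_insert) auto
    finally show ?thesis .
  qed
  have "(\<integral>\<^sup>+x. F (R x) \<partial>gauss_PiM I) = (\<integral>\<^sup>+x. (\<integral>\<^sup>+z. \<integral>\<^sup>+y. F (R (x(j := z, i := y))) \<partial>cgauss \<partial>cgauss) \<partial>gauss_PiM K)"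
    by (intro int measurable_compose[OF R F])
  also have "\<dots> = (\<integral>\<^sup>+x. (\<integral>\<^sup>+z. \<integral>\<^sup>+y. F (x(j := z, i := y)) \<partial>cgauss \<partial>cgauss) \<partial>gauss_PiM K)"
  proof (rule nn_integral_cong)
    fix x assume x: "x \<in> space (gauss_PiM K)"
    have "(\<lambda>p. x(j := fst p)) \<in> cgauss \<Otimes>\<^sub>M cgauss \<rightarrow>\<^sub>M gauss_PiM (insert j K)"
      by (rule measurable_fun_upd[where J=K]) (use x in auto)
    then have "(\<lambda>p. x(j := fst p, i := snd p)) \<in> cgauss \<Otimes>\<^sub>M cgauss \<rightarrow>\<^sub>M gauss_PiM I"
      unfolding K(4) by (intro measurable_fun_upd[OF _ \<open>(\<lambda>p. x(j := fst p)) \<in> _\<close>]) auto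
    then have "(\<lambda>p. F (x(j := fst p, i := snd p))) \<in> borel_measurable (cgauss \<Otimes>\<^sub>M cgauss)"
      by measurable
    then have g: "(\<lambda>p. F (x(j := fst p, i := snd p))) \<in> borel_measurable borel"
      by (simp add: borel_prod[symmetric] cong: measurable_cong_sets)
    \<comment> \<open>The outer integration variable is coordinate \<open>j\<close>, so the rotation
      is read with its rows exchanged: the parameters become \<open>cnj a\<close> and
      \<open>- cnj b\<close>.\<close>
    have ab': "(cmod (cnj a))\<^sup>2 + (cmod (- cnj b))\<^sup>2 = 1" using ab by simp
    show "(\<integral>\<^sup>+z. \<integral>\<^sup>+y. F (R (x(j := z, i := y))) \<partial>cgauss \<partial>cgauss) = (\<integral>\<^sup>+z. \<integral>\<^sup>+y. F (x(j := z, i := y)) \<partial>cgauss \<partial>cgauss)"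
      using nn_integral_cgauss_unitary[OF g ab'] I
      by (simp add: R_def fun_upd_twist add.commute)
  qed
  also have "\<dots> = (\<integral>\<^sup>+x. F x \<partial>gauss_PiM I)"
    by (rule int[symmetric]) simp
  finally show ?thesis by (simp add: R_def)
qed

lemma gauss_PiM_phase:
  fixes F :: "('i \<Rightarrow> complex) \<Rightarrow> ennreal"
  assumes I: "finite I" "i \<in> I"
    and F[measurable]: "F \<in> borel_measurable (gauss_PiM I)"
    and c: "cmod c = 1"
  shows "(\<integral>\<^sup>+x. F (x(i := c * x i)) \<partial>gauss_PiM I) = (\<integral>\<^sup>+x. F x \<partial>gauss_PiM I)"
proof -
  define K where "K = I - {i}"
  have K: "finite K" "i \<notin> K" "I = insert i K" using I by (auto simp: K_def)
  have [measurable]: "(\<lambda>x. x i) \<in> borel_measurable (gauss_PiM I)" using I by measurable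
  have R: "(\<lambda>x. x(i := c * x i)) \<in> gauss_PiM I \<rightarrow>\<^sub>M gauss_PiM I"
    using I by (intro measurable_fun_upd[where J=I]) (auto simp: insert_absorb)
  have int: "(\<integral>\<^sup>+x. G x \<partial>gauss_PiM I) = (\<integral>\<^sup>+x. (\<integral>\<^sup>+y. G (x(i := y)) \<partial>cgauss) \<partial>gauss_PiM K)"
    if G: "G \<in> borel_measurable (gauss_PiM I)" for G :: "('i \<Rightarrow> complex) \<Rightarrow> ennreal"
    unfolding K(3) using K by (intro gauss_PiM.product_nn_integral_insert G[unfolded K(3)]) auto
  have "(\<integral>\<^sup>+x. F (x(i := c * x i)) \<partial>gauss_PiM I) = (\<integral>\<^sup>+x. (\<integral>\<^sup>+y. F ((x(i := y))(i := c * (x(i := y)) i)) \<partial>cgauss) \<partial>gauss_PiM K)"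
    by (intro int measurable_compose[OF R F])
  also have "\<dots> = (\<integral>\<^sup>+x. (\<integral>\<^sup>+y. F (x(i := y)) \<partial>cgauss) \<partial>gauss_PiM K)"
  proof (rule nn_integral_cong)
    fix x assume x: "x \<in> space (gauss_PiM K)"
    have "(\<lambda>y. x(i := y)) \<in> cgauss \<rightarrow>\<^sub>M gauss_PiM I"
      unfolding K(3) by (rule measurable_fun_upd[where J=K]) (use x in auto)
    then have "(\<lambda>y. F (x(i := y))) \<in> borel_measurable cgauss"
      by measurable
    then have "(\<lambda>y. F (x(i := y))) \<in> borel_measurable borel"
      by (simp cong: measurable_cong_sets)
    from nn_integral_cgauss_phase[OF this c]
    show "(\<integral>\<^sup>+y. F ((x(i := y))(i := c * (x(i := y)) i)) \<partial>cgauss) = (\<integral>\<^sup>+y. F (x(i := y)) \<partial>cgauss)"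
      by simp
  qed
  also have "\<dots> = (\<integral>\<^sup>+x. F x \<partial>gauss_PiM I)"
    by (rule int[symmetric]) simp
  finally show ?thesis .
qed

text \<open>\<open>H\<close> acts on coefficient vectors of linear forms and preserves their
  Hermitian product; \<open>R\<close> is its transpose, acting on samples. Building the invariance
  of the measure into the notion makes it closed under composition, so no determinant of a large
  matrix is ever needed.\<close>

definition gauss_unitary :: "'i set \<Rightarrow> (('i \<Rightarrow> complex) \<Rightarrow> ('i \<Rightarrow> complex)) \<Rightarrow> bool" where
  "gauss_unitary I H \<longleftrightarrow>
    (\<forall>u v. (\<Sum>i\<in>I. H u i * cnj (H v i)) = (\<Sum>i\<in>I. u i * cnj (v i))) \<and>
    (\<exists>R. R \<in> gauss_PiM I \<rightarrow>\<^sub>M gauss_PiM I \<and>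
      (\<forall>F. F \<in> borel_measurable (gauss_PiM I) \<longrightarrow> (\<integral>\<^sup>+x. F (R x) \<partial>gauss_PiM I) = (\<integral>\<^sup>+x. F x \<partial>gauss_PiM I :: ennreal)) \<and>
      (\<forall>x v. (\<Sum>i\<in>I. R x i * v i) = (\<Sum>i\<in>I. x i * H v i)))"

lemma gauss_unitary_comp:
  assumes "gauss_unitary I H1" "gauss_unitary I H2"
  shows "gauss_unitary I (\<lambda>v. H2 (H1 v))"
proof -
  from assms(1) obtain R1 where 1: "R1 \<in> gauss_PiM I \<rightarrow>\<^sub>M gauss_PiM I"
     "\<And>F. F \<in> borel_measurable (gauss_PiM I) \<Longrightarrow> (\<integral>\<^sup>+x. F (R1 x) \<partial>gauss_PiM I) = (\<integral>\<^sup>+x. F x \<partial>gauss_PiM I :: ennreal)"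
     "\<And>x v. (\<Sum>i\<in>I. R1 x i * v i) = (\<Sum>i\<in>I. x i * H1 v i)"
    unfolding gauss_unitary_def by blast
  from assms(2) obtain R2 where 2: "R2 \<in> gauss_PiM I \<rightarrow>\<^sub>M gauss_PiM I"
     "\<And>F. F \<in> borel_measurable (gauss_PiM I) \<Longrightarrow> (\<integral>\<^sup>+x. F (R2 x) \<partial>gauss_PiM I) = (\<integral>\<^sup>+x. F x \<partial>gauss_PiM I :: ennreal)"
     "\<And>x v. (\<Sum>i\<in>I. R2 x i * v i) = (\<Sum>i\<in>I. x i * H2 v i)"
    unfolding gauss_unitary_def by blast
  have "(\<integral>\<^sup>+x. F (R1 (R2 x)) \<partial>gauss_PiM I) = (\<integral>\<^sup>+x. F x \<partial>gauss_PiM I :: ennreal)"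
    if "F \<in> borel_measurable (gauss_PiM I)" for F
    using 2(2)[of "\<lambda>x. F (R1 x)"] 1(1) 1(2)[OF that] that by simp
  moreover have "(\<lambda>x. R1 (R2 x)) \<in> gauss_PiM I \<rightarrow>\<^sub>M gauss_PiM I"
    using 1(1) 2(1) by measurable
  moreover have "(\<Sum>i\<in>I. R1 (R2 x) i * v i) = (\<Sum>i\<in>I. x i * H2 (H1 v) i)" for x v
    by (simp add: 1(3) 2(3))
  ultimately show ?thesis
    using assms unfolding gauss_unitary_def by (intro conjI allI exI[of _ "\<lambda>x. R1 (R2 x)"]) auto
qed

lemma gauss_unitary_rotate:
  fixes i j :: 'i
  assumes I: "finite I" "i \<in> I" "j \<in> I" "i \<noteq> j" and ab: "(cmod a)\<^sup>2 + (cmod b)\<^sup>2 = 1"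
  shows "gauss_unitary I (\<lambda>v. v(i := a * v i - cnj b * v j, j := b * v i + cnj a * v j))"
proof -
  define K where "K = I - {i, j}"
  have K: "finite K" "j \<notin> K" "i \<notin> insert j K" "I = insert i (insert j K)" "finite (insert j K)"
    using I by (auto simp: K_def)
  define R where "R = (\<lambda>x :: 'i \<Rightarrow> complex. x(j := - cnj b * x i + cnj a * x j, i := a * x i + b * x j))"
  define H where "H = (\<lambda>v. v(i := a * v i - cnj b * v j, j := b * v i + cnj a * v j))"
  have ab': "a * cnj a + b * cnj b = 1"
    by (simp only: complex_norm_square[symmetric] of_real_add[symmetric] ab) simp
  have [measurable]: "(\<lambda>x. x i) \<in> borel_measurable (gauss_PiM I)" "(\<lambda>x. x j) \<in> borel_measurable (gauss_PiM I)"
    using I by measurable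
  have R: "R \<in> gauss_PiM I \<rightarrow>\<^sub>M gauss_PiM I"
  proof -
    have "(\<lambda>x. (x(j := - cnj b * x i + cnj a * x j))(i := a * x i + b * x j)) \<in> gauss_PiM I \<rightarrow>\<^sub>M gauss_PiM I"
      using I by (intro measurable_fun_upd[where J=I]) (auto simp: insert_absorb)
    then show ?thesis by (simp add: R_def)
  qed
  have S: "(\<Sum>k\<in>I. f k) = f i + f j + (\<Sum>k\<in>K. f k)" for f :: "'i \<Rightarrow> complex"
    unfolding K(4) using K by (simp add: add.assoc)
  have Hs: "H v i = a * v i - cnj b * v j" "H v j = b * v i + cnj a * v j" "k \<in> K \<Longrightarrow> H v k = v k" for v k
    using K I by (auto simp: H_def)
  have Rs: "R v j = - cnj b * v i + cnj a * v j" "R v i = a * v i + b * v j" "k \<in> K \<Longrightarrow> R v k = v k" for v k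
    using K I by (auto simp: R_def)
  have 1: "(\<Sum>k\<in>I. H u k * cnj (H v k)) = (\<Sum>k\<in>I. u k * cnj (v k))" for u v
  proof -
    have "(a * u i - cnj b * u j) * cnj (a * v i - cnj b * v j) + (b * u i + cnj a * u j) * cnj (b * v i + cnj a * v j)
        = (a * cnj a + b * cnj b) * (u i * cnj (v i) + u j * cnj (v j))"
      by (simp add: algebra_simps)
    moreover have "(\<Sum>k\<in>K. H u k * cnj (H v k)) = (\<Sum>k\<in>K. u k * cnj (v k))"
      by (simp add: Hs)
    ultimately show ?thesis unfolding S by (simp add: Hs(1,2) ab')
  qed
  have 2: "(\<Sum>k\<in>I. R x k * v k) = (\<Sum>k\<in>I. x k * H v k)" for x v
  proof -
    have "(\<Sum>k\<in>K. R x k * v k) = (\<Sum>k\<in>K. x k * H v k)"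
      by (simp add: Hs Rs)
    then show ?thesis unfolding S by (simp add: Hs(1,2) Rs(1,2) algebra_simps)
  qed
  have 3: "(\<integral>\<^sup>+x. F (R x) \<partial>gauss_PiM I) = (\<integral>\<^sup>+x. F x \<partial>gauss_PiM I)" if "F \<in> borel_measurable (gauss_PiM I)" for F
    unfolding R_def by (rule gauss_PiM_rotate) (use I ab that in auto)
  show ?thesis
    unfolding H_def[symmetric] gauss_unitary_def using R 1 2 3 by blast
qed

lemma gauss_unitary_phase:
  fixes i :: 'i
  assumes I: "finite I" "i \<in> I" and c: "cmod c = 1"
  shows "gauss_unitary I (\<lambda>v. v(i := c * v i))"
proof -
  have [measurable]: "(\<lambda>x. x i) \<in> borel_measurable (gauss_PiM I)" using I by measurable
  have R: "(\<lambda>x. x(i := c * x i)) \<in> gauss_PiM I \<rightarrow>\<^sub>M gauss_PiM I"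
    using I by (intro measurable_fun_upd[where J=I]) (auto simp: insert_absorb)
  have "c * cnj c = 1" using c by (simp flip: complex_norm_square)
  then have "(c * u i) * cnj (c * v i) = u i * cnj (v i)" for u v :: "'i \<Rightarrow> complex"
    by (metis (no_types, lifting) complex_cnj_mult mult.assoc mult.left_commute mult.left_neutral)
  then have 1: "(\<Sum>k\<in>I. (u(i := c * u i)) k * cnj ((v(i := c * v i)) k)) = (\<Sum>k\<in>I. u k * cnj (v k))" for u v
    by (intro sum.cong) auto
  have 2: "(\<Sum>k\<in>I. (x(i := c * x i)) k * v k) = (\<Sum>k\<in>I. x k * (v(i := c * v i)) k)" for x v
    by (intro sum.cong) auto
  show ?thesis
    unfolding gauss_unitary_def using R 1 2 gauss_PiM_phase[OF I _ c] by blast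
qed

text \<open>Elimination by plane rotations: \<open>S\<close> carries the support of
  \<open>w\<close>, each rotation annihilates one entry, and when a single entry is left it has
  modulus one and a phase turns it into 1.\<close>

lemma gauss_unitary_to_basis:
  fixes w :: "'i \<Rightarrow> complex"
  assumes "finite I" "S \<subseteq> I" "\<And>i. i \<in> I - S \<Longrightarrow> w i = 0" "(\<Sum>i\<in>I. w i * cnj (w i)) = 1"
  shows "\<exists>H i0. gauss_unitary I H \<and> i0 \<in> I \<and> (\<forall>i\<in>I. H w i = (if i = i0 then 1 else 0))"
  using assms
proof (induction "card S" arbitrary: S w rule: less_induct)
  case less
  have finS: "finite S" using less.prems finite_subset by blast
  have "S \<noteq> {}"
  proof
    assume "S = {}"
    then have "(\<Sum>i\<in>I. w i * cnj (w i)) = 0" using less.prems by (intro sum.neutral) auto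
    with less.prems show False by simp
  qed
  then obtain i where i: "i \<in> S" by blast
  then have iI: "i \<in> I" using less.prems by auto
  show ?case
  proof (cases "S = {i}")
    case True
    have "(\<Sum>k\<in>I. w k * cnj (w k)) = (\<Sum>k\<in>I. if k = i then w i * cnj (w i) else 0)"
      using less.prems True by (intro sum.cong) auto
    with less.prems iI have wi: "w i * cnj (w i) = 1" by simp
    then have "complex_of_real ((cmod (w i))\<^sup>2) = 1" by (metis complex_norm_square)
    then have "(cmod (w i))\<^sup>2 = 1" by (simp only: of_real_eq_1_iff)
    then have "cmod (cnj (w i)) = 1" using norm_ge_zero[of "w i"] unfolding power2_eq_1_iff by auto
    from gauss_unitary_phase[OF less.prems(1) iI this] wi less.prems True iI
    show ?thesis by (intro exI[of _ "\<lambda>v. v(i := cnj (w i) * v i)"] exI[of _ i]) (auto simp: mult.commute)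
  next
    case False
    with i obtain j where j: "j \<in> S" "j \<noteq> i" by blast
    then have jI: "j \<in> I" using less.prems by auto
    show ?thesis
    proof (cases "w j = 0")
      case True
      show ?thesis
      proof (rule less.hyps[of "S - {j}"])
        show "card (S - {j}) < card S" using finS j by (meson card_Diff1_less)
      qed (use less.prems True in auto)
    next
      case nz: False
      define r where "r = sqrt ((cmod (w i))\<^sup>2 + (cmod (w j))\<^sup>2)"
      have r2: "r\<^sup>2 = (cmod (w i))\<^sup>2 + (cmod (w j))\<^sup>2" by (simp add: r_def)
      have rpos: "r > 0" using nz by (auto simp: r_def intro: add_nonneg_pos)
      \<comment> \<open>Chosen so that the new entry \<open>b * w i + cnj a * w j\<close>
        vanishes.\<close>
      define a b where "a = cnj (w i) / r" and "b = - w j / r"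
      have "(cmod a)\<^sup>2 + (cmod b)\<^sup>2 = ((cmod (w i))\<^sup>2 + (cmod (w j))\<^sup>2) / r\<^sup>2"
        using rpos by (simp add: a_def b_def norm_divide power_divide add_divide_distrib)
      then have ab: "(cmod a)\<^sup>2 + (cmod b)\<^sup>2 = 1" using r2 rpos nz by simp
      define H where "H = (\<lambda>v :: 'i \<Rightarrow> complex. v(i := a * v i - cnj b * v j, j := b * v i + cnj a * v j))"
      have H: "gauss_unitary I H"
        unfolding H_def using less.prems(1) iI jI j ab by (intro gauss_unitary_rotate) auto
      have "H w j = 0" using rpos by (simp add: H_def a_def b_def)
      then have "w' = H w \<Longrightarrow> \<exists>H' i0. gauss_unitary I H' \<and> i0 \<in> I \<and> (\<forall>i\<in>I. H' w' i = (if i = i0 then 1 else 0))" for w'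
      proof (intro less.hyps[of "S - {j}"])
        show "card (S - {j}) < card S" using finS j by (meson card_Diff1_less)
        show "w' = H w \<Longrightarrow> (\<Sum>i\<in>I. w' i * cnj (w' i)) = 1"
          using H less.prems unfolding gauss_unitary_def by simp
        show "\<And>k. w' = H w \<Longrightarrow> H w j = 0 \<Longrightarrow> k \<in> I - (S - {j}) \<Longrightarrow> w' k = 0"
          using less.prems i by (auto simp: H_def)
      qed (use less.prems in auto)
      then obtain H' i0 where H': "gauss_unitary I H'" "i0 \<in> I" "\<forall>i\<in>I. H' (H w) i = (if i = i0 then 1 else 0)"
        by blast
      show ?thesis
        using gauss_unitary_comp[OF H H'(1)] H'(2,3) by blast
    qed
  qed
qed

definition orthonormal_on :: "'i set \<Rightarrow> 'j set \<Rightarrow> ('j \<Rightarrow> 'i \<Rightarrow> complex) \<Rightarrow> bool" where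
  "orthonormal_on I J w \<longleftrightarrow> (\<forall>j\<in>J. \<forall>k\<in>J. (\<Sum>i\<in>I. w j i * cnj (w k i)) = (if j = k then 1 else 0))"

lemma measurable_lins_gauss_PiM:
  "(\<lambda>x. \<lambda>j\<in>J. \<Sum>i\<in>I. x i * w j i) \<in> gauss_PiM I \<rightarrow>\<^sub>M gauss_PiM J"
  by (intro measurable_restrict) (simp cong: measurable_cong_sets)

text \<open>Induction on the family: a product of rotations of pairs of coordinates takes one member to a
  basis vector, and then the other members do not involve that coordinate.\<close>

theorem nn_integral_gauss_orthonormal:
  fixes w :: "'j \<Rightarrow> 'i \<Rightarrow> complex"
  assumes "finite J" "finite I" "orthonormal_on I J w" "g \<in> borel_measurable (gauss_PiM J)"
  shows "(\<integral>\<^sup>+x. g (\<lambda>j\<in>J. \<Sum>i\<in>I. x i * w j i) \<partial>gauss_PiM I) = (\<integral>\<^sup>+y. g y \<partial>gauss_PiM J)"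
  using assms
proof (induction J arbitrary: I w g rule: finite_induct)
  case empty
  interpret prob_space "gauss_PiM I" by (rule prob_space_gauss_PiM)
  have "(\<integral>\<^sup>+x. g (\<lambda>j\<in>{}. \<Sum>i\<in>I. x i * w j i) \<partial>gauss_PiM I) = g (\<lambda>_. undefined)"
    by (simp add: restrict_def emeasure_space_1)
  also have "\<dots> = (\<integral>\<^sup>+y. g y \<partial>gauss_PiM {})"
    by (simp add: gauss_PiM.nn_integral_empty)
  finally show ?case .
next
  case (insert k J)
  have "\<exists>H i0. gauss_unitary I H \<and> i0 \<in> I \<and> (\<forall>i\<in>I. H (w k) i = (if i = i0 then 1 else 0))"
    by (rule gauss_unitary_to_basis[of I I]) (use insert.prems in \<open>auto simp: orthonormal_on_def\<close>)
  then obtain H i0 where H: "gauss_unitary I H" "i0 \<in> I" "\<And>i. i \<in> I \<Longrightarrow> H (w k) i = (if i = i0 then 1 else 0)"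
    by blast
  from H(1) obtain R where R: "R \<in> gauss_PiM I \<rightarrow>\<^sub>M gauss_PiM I"
     "\<And>F. F \<in> borel_measurable (gauss_PiM I) \<Longrightarrow> (\<integral>\<^sup>+x. F (R x) \<partial>gauss_PiM I) = (\<integral>\<^sup>+x. F x \<partial>gauss_PiM I :: ennreal)"
     "\<And>x v. (\<Sum>i\<in>I. R x i * v i) = (\<Sum>i\<in>I. x i * H v i)"
    and Hu: "\<And>u v. (\<Sum>i\<in>I. H u i * cnj (H v i)) = (\<Sum>i\<in>I. u i * cnj (v i))"
    unfolding gauss_unitary_def by blast
  define K where "K = I - {i0}"
  have K: "finite K" "i0 \<notin> K" "I = insert i0 K" using insert.prems H(2) by (auto simp: K_def)
  have H0: "H (w j) i0 = 0" if "j \<in> J" for j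
  proof -
    have "(\<Sum>i\<in>I. H (w j) i * cnj (H (w k) i)) = (\<Sum>i\<in>I. if i = i0 then H (w j) i0 else 0)"
      using H(3) by (intro sum.cong) auto
    also have "\<dots> = H (w j) i0" using H(2) insert.prems by simp
    finally show ?thesis
      using Hu[of "w j" "w k"] \<open>j \<in> J\<close> \<open>k \<notin> J\<close> insert.prems by (auto simp: orthonormal_on_def split: if_splits)
  qed
  have on: "orthonormal_on K J (\<lambda>j. H (w j))"
    unfolding orthonormal_on_def
  proof (intro ballI)
    fix j l assume jl: "j \<in> J" "l \<in> J"
    have "(\<Sum>i\<in>I. H (w j) i * cnj (H (w l) i)) = (\<Sum>i\<in>K. H (w j) i * cnj (H (w l) i))"
      unfolding K(3) using K(1,2) H0 jl by simp
    then show "(\<Sum>i\<in>K. H (w j) i * cnj (H (w l) i)) = (if j = l then 1 else 0)"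
      using insert.prems jl by (simp add: Hu orthonormal_on_def)
  qed
  note g[measurable] = insert.prems(3)
  have upd: "(\<lambda>x. x(k := y)) \<in> gauss_PiM J \<rightarrow>\<^sub>M gauss_PiM (insert k J)" for y
    by (rule measurable_fun_upd[where J=J]) auto
  note L = measurable_lins_gauss_PiM[where J="insert k J" and I=I]
  have "(\<integral>\<^sup>+x. g (\<lambda>j\<in>insert k J. \<Sum>i\<in>I. x i * w j i) \<partial>gauss_PiM I)
      = (\<integral>\<^sup>+x. g (\<lambda>j\<in>insert k J. \<Sum>i\<in>I. R x i * w j i) \<partial>gauss_PiM I)"
    by (rule R(2)[symmetric]) (use L in measurable)
  also have "\<dots> = (\<integral>\<^sup>+x. g (\<lambda>j\<in>insert k J. \<Sum>i\<in>I. x i * H (w j) i) \<partial>gauss_PiM I)"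
    by (simp only: R(3))
  also have "\<dots> = (\<integral>\<^sup>+y. \<integral>\<^sup>+x. g (\<lambda>j\<in>insert k J. \<Sum>i\<in>I. (x(i0 := y)) i * H (w j) i) \<partial>gauss_PiM K \<partial>cgauss)"
    unfolding K(3) by (rule gauss_PiM.product_nn_integral_insert_rev[OF K(1,2)])
      (use L[unfolded K(3)] in measurable)
  also have "\<dots> = (\<integral>\<^sup>+y. \<integral>\<^sup>+x. g ((\<lambda>j\<in>J. \<Sum>i\<in>K. x i * H (w j) i)(k := y)) \<partial>gauss_PiM K \<partial>cgauss)"
  proof (intro nn_integral_cong arg_cong[where f=g])
    fix y x
    show "(\<lambda>j\<in>insert k J. \<Sum>i\<in>I. (x(i0 := y)) i * H (w j) i) = (\<lambda>j\<in>J. \<Sum>i\<in>K. x i * H (w j) i)(k := y)"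
    proof (rule ext)
      fix j
      have 1: "(\<Sum>i\<in>K. (x(i0 := y)) i * v i) = (\<Sum>i\<in>K. x i * v i)" for v :: "'i \<Rightarrow> complex"
        using K(2) by (intro sum.cong) auto
      have 2: "(\<Sum>i\<in>K. x i * H (w k) i) = 0"
        using H(3) K(2) unfolding K(3) by (intro sum.neutral) auto
      have 3: "H (w k) i0 = 1" using H(2,3) by simp
      show "(\<lambda>j\<in>insert k J. \<Sum>i\<in>I. (x(i0 := y)) i * H (w j) i) j = ((\<lambda>j\<in>J. \<Sum>i\<in>K. x i * H (w j) i)(k := y)) j"
        unfolding K(3) sum.insert[OF K(1,2)] using insert.hyps 1 2 3 H0[of j]
        by (auto simp: restrict_def)
    qed
  qed
  also have "\<dots> = (\<integral>\<^sup>+y. \<integral>\<^sup>+x. g (x(k := y)) \<partial>gauss_PiM J \<partial>cgauss)"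
    by (intro nn_integral_cong insert.IH[OF K(1) on]) (use upd in measurable)
  also have "\<dots> = (\<integral>\<^sup>+y. g y \<partial>gauss_PiM (insert k J))"
    by (rule gauss_PiM.product_nn_integral_insert_rev[symmetric]) (use insert.hyps in auto)
  finally show ?case .
qed

section \<open>Zeros of doubly periodic maps\<close>

text \<open>Opposite sides of a period rectangle have the same image, traversed in opposite
  directions, so their winding contributions cancel in pairs.\<close>

lemma winding_number_periodic_rectpath:
  fixes G :: "complex \<Rightarrow> complex"
  assumes cont: "continuous_on UNIV G"
    and per: "\<And>z. G (z + complex_of_real p) = G z" "\<And>z. G (z + \<i> * complex_of_real q) = G z"
    and nz: "0 \<notin> G ` path_image (rectpath a (a + Complex p q))"
  shows "winding_number (G \<circ> rectpath a (a + Complex p q)) 0 = 0"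
proof -
  define l1 l2 l3 l4 where "l1 = linepath a (a + complex_of_real p)"
    and "l2 = linepath (a + complex_of_real p) (a + Complex p q)"
    and "l3 = linepath (a + Complex p q) (a + \<i> * complex_of_real q)"
    and "l4 = linepath (a + \<i> * complex_of_real q) a"
  have rect: "rectpath a (a + Complex p q) = l1 +++ l2 +++ l3 +++ l4"
  proof -
    have "Complex (Re (a + Complex p q)) (Im a) = a + complex_of_real p"
      "Complex (Re a) (Im (a + Complex p q)) = a + \<i> * complex_of_real q"
      by (simp_all add: complex_eq_iff)
    then show ?thesis by (simp only: rectpath_def Let_def l1_def l2_def l3_def l4_def)
  qed
  have path: "path (G \<circ> l)" if "path l" for l
    using path_continuous_image[OF that continuous_on_subset[OF cont subset_UNIV]] .
  have p4: "path l1" "path l2" "path l3" "path l4" by (simp_all add: l1_def l2_def l3_def l4_def)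
  have ends: "pathfinish l1 = pathstart l2" "pathfinish l2 = pathstart l3" "pathfinish l3 = pathstart l4"
    by (simp_all add: l1_def l2_def l3_def l4_def)
  have im: "path_image (rectpath a (a + Complex p q)) = path_image l1 \<union> path_image l2 \<union> path_image l3 \<union> path_image l4"
    unfolding rect using ends by (simp add: path_image_join Un_assoc)
  have nz4: "0 \<notin> path_image (G \<circ> l1)" "0 \<notin> path_image (G \<circ> l2)" "0 \<notin> path_image (G \<circ> l3)" "0 \<notin> path_image (G \<circ> l4)"
    using nz unfolding im path_image_compose by auto
  have ends': "pathfinish (G \<circ> l1) = pathstart (G \<circ> l2)" "pathfinish (G \<circ> l2) = pathstart (G \<circ> l3)"
    "pathfinish (G \<circ> l3) = pathstart (G \<circ> l4)"
    using ends by (simp_all add: pathfinish_compose pathstart_compose)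
  have "G \<circ> rectpath a (a + Complex p q) = (G \<circ> l1) +++ (G \<circ> l2) +++ (G \<circ> l3) +++ (G \<circ> l4)"
    unfolding rect by (simp add: path_compose_join)
  then have "winding_number (G \<circ> rectpath a (a + Complex p q)) 0 = winding_number (G \<circ> l1) 0
     + (winding_number (G \<circ> l2) 0 + (winding_number (G \<circ> l3) 0 + winding_number (G \<circ> l4) 0))"
    using path[OF p4(1)] path[OF p4(2)] path[OF p4(3)] path[OF p4(4)] nz4 ends'
    by (simp add: winding_number_join path_image_join not_in_path_image_join)
  moreover have "G \<circ> l3 = reversepath (G \<circ> l1)"
  proof
    fix t
    have "l3 t = l1 (1 - t) + \<i> * complex_of_real q"
      by (simp add: l1_def l3_def linepath_def complex_eq_iff algebra_simps)
    then show "(G \<circ> l3) t = reversepath (G \<circ> l1) t" by (simp add: reversepath_def per)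
  qed
  moreover have "G \<circ> l2 = reversepath (G \<circ> l4)"
  proof
    fix t
    have "l2 t = l4 (1 - t) + complex_of_real p"
      by (simp add: l2_def l4_def linepath_def complex_eq_iff algebra_simps)
    then show "(G \<circ> l2) t = reversepath (G \<circ> l4) t" by (simp add: reversepath_def per)
  qed
  ultimately show ?thesis
    using winding_number_reversepath[OF path[OF p4(1)] nz4(1)] winding_number_reversepath[OF path[OF p4(4)] nz4(4)]
    by simp
qed

text \<open>The degree of a map from a torus to the plane is zero, so a nondegenerate zero, which contributes
  \<open>\<plusminus>1\<close>, cannot be the only one.\<close>

theorem doubly_periodic_second_zero:
  fixes F :: "complex \<Rightarrow> complex"
  assumes cont: "continuous_on UNIV F"
    and per: "\<And>z. F (z + complex_of_real (2 * pi)) = F z" "\<And>z. F (z + \<i> * complex_of_real (2 * pi)) = F z"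
    and z0: "F z0 = 0" and L: "(F has_derivative L) (at z0)" "inj L"
  obtains z where "F z = 0" "\<And>(m::int) (n::int). z \<noteq> z0 + Complex (2 * pi * m) (2 * pi * n)"
proof (rule ccontr)
  assume "\<not> thesis"
  with that have only: "\<And>z. F z = 0 \<Longrightarrow> \<exists>(m::int) (n::int). z = z0 + Complex (2 * pi * m) (2 * pi * n)" by blast
  have lin: "linear L" using L(1) has_derivative_linear by blast
  obtain c where c: "c > 0" "\<And>v. norm (L v) \<ge> c * norm v" using linear_inj_bounded_below_pos[OF lin L(2)] by blast
  \<comment> \<open>The boundary of the fundamental square centred at the origin; translated by
    \<open>z0\<close> it surrounds exactly one point of the orbit of \<open>z0\<close>.\<close>
  define R where "R = rectpath (- Complex pi pi) (- Complex pi pi + Complex (2 * pi) (2 * pi))"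
  have corner: "- Complex pi pi + Complex (2 * pi) (2 * pi) = Complex pi pi" by (simp add: complex_eq_iff)
  have pR: "path R" "pathfinish R = pathstart R" by (simp_all add: R_def)
  have Rim: "\<bar>Re (R t)\<bar> \<le> pi \<and> \<bar>Im (R t)\<bar> \<le> pi \<and> R t \<noteq> 0" if "t \<in> {0..1}" for t
  proof -
    have "R t \<in> path_image R" using that by (auto simp: path_image_def)
    then have "R t \<in> cbox (- Complex pi pi) (Complex pi pi) - box (- Complex pi pi) (Complex pi pi)"
      unfolding R_def corner by (subst (asm) path_image_rectpath_cbox_minus_box) auto
    then show ?thesis by (auto simp: in_cbox_complex_iff in_box_complex_iff)
  qed
  \<comment> \<open>A lattice vector whose coordinates are at most pi in absolute value is zero, so
    the square can be shrunk towards \<open>z0\<close> without meeting a zero.\<close>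
  have nzF: "F (z0 + complex_of_real s * R t) \<noteq> 0" if s: "0 < s" "s \<le> 1" and t: "t \<in> {0..1}" for s t
  proof
    assume "F (z0 + complex_of_real s * R t) = 0"
    then obtain m n :: int where mn: "s * Re (R t) = 2 * pi * m" "s * Im (R t) = 2 * pi * n"
      using only[of "z0 + complex_of_real s * R t"] by (auto simp: complex_eq_iff)
    have small: "k = 0" if "\<bar>x\<bar> \<le> pi" "s * x = 2 * pi * of_int k" for x and k :: int
    proof (rule ccontr)
      assume "k \<noteq> 0"
      then have "1 \<le> \<bar>real_of_int k\<bar>" by linarith
      then have "2 * pi \<le> \<bar>s * x\<bar>" unfolding that(2) by (simp add: abs_mult)
      also have "\<dots> \<le> 1 * pi" unfolding abs_mult using s that(1) by (intro mult_mono) auto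
      finally show False using pi_gt_zero by linarith
    qed
    from mn small[OF _ mn(1)] small[OF _ mn(2)] Rim[OF t] s show False
      by (auto simp: complex_eq_iff)
  qed
  have cl: "continuous_on {0..1} R" using pR(1) by (simp add: path_def)
  obtain \<delta> where \<delta>: "\<delta> > 0" "\<And>z. norm (z - z0) < \<delta> \<Longrightarrow> norm (F z - F z0 - L (z - z0)) \<le> c / 2 * norm (z - z0)"
    using L(1) c(1) unfolding has_derivative_at_alt by (meson half_gt_zero)
  obtain B where B: "B > 0" "\<And>t. t \<in> {0..1} \<Longrightarrow> norm (R t) < B"
    using compact_imp_bounded[OF compact_path_image[OF pR(1)]] unfolding bounded_pos_less path_image_def by auto
  \<comment> \<open>Shrinks the square into the disc on which the first-order expansion at
    \<open>z0\<close> has error at most half the lower bound of \<open>L\<close>.\<close>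
  define s where "s = min 1 (\<delta> / B)"
  have s: "0 < s" "s \<le> 1" "s * B \<le> \<delta>" using \<delta>(1) B(1) by (auto simp: s_def min_def field_simps)
  define G1 where "G1 = (\<lambda>t. F (z0 + R t))"
  define Gs where "Gs = (\<lambda>t. F (z0 + complex_of_real s * R t))"
  define Ls where "Ls = (\<lambda>t. L (complex_of_real s * R t))"
  \<comment> \<open>The image of the large square, of winding number 0 by periodicity, is deformed
    into the image of the small one.\<close>
  have h1: "homotopic_loops (- {0}) G1 Gs"
  proof -
    have "homotopic_loops (- {z. F z = 0}) (\<lambda>t. z0 + R t) (\<lambda>t. z0 + complex_of_real s * R t)"
    proof (rule homotopic_loops_linear)
      fix t :: real assume t: "t \<in> {0..1}"
      show "closed_segment (z0 + R t) (z0 + complex_of_real s * R t) \<subseteq> - {z. F z = 0}"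
      proof
        fix z assume "z \<in> closed_segment (z0 + R t) (z0 + complex_of_real s * R t)"
        then obtain u where u: "0 \<le> u" "u \<le> 1" "z = (1 - u) *\<^sub>R (z0 + R t) + u *\<^sub>R (z0 + complex_of_real s * R t)"
          by (auto simp: closed_segment_def)
        then have "z = z0 + complex_of_real (1 - u + u * s) * R t"
          by (simp add: scaleR_conv_of_real algebra_simps)
        moreover have "0 < 1 - u + u * s" "1 - u + u * s \<le> 1"
          using u s by (cases "u = 1"; auto simp: add_pos_nonneg mult_left_le)+
        ultimately show "z \<in> - {z. F z = 0}" using nzF[OF _ _ t, of "1 - u + u * s"] by simp
      qed
    qed (use pR cl in \<open>auto simp: path_def pathfinish_def pathstart_def intro!: continuous_intros\<close>)
    from homotopic_loops_continuous_image[OF this continuous_on_subset[OF cont subset_UNIV], of "- {0}"]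
    show ?thesis by (auto simp: G1_def Gs_def o_def)
  qed
  have contL: "continuous_on A L" for A
    using lin linear_continuous_on linear_conv_bounded_linear by blast
  have pLs: "path Ls" unfolding Ls_def path_def
    by (intro continuous_on_compose2[OF contL[of UNIV]] continuous_intros cl) auto
  have nLs: "Ls t \<noteq> 0" if "t \<in> {0..1}" for t
  proof -
    have "norm (Ls t) \<ge> c * norm (complex_of_real s * R t)" unfolding Ls_def by (rule c)
    moreover have "c * norm (complex_of_real s * R t) > 0" using c(1) s(1) Rim[OF that] by simp
    ultimately show ?thesis by auto
  qed
  \<comment> \<open>On the small square the error of linearization is at most c/2 |v|, less than |L
    v|, so the field can be replaced by its derivative.\<close>
  have h2: "homotopic_loops (- {0}) Ls Gs"
  proof (rule homotopic_loops_nearby_explicit)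
    show "path Gs" unfolding Gs_def path_def
      by (intro continuous_on_compose2[OF cont] continuous_intros cl) auto
    fix t :: real and x assume t: "t \<in> {0..1}" and "x \<notin> - {0::complex}"
    then have x: "x = 0" by simp
    have sz: "norm (complex_of_real s * R t) < \<delta>"
    proof -
      have "norm (complex_of_real s * R t) = s * norm (R t)" using s by (simp add: norm_mult)
      also have "\<dots> < s * B" using s B(2)[OF t] by simp
      finally show ?thesis using s by simp
    qed
    have pos: "norm (complex_of_real s * R t) > 0" using s Rim[OF t] by simp
    have "norm (Gs t - Ls t) \<le> c / 2 * norm (complex_of_real s * R t)"
      using \<delta>(2)[of "z0 + complex_of_real s * R t"] sz z0 by (simp add: Gs_def Ls_def)
    also have "\<dots> < c * norm (complex_of_real s * R t)" using c(1) pos by simp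
    also have "\<dots> \<le> norm (Ls t)" unfolding Ls_def by (rule c)
    finally show "norm (Gs t - Ls t) < norm (Ls t - x)" using x by simp
  qed (use pR pLs in \<open>auto simp: Ls_def Gs_def pathfinish_def pathstart_def\<close>)
  have "winding_number G1 0 = 0"
  proof -
    have "winding_number ((\<lambda>z. F (z0 + z)) \<circ> rectpath (- Complex pi pi) (- Complex pi pi + Complex (2 * pi) (2 * pi))) 0 = 0"
    proof (rule winding_number_periodic_rectpath)
      show "continuous_on UNIV (\<lambda>z. F (z0 + z))" by (intro continuous_on_compose2[OF cont] continuous_intros) auto
      show "0 \<notin> (\<lambda>z. F (z0 + z)) ` path_image (rectpath (- Complex pi pi) (- Complex pi pi + Complex (2 * pi) (2 * pi)))"
        using nzF[of 1] unfolding path_image_def R_def by force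
    qed (use per in \<open>auto simp: add.assoc[symmetric]\<close>)
    then show ?thesis by (simp add: G1_def R_def o_def)
  qed
  then have "winding_number Ls 0 = 0"
    using winding_number_homotopic_loops[OF h1] winding_number_homotopic_loops[OF h2] by simp
  moreover have "0 \<notin> path_image Ls" using nLs by (force simp: path_image_def)
  ultimately obtain a where a: "homotopic_loops (- {0}) Ls (\<lambda>t. a)"
    using winding_number_homotopic_loops_null_eq[OF pLs] by blast
  \<comment> \<open>The winding number of the image of a square under \<open>L\<close> is 1 or -1
    according to orientation. Applying the inverse of \<open>L\<close> to the contraction avoids
    this distinction: it would contract the square itself in the punctured plane.\<close>
  obtain L' where L': "linear L'" "L' \<circ> L = id"
    using linear_injective_left_inverse[OF lin L(2)] by blast
  have injL': "L' z \<noteq> 0" if "z \<noteq> 0" for z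
  proof -
    have "surj L" using lin L(2) linear_injective_imp_surjective by blast
    then obtain y where y: "z = L y" by blast
    then have "L' z = y" using L'(2) by (simp add: fun_eq_iff)
    with y that lin show ?thesis by (auto simp: linear_0)
  qed
  have cL': "continuous_on A L'" for A
    using L'(1) linear_continuous_on linear_conv_bounded_linear by blast
  have "homotopic_loops (- {0}) ((\<lambda>z. L' z / complex_of_real s) \<circ> Ls) ((\<lambda>z. L' z / complex_of_real s) \<circ> (\<lambda>t. a))"
  proof (rule homotopic_loops_continuous_image[OF a])
    show "continuous_on (- {0}) (\<lambda>z. L' z / complex_of_real s)"
      using s by (intro continuous_on_divide cL' continuous_on_const) auto
    show "(\<lambda>z. L' z / complex_of_real s) \<in> - {0} \<rightarrow> - {0}"
      using s injL' by simp
  qed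
  moreover have "(\<lambda>z. L' z / complex_of_real s) \<circ> Ls = R"
    using L'(2) s by (auto simp: fun_eq_iff Ls_def)
  ultimately have "\<exists>a. homotopic_loops (- {0}) R (\<lambda>t. a)" by (auto simp: o_def)
  moreover have "0 \<notin> path_image R" using Rim by (force simp: path_image_def)
  ultimately have "winding_number R 0 = 0"
    using winding_number_homotopic_loops_null_eq[OF pR(1)] by blast
  moreover have "winding_number R 0 = 1"
    unfolding R_def corner by (rule winding_number_rectpath) (auto simp: in_box_complex_iff)
  ultimately show False by simp
qed

section \<open>A local Kac-Rice inequality\<close>

text \<open>\<open>Im (cnj U * V)\<close> is the determinant of the real-linear map of the plane
  with columns \<open>U\<close> and \<open>V\<close>, and the preimage of a disc is an
  ellipse.\<close>

lemma emeasure_linear_preimage_ball: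
  fixes U V :: complex
  assumes D: "Im (cnj U * V) \<noteq> 0" and r: "r \<ge> 0"
  shows "emeasure lborel {z. cmod (Re (z - z0) *\<^sub>R U + Im (z - z0) *\<^sub>R V) < r} = ennreal (pi * r\<^sup>2 / \<bar>Im (cnj U * V)\<bar>)"
proof -
  let ?D = "Im (cnj U * V)"
  define g :: "real \<times> real \<Rightarrow> ennreal" where "g = indicator (ball 0 r)"
  have gm: "g \<in> borel_measurable borel"
    unfolding g_def by (intro borel_measurable_indicator) simp
  have det: "Re U * Im V - Re V * Im U = ?D" by simp
  define S where "S = {z. cmod (Re z *\<^sub>R U + Im z *\<^sub>R V) < r}"
  have S[measurable]: "S \<in> sets borel"
    unfolding S_def by (intro borel_open open_Collect_less continuous_intros)
  have gS: "g (Re U * x + Re V * y, Im U * x + Im V * y) = indicator S (Complex x y)" for x y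
    by (auto simp: g_def S_def indicator_def norm_Pair cmod_def algebra_simps)
  have "emeasure lborel (ball (0::real \<times> real) r) = (\<integral>\<^sup>+x. g x \<partial>lborel)"
    by (simp add: g_def)
  also have "\<dots> = (\<integral>\<^sup>+x. \<integral>\<^sup>+y. g (x, y) \<partial>lborel \<partial>lborel)"
    unfolding lborel_prod[symmetric] using gm
    by (intro lborel.nn_integral_fst[symmetric]) (simp add: lborel_prod)
  also have "\<dots> = ennreal \<bar>?D\<bar> * (\<integral>\<^sup>+x. \<integral>\<^sup>+y. g (Re U * x + Re V * y, Im U * x + Im V * y) \<partial>lborel \<partial>lborel)"
    using nn_integral_linear2_real[OF gm, of "Re U" "Im V" "Re V" "Im U"] D unfolding det by simp
  also have "(\<integral>\<^sup>+x. \<integral>\<^sup>+y. g (Re U * x + Re V * y, Im U * x + Im V * y) \<partial>lborel \<partial>lborel) = (\<integral>\<^sup>+z. indicator S z \<partial>lborel)"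
    unfolding gS by (rule nn_integral_lborel_complex[symmetric]) simp
  also have "\<dots> = emeasure lborel S" by simp
  finally have *: "emeasure lborel (ball (0::real \<times> real) r) = ennreal \<bar>?D\<bar> * emeasure lborel S" .
  have "emeasure lborel (ball (0::real \<times> real) r) = ennreal (pi * r\<^sup>2)"
    using r by (simp add: emeasure_ball unit_ball_vol_2 power2_eq_square)
  moreover have "emeasure lborel S = ennreal (inverse \<bar>?D\<bar>) * (ennreal \<bar>?D\<bar> * emeasure lborel S)"
    using D by (simp add: mult.assoc[symmetric] ennreal_mult[symmetric] del: times_complex.sel)
  ultimately have ES: "emeasure lborel S = ennreal (pi * r\<^sup>2 / \<bar>?D\<bar>)"
    using D * by (simp add: ennreal_mult[symmetric] divide_inverse mult.commute del: times_complex.sel)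
  have "emeasure lborel {z. cmod (Re (z - z0) *\<^sub>R U + Im (z - z0) *\<^sub>R V) < r} = (\<integral>\<^sup>+z. indicator S (- z0 + z) \<partial>lborel)"
  proof -
    have "{z. cmod (Re (z - z0) *\<^sub>R U + Im (z - z0) *\<^sub>R V) < r} \<in> sets borel"
      by (intro borel_open open_Collect_less continuous_intros)
    then have "emeasure lborel {z. cmod (Re (z - z0) *\<^sub>R U + Im (z - z0) *\<^sub>R V) < r}
      = (\<integral>\<^sup>+z. indicator {z. cmod (Re (z - z0) *\<^sub>R U + Im (z - z0) *\<^sub>R V) < r} z \<partial>lborel)" by simp
    also have "\<dots> = (\<integral>\<^sup>+z. indicator S (- z0 + z) \<partial>lborel)"
      by (intro nn_integral_cong) (auto simp: S_def indicator_def)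
    finally show ?thesis .
  qed
  also have "\<dots> = (\<integral>\<^sup>+z. indicator S z \<partial>lborel)"
    by (rule nn_integral_lborel_translate) simp
  also have "\<dots> = ennreal (pi * r\<^sup>2 / \<bar>?D\<bar>)" by (simp add: ES)
  finally show ?thesis .
qed

lemma linear_Re_Im_inj:
  assumes D: "Im (cnj U * V) \<noteq> 0"
  shows "linear (\<lambda>v. Re v *\<^sub>R U + Im v *\<^sub>R V)" "inj (\<lambda>v. Re v *\<^sub>R U + Im v *\<^sub>R V)"
proof -
  show lin: "linear (\<lambda>v. Re v *\<^sub>R U + Im v *\<^sub>R V)"
    by (auto intro!: linearI simp: algebra_simps)
  show "inj (\<lambda>v. Re v *\<^sub>R U + Im v *\<^sub>R V)"
    unfolding linear_injective_0[OF lin]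
  proof (intro allI impI)
    fix v assume v: "Re v *\<^sub>R U + Im v *\<^sub>R V = 0"
    have "Im (cnj U * (Re v *\<^sub>R U + Im v *\<^sub>R V)) = Im v * Im (cnj U * V)"
      "Im (cnj V * (Re v *\<^sub>R U + Im v *\<^sub>R V)) = - Re v * Im (cnj U * V)"
      by (simp_all add: algebra_simps)
    with v D show "v = 0" by (auto simp: complex_eq_iff)
  qed
qed

text \<open>Near a nondegenerate zero the set |f| < epsilon contains a slightly shrunken ellipse of
  the linearization, of area close to pi epsilon^2 / |D z0|; the weight |D| cancels the determinant.
  Any factor \<open>\<kappa>\<close> below 1 absorbs both losses.\<close>

lemma kac_local_lower_bound:
  fixes f :: "complex \<Rightarrow> complex" and D :: "complex \<Rightarrow> real"
  assumes f: "f z0 = 0" "(f has_derivative (\<lambda>v. Re v *\<^sub>R U + Im v *\<^sub>R V)) (at z0)"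
    and D: "isCont D z0" "D z0 = Im (cnj U * V)" "D z0 \<noteq> 0"
    and \<rho>: "\<rho> > 0" and \<kappa>: "0 \<le> \<kappa>" "\<kappa> < 1"
  shows "\<exists>\<epsilon>0>0. \<forall>\<epsilon>. 0 < \<epsilon> \<longrightarrow> \<epsilon> < \<epsilon>0 \<longrightarrow>
    ennreal (\<kappa> * (pi * \<epsilon>\<^sup>2)) \<le> (\<integral>\<^sup>+z. indicator {z \<in> ball z0 \<rho>. cmod (f z) < \<epsilon>} z * ennreal \<bar>D z\<bar> \<partial>lborel)"
proof -
  define L where "L = (\<lambda>v. Re v *\<^sub>R U + Im v *\<^sub>R V)"
  have D': "Im (cnj U * V) \<noteq> 0" using D by simp
  obtain c where c: "c > 0" "\<And>v. c * cmod v \<le> cmod (L v)"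
    using linear_inj_bounded_below_pos[OF linear_Re_Im_inj[OF D']] unfolding L_def by blast
  \<comment> \<open>The relative error allowed to the linearization and to \<open>D\<close> alike.
    The ellipse loses (1 + mu)^2 and the weight loses 1 - mu, and 1 - 3 mu is at most (1 - mu) / (1
    + mu)^2.\<close>
  define \<mu> where "\<mu> = (1 - \<kappa>) / 3"
  have \<mu>: "0 < \<mu>" "\<mu> \<le> 1 / 3" "\<kappa> = 1 - 3 * \<mu>" using \<kappa> by (auto simp: \<mu>_def field_simps)
  obtain \<delta>1 where \<delta>1: "\<delta>1 > 0" "\<And>z. cmod (z - z0) < \<delta>1 \<Longrightarrow> cmod (f z - f z0 - L (z - z0)) \<le> (\<mu> * c) * cmod (z - z0)"
    using f(2) c(1) \<mu>(1) unfolding has_derivative_at_alt L_def by (meson mult_pos_pos)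
  obtain \<delta>2 where \<delta>2: "\<delta>2 > 0" "\<And>z. cmod (z - z0) < \<delta>2 \<Longrightarrow> \<bar>D z - D z0\<bar> < \<mu> * \<bar>D z0\<bar>"
    using D(1,3) \<mu>(1) unfolding continuous_at_eps_delta dist_norm
    by (metis mult_pos_pos real_norm_def zero_less_abs_iff)
  define \<delta> where "\<delta> = min \<rho> (min \<delta>1 \<delta>2)"
  have \<delta>: "\<delta> > 0" "\<delta> \<le> \<rho>" "\<delta> \<le> \<delta>1" "\<delta> \<le> \<delta>2" using \<delta>1(1) \<delta>2(1) \<rho> by (auto simp: \<delta>_def)
  show ?thesis
  proof (intro exI[of _ "c * \<delta>"] conjI allI impI)
    show "c * \<delta> > 0" using c(1) \<delta>(1) by simp
    fix \<epsilon> :: real assume \<epsilon>: "0 < \<epsilon>" "\<epsilon> < c * \<delta>"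
    define A where "A = {z. cmod (L (z - z0)) < \<epsilon> / (1 + \<mu>)}"
    have Am[measurable]: "A \<in> sets borel"
      unfolding A_def L_def by (intro borel_open open_Collect_less continuous_intros)
    have A: "z \<in> ball z0 \<rho> \<and> cmod (f z) < \<epsilon> \<and> (1 - \<mu>) * \<bar>D z0\<bar> \<le> \<bar>D z\<bar>" if "z \<in> A" for z
    proof -
      have "c * cmod (z - z0) \<le> cmod (L (z - z0))" by (rule c)
      also have "\<dots> < \<epsilon> / (1 + \<mu>)" using that by (simp add: A_def)
      also have "\<dots> \<le> \<epsilon>" using \<epsilon> \<mu> by (simp add: field_simps)
      also have "\<dots> < c * \<delta>" by fact
      finally have d: "cmod (z - z0) < \<delta>" using c(1) by simp
      have "cmod (f z) \<le> cmod (L (z - z0)) + cmod (f z - f z0 - L (z - z0))"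
        using f(1) norm_triangle_sub[of "f z" "L (z - z0)"] by (simp add: norm_minus_commute add.commute)
      also have "cmod (f z - f z0 - L (z - z0)) \<le> \<mu> * (c * cmod (z - z0))"
        using \<delta>1(2)[of z] d \<delta> by (simp add: mult.assoc)
      also have "\<mu> * (c * cmod (z - z0)) \<le> \<mu> * cmod (L (z - z0))"
        using \<mu> c(2) by (intro mult_left_mono) auto
      also have "cmod (L (z - z0)) + \<mu> * cmod (L (z - z0)) = (1 + \<mu>) * cmod (L (z - z0))"
        by (simp add: algebra_simps)
      also have "\<dots> < \<epsilon>" using that \<mu> by (simp add: A_def field_simps)
      finally have 1: "cmod (f z) < \<epsilon>" by simp
      have "\<bar>D z - D z0\<bar> < \<mu> * \<bar>D z0\<bar>" using \<delta>2(2)[of z] d \<delta> by simp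
      then have 2: "(1 - \<mu>) * \<bar>D z0\<bar> \<le> \<bar>D z\<bar>" by (simp add: algebra_simps)
      show ?thesis using 1 2 d \<delta> by (simp add: dist_norm norm_minus_commute)
    qed
    have "\<kappa> \<le> (1 - \<mu>) / (1 + \<mu>)\<^sup>2"
    proof -
      have "\<kappa> * (1 + \<mu>)\<^sup>2 = 1 - \<mu> - 5 * \<mu>\<^sup>2 - 3 * \<mu> ^ 3"
        unfolding \<mu>(3) by (simp add: power2_eq_square power3_eq_cube algebra_simps)
      also have "\<dots> \<le> 1 - \<mu>" using \<mu>(1) zero_le_power[of \<mu> 3] zero_le_power2[of \<mu>] by linarith
      finally show ?thesis using \<mu>(1) by (simp add: field_simps)
    qed
    then have "\<kappa> * (pi * \<epsilon>\<^sup>2) \<le> (1 - \<mu>) / (1 + \<mu>)\<^sup>2 * (pi * \<epsilon>\<^sup>2)"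
      by (intro mult_right_mono) auto
    also have "\<dots> = (1 - \<mu>) * \<bar>D z0\<bar> * (pi * (\<epsilon> / (1 + \<mu>))\<^sup>2 / \<bar>D z0\<bar>)"
      using D(3) by (simp add: power_divide)
    finally have "ennreal (\<kappa> * (pi * \<epsilon>\<^sup>2)) \<le> ennreal ((1 - \<mu>) * \<bar>D z0\<bar> * (pi * (\<epsilon> / (1 + \<mu>))\<^sup>2 / \<bar>D z0\<bar>))"
      by (rule ennreal_leI)
    also have "\<dots> = ennreal ((1 - \<mu>) * \<bar>D z0\<bar>) * emeasure lborel A"
      unfolding A_def L_def using emeasure_linear_preimage_ball[OF D', of "\<epsilon> / (1 + \<mu>)" z0] \<mu> \<epsilon> D(2)
      by (subst ennreal_mult) auto
    also have "\<dots> = (\<integral>\<^sup>+z. ennreal ((1 - \<mu>) * \<bar>D z0\<bar>) * indicator A z \<partial>lborel)"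
      by (simp add: nn_integral_cmult_indicator)
    also have "\<dots> \<le> (\<integral>\<^sup>+z. indicator {z \<in> ball z0 \<rho>. cmod (f z) < \<epsilon>} z * ennreal \<bar>D z\<bar> \<partial>lborel)"
      by (intro nn_integral_mono) (use A in \<open>auto simp: indicator_def intro!: ennreal_leI\<close>)
    finally show "ennreal (\<kappa> * (pi * \<epsilon>\<^sup>2)) \<le> (\<integral>\<^sup>+z. indicator {z \<in> ball z0 \<rho>. cmod (f z) < \<epsilon>} z * ennreal \<bar>D z\<bar> \<partial>lborel)" .
  qed
qed

text \<open>Kac's counting functional: an approximate delta at 0, composed with the field and
  weighted by its Jacobian \<open>D\<close>. Each nondegenerate zero contributes 1 in the limit of
  small epsilon.\<close>

definition kac_integral :: "complex set \<Rightarrow> (complex \<Rightarrow> complex) \<Rightarrow> (complex \<Rightarrow> real) \<Rightarrow> real \<Rightarrow> ennreal" where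
  "kac_integral \<Omega> f D \<epsilon> = (\<integral>\<^sup>+z. indicator {z \<in> \<Omega>. cmod (f z) < \<epsilon>} z * ennreal \<bar>D z\<bar> \<partial>lborel) / ennreal (pi * \<epsilon>\<^sup>2)"

text \<open>Each zero contributes nearly 1 through a ball of its own, and disjoint balls make the
  contributions add up. Only a lower limit is claimed, which is the form in which Fatou's lemma
  takes it.\<close>

lemma kac_two_zeros:
  fixes f :: "complex \<Rightarrow> complex" and D :: "complex \<Rightarrow> real"
  assumes \<Omega>: "open \<Omega>" "z0 \<in> \<Omega>" "z1 \<in> \<Omega>" "z0 \<noteq> z1" "f z0 = 0" "f z1 = 0"
    and der: "\<And>z. (f has_derivative (\<lambda>v. Re v *\<^sub>R U z + Im v *\<^sub>R V z)) (at z)"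
    and D: "continuous_on UNIV D" "\<And>z. D z = Im (cnj (U z) * V z)" "D z0 \<noteq> 0" "D z1 \<noteq> 0"
  shows "2 \<le> liminf (\<lambda>n. kac_integral \<Omega> f D (1 / real (Suc n)))"
  unfolding le_Liminf_iff
proof (intro allI impI)
  fix y :: ennreal assume y: "y < 2"
  obtain y' where y': "y = ennreal y'" "0 \<le> y'" "y' < 2"
  proof -
    have "y \<noteq> top" using y by auto
    then obtain r where r: "y = ennreal r" "0 \<le> r" using ennreal_cases by auto
    then have "r < 2" using y by (metis ennreal_less_iff ennreal_numeral)
    with r show ?thesis using that by blast
  qed
  define \<kappa> where "\<kappa> = (y' / 2 + 1) / 2"
  have \<kappa>: "0 \<le> \<kappa>" "\<kappa> < 1" "y' < 2 * \<kappa>" using y' by (auto simp: \<kappa>_def)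
  obtain \<rho>0 where \<rho>0: "\<rho>0 > 0" "ball z0 \<rho>0 \<subseteq> \<Omega>" using \<Omega> open_contains_ball by blast
  obtain \<rho>1 where \<rho>1: "\<rho>1 > 0" "ball z1 \<rho>1 \<subseteq> \<Omega>" using \<Omega> open_contains_ball by blast
  define \<rho> where "\<rho> = min (min \<rho>0 \<rho>1) (dist z0 z1 / 2)"
  have \<rho>: "\<rho> > 0" "ball z0 \<rho> \<subseteq> \<Omega>" "ball z1 \<rho> \<subseteq> \<Omega>"
    using \<rho>0 \<rho>1 \<Omega>(4) by (auto simp: \<rho>_def)
  have disj: "ball z0 \<rho> \<inter> ball z1 \<rho> = {}"
    by (intro disjoint_ballI) (auto simp: \<rho>_def)
  have cD: "isCont D z" for z using D(1) by (simp add: continuous_on_eq_continuous_at)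
  have cf: "continuous_on UNIV f"
    by (meson continuous_at_imp_continuous_on der has_derivative_continuous)
  have [measurable]: "f \<in> borel_measurable borel" "D \<in> borel_measurable borel"
    using cf D(1) by (auto intro: borel_measurable_continuous_onI)
  obtain e0 where e0: "e0 > 0" "\<And>\<epsilon>. 0 < \<epsilon> \<Longrightarrow> \<epsilon> < e0 \<Longrightarrow> ennreal (\<kappa> * (pi * \<epsilon>\<^sup>2)) \<le> (\<integral>\<^sup>+z. indicator {z \<in> ball z0 \<rho>. cmod (f z) < \<epsilon>} z * ennreal \<bar>D z\<bar> \<partial>lborel)"
    using kac_local_lower_bound[OF \<Omega>(5) der cD D(2,3) \<rho>(1) \<kappa>(1,2)] by blast
  obtain e1 where e1: "e1 > 0" "\<And>\<epsilon>. 0 < \<epsilon> \<Longrightarrow> \<epsilon> < e1 \<Longrightarrow> ennreal (\<kappa> * (pi * \<epsilon>\<^sup>2)) \<le> (\<integral>\<^sup>+z. indicator {z \<in> ball z1 \<rho>. cmod (f z) < \<epsilon>} z * ennreal \<bar>D z\<bar> \<partial>lborel)"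
    using kac_local_lower_bound[OF \<Omega>(6) der cD D(2,4) \<rho>(1) \<kappa>(1,2)] by blast
  have "eventually (\<lambda>n. 1 / real (Suc n) < min e0 e1) sequentially"
    using LIMSEQ_inverse_real_of_nat e0(1) e1(1)
    by (intro order_tendstoD(2)[where y=0]) (auto simp: inverse_eq_divide)
  then show "eventually (\<lambda>n. y < kac_integral \<Omega> f D (1 / real (Suc n))) sequentially"
  proof eventually_elim
    case (elim n)
    define \<epsilon> where "\<epsilon> = 1 / real (Suc n)"
    have \<epsilon>: "0 < \<epsilon>" "\<epsilon> < e0" "\<epsilon> < e1" using elim by (auto simp: \<epsilon>_def)
    have pos: "pi * \<epsilon>\<^sup>2 > 0" using \<epsilon> by simp
    have "ennreal (2 * \<kappa> * (pi * \<epsilon>\<^sup>2)) = ennreal (\<kappa> * (pi * \<epsilon>\<^sup>2)) + ennreal (\<kappa> * (pi * \<epsilon>\<^sup>2))"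
      using \<kappa>(1) by (subst ennreal_plus[symmetric]) auto
    also have "\<dots> \<le> (\<integral>\<^sup>+z. indicator {z \<in> ball z0 \<rho>. cmod (f z) < \<epsilon>} z * ennreal \<bar>D z\<bar> \<partial>lborel)
        + (\<integral>\<^sup>+z. indicator {z \<in> ball z1 \<rho>. cmod (f z) < \<epsilon>} z * ennreal \<bar>D z\<bar> \<partial>lborel)"
      using e0(2) e1(2) \<epsilon> by (intro add_mono) auto
    also have "\<dots> = (\<integral>\<^sup>+z. indicator {z \<in> ball z0 \<rho>. cmod (f z) < \<epsilon>} z * ennreal \<bar>D z\<bar> + indicator {z \<in> ball z1 \<rho>. cmod (f z) < \<epsilon>} z * ennreal \<bar>D z\<bar> \<partial>lborel)"
      by (rule nn_integral_add[symmetric]) auto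
    also have "\<dots> \<le> (\<integral>\<^sup>+z. indicator {z \<in> \<Omega>. cmod (f z) < \<epsilon>} z * ennreal \<bar>D z\<bar> \<partial>lborel)"
      using disj \<rho>(2,3) by (intro nn_integral_mono) (auto simp: indicator_def)
    finally have "ennreal (2 * \<kappa> * (pi * \<epsilon>\<^sup>2)) / ennreal (pi * \<epsilon>\<^sup>2) \<le> kac_integral \<Omega> f D \<epsilon>"
      unfolding kac_integral_def by (intro divide_right_mono_ennreal)
    moreover have "ennreal (2 * \<kappa> * (pi * \<epsilon>\<^sup>2)) / ennreal (pi * \<epsilon>\<^sup>2) = ennreal (2 * \<kappa>)"
      using pos \<kappa>(1) by (subst divide_ennreal) auto
    moreover have "y < ennreal (2 * \<kappa>)" unfolding y'(1) using \<kappa> y' by (intro ennreal_lessI) auto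
    ultimately show ?case unfolding \<epsilon>_def by (metis less_le_trans)
  qed
qed

section \<open>Moments of complex Gaussians\<close>

lemma emeasure_norm_power2_Ioc:
  "emeasure lborel {z::complex. a < (cmod z)\<^sup>2 \<and> (cmod z)\<^sup>2 \<le> b} = ennreal (pi * (max 0 b - max 0 a))"
proof (cases "0 \<le> b \<and> a \<le> b")
  case False
  have "{z::complex. a < (cmod z)\<^sup>2 \<and> (cmod z)\<^sup>2 \<le> b} = {}"
    using False by (auto simp: not_le) (metis dual_order.strict_trans1 not_less zero_le_power2)
  moreover have "pi * (max 0 b - max 0 a) \<le> 0"
    using False by (intro mult_nonneg_nonpos) auto
  ultimately show ?thesis by (simp only: emeasure_empty ennreal_neg)
next
  case b: True
  have disc: "emeasure lborel {z::complex. (cmod z)\<^sup>2 \<le> c} = ennreal (pi * c)" if "c \<ge> 0" for c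
  proof -
    have "(cmod z)\<^sup>2 \<le> c \<longleftrightarrow> cmod z \<le> sqrt c" for z
      using real_sqrt_le_iff[of "(cmod z)\<^sup>2" c] by simp
    then have "{z::complex. (cmod z)\<^sup>2 \<le> c} = cball 0 (sqrt c)" by (simp only: cball_def dist_0_norm)
    then show ?thesis using that by (simp add: emeasure_cball unit_ball_vol_2)
  qed
  show ?thesis
  proof (cases "a \<ge> 0")
    case True
    have "{z::complex. a < (cmod z)\<^sup>2 \<and> (cmod z)\<^sup>2 \<le> b} = {z. (cmod z)\<^sup>2 \<le> b} - {z. (cmod z)\<^sup>2 \<le> a}"
      by auto
    also have "emeasure lborel \<dots> = emeasure lborel {z::complex. (cmod z)\<^sup>2 \<le> b} - emeasure lborel {z::complex. (cmod z)\<^sup>2 \<le> a}"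
    proof (rule emeasure_Diff)
      show "emeasure lborel {z::complex. (cmod z)\<^sup>2 \<le> a} \<noteq> \<infinity>" using disc[OF True] by simp
    qed (use b in auto)
    also have "\<dots> = ennreal (pi * (max 0 b - max 0 a))"
      using True b by (simp add: disc ennreal_minus right_diff_distrib)
    finally show ?thesis .
  next
    case False
    then have "{z::complex. a < (cmod z)\<^sup>2 \<and> (cmod z)\<^sup>2 \<le> b} = {z. (cmod z)\<^sup>2 \<le> b}"
      by auto (meson less_le_trans not_le zero_le_power2)
    then show ?thesis using False b disc by simp
  qed
qed

text \<open>Annuli a < |z|^2 \<le> b have area pi (b - a). Consequently |z|^2 is a standard
  exponential variable under \<open>cgauss\<close>, and radial moments become values of
  Gamma.\<close>

lemma distr_norm_power2:
  "distr lborel borel (\<lambda>z::complex. (cmod z)\<^sup>2) = density lborel (\<lambda>t. ennreal pi * indicator {0..} t)"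
    (is "?M = ?N")
proof (rule measure_eqI_generator_eq)
  let ?E = "range (\<lambda>(a, b). {a<..b::real})"
  have M: "emeasure ?M {a<..b} = ennreal (pi * (max 0 b - max 0 a))" for a b
    using emeasure_norm_power2_Ioc[of a b]
    by (subst emeasure_distr) (auto simp: vimage_def greaterThanAtMost_def greaterThan_def atMost_def Int_def conj_commute)
  have N: "emeasure ?N {a<..b} = ennreal (pi * (max 0 b - max 0 a))" for a b
  proof -
    have "emeasure ?N {a<..b} = (\<integral>\<^sup>+x. ennreal pi * indicator ({a<..b} \<inter> {0..}) x \<partial>lborel)"
      by (subst emeasure_density) (auto simp: indicator_def intro!: nn_integral_cong)
    also have "\<dots> = ennreal pi * emeasure lborel ({a<..b} \<inter> {0..})"
      by (simp add: nn_integral_cmult_indicator)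
    also have "emeasure lborel ({a<..b} \<inter> {0..}) = ennreal (max 0 b - max 0 a)"
    proof (cases "a < 0")
      case True
      then have "{a<..b} \<inter> {0..} = {0..b}" by auto
      then show ?thesis using True by (auto simp: max_def emeasure_lborel_Icc_eq)
    next
      case False
      then have "{a<..b} \<inter> {0..} = {a<..b}" by auto
      then show ?thesis using False by (cases "a \<le> b") (auto simp: max_def ennreal_neg)
    qed
    finally show ?thesis by (simp add: ennreal_mult')
  qed
  show "Int_stable ?E"
  proof (rule Int_stableI_image)
    fix x y :: "real \<times> real"
    show "\<exists>z\<in>UNIV. (case x of (a, b) \<Rightarrow> {a<..b}) \<inter> (case y of (a, b) \<Rightarrow> {a<..b}) = (case z of (a, b) \<Rightarrow> {a<..b})"
      by (intro bexI[of _ "(max (fst x) (fst y), min (snd x) (snd y))"]) (auto simp: split_beta)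
  qed
  show "emeasure ?M X = emeasure ?N X" if "X \<in> ?E" for X using that M N by auto
  show "sets ?M = sigma_sets UNIV ?E" "sets ?N = sigma_sets UNIV ?E"
    by (simp_all add: borel_sigma_sets_Ioc)
  show "range (\<lambda>n::nat. {- real n<..real n}) \<subseteq> ?E" by auto
  show "(\<Union>n::nat. {- real n<..real n}) = UNIV"
  proof -
    have "\<exists>n::nat. - real n < x \<and> x \<le> real n" for x
    proof -
      obtain n :: nat where "\<bar>x\<bar> < real n" using reals_Archimedean2 by blast
      then show ?thesis by (intro exI[of _ n]) auto
    qed
    then show ?thesis by auto
  qed
  show "emeasure ?M {- real n<..real n} \<noteq> \<infinity>" for n by (simp add: M)
qed auto

lemma nn_integral_cgauss_radial:
  fixes h :: "real \<Rightarrow> ennreal"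
  assumes [measurable]: "h \<in> borel_measurable borel"
  shows "(\<integral>\<^sup>+z. h ((cmod z)\<^sup>2) \<partial>cgauss) = (\<integral>\<^sup>+t. indicator {0..} t * ennreal (exp (- t)) * h t \<partial>lborel)"
proof -
  have "(\<integral>\<^sup>+z. h ((cmod z)\<^sup>2) \<partial>cgauss) = (\<integral>\<^sup>+z. (\<lambda>t. ennreal (exp (- t) / pi) * h t) ((cmod z)\<^sup>2) \<partial>lborel)"
    by (subst nn_integral_cgauss) auto
  also have "\<dots> = (\<integral>\<^sup>+t. ennreal (exp (- t) / pi) * h t \<partial>distr lborel borel (\<lambda>z::complex. (cmod z)\<^sup>2))"
    by (rule nn_integral_distr[symmetric]) auto
  also have "\<dots> = (\<integral>\<^sup>+t. ennreal pi * indicator {0..} t * (ennreal (exp (- t) / pi) * h t) \<partial>lborel)"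
    unfolding distr_norm_power2 by (subst nn_integral_density) auto
  also have "\<dots> = (\<integral>\<^sup>+t. indicator {0..} t * ennreal (exp (- t)) * h t \<partial>lborel)"
    by (intro nn_integral_cong) (auto simp: indicator_def mult.assoc[symmetric] ennreal_mult[symmetric])
  finally show ?thesis .
qed

lemma nn_integral_cgauss_norm: "(\<integral>\<^sup>+z. ennreal (cmod z) \<partial>cgauss) = ennreal (sqrt pi / 2)"
proof -
  have "(\<integral>\<^sup>+z. ennreal (cmod z) \<partial>cgauss) = (\<integral>\<^sup>+z. (\<lambda>t. ennreal (sqrt t)) ((cmod z)\<^sup>2) \<partial>cgauss)"
    by simp
  also have "\<dots> = (\<integral>\<^sup>+t. indicator {0..} t * ennreal (exp (- t)) * ennreal (sqrt t) \<partial>lborel)"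
    by (rule nn_integral_cgauss_radial) simp
  also have "\<dots> = (\<integral>\<^sup>+t. ennreal (indicator {0..} t * t powr (3 / 2 - 1) / exp t) \<partial>lborel)"
    by (intro nn_integral_cong)
       (auto simp: indicator_def ennreal_mult[symmetric] powr_half_sqrt exp_minus field_simps)
  also have "\<dots> = ennreal (Gamma (3 / 2))"
    by (rule Gamma_conv_nn_integral_real[symmetric]) simp
  also have "Gamma (3 / 2 :: real) = sqrt pi / 2"
    using Gamma_plus1[of "1 / 2 :: real"] nonpos_Ints_nonpos[of "1 / 2 :: real"]
    by (auto simp: Gamma_one_half_real)
  finally show ?thesis .
qed

lemma nn_integral_cgauss_abs_Im: "(\<integral>\<^sup>+z. ennreal \<bar>Im z\<bar> \<partial>cgauss) = ennreal (1 / sqrt pi)"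
proof -
  have ex: "(\<integral>\<^sup>+y. ennreal (exp (- y\<^sup>2) * \<bar>y\<bar>) \<partial>lborel) = 1"
  proof -
    have "(\<integral>\<^sup>+y. ennreal (exp (- y\<^sup>2) * \<bar>y\<bar>) \<partial>lborel)
       = ennreal \<bar>1 / sqrt 2\<bar> * (\<integral>\<^sup>+y. ennreal (exp (- (0 + 1 / sqrt 2 * y)\<^sup>2) * \<bar>0 + 1 / sqrt 2 * y\<bar>) \<partial>lborel)"
      by (rule nn_integral_real_affine) auto
    also have "(\<integral>\<^sup>+y. ennreal (exp (- (0 + 1 / sqrt 2 * y)\<^sup>2) * \<bar>0 + 1 / sqrt 2 * y\<bar>) \<partial>lborel)
       = (\<integral>\<^sup>+y. ennreal (sqrt pi) * ennreal (std_normal_density y * \<bar>y\<bar> ^ (2 * 0 + 1)) \<partial>lborel)"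
      by (intro nn_integral_cong)
         (simp add: std_normal_density_def ennreal_mult[symmetric] power_mult_distrib power_divide abs_mult real_sqrt_mult)
    also have "\<dots> = ennreal (sqrt pi) * (\<integral>\<^sup>+y. ennreal (std_normal_density y * \<bar>y\<bar> ^ (2 * 0 + 1)) \<partial>lborel)"
      by (rule nn_integral_cmult) simp
    also have "(\<integral>\<^sup>+y. ennreal (std_normal_density y * \<bar>y\<bar> ^ (2 * 0 + 1)) \<partial>lborel) = ennreal (sqrt (2 / pi) * 2 ^ 0 * fact 0)"
      using std_normal_moment_abs_odd[of 0]
      by (subst nn_integral_eq_integral) (auto simp: has_bochner_integral_iff)
    finally show ?thesis
      by (simp add: ennreal_mult[symmetric] real_sqrt_divide)
  qed
  have "(\<integral>\<^sup>+z. ennreal \<bar>Im z\<bar> \<partial>cgauss) = (\<integral>\<^sup>+z. ennreal (exp (- (cmod z)\<^sup>2) / pi) * ennreal \<bar>Im z\<bar> \<partial>lborel)"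
    by (rule nn_integral_cgauss) simp
  also have "\<dots> = (\<integral>\<^sup>+x. \<integral>\<^sup>+y. ennreal (exp (- x\<^sup>2) / pi) * ennreal (exp (- y\<^sup>2) * \<bar>y\<bar>) \<partial>lborel \<partial>lborel)"
    by (subst nn_integral_lborel_complex)
       (auto simp: cmod_power2 exp_diff exp_minus ennreal_mult[symmetric] field_simps intro!: nn_integral_cong)
  also have "\<dots> = (\<integral>\<^sup>+x. ennreal (exp (- x\<^sup>2)) * ennreal (1 / pi) \<partial>lborel)"
    by (subst nn_integral_cmult) (auto simp: ex ennreal_mult[symmetric] intro!: nn_integral_cong)
  also have "\<dots> = ennreal (sqrt pi) * ennreal (1 / pi)"
    by (subst nn_integral_multc) (auto simp: nn_integral_gauss_half)
  also have "\<dots> = ennreal (1 / sqrt pi)"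
    by (simp add: ennreal_mult[symmetric] field_simps)
  finally show ?thesis .
qed

text \<open>The argument of \<open>cnj x\<close> is absorbed by the phase invariance of
  \<open>y\<close>; only the modulus of \<open>x\<close> remains.\<close>

lemma cgauss_cnj_mult:
  fixes h :: "real \<Rightarrow> ennreal"
  assumes [measurable]: "h \<in> borel_measurable borel"
  shows "(\<integral>\<^sup>+y. h (Im (cnj x * y)) \<partial>cgauss) = (\<integral>\<^sup>+y. h (cmod x * Im y) \<partial>cgauss)"
proof (cases "x = 0")
  case False
  define c where "c = cnj x / complex_of_real (cmod x)"
  have c: "cmod c = 1" using False by (simp add: c_def norm_divide)
  have "Im (cnj x * y) = cmod x * Im (c * y)" for y
    using False by (simp add: c_def Im_divide_of_real times_divide_eq_left del: times_complex.sel)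
  then show ?thesis
    using nn_integral_cgauss_phase[OF _ c, of "\<lambda>y. h (cmod x * Im y)"] by simp
qed simp

text \<open>The mean absolute Jacobian of the Kac-Rice bound for unit covariance: E |x| = sqrt pi /
  2 times E |Im y| = 1 / sqrt pi.\<close>

lemma nn_integral_cgauss_abs_Im_cnj_mult:
  "(\<integral>\<^sup>+x. \<integral>\<^sup>+y. ennreal \<bar>Im (cnj x * y)\<bar> \<partial>cgauss \<partial>cgauss) = ennreal (1 / 2)"
proof -
  have "(\<integral>\<^sup>+y. ennreal \<bar>Im (cnj x * y)\<bar> \<partial>cgauss) = ennreal (cmod x) * ennreal (1 / sqrt pi)" for x
  proof -
    have "(\<integral>\<^sup>+y. ennreal \<bar>Im (cnj x * y)\<bar> \<partial>cgauss) = (\<integral>\<^sup>+y. ennreal (cmod x) * ennreal \<bar>Im y\<bar> \<partial>cgauss)"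
      by (subst cgauss_cnj_mult[where h="\<lambda>t. ennreal \<bar>t\<bar>"]) (auto simp: abs_mult ennreal_mult)
    then show ?thesis by (simp add: nn_integral_cmult nn_integral_cgauss_abs_Im)
  qed
  then have "(\<integral>\<^sup>+x. \<integral>\<^sup>+y. ennreal \<bar>Im (cnj x * y)\<bar> \<partial>cgauss \<partial>cgauss) = (\<integral>\<^sup>+x. ennreal (cmod x) * ennreal (1 / sqrt pi) \<partial>cgauss)"
    by simp
  also have "\<dots> = ennreal (sqrt pi / 2) * ennreal (1 / sqrt pi)"
    by (subst nn_integral_multc) (auto simp: nn_integral_cgauss_norm)
  also have "\<dots> = ennreal (1 / 2)" by (simp add: ennreal_mult[symmetric])
  finally show ?thesis .
qed

lemma emeasure_cgauss_ball_le: "emeasure cgauss {z. cmod z < \<epsilon>} \<le> ennreal (\<epsilon>\<^sup>2)"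
proof (cases "\<epsilon> > 0")
  case True
  have "emeasure cgauss {z. cmod z < \<epsilon>} = (\<integral>\<^sup>+z. indicator {z. cmod z < \<epsilon>} z \<partial>cgauss)"
    by simp
  also have "\<dots> = (\<integral>\<^sup>+z. ennreal (exp (- (cmod z)\<^sup>2) / pi) * indicator {z. cmod z < \<epsilon>} z \<partial>lborel)"
    by (rule nn_integral_cgauss) simp
  also have "\<dots> \<le> (\<integral>\<^sup>+z. ennreal (1 / pi) * indicator {z. cmod z < \<epsilon>} z \<partial>lborel)"
    by (intro nn_integral_mono mult_right_mono ennreal_leI divide_right_mono) auto
  also have "\<dots> = ennreal (1 / pi) * emeasure lborel {z::complex. cmod z < \<epsilon>}"
    by (simp add: nn_integral_cmult_indicator)
  also have "\<dots> = ennreal (1 / pi) * emeasure lborel (ball (0::complex) \<epsilon>)"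
    by (simp add: ball_def dist_norm)
  also have "\<dots> = ennreal (\<epsilon>\<^sup>2)"
    using True by (simp add: emeasure_ball unit_ball_vol_2 ennreal_mult[symmetric])
  finally show ?thesis .
next
  case False
  then have "{z::complex. cmod z < \<epsilon>} = {}" by (auto simp: not_less intro: order_trans)
  then show ?thesis by simp
qed

lemma nn_integral_gauss_PiM_3:
  fixes G :: "complex \<times> complex \<times> complex \<Rightarrow> ennreal"
  assumes G[measurable]: "G \<in> borel_measurable (borel \<Otimes>\<^sub>M (borel \<Otimes>\<^sub>M borel))"
  shows "(\<integral>\<^sup>+y. G (y 0, y 1, y 2) \<partial>gauss_PiM {0, 1, 2::nat})
    = (\<integral>\<^sup>+u. \<integral>\<^sup>+v. \<integral>\<^sup>+w. G (u, v, w) \<partial>cgauss \<partial>cgauss \<partial>cgauss)"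
proof -
  have c: "(\<lambda>y. y i) \<in> borel_measurable (gauss_PiM J)" if "i \<in> J" for i and J :: "nat set"
    using measurable_component_singleton[OF that, of "\<lambda>_. cgauss"] by (simp cong: measurable_cong_sets)
  have m: "(\<lambda>y. G (y 0, y 1, y 2)) \<in> borel_measurable (gauss_PiM {0, 1, 2::nat})"
    "(\<lambda>y. G (u, y 1, y 2)) \<in> borel_measurable (gauss_PiM {1, 2::nat})"
    "(\<lambda>w. G (u, v, w)) \<in> borel_measurable cgauss" for u v
    by (intro measurable_compose[OF _ G] measurable_Pair c measurable_const; simp)+
  have "(\<integral>\<^sup>+y. G (y 0, y 1, y 2) \<partial>gauss_PiM {0, 1, 2::nat})
     = (\<integral>\<^sup>+u. \<integral>\<^sup>+y. G ((y(0:=u)) 0, (y(0:=u)) 1, (y(0:=u)) 2) \<partial>gauss_PiM {1, 2::nat} \<partial>cgauss)"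
    by (rule gauss_PiM.product_nn_integral_insert_rev[OF _ _ m(1)]) simp_all
  also have "\<dots> = (\<integral>\<^sup>+u. \<integral>\<^sup>+y. G (u, y 1, y 2) \<partial>gauss_PiM {1, 2::nat} \<partial>cgauss)"
    by simp
  also have "\<dots> = (\<integral>\<^sup>+u. \<integral>\<^sup>+v. \<integral>\<^sup>+y. G (u, (y(1:=v)) 1, (y(1:=v)) 2) \<partial>gauss_PiM {2::nat} \<partial>cgauss \<partial>cgauss)"
    by (intro nn_integral_cong gauss_PiM.product_nn_integral_insert_rev[OF _ _ m(2)]) simp_all
  also have "\<dots> = (\<integral>\<^sup>+u. \<integral>\<^sup>+v. \<integral>\<^sup>+y. G (u, v, y 2) \<partial>gauss_PiM {2::nat} \<partial>cgauss \<partial>cgauss)"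
    by simp
  also have "\<dots> = (\<integral>\<^sup>+u. \<integral>\<^sup>+v. \<integral>\<^sup>+w. G (u, v, w) \<partial>cgauss \<partial>cgauss \<partial>cgauss)"
    by (intro nn_integral_cong gauss_PiM.product_nn_integral_singleton m(3))
  finally show ?thesis .
qed

section \<open>Gaussian combinations of plane waves\<close>

text \<open>The union over \<open>K\<close> is uncountable. By compactness and continuity a zero
  exists iff |f| takes arbitrarily small values on a countable dense subset, which is a countable
  condition.\<close>

lemma measurable_ex_zero_compact:
  fixes f :: "'a \<Rightarrow> 'z::euclidean_space \<Rightarrow> complex"
  assumes K: "compact K" and cont: "\<And>a. a \<in> space M \<Longrightarrow> continuous_on K (f a)"
    and meas: "\<And>z. z \<in> K \<Longrightarrow> (\<lambda>a. f a z) \<in> borel_measurable M"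
  shows "{a \<in> space M. \<exists>z\<in>K. f a z = 0} \<in> sets M"
proof -
  obtain T where T: "countable T" "T \<subseteq> K" "K \<subseteq> closure T"
    using separable[of K] by blast
  have eq: "(\<exists>z\<in>K. f a z = 0) \<longleftrightarrow> (\<forall>n::nat. \<exists>q\<in>T. cmod (f a q) < 1 / real (Suc n))" if a: "a \<in> space M" for a
  proof
    assume "\<exists>z\<in>K. f a z = 0"
    then obtain z where z: "z \<in> K" "f a z = 0" by blast
    show "\<forall>n::nat. \<exists>q\<in>T. cmod (f a q) < 1 / real (Suc n)"
    proof
      fix n :: nat
      have "0 < 1 / real (Suc n)" by simp
      with cont[OF a] z(1) obtain d where d: "d > 0" "\<And>x. x \<in> K \<Longrightarrow> dist x z < d \<Longrightarrow> dist (f a x) (f a z) < 1 / real (Suc n)"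
        unfolding continuous_on_iff by metis
      obtain q where q: "q \<in> T" "dist q z < d"
        using T(3) z(1) d(1) closure_approachable by blast
      have "cmod (f a q) < 1 / real (Suc n)" using d(2)[of q] q T(2) z(2) by auto
      with q show "\<exists>q\<in>T. cmod (f a q) < 1 / real (Suc n)" by blast
    qed
  next
    assume *: "\<forall>n::nat. \<exists>q\<in>T. cmod (f a q) < 1 / real (Suc n)"
    then have "K \<noteq> {}" using T by blast
    moreover have "continuous_on K (\<lambda>z. cmod (f a z))" using cont[OF a] by (intro continuous_intros)
    ultimately obtain z where z: "z \<in> K" "\<And>y. y \<in> K \<Longrightarrow> cmod (f a z) \<le> cmod (f a y)"
      using continuous_attains_inf[OF K] by blast
    have "cmod (f a z) < 1 / real (Suc n)" for n
      using * z(2) T(2) by (meson le_less_trans subsetD)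
    then have "\<not> cmod (f a z) > 0" using nat_approx_posE by (metis not_less_iff_gr_or_eq)
    with z(1) show "\<exists>z\<in>K. f a z = 0" by auto
  qed
  have "{a \<in> space M. \<exists>z\<in>K. f a z = 0} = {a \<in> space M. \<forall>n::nat. \<exists>q\<in>T. cmod (f a q) < 1 / real (Suc n)}"
    using eq by blast
  also have "\<dots> \<in> sets M"
  proof (intro sets.sets_Collect_countable_All sets.sets_Collect_countable_Ex' T(1))
    fix n :: nat and q assume "q \<in> T"
    then have [measurable]: "(\<lambda>a. f a q) \<in> borel_measurable M" using T meas by blast
    show "{a \<in> space M. cmod (f a q) < 1 / real (Suc n)} \<in> sets M" by measurable
  qed
  finally show ?thesis .
qed

text \<open>\<open>Re z\<close> and \<open>Im z\<close> are two real angles; packing them into a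
  complex number makes the field a map from the plane to itself, as the degree and Brouwer arguments
  require. \<open>(\<alpha> i, \<beta> i)\<close> is the frequency and \<open>r i\<close> the
  amplitude.\<close>

definition wave :: "('i \<Rightarrow> real) \<Rightarrow> ('i \<Rightarrow> real) \<Rightarrow> ('i \<Rightarrow> real) \<Rightarrow> complex \<Rightarrow> 'i \<Rightarrow> complex" where
  "wave r \<alpha> \<beta> z i = complex_of_real (r i) * cis (\<alpha> i * Re z + \<beta> i * Im z)"

definition wave_field where
  "wave_field I r \<alpha> \<beta> a z = (\<Sum>i\<in>I. a i * wave r \<alpha> \<beta> z i)"

definition wave_field_dx where
  "wave_field_dx I r \<alpha> \<beta> a z = (\<Sum>i\<in>I. a i * (\<i> * complex_of_real (\<alpha> i) * wave r \<alpha> \<beta> z i))"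

definition wave_field_dy where
  "wave_field_dy I r \<alpha> \<beta> a z = (\<Sum>i\<in>I. a i * (\<i> * complex_of_real (\<beta> i) * wave r \<alpha> \<beta> z i))"

definition wave_field_jac where
  "wave_field_jac I r \<alpha> \<beta> a z = Im (cnj (wave_field_dx I r \<alpha> \<beta> a z) * wave_field_dy I r \<alpha> \<beta> a z)"

lemma wave_has_derivative:
  "((\<lambda>z. wave r \<alpha> \<beta> z i) has_derivative
     (\<lambda>v. Re v *\<^sub>R (\<i> * complex_of_real (\<alpha> i) * wave r \<alpha> \<beta> z i) + Im v *\<^sub>R (\<i> * complex_of_real (\<beta> i) * wave r \<alpha> \<beta> z i))) (at z)"
proof -
  have "((\<lambda>z. \<i> * complex_of_real (\<alpha> i * Re z + \<beta> i * Im z)) has_derivative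
      (\<lambda>v. \<i> * complex_of_real (\<alpha> i * Re v + \<beta> i * Im v))) (at z)"
    by (auto intro!: derivative_eq_intros)
  from has_derivative_compose[OF this DERIV_exp[unfolded has_field_derivative_def]]
  have "((\<lambda>z. cis (\<alpha> i * Re z + \<beta> i * Im z)) has_derivative
      (\<lambda>v. \<i> * complex_of_real (\<alpha> i * Re v + \<beta> i * Im v) * cis (\<alpha> i * Re z + \<beta> i * Im z))) (at z)"
    by (simp add: cis_conv_exp mult.commute)
  from has_derivative_mult_right[OF this, of "complex_of_real (r i)"]
  show ?thesis
    unfolding wave_def by (rule has_derivative_eq_rhs) (auto simp: fun_eq_iff scaleR_conv_of_real algebra_simps)
qed

lemma wave_field_has_derivative:
  "(wave_field I r \<alpha> \<beta> a has_derivative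
     (\<lambda>v. Re v *\<^sub>R wave_field_dx I r \<alpha> \<beta> a z + Im v *\<^sub>R wave_field_dy I r \<alpha> \<beta> a z)) (at z)"
proof -
  have "((\<lambda>z. \<Sum>i\<in>I. a i * wave r \<alpha> \<beta> z i) has_derivative (\<lambda>v. \<Sum>i\<in>I. a i *
    (Re v *\<^sub>R (\<i> * complex_of_real (\<alpha> i) * wave r \<alpha> \<beta> z i) + Im v *\<^sub>R (\<i> * complex_of_real (\<beta> i) * wave r \<alpha> \<beta> z i)))) (at z)"
    by (intro has_derivative_sum has_derivative_mult_right wave_has_derivative)
  then show ?thesis
    unfolding wave_field_def[abs_def] wave_field_dx_def wave_field_dy_def
    by (simp add: scaleR_sum_right sum.distrib[symmetric] distrib_left)
qed

lemma continuous_on_wave: "continuous_on A (\<lambda>z. wave r \<alpha> \<beta> z i)"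
  unfolding wave_def by (intro continuous_intros)

lemma continuous_on_wave_field: "continuous_on A (wave_field I r \<alpha> \<beta> a)"
  "continuous_on A (wave_field_dx I r \<alpha> \<beta> a)" "continuous_on A (wave_field_dy I r \<alpha> \<beta> a)"
  "continuous_on A (wave_field_jac I r \<alpha> \<beta> a)"
  unfolding wave_field_jac_def[abs_def] wave_field_def[abs_def] wave_field_dx_def[abs_def] wave_field_dy_def[abs_def]
  by (intro continuous_intros continuous_on_wave)+

lemma measurable_wave_field[measurable]:
  "(\<lambda>p. wave_field I r \<alpha> \<beta> (fst p) (snd p)) \<in> borel_measurable (gauss_PiM I \<Otimes>\<^sub>M borel)"
  "(\<lambda>p. wave_field_dx I r \<alpha> \<beta> (fst p) (snd p)) \<in> borel_measurable (gauss_PiM I \<Otimes>\<^sub>M borel)"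
  "(\<lambda>p. wave_field_dy I r \<alpha> \<beta> (fst p) (snd p)) \<in> borel_measurable (gauss_PiM I \<Otimes>\<^sub>M borel)"
  "(\<lambda>p. wave_field_jac I r \<alpha> \<beta> (fst p) (snd p)) \<in> borel_measurable (gauss_PiM I \<Otimes>\<^sub>M borel)"
proof -
  have w[measurable]: "(\<lambda>z. wave r \<alpha> \<beta> z i) \<in> borel_measurable borel" for i
    by (intro borel_measurable_continuous_onI continuous_on_wave)
  have a[measurable]: "(\<lambda>p. fst p i) \<in> borel_measurable (gauss_PiM I \<Otimes>\<^sub>M (borel::complex measure))" if "i \<in> I" for i
  proof -
    have "(\<lambda>x. x i) \<in> borel_measurable (gauss_PiM I)"
      using measurable_component_singleton[OF that, of "\<lambda>_. cgauss"] by (simp cong: measurable_cong_sets)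
    then show ?thesis by measurable
  qed
  show 1: "(\<lambda>p. wave_field I r \<alpha> \<beta> (fst p) (snd p)) \<in> borel_measurable (gauss_PiM I \<Otimes>\<^sub>M borel)"
    "(\<lambda>p. wave_field_dx I r \<alpha> \<beta> (fst p) (snd p)) \<in> borel_measurable (gauss_PiM I \<Otimes>\<^sub>M borel)"
    "(\<lambda>p. wave_field_dy I r \<alpha> \<beta> (fst p) (snd p)) \<in> borel_measurable (gauss_PiM I \<Otimes>\<^sub>M borel)"
    unfolding wave_field_def wave_field_dx_def wave_field_dy_def
    by (intro borel_measurable_sum borel_measurable_times a; measurable)+
  have jac: "wave_field_jac I r \<alpha> \<beta> a z = Re (wave_field_dx I r \<alpha> \<beta> a z) * Im (wave_field_dy I r \<alpha> \<beta> a z)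
      - Im (wave_field_dx I r \<alpha> \<beta> a z) * Re (wave_field_dy I r \<alpha> \<beta> a z)" for a z
    by (simp add: wave_field_jac_def)
  have ReIm: "Re \<in> borel_measurable borel" "Im \<in> borel_measurable borel" by simp_all
  show "(\<lambda>p. wave_field_jac I r \<alpha> \<beta> (fst p) (snd p)) \<in> borel_measurable (gauss_PiM I \<Otimes>\<^sub>M borel)"
    unfolding jac
    by (intro borel_measurable_diff borel_measurable_times measurable_compose[OF 1(2) ReIm(1)] measurable_compose[OF 1(2) ReIm(2)]
        measurable_compose[OF 1(3) ReIm(1)] measurable_compose[OF 1(3) ReIm(2)])
qed

lemma measurable_wave_field_at[measurable]:
  "(\<lambda>a. wave_field I r \<alpha> \<beta> a z) \<in> borel_measurable (gauss_PiM I)"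
  "(\<lambda>a. wave_field_dx I r \<alpha> \<beta> a z) \<in> borel_measurable (gauss_PiM I)"
  "(\<lambda>a. wave_field_dy I r \<alpha> \<beta> a z) \<in> borel_measurable (gauss_PiM I)"
  "(\<lambda>a. wave_field_jac I r \<alpha> \<beta> a z) \<in> borel_measurable (gauss_PiM I)"
  using measurable_compose[OF measurable_Pair[OF measurable_ident measurable_const] measurable_wave_field(1), of z]
    measurable_compose[OF measurable_Pair[OF measurable_ident measurable_const] measurable_wave_field(2), of z]
    measurable_compose[OF measurable_Pair[OF measurable_ident measurable_const] measurable_wave_field(3), of z]
    measurable_compose[OF measurable_Pair[OF measurable_ident measurable_const] measurable_wave_field(4), of z]
  by simp_all

lemma cmod_cis_diff_le: "cmod (cis x - cis y) \<le> \<bar>x - y\<bar>"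
proof -
  have d: "((\<lambda>t. cis t) has_derivative (\<lambda>h. h *\<^sub>R (\<i> * cis t))) (at t within UNIV)" for t
  proof -
    have "((\<lambda>t. \<i> * complex_of_real t) has_derivative (\<lambda>h. \<i> * complex_of_real h)) (at t)"
      by (auto intro!: derivative_eq_intros)
    from has_derivative_compose[OF this DERIV_exp[unfolded has_field_derivative_def]]
    show ?thesis by (simp add: cis_conv_exp scaleR_conv_of_real mult_ac)
  qed
  have "norm (cis x - cis y) \<le> 1 * norm (x - y)"
    by (rule differentiable_bound[OF convex_UNIV d]) (auto intro!: onorm_le simp: norm_mult)
  then show ?thesis by simp
qed

lemma wave_lipschitz:
  "cmod (wave r \<alpha> \<beta> z i - wave r \<alpha> \<beta> z' i) \<le> \<bar>r i\<bar> * (\<bar>\<alpha> i\<bar> + \<bar>\<beta> i\<bar>) * cmod (z - z')"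
proof -
  have "cmod (wave r \<alpha> \<beta> z i - wave r \<alpha> \<beta> z' i) = \<bar>r i\<bar> * cmod (cis (\<alpha> i * Re z + \<beta> i * Im z) - cis (\<alpha> i * Re z' + \<beta> i * Im z'))"
    unfolding wave_def by (simp add: right_diff_distrib[symmetric] norm_mult)
  also have "\<dots> \<le> \<bar>r i\<bar> * \<bar>(\<alpha> i * Re z + \<beta> i * Im z) - (\<alpha> i * Re z' + \<beta> i * Im z')\<bar>"
    by (intro mult_left_mono cmod_cis_diff_le) auto
  also have "(\<alpha> i * Re z + \<beta> i * Im z) - (\<alpha> i * Re z' + \<beta> i * Im z') = \<alpha> i * Re (z - z') + \<beta> i * Im (z - z')"
    by (simp add: algebra_simps)
  also have "\<bar>\<alpha> i * Re (z - z') + \<beta> i * Im (z - z')\<bar> \<le> \<bar>\<alpha> i\<bar> * cmod (z - z') + \<bar>\<beta> i\<bar> * cmod (z - z')"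
    by (intro order_trans[OF abs_triangle_ineq] add_mono) (auto simp: abs_mult intro!: mult_left_mono abs_Re_le_cmod[of "z - z'", simplified] abs_Im_le_cmod[of "z - z'", simplified])
  finally have "cmod (wave r \<alpha> \<beta> z i - wave r \<alpha> \<beta> z' i) \<le> \<bar>r i\<bar> * (\<bar>\<alpha> i\<bar> * cmod (z - z') + \<bar>\<beta> i\<bar> * cmod (z - z'))"
    by (simp add: mult_left_mono)
  then show ?thesis by (simp add: algebra_simps)
qed

text \<open>One pathwise constant for the field and for its Jacobian: the square in \<open>K\<close>
  pays for a frequency factor from a derivative and for another from the Lipschitz bound of a
  wave.\<close>

lemma wave_field_bounds:
  fixes a :: "'i \<Rightarrow> complex" and r \<alpha> \<beta> :: "'i \<Rightarrow> real" and I :: "'i set"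
  defines "K \<equiv> \<Sum>i\<in>I. cmod (a i) * \<bar>r i\<bar> * (1 + \<bar>\<alpha> i\<bar> + \<bar>\<beta> i\<bar>)\<^sup>2"
  shows "cmod (wave_field I r \<alpha> \<beta> a z - wave_field I r \<alpha> \<beta> a z') \<le> K * cmod (z - z')"
    and "\<bar>wave_field_jac I r \<alpha> \<beta> a z - wave_field_jac I r \<alpha> \<beta> a z'\<bar> \<le> 2 * K\<^sup>2 * cmod (z - z')"
proof -
  define k where "k i = \<bar>\<alpha> i\<bar> + \<bar>\<beta> i\<bar>" for i
  have k: "k i \<ge> 0" "\<bar>\<alpha> i\<bar> \<le> k i" "\<bar>\<beta> i\<bar> \<le> k i" for i by (auto simp: k_def)
  have K0: "K \<ge> 0" unfolding K_def by (intro sum_nonneg) auto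
  have wl: "cmod (wave r \<alpha> \<beta> z i - wave r \<alpha> \<beta> z' i) \<le> \<bar>r i\<bar> * k i * cmod (z - z')" for i z z'
    using wave_lipschitz[of r \<alpha> \<beta> z i z'] by (simp add: k_def)
  have gen: "cmod (\<Sum>i\<in>I. a i * (c i * wave r \<alpha> \<beta> z i) - a i * (c i * wave r \<alpha> \<beta> z' i)) \<le> K * cmod (z - z')"
    if c: "\<And>i. cmod (c i) \<le> 1 + k i" for c z z'
  proof -
    have "cmod (\<Sum>i\<in>I. a i * (c i * wave r \<alpha> \<beta> z i) - a i * (c i * wave r \<alpha> \<beta> z' i))
      \<le> (\<Sum>i\<in>I. cmod (a i * (c i * wave r \<alpha> \<beta> z i) - a i * (c i * wave r \<alpha> \<beta> z' i)))"
      by (rule norm_sum)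
    also have "\<dots> \<le> (\<Sum>i\<in>I. cmod (a i) * \<bar>r i\<bar> * (1 + \<bar>\<alpha> i\<bar> + \<bar>\<beta> i\<bar>)\<^sup>2 * cmod (z - z'))"
    proof (rule sum_mono)
      fix i
      have "cmod (a i * (c i * wave r \<alpha> \<beta> z i) - a i * (c i * wave r \<alpha> \<beta> z' i))
         = cmod (a i) * (cmod (c i) * cmod (wave r \<alpha> \<beta> z i - wave r \<alpha> \<beta> z' i))"
        by (simp only: right_diff_distrib[symmetric] norm_mult)
      also have "\<dots> \<le> cmod (a i) * ((1 + k i) * (\<bar>r i\<bar> * k i * cmod (z - z')))"
        using c wl k by (intro mult_left_mono mult_mono) auto
      also have "\<dots> \<le> cmod (a i) * ((1 + k i) * (\<bar>r i\<bar> * (1 + k i) * cmod (z - z')))"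
        using k by (intro mult_left_mono mult_right_mono) auto
      also have "\<dots> = cmod (a i) * \<bar>r i\<bar> * (1 + \<bar>\<alpha> i\<bar> + \<bar>\<beta> i\<bar>)\<^sup>2 * cmod (z - z')"
        by (simp add: power2_eq_square k_def algebra_simps)
      finally show "cmod (a i * (c i * wave r \<alpha> \<beta> z i) - a i * (c i * wave r \<alpha> \<beta> z' i))
         \<le> cmod (a i) * \<bar>r i\<bar> * (1 + \<bar>\<alpha> i\<bar> + \<bar>\<beta> i\<bar>)\<^sup>2 * cmod (z - z')" .
    qed
    also have "\<dots> = K * cmod (z - z')" by (simp add: K_def sum_distrib_right)
    finally show ?thesis .
  qed
  have bnd: "cmod (\<Sum>i\<in>I. a i * (c i * wave r \<alpha> \<beta> z i)) \<le> K" if c: "\<And>i. cmod (c i) \<le> k i" for c z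
  proof -
    have "cmod (\<Sum>i\<in>I. a i * (c i * wave r \<alpha> \<beta> z i)) \<le> (\<Sum>i\<in>I. cmod (a i * (c i * wave r \<alpha> \<beta> z i)))"
      by (rule norm_sum)
    also have "\<dots> \<le> K" unfolding K_def
    proof (rule sum_mono)
      fix i
      have "cmod (a i * (c i * wave r \<alpha> \<beta> z i)) = cmod (a i) * (cmod (c i) * \<bar>r i\<bar>)"
        by (simp add: norm_mult wave_def)
      also have "\<dots> \<le> cmod (a i) * ((1 + k i)\<^sup>2 * \<bar>r i\<bar>)"
      proof (intro mult_left_mono mult_right_mono)
        have "cmod (c i) \<le> 1 * (1 + k i)" using c[of i] by simp
        also have "\<dots> \<le> (1 + k i)\<^sup>2" unfolding power2_eq_square using k by (intro mult_right_mono) auto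
        finally show "cmod (c i) \<le> (1 + k i)\<^sup>2" .
      qed auto
      finally show "cmod (a i * (c i * wave r \<alpha> \<beta> z i)) \<le> cmod (a i) * \<bar>r i\<bar> * (1 + \<bar>\<alpha> i\<bar> + \<bar>\<beta> i\<bar>)\<^sup>2"
        by (simp add: k_def algebra_simps)
    qed
    finally show ?thesis .
  qed
  show "cmod (wave_field I r \<alpha> \<beta> a z - wave_field I r \<alpha> \<beta> a z') \<le> K * cmod (z - z')"
    using gen[of "\<lambda>_. 1" z z'] k by (simp add: wave_field_def sum_subtractf)
  let ?p = "wave_field_dx I r \<alpha> \<beta> a z" and ?q = "wave_field_dy I r \<alpha> \<beta> a z"
  let ?p' = "wave_field_dx I r \<alpha> \<beta> a z'" and ?q' = "wave_field_dy I r \<alpha> \<beta> a z'"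
  have p: "cmod (?p - ?p') \<le> K * cmod (z - z')" "cmod ?p' \<le> K"
    using gen[of "\<lambda>i. \<i> * complex_of_real (\<alpha> i)" z z'] bnd[of "\<lambda>i. \<i> * complex_of_real (\<alpha> i)" z'] k
    by (auto simp: wave_field_dx_def sum_subtractf norm_mult add_increasing)
  have q: "cmod (?q - ?q') \<le> K * cmod (z - z')" "cmod ?q \<le> K"
    using gen[of "\<lambda>i. \<i> * complex_of_real (\<beta> i)" z z'] bnd[of "\<lambda>i. \<i> * complex_of_real (\<beta> i)" z] k
    by (auto simp: wave_field_dy_def sum_subtractf norm_mult add_increasing)
  \<comment> \<open>The Jacobian is bilinear in the two derivatives, so one of them is changed at a
    time.\<close>
  have "wave_field_jac I r \<alpha> \<beta> a z - wave_field_jac I r \<alpha> \<beta> a z' = Im (cnj (?p - ?p') * ?q + cnj ?p' * (?q - ?q'))"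
    by (simp add: wave_field_jac_def algebra_simps)
  then have "\<bar>wave_field_jac I r \<alpha> \<beta> a z - wave_field_jac I r \<alpha> \<beta> a z'\<bar> \<le> cmod (cnj (?p - ?p') * ?q + cnj ?p' * (?q - ?q'))"
    by (metis abs_Im_le_cmod)
  also have "\<dots> \<le> cmod (?p - ?p') * cmod ?q + cmod ?p' * cmod (?q - ?q')"
    by (rule order_trans[OF norm_triangle_ineq]) (simp add: norm_mult flip: complex_cnj_diff)
  also have "\<dots> \<le> (K * cmod (z - z')) * K + K * (K * cmod (z - z'))"
    using p q K0 by (intro add_mono mult_mono) auto
  also have "\<dots> = 2 * K\<^sup>2 * cmod (z - z')" by (simp add: power2_eq_square algebra_simps)
  finally show "\<bar>wave_field_jac I r \<alpha> \<beta> a z - wave_field_jac I r \<alpha> \<beta> a z'\<bar> \<le> 2 * K\<^sup>2 * cmod (z - z')" .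
qed

text \<open>\<open>A\<close>, \<open>B\<close>, \<open>C\<close> are the covariances of the two
  derivatives at a point. Centred frequencies make the field uncorrelated, hence independent, of its
  derivatives there; positivity of the determinant makes the gradient nondegenerate.\<close>

locale wave_covariance =
  fixes I :: "'i set" and r \<alpha> \<beta> :: "'i \<Rightarrow> real" and A B C :: real
  assumes fin: "finite I"
    and mom: "(\<Sum>i\<in>I. (r i)\<^sup>2) = 1" "(\<Sum>i\<in>I. (r i)\<^sup>2 * \<alpha> i) = 0" "(\<Sum>i\<in>I. (r i)\<^sup>2 * \<beta> i) = 0"
      "(\<Sum>i\<in>I. (r i)\<^sup>2 * (\<alpha> i)\<^sup>2) = A" "(\<Sum>i\<in>I. (r i)\<^sup>2 * (\<alpha> i * \<beta> i)) = B" "(\<Sum>i\<in>I. (r i)\<^sup>2 * (\<beta> i)\<^sup>2) = C"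
    and pos: "A > 0" "A * C - B\<^sup>2 > 0"
begin

abbreviation "\<Delta> \<equiv> A * C - B\<^sup>2"
abbreviation "fld \<equiv> wave_field I r \<alpha> \<beta>"
abbreviation "fdx \<equiv> wave_field_dx I r \<alpha> \<beta>"
abbreviation "fdy \<equiv> wave_field_dy I r \<alpha> \<beta>"
abbreviation "jac \<equiv> wave_field_jac I r \<alpha> \<beta>"

text \<open>Gram-Schmidt writes the value and the two derivatives through three orthonormal linear
  forms, which are independent Gaussians. The phases of the waves cancel in all Hermitian products,
  so the law does not depend on \<open>z\<close>.\<close>

lemma jet_law:
  fixes G :: "complex \<times> complex \<times> complex \<Rightarrow> ennreal"
  assumes G[measurable]: "G \<in> borel_measurable (borel \<Otimes>\<^sub>M (borel \<Otimes>\<^sub>M borel))"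
  shows "(\<integral>\<^sup>+a. G (fld a z, fdx a z, fdy a z) \<partial>gauss_PiM I)
    = (\<integral>\<^sup>+u. \<integral>\<^sup>+v. \<integral>\<^sup>+w. G (u, complex_of_real (sqrt A) * v,
        complex_of_real (B / sqrt A) * v + complex_of_real (sqrt (\<Delta> / A)) * w) \<partial>cgauss \<partial>cgauss \<partial>cgauss)"
proof -
  let ?w = "\<lambda>i. wave r \<alpha> \<beta> z i"
  define s t where "s = sqrt A" and "t = sqrt (\<Delta> / A)"
  have s: "s > 0" "s * s = A" and t: "t > 0" "t * t = \<Delta> / A"
    using pos by (auto simp: s_def t_def)
  \<comment> \<open>The factor from differentiating a phase is split off, so that the coefficients
    \<open>e\<close> to be orthonormalized are real.\<close>
  define ph :: "nat \<Rightarrow> complex" where "ph j = (if j = 0 then 1 else \<i>)" for j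
  define e where "e j i = (if j = (0::nat) then 1 else if j = 1 then \<alpha> i / s
     else (\<beta> i - B / A * \<alpha> i) / t)" for j i
  define c where "c j i = ph j * complex_of_real (e j i)" for j i
  have w2: "?w i * cnj (?w i) = complex_of_real ((r i)\<^sup>2)" for i
    by (simp add: wave_def power2_eq_square cis_cnj cis_mult algebra_simps flip: mult.assoc)
  have prod: "(\<Sum>i\<in>I. (c j i * ?w i) * cnj (c k i * ?w i))
      = ph j * cnj (ph k) * complex_of_real (\<Sum>i\<in>I. (r i)\<^sup>2 * (e j i * e k i))" for j k
  proof -
    have "(c j i * ?w i) * cnj (c k i * ?w i) = ph j * cnj (ph k) * (complex_of_real (e j i * e k i) * (?w i * cnj (?w i)))" for i
      by (simp add: c_def)
    then show ?thesis unfolding w2 by (simp add: sum_distrib_left mult_ac)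
  qed
  have on: "orthonormal_on I {0, 1, 2} (\<lambda>j i. c j i * ?w i)"
  proof -
    have s1: "(\<Sum>i\<in>I. (r i)\<^sup>2 * (\<alpha> i / s)) = 0"
      using mom(2) by (simp add: sum_divide_distrib[symmetric] times_divide_eq_right)
    have s2: "(\<Sum>i\<in>I. (r i)\<^sup>2 * ((\<beta> i - B / A * \<alpha> i) / t)) = 0"
    proof -
      have "(\<Sum>i\<in>I. (r i)\<^sup>2 * ((\<beta> i - B / A * \<alpha> i) / t)) = ((\<Sum>i\<in>I. (r i)\<^sup>2 * \<beta> i) - B / A * (\<Sum>i\<in>I. (r i)\<^sup>2 * \<alpha> i)) / t"
        by (simp add: sum_distrib_left sum_subtractf sum_divide_distrib right_diff_distrib diff_divide_distrib mult_ac)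
      then show ?thesis using mom by simp
    qed
    have s11: "(\<Sum>i\<in>I. (r i)\<^sup>2 * (\<alpha> i / s * (\<alpha> i / s))) = 1"
    proof -
      have "(\<Sum>i\<in>I. (r i)\<^sup>2 * (\<alpha> i / s * (\<alpha> i / s))) = (\<Sum>i\<in>I. (r i)\<^sup>2 * (\<alpha> i)\<^sup>2) / (s * s)"
        by (simp add: sum_divide_distrib power2_eq_square)
      then show ?thesis using mom s pos by simp
    qed
    have s12: "(\<Sum>i\<in>I. (r i)\<^sup>2 * (\<alpha> i / s * ((\<beta> i - B / A * \<alpha> i) / t))) = 0"
    proof -
      have "(\<Sum>i\<in>I. (r i)\<^sup>2 * (\<alpha> i / s * ((\<beta> i - B / A * \<alpha> i) / t)))
         = ((\<Sum>i\<in>I. (r i)\<^sup>2 * (\<alpha> i * \<beta> i)) - B / A * (\<Sum>i\<in>I. (r i)\<^sup>2 * (\<alpha> i)\<^sup>2)) / (s * t)"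
        by (simp add: sum_distrib_left sum_subtractf sum_divide_distrib right_diff_distrib diff_divide_distrib power2_eq_square mult_ac)
      then show ?thesis using mom pos by simp
    qed
    have s22: "(\<Sum>i\<in>I. (r i)\<^sup>2 * ((\<beta> i - B / A * \<alpha> i) / t * ((\<beta> i - B / A * \<alpha> i) / t))) = 1"
    proof -
      have "(\<Sum>i\<in>I. (r i)\<^sup>2 * ((\<beta> i - B / A * \<alpha> i) / t * ((\<beta> i - B / A * \<alpha> i) / t)))
         = ((\<Sum>i\<in>I. (r i)\<^sup>2 * (\<beta> i)\<^sup>2) - 2 * (B / A) * (\<Sum>i\<in>I. (r i)\<^sup>2 * (\<alpha> i * \<beta> i)) + (B / A) * (B / A) * (\<Sum>i\<in>I. (r i)\<^sup>2 * (\<alpha> i)\<^sup>2)) / (t * t)"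
        by (simp add: sum_distrib_left sum_subtractf sum.distrib sum_divide_distrib power2_eq_square algebra_simps diff_divide_distrib add_divide_distrib)
      also have "\<dots> = (C - 2 * (B / A) * B + (B / A) * (B / A) * A) / (\<Delta> / A)"
        by (simp only: mom t(2))
      also have "\<dots> = 1"
      proof -
        have "C - 2 * (B / A) * B + (B / A) * (B / A) * A = \<Delta> / A"
          using pos by (simp add: field_simps power2_eq_square)
        moreover have "\<Delta> / A \<noteq> 0" using pos by auto
        ultimately show ?thesis by simp
      qed
      finally show ?thesis .
    qed
    have re: "(\<Sum>i\<in>I. (r i)\<^sup>2 * (e j i * e k i)) = (if j = k then 1 else 0)" if "j \<in> {0,1,2}" "k \<in> {0,1,2}" for j k
      using that s1 s2 s11 s12 s22 mom(1) by (auto simp: e_def mult.commute)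
    show ?thesis
      unfolding orthonormal_on_def prod
    proof (intro ballI)
      fix j k :: nat assume "j \<in> {0,1,2}" "k \<in> {0,1,2}"
      from re[OF this] show "ph j * cnj (ph k) * complex_of_real (\<Sum>i\<in>I. (r i)\<^sup>2 * (e j i * e k i)) = (if j = k then 1 else 0)"
        by (simp add: ph_def del: of_real_sum)
    qed
  qed
  have G': "(\<lambda>p. G (fst p, complex_of_real s * fst (snd p), complex_of_real (B / s) * fst (snd p) + complex_of_real t * snd (snd p)))
     \<in> borel_measurable (borel \<Otimes>\<^sub>M (borel \<Otimes>\<^sub>M borel))"
    by measurable
  let ?H = "\<lambda>y :: nat \<Rightarrow> complex. G (y 0, complex_of_real s * y 1, complex_of_real (B / s) * y 1 + complex_of_real t * y 2)"
  have H: "?H \<in> borel_measurable (gauss_PiM {0, 1, 2::nat})"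
  proof -
    have c: "(\<lambda>y. y i) \<in> borel_measurable (gauss_PiM J)" if "i \<in> J" for i and J :: "nat set"
      using measurable_component_singleton[OF that, of "\<lambda>_. cgauss"] by (simp cong: measurable_cong_sets)
    have "(\<lambda>y. (y 0, y 1, y 2)) \<in> gauss_PiM {0, 1, 2::nat} \<rightarrow>\<^sub>M borel \<Otimes>\<^sub>M (borel \<Otimes>\<^sub>M borel)"
      by (intro measurable_Pair c) auto
    from measurable_compose[OF this G'] show ?thesis by simp
  qed
  have "(\<integral>\<^sup>+a. G (fld a z, fdx a z, fdy a z) \<partial>gauss_PiM I)
      = (\<integral>\<^sup>+a. ?H (\<lambda>j\<in>{0,1,2}. \<Sum>i\<in>I. a i * (c j i * ?w i)) \<partial>gauss_PiM I)"
  proof (intro nn_integral_cong arg_cong[where f=G])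
    fix a :: "'i \<Rightarrow> complex"
    have 0: "(\<Sum>i\<in>I. a i * (c 0 i * ?w i)) = fld a z" by (simp add: c_def ph_def e_def wave_field_def)
    have 1: "complex_of_real s * (\<Sum>i\<in>I. a i * (c 1 i * ?w i)) = fdx a z"
      using s by (simp add: c_def ph_def e_def wave_field_dx_def sum_distrib_left field_simps)
    have 2: "complex_of_real (B / s) * (\<Sum>i\<in>I. a i * (c 1 i * ?w i)) + complex_of_real t * (\<Sum>i\<in>I. a i * (c 2 i * ?w i)) = fdy a z"
      unfolding wave_field_dy_def sum_distrib_left sum.distrib[symmetric]
    proof (rule sum.cong[OF refl])
      fix i
      have "B / s * (\<alpha> i / s) + t * ((\<beta> i - B / A * \<alpha> i) / t) = \<beta> i"
        using s t by (simp add: s(2)[symmetric])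
      then have b: "complex_of_real (B / s) * complex_of_real (\<alpha> i / s) + complex_of_real t * complex_of_real ((\<beta> i - B / A * \<alpha> i) / t) = complex_of_real (\<beta> i)"
        by (metis of_real_add of_real_mult)
      show "complex_of_real (B / s) * (a i * (c 1 i * ?w i)) + complex_of_real t * (a i * (c 2 i * ?w i)) = a i * (\<i> * complex_of_real (\<beta> i) * ?w i)"
        unfolding b[symmetric] by (simp add: c_def ph_def e_def algebra_simps del: of_real_divide of_real_diff of_real_mult)
    qed
    show "(fld a z, fdx a z, fdy a z) = ((\<lambda>j\<in>{0,1,2}. \<Sum>i\<in>I. a i * (c j i * ?w i)) 0,
       complex_of_real s * (\<lambda>j\<in>{0,1,2}. \<Sum>i\<in>I. a i * (c j i * ?w i)) 1,
       complex_of_real (B / s) * (\<lambda>j\<in>{0,1,2}. \<Sum>i\<in>I. a i * (c j i * ?w i)) 1 + complex_of_real t * (\<lambda>j\<in>{0,1,2}. \<Sum>i\<in>I. a i * (c j i * ?w i)) 2)"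
      using 0 1 2 by simp
  qed
  also have "\<dots> = (\<integral>\<^sup>+y. ?H y \<partial>gauss_PiM {0, 1, 2::nat})"
    by (rule nn_integral_gauss_orthonormal[OF _ fin on H]) simp
  also have "\<dots> = (\<integral>\<^sup>+u. \<integral>\<^sup>+v. \<integral>\<^sup>+w. G (u, complex_of_real s * v, complex_of_real (B / s) * v + complex_of_real t * w) \<partial>cgauss \<partial>cgauss \<partial>cgauss)"
    using nn_integral_gauss_PiM_3[OF G'] by simp
  finally show ?thesis by (simp add: s_def t_def)
qed

end

section \<open>The probability of a zero from above\<close>

text \<open>The law of the Jacobian of the field at a point, divided by the square root of the
  covariance determinant.\<close>

definition cgauss_jac_dist :: "real measure" where
  "cgauss_jac_dist = distr (cgauss \<Otimes>\<^sub>M cgauss) borel (\<lambda>p. Im (cnj (fst p) * snd p))"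

lemma measurable_Im_cnj_mult[measurable]:
  assumes f: "f \<in> borel_measurable M" "g \<in> borel_measurable M"
  shows "(\<lambda>p. Im (cnj (f p) * g p)) \<in> borel_measurable M"
proof -
  have "(\<lambda>p. Im (cnj (f p) * g p)) = (\<lambda>p. Re (f p) * Im (g p) - Im (f p) * Re (g p))" by (simp add: fun_eq_iff)
  then show ?thesis using f by simp
qed

lemma nn_integral_cgauss_jac_dist:
  assumes [measurable]: "\<psi> \<in> borel_measurable borel"
  shows "(\<integral>\<^sup>+t. \<psi> t \<partial>cgauss_jac_dist) = (\<integral>\<^sup>+v. \<integral>\<^sup>+w. \<psi> (Im (cnj v * w)) \<partial>cgauss \<partial>cgauss)"
proof -
  have m: "(\<lambda>p. Im (cnj (fst p) * snd p)) \<in> borel_measurable (cgauss \<Otimes>\<^sub>M cgauss)"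
    by (intro measurable_Im_cnj_mult) measurable
  have "(\<integral>\<^sup>+t. \<psi> t \<partial>cgauss_jac_dist) = (\<integral>\<^sup>+p. \<psi> (Im (cnj (fst p) * snd p)) \<partial>(cgauss \<Otimes>\<^sub>M cgauss))"
    unfolding cgauss_jac_dist_def by (rule nn_integral_distr[OF m]) simp
  also have "\<dots> = (\<integral>\<^sup>+v. \<integral>\<^sup>+w. \<psi> (Im (cnj v * w)) \<partial>cgauss \<partial>cgauss)"
    by (subst cgauss.nn_integral_fst[symmetric]) (use measurable_compose[OF m assms] in simp_all)
  finally show ?thesis .
qed

lemma prob_space_cgauss_jac_dist: "prob_space cgauss_jac_dist"
proof -
  interpret P: pair_prob_space cgauss cgauss ..
  show ?thesis unfolding cgauss_jac_dist_def
    by (intro P.prob_space_distr measurable_Im_cnj_mult) measurable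
qed

lemma sets_cgauss_jac_dist[simp, measurable_cong]: "sets cgauss_jac_dist = sets borel"
  by (simp add: cgauss_jac_dist_def)

text \<open>After the phase reduction the event says that \<open>v\<close> vanishes or
  \<open>w\<close> is real, and both have Lebesgue measure zero.\<close>

lemma cgauss_jac_dist_0: "emeasure cgauss_jac_dist {0} = 0"
proof -
  have Im0: "(\<integral>\<^sup>+w. indicator {w. Im w = 0} w \<partial>cgauss) = (0::ennreal)"
  proof -
    have "{w. Im w = 0} \<in> sets borel" by (intro borel_closed closed_Collect_eq continuous_intros)
    then have "(\<integral>\<^sup>+w. indicator {w. Im w = 0} w \<partial>cgauss) = (\<integral>\<^sup>+w. ennreal (exp (- (cmod w)\<^sup>2) / pi) * indicator {w. Im w = 0} w \<partial>lborel)"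
      by (intro nn_integral_cgauss) simp
    also have "\<dots> = (\<integral>\<^sup>+x. \<integral>\<^sup>+y. ennreal (exp (- (x\<^sup>2 + y\<^sup>2)) / pi) * indicator {0} y \<partial>lborel \<partial>lborel)"
      using \<open>{w. Im w = 0} \<in> sets borel\<close>
      by (subst nn_integral_lborel_complex) (auto simp: cmod_power2 indicator_def intro!: nn_integral_cong)
    also have "\<dots> = 0"
      by (simp add: nn_integral_0_iff_AE)
    finally show ?thesis .
  qed
  have "emeasure cgauss_jac_dist {0} = (\<integral>\<^sup>+t. indicator {0} t \<partial>cgauss_jac_dist)" by simp
  also have "\<dots> = (\<integral>\<^sup>+v. \<integral>\<^sup>+w. indicator {0} (Im (cnj v * w)) \<partial>cgauss \<partial>cgauss)"
    by (rule nn_integral_cgauss_jac_dist) simp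
  also have "\<dots> = (\<integral>\<^sup>+v. indicator {0} v \<partial>cgauss)"
  proof (intro nn_integral_cong)
    fix v :: complex
    have "(\<integral>\<^sup>+w. indicator {0} (Im (cnj v * w)) \<partial>cgauss) = (\<integral>\<^sup>+w. indicator {0::real} (cmod v * Im w) \<partial>cgauss)"
      by (rule cgauss_cnj_mult) simp
    also have "\<dots> = indicator {0} v"
    proof (cases "v = 0")
      case True then show ?thesis using cgauss.emeasure_space_1 by simp
    next
      case False
      then have "(\<lambda>w. indicator {0::real} (cmod v * Im w) :: ennreal) = indicator {w. Im w = 0}"
        by (auto simp: indicator_def fun_eq_iff)
      with False Im0 show ?thesis by simp
    qed
    finally show "(\<integral>\<^sup>+w. indicator {0} (Im (cnj v * w)) \<partial>cgauss) = (indicator {0} v :: ennreal)" .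
  qed
  also have "\<dots> = (\<integral>\<^sup>+v. ennreal (exp (- (cmod v)\<^sup>2) / pi) * indicator {0} v \<partial>lborel)"
    by (rule nn_integral_cgauss) simp
  also have "\<dots> = 0"
    by (simp add: nn_integral_0_iff_AE)
  finally show ?thesis .
qed

text \<open>Continuity from above at the null set {0}. No rate is asked for: the gain over the size
  of the mesh in the exclusion of degenerate zeros only has to tend to zero.\<close>

lemma cgauss_jac_dist_small:
  assumes "e > 0"
  obtains x where "x > 0" "emeasure cgauss_jac_dist {-x..x} < ennreal e"
proof -
  interpret prob_space cgauss_jac_dist by (rule prob_space_cgauss_jac_dist)
  define S where "S n = {- (1 / real (Suc n))..1 / real (Suc n)}" for n
  have "(\<lambda>n. emeasure cgauss_jac_dist (S n)) \<longlonglongrightarrow> emeasure cgauss_jac_dist (\<Inter>n. S n)"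
  proof (rule Lim_emeasure_decseq)
    show "decseq S"
      unfolding S_def decseq_def by (auto simp: le_divide_eq divide_le_eq)
  qed (auto simp: S_def)
  moreover have "(\<Inter>n. S n) = {0}"
  proof -
    have "x = 0" if x: "\<And>n. \<bar>x\<bar> \<le> 1 / real (Suc n)" for x :: real
    proof (rule ccontr)
      assume "x \<noteq> 0"
      then obtain n where "1 / real (Suc n) < \<bar>x\<bar>" using nat_approx_posE[of "\<bar>x\<bar>"] by auto
      with x[of n] show False by simp
    qed
    then show ?thesis by (fastforce simp: S_def abs_le_iff)
  qed
  ultimately have "(\<lambda>n. emeasure cgauss_jac_dist (S n)) \<longlonglongrightarrow> 0" by (simp add: cgauss_jac_dist_0)
  then have "eventually (\<lambda>n. emeasure cgauss_jac_dist (S n) < ennreal e) sequentially"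
    using assms by (intro order_tendstoD(2)) auto
  then obtain n where "emeasure cgauss_jac_dist (S n) < ennreal e" by (auto simp: eventually_sequentially)
  then show ?thesis using that[of "1 / real (Suc n)"] by (simp add: S_def)
qed

context wave_covariance
begin

text \<open>The field and its Jacobian at one point are independent, with the Jacobian distributed
  as \<open>sqrt \<Delta>\<close> times the normalized one.\<close>

lemma field_jac_law:
  assumes [measurable]: "\<phi> \<in> borel_measurable borel" "\<psi> \<in> borel_measurable borel"
  shows "(\<integral>\<^sup>+a. \<phi> (fld a z) * \<psi> (jac a z) \<partial>gauss_PiM I)
    = (\<integral>\<^sup>+u. \<phi> u \<partial>cgauss) * (\<integral>\<^sup>+t. \<psi> (sqrt \<Delta> * t) \<partial>cgauss_jac_dist)"
proof -
  define G where "G = (\<lambda>p :: complex \<times> complex \<times> complex. \<phi> (fst p) * \<psi> (Im (cnj (fst (snd p)) * snd (snd p))))"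
  have G: "G \<in> borel_measurable (borel \<Otimes>\<^sub>M (borel \<Otimes>\<^sub>M borel))"
    unfolding G_def by (intro borel_measurable_times_ennreal measurable_compose[OF _ assms(1)] measurable_compose[OF _ assms(2)]
      measurable_Im_cnj_mult) measurable
  have s: "sqrt A * sqrt (\<Delta> / A) = sqrt \<Delta>" using pos by (simp add: real_sqrt_mult[symmetric])
  \<comment> \<open>The correlated part of the second derivative contributes a real multiple of
    |v|^2, which has no imaginary part.\<close>
  have im: "Im (cnj (complex_of_real (sqrt A) * v) * (complex_of_real (B / sqrt A) * v + complex_of_real (sqrt (\<Delta> / A)) * w))
       = sqrt \<Delta> * Im (cnj v * w)" for v w
    unfolding s[symmetric] by (simp add: algebra_simps del: real_sqrt_divide)
  have "(\<integral>\<^sup>+a. \<phi> (fld a z) * \<psi> (jac a z) \<partial>gauss_PiM I) = (\<integral>\<^sup>+a. G (fld a z, fdx a z, fdy a z) \<partial>gauss_PiM I)"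
    by (simp add: G_def wave_field_jac_def)
  also have "\<dots> = (\<integral>\<^sup>+u. \<integral>\<^sup>+v. \<integral>\<^sup>+w. \<phi> u * \<psi> (sqrt \<Delta> * Im (cnj v * w)) \<partial>cgauss \<partial>cgauss \<partial>cgauss)"
    unfolding jet_law[OF G] by (simp only: G_def fst_conv snd_conv im)
  also have "\<dots> = (\<integral>\<^sup>+u. \<phi> u * (\<integral>\<^sup>+v. \<integral>\<^sup>+w. \<psi> (sqrt \<Delta> * Im (cnj v * w)) \<partial>cgauss \<partial>cgauss) \<partial>cgauss)"
  proof -
    have m: "(\<lambda>p. \<psi> (sqrt \<Delta> * Im (cnj (fst p) * snd p))) \<in> borel_measurable (cgauss \<Otimes>\<^sub>M cgauss)"
      by (intro measurable_compose[OF _ assms(2)] borel_measurable_times borel_measurable_const measurable_Im_cnj_mult) measurable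
    have m1: "(\<lambda>w. \<psi> (sqrt \<Delta> * Im (cnj v * w))) \<in> borel_measurable cgauss" for v
      by (intro measurable_compose[OF _ assms(2)] borel_measurable_times borel_measurable_const measurable_Im_cnj_mult) measurable
    have m2: "(\<lambda>v. \<integral>\<^sup>+w. \<psi> (sqrt \<Delta> * Im (cnj v * w)) \<partial>cgauss) \<in> borel_measurable cgauss"
      using cgauss.borel_measurable_nn_integral_fst[OF m] by simp
    show ?thesis using m1 m2 by (simp add: nn_integral_cmult)
  qed
  also have "\<dots> = (\<integral>\<^sup>+u. \<phi> u \<partial>cgauss) * (\<integral>\<^sup>+v. \<integral>\<^sup>+w. \<psi> (sqrt \<Delta> * Im (cnj v * w)) \<partial>cgauss \<partial>cgauss)"
    by (rule nn_integral_multc) simp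
  also have "(\<integral>\<^sup>+v. \<integral>\<^sup>+w. \<psi> (sqrt \<Delta> * Im (cnj v * w)) \<partial>cgauss \<partial>cgauss) = (\<integral>\<^sup>+t. \<psi> (sqrt \<Delta> * t) \<partial>cgauss_jac_dist)"
    by (rule nn_integral_cgauss_jac_dist[symmetric]) simp
  finally show ?thesis .
qed

lemma measurable_kac_integrand:
  assumes [measurable]: "\<Omega> \<in> sets borel"
  shows "(\<lambda>p. indicator {z \<in> \<Omega>. cmod (fld (fst p) z) < \<epsilon>} (snd p) * ennreal \<bar>jac (fst p) (snd p)\<bar>)
    \<in> borel_measurable (gauss_PiM I \<Otimes>\<^sub>M lborel)"
proof -
  have m: "(\<lambda>p. fld (fst p) (snd p)) \<in> borel_measurable (gauss_PiM I \<Otimes>\<^sub>M lborel)"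
    "(\<lambda>p. jac (fst p) (snd p)) \<in> borel_measurable (gauss_PiM I \<Otimes>\<^sub>M lborel)"
    using measurable_wave_field(1,4)[of I r \<alpha> \<beta>]
    by (simp_all cong: measurable_cong_sets sets_pair_measure_cong)
  have s: "{p \<in> space (gauss_PiM I \<Otimes>\<^sub>M lborel). snd p \<in> \<Omega> \<and> cmod (fld (fst p) (snd p)) < \<epsilon>} \<in> sets (gauss_PiM I \<Otimes>\<^sub>M lborel)"
    using m(1) by measurable
  have "(\<lambda>p. indicator {p \<in> space (gauss_PiM I \<Otimes>\<^sub>M lborel). snd p \<in> \<Omega> \<and> cmod (fld (fst p) (snd p)) < \<epsilon>} p * ennreal \<bar>jac (fst p) (snd p)\<bar>)
    \<in> borel_measurable (gauss_PiM I \<Otimes>\<^sub>M lborel)"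
    using m(2) s by measurable
  then show ?thesis
    by (rule measurable_cong[THEN iffD1, rotated]) (auto simp: indicator_def)
qed

lemma measurable_kac_integral:
  assumes \<Omega>: "\<Omega> \<in> sets borel"
  shows "(\<lambda>a. kac_integral \<Omega> (fld a) (jac a) \<epsilon>) \<in> borel_measurable (gauss_PiM I)"
  using lborel.borel_measurable_nn_integral_fst[OF measurable_kac_integrand[OF \<Omega>, of \<epsilon>]]
  unfolding kac_integral_def by simp

text \<open>By Tonelli and independence each point contributes at most epsilon^2 times the mean
  absolute Jacobian \<open>sqrt \<Delta> / 2\<close>; division by pi epsilon^2 leaves a bound
  uniform in epsilon.\<close>

lemma kac_expectation_le:
  assumes \<Omega>: "\<Omega> \<in> sets borel" and \<epsilon>: "\<epsilon> > 0"
  shows "(\<integral>\<^sup>+a. kac_integral \<Omega> (fld a) (jac a) \<epsilon> \<partial>gauss_PiM I) \<le> emeasure lborel \<Omega> * ennreal (sqrt \<Delta> / (2 * pi))"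
proof -
  interpret P: prob_space "gauss_PiM I" by (rule prob_space_gauss_PiM)
  interpret PL: pair_sigma_finite "gauss_PiM I" "lborel :: complex measure" ..
  note m = measurable_kac_integrand[OF \<Omega>, of \<epsilon>]
  have "(\<integral>\<^sup>+a. \<integral>\<^sup>+z. indicator {z \<in> \<Omega>. cmod (fld a z) < \<epsilon>} z * ennreal \<bar>jac a z\<bar> \<partial>lborel \<partial>gauss_PiM I)
      = (\<integral>\<^sup>+z. \<integral>\<^sup>+a. indicator {z \<in> \<Omega>. cmod (fld a z) < \<epsilon>} z * ennreal \<bar>jac a z\<bar> \<partial>gauss_PiM I \<partial>lborel)"
    using PL.Fubini'[of "\<lambda>a z. indicator {z \<in> \<Omega>. cmod (fld a z) < \<epsilon>} z * ennreal \<bar>jac a z\<bar>"] m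
    by (simp add: case_prod_unfold)
  also have "\<dots> \<le> (\<integral>\<^sup>+z. ennreal (\<epsilon>\<^sup>2 * (sqrt \<Delta> / 2)) * indicator \<Omega> z \<partial>lborel)"
  proof (intro nn_integral_mono)
    fix z
    have "(\<integral>\<^sup>+a. indicator {z \<in> \<Omega>. cmod (fld a z) < \<epsilon>} z * ennreal \<bar>jac a z\<bar> \<partial>gauss_PiM I)
       = (\<integral>\<^sup>+a. (indicator {u. cmod u < \<epsilon>} (fld a z) * ennreal \<bar>jac a z\<bar>) * indicator \<Omega> z \<partial>gauss_PiM I)"
      by (intro nn_integral_cong) (auto simp: indicator_def)
    also have "\<dots> = (\<integral>\<^sup>+a. indicator {u. cmod u < \<epsilon>} (fld a z) * ennreal \<bar>jac a z\<bar> \<partial>gauss_PiM I) * indicator \<Omega> z"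
    proof (rule nn_integral_multc)
      have "{u. cmod u < \<epsilon>} \<in> sets borel" by simp
      then have "(\<lambda>a. indicator {u. cmod u < \<epsilon>} (fld a z) :: ennreal) \<in> borel_measurable (gauss_PiM I)"
        by (intro measurable_compose[OF measurable_wave_field_at(1)]) simp
      moreover have "(\<lambda>a. ennreal \<bar>jac a z\<bar>) \<in> borel_measurable (gauss_PiM I)"
        by (intro measurable_compose[OF measurable_wave_field_at(4)]) simp
      ultimately show "(\<lambda>a. indicator {u. cmod u < \<epsilon>} (fld a z) * ennreal \<bar>jac a z\<bar>) \<in> borel_measurable (gauss_PiM I)"
        by simp
    qed
    also have "(\<integral>\<^sup>+a. indicator {u. cmod u < \<epsilon>} (fld a z) * ennreal \<bar>jac a z\<bar> \<partial>gauss_PiM I)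
       = emeasure cgauss {u. cmod u < \<epsilon>} * (\<integral>\<^sup>+t. ennreal \<bar>sqrt \<Delta> * t\<bar> \<partial>cgauss_jac_dist)"
      by (subst field_jac_law) auto
    also have "(\<integral>\<^sup>+t. ennreal \<bar>sqrt \<Delta> * t\<bar> \<partial>cgauss_jac_dist) = (\<integral>\<^sup>+t. ennreal (sqrt \<Delta>) * ennreal \<bar>t\<bar> \<partial>cgauss_jac_dist)"
      using pos by (intro nn_integral_cong) (simp add: abs_mult ennreal_mult)
    also have "\<dots> = ennreal (sqrt \<Delta>) * (\<integral>\<^sup>+t. ennreal \<bar>t\<bar> \<partial>cgauss_jac_dist)"
      by (rule nn_integral_cmult) simp
    also have "(\<integral>\<^sup>+t. ennreal \<bar>t\<bar> \<partial>cgauss_jac_dist) = ennreal (1 / 2)"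
      using nn_integral_cgauss_jac_dist[of "\<lambda>t. ennreal \<bar>t\<bar>"] nn_integral_cgauss_abs_Im_cnj_mult by simp
    also have "emeasure cgauss {u. cmod u < \<epsilon>} * (ennreal (sqrt \<Delta>) * ennreal (1 / 2)) \<le> ennreal (\<epsilon>\<^sup>2) * (ennreal (sqrt \<Delta>) * ennreal (1 / 2))"
      by (intro mult_right_mono emeasure_cgauss_ball_le) simp
    also have "\<dots> = ennreal (\<epsilon>\<^sup>2 * (sqrt \<Delta> / 2))"
      using pos by (subst ennreal_mult[symmetric], simp, simp, subst ennreal_mult[symmetric], simp, simp, simp)
    finally show "(\<integral>\<^sup>+a. indicator {z \<in> \<Omega>. cmod (fld a z) < \<epsilon>} z * ennreal \<bar>jac a z\<bar> \<partial>gauss_PiM I) \<le> ennreal (\<epsilon>\<^sup>2 * (sqrt \<Delta> / 2)) * indicator \<Omega> z"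
      by (simp add: mult_right_mono)
  qed
  also have "\<dots> = ennreal (\<epsilon>\<^sup>2 * (sqrt \<Delta> / 2)) * emeasure lborel \<Omega>"
    using \<Omega> by (simp add: nn_integral_cmult_indicator)
  finally have 1: "(\<integral>\<^sup>+a. \<integral>\<^sup>+z. indicator {z \<in> \<Omega>. cmod (fld a z) < \<epsilon>} z * ennreal \<bar>jac a z\<bar> \<partial>lborel \<partial>gauss_PiM I) \<le> ennreal (\<epsilon>\<^sup>2 * (sqrt \<Delta> / 2)) * emeasure lborel \<Omega>" .
  have "(\<integral>\<^sup>+a. kac_integral \<Omega> (fld a) (jac a) \<epsilon> \<partial>gauss_PiM I)
     = (\<integral>\<^sup>+a. \<integral>\<^sup>+z. indicator {z \<in> \<Omega>. cmod (fld a z) < \<epsilon>} z * ennreal \<bar>jac a z\<bar> \<partial>lborel \<partial>gauss_PiM I) / ennreal (pi * \<epsilon>\<^sup>2)"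
    unfolding kac_integral_def using lborel.borel_measurable_nn_integral_fst[OF m]
    by (intro nn_integral_divide) simp
  also have "\<dots> \<le> ennreal (\<epsilon>\<^sup>2 * (sqrt \<Delta> / 2)) * emeasure lborel \<Omega> / ennreal (pi * \<epsilon>\<^sup>2)"
    by (rule divide_right_mono_ennreal[OF 1])
  also have "\<dots> = emeasure lborel \<Omega> * (ennreal (\<epsilon>\<^sup>2 * (sqrt \<Delta> / 2)) / ennreal (pi * \<epsilon>\<^sup>2))"
    by (simp add: ennreal_times_divide mult.commute)
  also have "ennreal (\<epsilon>\<^sup>2 * (sqrt \<Delta> / 2)) / ennreal (pi * \<epsilon>\<^sup>2) = ennreal (sqrt \<Delta> / (2 * pi))"
    using \<epsilon> pos by (subst divide_ennreal) (auto simp: field_simps)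
  finally show ?thesis .
qed

text \<open>Bulinskaya's argument: on a mesh of \<open>N\<^sup>2\<close> points a degenerate zero makes the field and its
  Jacobian of order \<open>1 / N\<close> at a mesh point, an event of probability \<open>o(1 / N\<^sup>2)\<close>.\<close>

lemma AE_no_degenerate_zero:
  assumes T: "T > 0"
  shows "AE a in gauss_PiM I. \<forall>z\<in>cbox z0 (z0 + Complex T T). fld a z = 0 \<longrightarrow> jac a z \<noteq> 0"
proof -
  interpret P: prob_space "gauss_PiM I" by (rule prob_space_gauss_PiM)
  define K where "K a = (\<Sum>i\<in>I. cmod (a i) * \<bar>r i\<bar> * (1 + \<bar>\<alpha> i\<bar> + \<bar>\<beta> i\<bar>)\<^sup>2)" for a :: "'i \<Rightarrow> complex"
  have K0: "K a \<ge> 0" for a unfolding K_def by (intro sum_nonneg) auto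
  \<comment> \<open>The Lipschitz constant is random, so the event is truncated at the level
    \<open>k\<close>; countably many levels exhaust all samples.\<close>
  have main: "AE a in gauss_PiM I. K a \<le> real k \<longrightarrow> (\<forall>z\<in>cbox z0 (z0 + Complex T T). fld a z = 0 \<longrightarrow> jac a z \<noteq> 0)" for k :: nat
  proof -
    define \<kappa> where "\<kappa> = real (Suc k)"
    have \<kappa>: "\<kappa> > 0" by (simp add: \<kappa>_def)
    define Bad where "Bad = {a \<in> space (gauss_PiM I). K a \<le> real k \<and> (\<exists>z\<in>cbox z0 (z0 + Complex T T). fld a z = 0 \<and> jac a z = 0)}"
    have "\<exists>S. Bad \<subseteq> S \<and> S \<in> sets (gauss_PiM I) \<and> emeasure (gauss_PiM I) S \<le> ennreal e" if e: "e > 0" for e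
    proof -
      \<comment> \<open>At most (2 N)^2 mesh points, each of probability at most (2 kappa delta)^2
        e' with delta = 2 T / N, add up to 64 kappa^2 T^2 e', independently of
        \<open>N\<close>.\<close>
      define e' where "e' = e / (64 * \<kappa>\<^sup>2 * T\<^sup>2)"
      have e': "e' > 0" using e \<kappa> T by (simp add: e'_def)
      obtain x where x: "x > 0" "emeasure cgauss_jac_dist {-x..x} < ennreal e'" using cgauss_jac_dist_small[OF e'] .
      define y where "y = x * sqrt \<Delta>"
      have y: "y > 0" using x(1) pos by (simp add: y_def)
      \<comment> \<open>The mesh is made so fine that the Jacobian varies by at most
        \<open>y\<close> between a degenerate zero and its mesh point.\<close>
      obtain N0 :: nat where N0: "2 * \<kappa>\<^sup>2 * (2 * T) / y < real N0" using reals_Archimedean2 by blast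
      define N where "N = Suc N0"
      define \<delta> where "\<delta> = 2 * T / real N"
      have N: "N > 0" and \<delta>: "\<delta> > 0" using T by (auto simp: N_def \<delta>_def)
      have "2 * \<kappa>\<^sup>2 * (2 * T) < real N * y"
        using N0 y by (simp add: N_def field_simps)
      then have \<delta>y: "2 * \<kappa>\<^sup>2 * \<delta> \<le> y" using N by (simp add: \<delta>_def field_simps)
      define g where "g = (\<lambda>(m, n). z0 + Complex (T / real N * real m) (T / real N * real n))"
      define E where "E p = {a \<in> space (gauss_PiM I). cmod (fld a (g p)) < 2 * \<kappa> * \<delta> \<and> jac a (g p) \<in> {-y..y}}" for p
      have E: "E p \<in> sets (gauss_PiM I)" for p
        unfolding E_def using measurable_wave_field_at(1,4)[of I r \<alpha> \<beta> "g p"] by measurable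
      have Em: "emeasure (gauss_PiM I) (E p) \<le> ennreal ((2 * \<kappa> * \<delta>)\<^sup>2 * e')" for p
      proof -
        have "emeasure (gauss_PiM I) (E p) = (\<integral>\<^sup>+a. indicator (E p) a \<partial>gauss_PiM I)" using E by simp
        also have "\<dots> = (\<integral>\<^sup>+a. indicator {u. cmod u < 2 * \<kappa> * \<delta>} (fld a (g p)) * indicator {-y..y} (jac a (g p)) \<partial>gauss_PiM I)"
          by (intro nn_integral_cong) (auto simp: E_def indicator_def)
        also have "\<dots> = (\<integral>\<^sup>+u. indicator {u. cmod u < 2 * \<kappa> * \<delta>} u \<partial>cgauss) * (\<integral>\<^sup>+t. indicator {-y..y} (sqrt \<Delta> * t) \<partial>cgauss_jac_dist)"
          by (rule field_jac_law) auto
        also have "(\<integral>\<^sup>+t. indicator {-y..y} (sqrt \<Delta> * t) \<partial>cgauss_jac_dist) = (\<integral>\<^sup>+t. indicator {-x..x} t \<partial>cgauss_jac_dist)"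
        proof -
          have "sqrt \<Delta> * t \<in> {-y..y} \<longleftrightarrow> t \<in> {-x..x}" for t
          proof -
            have "sqrt \<Delta> > 0" using pos by simp
            then show ?thesis
              unfolding y_def atLeastAtMost_iff mult_minus_left[symmetric]
              by (simp only: mult.commute[of "sqrt \<Delta>"] mult_le_cancel_right) auto
          qed
          then show ?thesis by (simp add: indicator_def)
        qed
        also have "(\<integral>\<^sup>+u. indicator {u. cmod u < 2 * \<kappa> * \<delta>} u \<partial>cgauss) * (\<integral>\<^sup>+t. indicator {-x..x} t \<partial>cgauss_jac_dist)
           = emeasure cgauss {u. cmod u < 2 * \<kappa> * \<delta>} * emeasure cgauss_jac_dist {-x..x}" by simp
        also have "\<dots> \<le> ennreal ((2 * \<kappa> * \<delta>)\<^sup>2) * ennreal e'"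
          using x(2) by (intro mult_mono emeasure_cgauss_ball_le) auto
        finally show ?thesis using e' by (simp add: ennreal_mult)
      qed
      define S where "S = (\<Union>p\<in>{..N} \<times> {..N}. E p)"
      have "emeasure (gauss_PiM I) S \<le> (\<Sum>p\<in>{..N} \<times> {..N}. emeasure (gauss_PiM I) (E p))"
        unfolding S_def by (rule emeasure_subadditive_finite) (use E in auto)
      also have "\<dots> \<le> (\<Sum>p\<in>{..N} \<times> {..N}. ennreal ((2 * \<kappa> * \<delta>)\<^sup>2 * e'))"
        by (intro sum_mono Em)
      also have "\<dots> = ennreal (real (Suc N) * real (Suc N) * ((2 * \<kappa> * \<delta>)\<^sup>2 * e'))"
        using e' by (subst sum_ennreal) (simp_all add: card_cartesian_product algebra_simps)
      also have "\<dots> \<le> ennreal e"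
      proof (rule ennreal_leI)
        have "real (Suc N) \<le> 2 * real N" using N by simp
        then have "real (Suc N) * real (Suc N) * ((2 * \<kappa> * \<delta>)\<^sup>2 * e') \<le> (2 * real N) * (2 * real N) * ((2 * \<kappa> * \<delta>)\<^sup>2 * e')"
          using e' by (intro mult_right_mono mult_mono) auto
        also have "\<dots> = e" using N \<kappa> T by (simp add: \<delta>_def e'_def power2_eq_square field_simps)
        finally show "real (Suc N) * real (Suc N) * ((2 * \<kappa> * \<delta>)\<^sup>2 * e') \<le> e" .
      qed
      finally have "emeasure (gauss_PiM I) S \<le> ennreal e" .
      moreover have "S \<in> sets (gauss_PiM I)" unfolding S_def using E by (intro sets.finite_UN) auto
      moreover have "Bad \<subseteq> S"
      proof
        fix a assume "a \<in> Bad"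
        then obtain z where a: "a \<in> space (gauss_PiM I)" "K a \<le> real k" and z: "z \<in> cbox z0 (z0 + Complex T T)" "fld a z = 0" "jac a z = 0"
          by (auto simp: Bad_def)
        define h where "h = T / real N"
        have h: "h > 0" using T N by (simp add: h_def)
        define m n where "m = nat \<lfloor>Re (z - z0) / h\<rfloor>" and "n = nat \<lfloor>Im (z - z0) / h\<rfloor>"
        have near: "nat \<lfloor>t / h\<rfloor> \<le> N \<and> \<bar>t - h * real (nat \<lfloor>t / h\<rfloor>)\<bar> \<le> h" if t: "0 \<le> t" "t \<le> T" for t
        proof -
          have "0 \<le> t / h" using t h by simp
          then have nn: "real (nat \<lfloor>t / h\<rfloor>) = of_int \<lfloor>t / h\<rfloor>" by simp
          have "t / h \<le> real N" using t h N by (simp add: h_def field_simps)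
          then have "real (nat \<lfloor>t / h\<rfloor>) \<le> real N" unfolding nn using of_int_floor_le order_trans by blast
          moreover have "of_int \<lfloor>t / h\<rfloor> \<le> t / h" "t / h < of_int \<lfloor>t / h\<rfloor> + 1" by linarith+
          from mult_left_mono[OF this(1), of h] mult_strict_left_mono[OF this(2) h] h
          have "h * of_int \<lfloor>t / h\<rfloor> \<le> t" "t < h * (of_int \<lfloor>t / h\<rfloor> + 1)" by simp_all
          ultimately show ?thesis unfolding nn by (simp add: algebra_simps)
        qed
        have zz: "0 \<le> Re (z - z0)" "Re (z - z0) \<le> T" "0 \<le> Im (z - z0)" "Im (z - z0) \<le> T"
          using z(1) by (auto simp: in_cbox_complex_iff)
        have mn: "m \<le> N" "n \<le> N" "\<bar>Re (z - z0) - h * real m\<bar> \<le> h" "\<bar>Im (z - z0) - h * real n\<bar> \<le> h"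
          using near[OF zz(1,2)] near[OF zz(3,4)] by (auto simp: m_def n_def)
        have "cmod (g (m, n) - z) \<le> \<bar>Re (g (m, n) - z)\<bar> + \<bar>Im (g (m, n) - z)\<bar>" by (rule cmod_le)
        also have "\<dots> \<le> h + h"
        proof (intro add_mono)
          show "\<bar>Re (g (m, n) - z)\<bar> \<le> h" using mn(3) by (simp add: g_def h_def[symmetric])
          show "\<bar>Im (g (m, n) - z)\<bar> \<le> h" using mn(4) by (simp add: g_def h_def[symmetric])
        qed
        finally have d: "cmod (g (m, n) - z) \<le> \<delta>" by (simp add: \<delta>_def h_def)
        have Ka: "K a \<le> \<kappa>" using a(2) by (simp add: \<kappa>_def)
        have "cmod (fld a (g (m, n))) \<le> K a * cmod (g (m, n) - z)"
          using wave_field_bounds(1)[of I r \<alpha> \<beta> a "g (m, n)" z] z(2) by (simp add: K_def)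
        also have "\<dots> \<le> \<kappa> * \<delta>" using Ka K0[of a] d \<delta> by (intro mult_mono) auto
        also have "\<dots> < 2 * \<kappa> * \<delta>" using \<kappa> \<delta> by simp
        finally have 1: "cmod (fld a (g (m, n))) < 2 * \<kappa> * \<delta>" .
        have "\<bar>jac a (g (m, n))\<bar> \<le> 2 * (K a)\<^sup>2 * cmod (g (m, n) - z)"
          using wave_field_bounds(2)[of I r \<alpha> \<beta> a "g (m, n)" z] z(3) by (simp add: K_def)
        also have "\<dots> \<le> 2 * \<kappa>\<^sup>2 * \<delta>" using Ka K0[of a] d \<delta> by (intro mult_mono power_mono) auto
        also have "\<dots> \<le> y" by (rule \<delta>y)
        finally have 2: "jac a (g (m, n)) \<in> {-y..y}" by auto
        show "a \<in> S" unfolding S_def E_def using a(1) 1 2 mn(1,2) by blast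
      qed
      ultimately show ?thesis by blast
    qed
    then obtain S where S: "\<And>e. e > 0 \<Longrightarrow> Bad \<subseteq> S e \<and> S e \<in> sets (gauss_PiM I) \<and> emeasure (gauss_PiM I) (S e) \<le> ennreal e"
      by metis
    \<comment> \<open>\<open>Bad\<close> itself is not shown to be measurable; this measurable null
      set contains it.\<close>
    define N where "N = (\<Inter>n::nat. S (1 / real (Suc n)))"
    have N: "N \<in> sets (gauss_PiM I)" unfolding N_def using S by (intro sets.countable_INT) auto
    have "emeasure (gauss_PiM I) N \<le> ennreal e" if "e > 0" for e
    proof -
      obtain n where n: "1 / real (Suc n) < e" using nat_approx_posE[OF \<open>e > 0\<close>] by blast
      have "emeasure (gauss_PiM I) N \<le> emeasure (gauss_PiM I) (S (1 / real (Suc n)))"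
        using S by (intro emeasure_mono) (auto simp: N_def)
      also have "\<dots> \<le> ennreal (1 / real (Suc n))" using S by simp
      also have "\<dots> \<le> ennreal e" using n by (intro ennreal_leI) simp
      finally show ?thesis .
    qed
    then have "emeasure (gauss_PiM I) N = 0"
      by (metis ennreal_le_epsilon add_0 le_zero_eq)
    then have "N \<in> null_sets (gauss_PiM I)" using N by auto
    moreover have "Bad \<subseteq> N"
      unfolding N_def by (intro INT_greatest) (use S in \<open>simp del: of_nat_Suc\<close>)
    ultimately show ?thesis
      by (intro AE_I'[of N]) (auto simp: Bad_def)
  qed
  then have "AE a in gauss_PiM I. \<forall>k::nat. K a \<le> real k \<longrightarrow> (\<forall>z\<in>cbox z0 (z0 + Complex T T). fld a z = 0 \<longrightarrow> jac a z \<noteq> 0)"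
    unfolding AE_all_countable by blast
  then show ?thesis
    by eventually_elim (meson real_arch_simple)
qed

end

section \<open>Fields that are periodic up to a phase\<close>

context wave_covariance
begin

context
  fixes c1 c2 :: real
  assumes int: "\<And>i. i \<in> I \<Longrightarrow> \<alpha> i + c1 \<in> \<int>" "\<And>i. i \<in> I \<Longrightarrow> \<beta> i + c2 \<in> \<int>"
begin

text \<open>Centring the frequencies makes them nonintegral and destroys periodicity. This phase
  shifts them back to integers and leaves the zeros in place.\<close>

definition per_field :: "('i \<Rightarrow> complex) \<Rightarrow> complex \<Rightarrow> complex" where
  "per_field a z = cis (c1 * Re z + c2 * Im z) * fld a z"

lemma per_field_eq_0_iff: "per_field a z = 0 \<longleftrightarrow> fld a z = 0"
  by (simp add: per_field_def)

lemma per_field_periodic: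
  "per_field a (z + Complex (2 * pi * of_int m) (2 * pi * of_int n)) = per_field a z"
proof -
  have eq: "per_field a z = (\<Sum>i\<in>I. a i * (complex_of_real (r i) * cis ((\<alpha> i + c1) * Re z + (\<beta> i + c2) * Im z)))" for z
  proof -
    have "cis (c1 * Re z + c2 * Im z) * (a i * (complex_of_real (r i) * cis (\<alpha> i * Re z + \<beta> i * Im z)))
       = a i * (complex_of_real (r i) * (cis (c1 * Re z + c2 * Im z) * cis (\<alpha> i * Re z + \<beta> i * Im z)))" for i
      by simp
    then show ?thesis
      by (simp add: per_field_def wave_field_def wave_def sum_distrib_left cis_mult algebra_simps)
  qed
  show ?thesis unfolding eq
  proof (rule sum.cong[OF refl])
    fix i assume i: "i \<in> I"
    obtain k l :: int where kl: "\<alpha> i + c1 = of_int k" "\<beta> i + c2 = of_int l"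
      using int[OF i] by (auto elim!: Ints_cases)
    have "(\<alpha> i + c1) * Re (z + Complex (2 * pi * of_int m) (2 * pi * of_int n)) + (\<beta> i + c2) * Im (z + Complex (2 * pi * of_int m) (2 * pi * of_int n))
       = ((\<alpha> i + c1) * Re z + (\<beta> i + c2) * Im z) + 2 * pi * of_int (k * m + l * n)"
      unfolding kl by (simp add: algebra_simps)
    then show "a i * (complex_of_real (r i) * cis ((\<alpha> i + c1) * Re (z + Complex (2 * pi * of_int m) (2 * pi * of_int n)) + (\<beta> i + c2) * Im (z + Complex (2 * pi * of_int m) (2 * pi * of_int n))))
       = a i * (complex_of_real (r i) * cis ((\<alpha> i + c1) * Re z + (\<beta> i + c2) * Im z))"
      by (simp only: cis_mult[symmetric] cis_multiple_2pi[OF Ints_of_int] mult_1_right)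
  qed
qed

definition torus_rep :: "complex \<Rightarrow> complex" where
  "torus_rep z = z + Complex (2 * pi * of_int (- \<lfloor>Re z / (2 * pi)\<rfloor>)) (2 * pi * of_int (- \<lfloor>Im z / (2 * pi)\<rfloor>))"

lemma torus_rep_bounds:
  "0 \<le> Re (torus_rep z)" "Re (torus_rep z) < 2 * pi" "0 \<le> Im (torus_rep z)" "Im (torus_rep z) < 2 * pi"
proof -
  have fl: "0 \<le> t + 2 * pi * of_int (- \<lfloor>t / (2 * pi)\<rfloor>) \<and> t + 2 * pi * of_int (- \<lfloor>t / (2 * pi)\<rfloor>) < 2 * pi" for t
  proof -
    have 1: "of_int \<lfloor>t / (2 * pi)\<rfloor> \<le> t / (2 * pi)" "t / (2 * pi) < of_int \<lfloor>t / (2 * pi)\<rfloor> + 1" by linarith+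
    from mult_left_mono[OF 1(1), of "2 * pi"] mult_strict_left_mono[OF 1(2), of "2 * pi"]
    show ?thesis by (simp add: algebra_simps)
  qed
  show "0 \<le> Re (torus_rep z)" "Re (torus_rep z) < 2 * pi" "0 \<le> Im (torus_rep z)" "Im (torus_rep z) < 2 * pi"
    using fl[of "Re z"] fl[of "Im z"] by (simp_all add: torus_rep_def)
qed

lemma field_zero_torus_rep: "fld a (torus_rep z) = 0 \<longleftrightarrow> fld a z = 0"
proof -
  have "per_field a (torus_rep z) = per_field a z"
    unfolding torus_rep_def by (rule per_field_periodic)
  then show ?thesis using per_field_eq_0_iff by metis
qed

text \<open>The degree argument is applied to \<open>per_field\<close>. At a zero of the field the
  phase contributes nothing to the derivative, which is that of the field times a unit and hence
  still injective.\<close>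

lemma two_zeros_on_torus:
  assumes z0: "fld a z0 = 0" "jac a (torus_rep z0) \<noteq> 0"
  obtains z1 where "fld a z1 = 0" "torus_rep z1 \<noteq> torus_rep z0"
proof -
  let ?z = "torus_rep z0"
  let ?ph = "\<lambda>z. cis (c1 * Re z + c2 * Im z)"
  let ?L = "\<lambda>v. Re v *\<^sub>R fdx a ?z + Im v *\<^sub>R fdy a ?z"
  have f0: "fld a ?z = 0" using z0 field_zero_torus_rep by blast
  have "(?ph has_derivative (\<lambda>v. \<i> * complex_of_real (c1 * Re v + c2 * Im v) * ?ph ?z)) (at ?z)"
  proof -
    have "((\<lambda>z. \<i> * complex_of_real (c1 * Re z + c2 * Im z)) has_derivative
        (\<lambda>v. \<i> * complex_of_real (c1 * Re v + c2 * Im v))) (at ?z)"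
      by (auto intro!: derivative_eq_intros)
    from has_derivative_compose[OF this DERIV_exp[unfolded has_field_derivative_def]]
    show ?thesis by (simp add: cis_conv_exp mult.commute)
  qed
  from has_derivative_mult[OF this wave_field_has_derivative[of I r \<alpha> \<beta> a ?z]]
  have der: "(per_field a has_derivative (\<lambda>v. ?ph ?z * ?L v)) (at ?z)"
    unfolding per_field_def[abs_def] using f0 by simp
  have J: "Im (cnj (fdx a ?z) * fdy a ?z) \<noteq> 0" using z0(2) unfolding wave_field_jac_def .
  have inj: "inj (\<lambda>v. ?ph ?z * ?L v)"
  proof (rule injI)
    fix v w assume "?ph ?z * ?L v = ?ph ?z * ?L w"
    then have "?L v = ?L w" by (metis cis_neq_zero mult_left_cancel)
    then show "v = w" using linear_Re_Im_inj(2)[OF J] by (rule injD[rotated])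
  qed
  have cont: "continuous_on UNIV (per_field a)"
    unfolding per_field_def[abs_def] by (intro continuous_intros continuous_on_wave_field)
  have per: "per_field a (z + complex_of_real (2 * pi)) = per_field a z"
    "per_field a (z + \<i> * complex_of_real (2 * pi)) = per_field a z" for z
    using per_field_periodic[of a z 1 0] per_field_periodic[of a z 0 1]
    by (simp_all add: complex_of_real_def[symmetric] Complex_eq)
  obtain z1 where z1: "per_field a z1 = 0" "\<And>(m::int) (n::int). z1 \<noteq> ?z + Complex (2 * pi * m) (2 * pi * n)"
    using doubly_periodic_second_zero[OF cont per _ der inj] f0 per_field_eq_0_iff by blast
  have "torus_rep z1 \<noteq> ?z"
  proof
    assume "torus_rep z1 = ?z"
    then have "z1 = ?z + Complex (2 * pi * of_int \<lfloor>Re z1 / (2 * pi)\<rfloor>) (2 * pi * of_int \<lfloor>Im z1 / (2 * pi)\<rfloor>)"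
      unfolding torus_rep_def[of z1] by (auto simp: complex_eq_iff)
    with z1(2) show False by blast
  qed
  with z1(1) show ?thesis using that per_field_eq_0_iff by blast
qed

lemma zero_event_eq:
  "{a \<in> space (gauss_PiM I). \<exists>z. fld a z = 0} = {a \<in> space (gauss_PiM I). \<exists>z\<in>cbox 0 (Complex (2 * pi) (2 * pi)). fld a z = 0}"
proof -
  have "torus_rep z \<in> cbox 0 (Complex (2 * pi) (2 * pi))" for z
    using torus_rep_bounds[of z] by (simp add: in_cbox_complex_iff)
  then show ?thesis using field_zero_torus_rep by blast
qed

text \<open>Almost surely a zero comes with a second one on the torus, so twice the indicator is
  dominated by the lower limit of the Kac functionals; Fatou and the Kac bound give 2 P(zero) at
  most area * sqrt Delta / (2 pi), with area close to (2 pi)^2.\<close>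

theorem zero_probability_le:
  "{a \<in> space (gauss_PiM I). \<exists>z. fld a z = 0} \<in> sets (gauss_PiM I)" (is "?Z \<in> _")
  "emeasure (gauss_PiM I) {a \<in> space (gauss_PiM I). \<exists>z. fld a z = 0} \<le> ennreal (pi * sqrt \<Delta>)"
proof -
  interpret P: prob_space "gauss_PiM I" by (rule prob_space_gauss_PiM)
  show Z: "?Z \<in> sets (gauss_PiM I)"
    unfolding zero_event_eq
    by (rule measurable_ex_zero_compact) (auto intro: continuous_on_wave_field measurable_wave_field_at)
  have bound: "2 * emeasure (gauss_PiM I) ?Z \<le> ennreal ((2 * pi + 2 * \<eta>)\<^sup>2) * ennreal (sqrt \<Delta> / (2 * pi))" if \<eta>: "\<eta> > 0" for \<eta>
  proof -
    \<comment> \<open>The representatives fill a half-open square and zeros may lie on its edges; an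
      open set with margin \<open>\<eta>\<close> contains balls around all of them. The margin tends
      to zero at the end.\<close>
    define \<Omega> where "\<Omega> = box (- Complex \<eta> \<eta>) (- Complex \<eta> \<eta> + Complex (2 * pi + 2 * \<eta>) (2 * pi + 2 * \<eta>))"
    have \<Omega>: "open \<Omega>" "\<Omega> \<in> sets borel" by (auto simp: \<Omega>_def)
    have vol: "emeasure lborel \<Omega> = ennreal ((2 * pi + 2 * \<eta>)\<^sup>2)"
      using \<eta> pi_gt_zero unfolding \<Omega>_def
      by (subst emeasure_lborel_box) (auto simp: Basis_complex_def power2_eq_square intro!: add_nonneg_nonneg)
    have rep: "torus_rep z \<in> \<Omega>" for z
      using torus_rep_bounds[of z] \<eta> by (auto simp: \<Omega>_def in_box_complex_iff)
    have "AE a in gauss_PiM I. \<forall>z\<in>cbox (- Complex \<eta> \<eta>) (- Complex \<eta> \<eta> + Complex (2 * pi + 2 * \<eta>) (2 * pi + 2 * \<eta>)). fld a z = 0 \<longrightarrow> jac a z \<noteq> 0"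
      using \<eta> by (intro AE_no_degenerate_zero) (simp add: add_pos_pos)
    then have AE: "AE a in gauss_PiM I. 2 * indicator ?Z a \<le> liminf (\<lambda>n. kac_integral \<Omega> (fld a) (jac a) (1 / real (Suc n)))"
    proof eventually_elim
      case (elim a)
      show ?case
      proof (cases "a \<in> ?Z")
        case True
        then obtain z0 where z0: "fld a z0 = 0" by blast
        have nd: "jac a (torus_rep z) \<noteq> 0" if "fld a z = 0" for z
        proof -
          have "torus_rep z \<in> cbox (- Complex \<eta> \<eta>) (- Complex \<eta> \<eta> + Complex (2 * pi + 2 * \<eta>) (2 * pi + 2 * \<eta>))"
            using rep[of z] box_subset_cbox unfolding \<Omega>_def by blast
          then show ?thesis using elim that field_zero_torus_rep by blast
        qed
        obtain z1 where z1: "fld a z1 = 0" "torus_rep z1 \<noteq> torus_rep z0"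
          using two_zeros_on_torus[OF z0 nd[OF z0]] .
        have "2 \<le> liminf (\<lambda>n. kac_integral \<Omega> (fld a) (jac a) (1 / real (Suc n)))"
        proof (rule kac_two_zeros[where U = "fdx a" and V = "fdy a"])
          show "torus_rep z0 \<noteq> torus_rep z1" using z1(2) by simp
          show "jac a z = Im (cnj (fdx a z) * fdy a z)" for z by (rule wave_field_jac_def)
        qed (use \<Omega>(1) rep z0 z1 nd field_zero_torus_rep in \<open>auto intro: wave_field_has_derivative continuous_on_wave_field\<close>)
        then show ?thesis using True by simp
      next
        case False
        then have "indicator ?Z a = (0::ennreal)" by (rule indicator_simps(2))
        then show ?thesis by (simp only: mult_zero_right zero_le)
      qed
    qed
    have "2 * emeasure (gauss_PiM I) ?Z = (\<integral>\<^sup>+a. 2 * indicator ?Z a \<partial>gauss_PiM I)"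
      using Z by (simp add: nn_integral_cmult_indicator)
    also have "\<dots> \<le> (\<integral>\<^sup>+a. liminf (\<lambda>n. kac_integral \<Omega> (fld a) (jac a) (1 / real (Suc n))) \<partial>gauss_PiM I)"
      by (rule nn_integral_mono_AE[OF AE])
    also have "\<dots> \<le> liminf (\<lambda>n. \<integral>\<^sup>+a. kac_integral \<Omega> (fld a) (jac a) (1 / real (Suc n)) \<partial>gauss_PiM I)"
      by (intro nn_integral_liminf measurable_kac_integral \<Omega>(2))
    also have "\<dots> \<le> liminf (\<lambda>n. emeasure lborel \<Omega> * ennreal (sqrt \<Delta> / (2 * pi)))"
      by (intro Liminf_mono always_eventually allI kac_expectation_le \<Omega>(2)) simp
    also have "\<dots> = ennreal ((2 * pi + 2 * \<eta>)\<^sup>2) * ennreal (sqrt \<Delta> / (2 * pi))"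
      by (simp add: vol Liminf_const)
    finally show ?thesis .
  qed
  have real: "P.prob ?Z \<le> (2 * pi + 2 * \<eta>)\<^sup>2 * (sqrt \<Delta> / (2 * pi)) / 2" if \<eta>: "\<eta> > 0" for \<eta>
  proof -
    have "ennreal (2 * P.prob ?Z) \<le> ennreal ((2 * pi + 2 * \<eta>)\<^sup>2 * (sqrt \<Delta> / (2 * pi)))"
    proof -
      have "ennreal (2 * P.prob ?Z) = 2 * emeasure (gauss_PiM I) ?Z"
        by (simp add: P.emeasure_eq_measure ennreal_mult)
      also have "\<dots> \<le> ennreal ((2 * pi + 2 * \<eta>)\<^sup>2) * ennreal (sqrt \<Delta> / (2 * pi))" by (rule bound[OF \<eta>])
      also have "\<dots> = ennreal ((2 * pi + 2 * \<eta>)\<^sup>2 * (sqrt \<Delta> / (2 * pi)))"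
        using pos by (intro ennreal_mult[symmetric]) auto
      finally show ?thesis .
    qed
    moreover have "0 \<le> (2 * pi + 2 * \<eta>)\<^sup>2 * (sqrt \<Delta> / (2 * pi))" using pos by simp
    ultimately have "2 * P.prob ?Z \<le> (2 * pi + 2 * \<eta>)\<^sup>2 * (sqrt \<Delta> / (2 * pi))"
      by (simp only: ennreal_le_iff)
    then show ?thesis by simp
  qed
  have "((\<lambda>\<eta>. (2 * pi + 2 * \<eta>)\<^sup>2 * (sqrt \<Delta> / (2 * pi)) / 2) \<longlongrightarrow> (2 * pi + 2 * 0)\<^sup>2 * (sqrt \<Delta> / (2 * pi)) / 2) (at_right 0)"
    by (intro tendsto_intros) auto
  then have "P.prob ?Z \<le> (2 * pi + 2 * 0)\<^sup>2 * (sqrt \<Delta> / (2 * pi)) / 2"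
    by (rule tendsto_lowerbound[OF _ eventually_mono[OF eventually_at_right_less real]]) auto
  also have "\<dots> = pi * sqrt \<Delta>" by (simp add: power2_eq_square)
  finally show "emeasure (gauss_PiM I) ?Z \<le> ennreal (pi * sqrt \<Delta>)"
    unfolding P.emeasure_eq_measure by (rule ennreal_leI)
qed

end

end

section \<open>The trinomial distribution\<close>

definition trinomial :: "nat \<Rightarrow> nat \<times> nat \<times> nat \<Rightarrow> real" where
  "trinomial d = (\<lambda>(i0, i1, i2). fact d / (fact i0 * fact i1 * fact i2))"

lemma exponents_eq_image: "exponents d = (\<lambda>(j, k). (j, k, d - j - k)) ` (SIGMA j:{..d}. {..d - j})"
proof (intro equalityI subsetI)
  fix i assume "i \<in> exponents d"
  then obtain i0 i1 i2 where "i = (i0, i1, i2)" "i0 + i1 + i2 = d" by (auto simp: exponents_def)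
  then show "i \<in> (\<lambda>(j, k). (j, k, d - j - k)) ` (SIGMA j:{..d}. {..d - j})"
    by (intro image_eqI[of _ _ "(i0, i1)"]) auto
qed (auto simp: exponents_def)

lemma finite_exponents[simp]: "finite (exponents d)"
  unfolding exponents_eq_image by (intro finite_imageI finite_SigmaI) auto

lemma sum_exponents: "(\<Sum>i\<in>exponents d. f i) = (\<Sum>j\<le>d. \<Sum>k\<le>d - j. f (j, k, d - j - k))"
proof -
  have "inj_on (\<lambda>(j, k). (j, k, d - j - k)) (SIGMA j:{..d}. {..d - j})"
    by (auto simp: inj_on_def)
  then show ?thesis
    unfolding exponents_eq_image by (subst sum.reindex) (auto simp: sum.Sigma case_prod_unfold)
qed

lemma card_exponents: "card (exponents d) = (d + 1) * (d + 2) div 2"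
proof -
  have "card (exponents d) = (\<Sum>i\<in>exponents d. 1)" by simp
  also have "\<dots> = (\<Sum>j\<le>d. \<Sum>k\<le>d - j. 1)" by (rule sum_exponents)
  also have "\<dots> = (\<Sum>j\<le>d. Suc (d - j))" by simp
  also have "\<dots> = (\<Sum>j\<le>d. Suc j)"
    using sum.nat_diff_reindex[of "\<lambda>j. Suc j" "Suc d"] by (simp add: lessThan_Suc_atMost)
  also have "\<dots> = (d + 1) * (d + 2) div 2"
    by (induction d) auto
  finally show ?thesis .
qed

theorem trinomial_theorem:
  fixes a b c :: complex
  shows "(\<Sum>(i0, i1, i2)\<in>exponents d. complex_of_real (trinomial d (i0, i1, i2)) * (a ^ i0 * b ^ i1 * c ^ i2)) = (a + b + c) ^ d"
proof -
  have "(a + b + c) ^ d = (\<Sum>j\<le>d. of_nat (d choose j) * a ^ j * (b + c) ^ (d - j))"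
    using binomial_ring[of a "b + c" d] by (simp add: add.assoc)
  also have "\<dots> = (\<Sum>j\<le>d. \<Sum>k\<le>d - j. complex_of_real (trinomial d (j, k, d - j - k)) * (a ^ j * b ^ k * c ^ (d - j - k)))"
  proof (rule sum.cong[OF refl])
    fix j assume j: "j \<in> {..d}"
    have "of_nat (d choose j) * a ^ j * (b + c) ^ (d - j)
       = (\<Sum>k\<le>d - j. of_nat (d choose j) * a ^ j * (of_nat ((d - j) choose k) * b ^ k * c ^ (d - j - k)))"
      by (simp add: binomial_ring sum_distrib_left)
    also have "\<dots> = (\<Sum>k\<le>d - j. complex_of_real (trinomial d (j, k, d - j - k)) * (a ^ j * b ^ k * c ^ (d - j - k)))"
    proof (rule sum.cong[OF refl])
      fix k assume k: "k \<in> {..d - j}"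
      have "real (d choose j) * real ((d - j) choose k) = trinomial d (j, k, d - j - k)"
        using j k by (simp add: binomial_fact trinomial_def)
      then have "complex_of_real (trinomial d (j, k, d - j - k)) = of_nat (d choose j) * of_nat ((d - j) choose k)"
        by (metis of_real_mult of_real_of_nat_eq)
      then show "of_nat (d choose j) * a ^ j * (of_nat ((d - j) choose k) * b ^ k * c ^ (d - j - k))
         = complex_of_real (trinomial d (j, k, d - j - k)) * (a ^ j * b ^ k * c ^ (d - j - k))"
        by (simp add: mult_ac)
    qed
    finally show "of_nat (d choose j) * a ^ j * (b + c) ^ (d - j)
       = (\<Sum>k\<le>d - j. complex_of_real (trinomial d (j, k, d - j - k)) * (a ^ j * b ^ k * c ^ (d - j - k)))" .
  qed
  also have "\<dots> = (\<Sum>i\<in>exponents d. case i of (i0, i1, i2) \<Rightarrow> complex_of_real (trinomial d (i0, i1, i2)) * (a ^ i0 * b ^ i1 * c ^ i2))"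
    by (subst sum_exponents) simp
  finally show ?thesis by simp
qed

text \<open>The factorial moments are the derivatives of the generating function.\<close>

lemma trinomial_moments:
  fixes a b c :: complex and d :: nat
  defines "T \<equiv> \<lambda>i. complex_of_real (trinomial d i)"
  shows "(\<Sum>(i0, i1, i2)\<in>exponents d. T (i0, i1, i2) * (a ^ i0 * (of_nat i1 * b ^ (i1 - 1)) * c ^ i2)) = of_nat d * (a + b + c) ^ (d - 1)"
    and "(\<Sum>(i0, i1, i2)\<in>exponents d. T (i0, i1, i2) * (a ^ i0 * b ^ i1 * (of_nat i2 * c ^ (i2 - 1)))) = of_nat d * (a + b + c) ^ (d - 1)"
    and "(\<Sum>(i0, i1, i2)\<in>exponents d. T (i0, i1, i2) * (a ^ i0 * (of_nat i1 * (of_nat (i1 - 1) * b ^ (i1 - 2))) * c ^ i2)) = of_nat d * of_nat (d - 1) * (a + b + c) ^ (d - 2)"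
    and "(\<Sum>(i0, i1, i2)\<in>exponents d. T (i0, i1, i2) * (a ^ i0 * b ^ i1 * (of_nat i2 * (of_nat (i2 - 1) * c ^ (i2 - 2))))) = of_nat d * of_nat (d - 1) * (a + b + c) ^ (d - 2)"
    and "(\<Sum>(i0, i1, i2)\<in>exponents d. T (i0, i1, i2) * (a ^ i0 * (of_nat i1 * b ^ (i1 - 1)) * (of_nat i2 * c ^ (i2 - 1)))) = of_nat d * of_nat (d - 1) * (a + b + c) ^ (d - 2)"
proof -
  have D: "((\<lambda>x. \<Sum>i\<in>exponents d. K i * f i x) has_field_derivative (\<Sum>i\<in>exponents d. K i * f' i)) (at x)"
    if "\<And>i. i \<in> exponents d \<Longrightarrow> (f i has_field_derivative f' i) (at x)" for K f f' and x :: complex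
    using that by (intro DERIV_sum DERIV_cmult)
  have P: "((\<lambda>x. x ^ n) has_field_derivative of_nat n * x ^ (n - 1)) (at x)" for n and x :: complex
    by (auto intro!: derivative_eq_intros)
  have P2: "((\<lambda>x. of_nat n * x ^ (n - 1)) has_field_derivative of_nat n * (of_nat (n - 1) * x ^ (n - 2))) (at x)" for n and x :: complex
  proof -
    have "n - 1 - 1 = n - 2" by simp
    with DERIV_cmult[OF P[of "n - 1" x], of "of_nat n"] show ?thesis by metis
  qed
  have S: "((\<lambda>x. (u + x) ^ n) has_field_derivative of_nat n * (u + x) ^ (n - 1)) (at x)" for u x :: complex and n
    by (auto intro!: derivative_eq_intros)
  have b1: "(\<Sum>i\<in>exponents d. (T i * a ^ fst i * c ^ snd (snd i)) * (of_nat (fst (snd i)) * b ^ (fst (snd i) - 1))) = of_nat d * ((a + c) + b) ^ (d - 1)" for a b c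
  proof -
    have "(\<lambda>b. \<Sum>i\<in>exponents d. (T i * a ^ fst i * c ^ snd (snd i)) * b ^ fst (snd i)) = (\<lambda>b. ((a + c) + b) ^ d)"
      using trinomial_theorem[of d a _ c] by (simp add: T_def case_prod_unfold fun_eq_iff mult_ac add_ac)
    note e = this
    show ?thesis
      using D[of "\<lambda>i x. x ^ fst (snd i)" _ b, OF P, of "\<lambda>i. T i * a ^ fst i * c ^ snd (snd i)"] S[of "a + c" d b] unfolding e by (rule DERIV_unique)
  qed
  have c1: "(\<Sum>i\<in>exponents d. (T i * a ^ fst i * b ^ fst (snd i)) * (of_nat (snd (snd i)) * c ^ (snd (snd i) - 1))) = of_nat d * ((a + b) + c) ^ (d - 1)" for a b c
  proof -
    have "(\<lambda>c. \<Sum>i\<in>exponents d. (T i * a ^ fst i * b ^ fst (snd i)) * c ^ snd (snd i)) = (\<lambda>c. ((a + b) + c) ^ d)"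
      using trinomial_theorem[of d a b] by (simp add: T_def case_prod_unfold fun_eq_iff mult_ac add_ac)
    note e = this
    show ?thesis
      using D[of "\<lambda>i x. x ^ snd (snd i)" _ c, OF P, of "\<lambda>i. T i * a ^ fst i * b ^ fst (snd i)"] S[of "a + b" d c] unfolding e by (rule DERIV_unique)
  qed
  have S2: "((\<lambda>x. of_nat d * (u + x) ^ (d - 1)) has_field_derivative of_nat d * of_nat (d - 1) * (u + x) ^ (d - 2)) (at x)" for u x :: complex
  proof -
    have "d - 1 - 1 = d - 2" by simp
    with DERIV_cmult[OF S[of u "d - 1" x], of "of_nat d"] show ?thesis by (metis mult.assoc)
  qed
  have b2: "(\<Sum>i\<in>exponents d. (T i * a ^ fst i * c ^ snd (snd i)) * (of_nat (fst (snd i)) * (of_nat (fst (snd i) - 1) * b ^ (fst (snd i) - 2)))) = of_nat d * of_nat (d - 1) * ((a + c) + b) ^ (d - 2)"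
    using D[of "\<lambda>i x. of_nat (fst (snd i)) * x ^ (fst (snd i) - 1)" _ b, OF P2, of "\<lambda>i. T i * a ^ fst i * c ^ snd (snd i)"] S2[of "a + c" b]
    unfolding b1 by (rule DERIV_unique)
  have c2: "(\<Sum>i\<in>exponents d. (T i * a ^ fst i * b ^ fst (snd i)) * (of_nat (snd (snd i)) * (of_nat (snd (snd i) - 1) * c ^ (snd (snd i) - 2)))) = of_nat d * of_nat (d - 1) * ((a + b) + c) ^ (d - 2)"
    using D[of "\<lambda>i x. of_nat (snd (snd i)) * x ^ (snd (snd i) - 1)" _ c, OF P2, of "\<lambda>i. T i * a ^ fst i * b ^ fst (snd i)"] S2[of "a + b" c]
    unfolding c1 by (rule DERIV_unique)
  have bc: "(\<Sum>i\<in>exponents d. (T i * a ^ fst i * (of_nat (fst (snd i)) * b ^ (fst (snd i) - 1))) * (of_nat (snd (snd i)) * c ^ (snd (snd i) - 1))) = of_nat d * of_nat (d - 1) * ((a + b) + c) ^ (d - 2)"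
  proof -
    have "(\<lambda>c. \<Sum>i\<in>exponents d. (T i * a ^ fst i * (of_nat (fst (snd i)) * b ^ (fst (snd i) - 1))) * c ^ snd (snd i)) = (\<lambda>c. of_nat d * ((a + b) + c) ^ (d - 1))"
      using b1[of a _ b] by (simp add: fun_eq_iff mult_ac add_ac)
    note e = this
    show ?thesis
      using D[of "\<lambda>i x. x ^ snd (snd i)" _ c, OF P, of "\<lambda>i. T i * a ^ fst i * (of_nat (fst (snd i)) * b ^ (fst (snd i) - 1))"] S2[of "a + b" c] unfolding e by (rule DERIV_unique)
  qed
  show "(\<Sum>(i0, i1, i2)\<in>exponents d. T (i0, i1, i2) * (a ^ i0 * (of_nat i1 * b ^ (i1 - 1)) * c ^ i2)) = of_nat d * (a + b + c) ^ (d - 1)"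
    using b1[of a c b] by (simp add: case_prod_unfold mult_ac add_ac)
  show "(\<Sum>(i0, i1, i2)\<in>exponents d. T (i0, i1, i2) * (a ^ i0 * b ^ i1 * (of_nat i2 * c ^ (i2 - 1)))) = of_nat d * (a + b + c) ^ (d - 1)"
    using c1[of a b c] by (simp add: case_prod_unfold mult_ac add_ac)
  show "(\<Sum>(i0, i1, i2)\<in>exponents d. T (i0, i1, i2) * (a ^ i0 * (of_nat i1 * (of_nat (i1 - 1) * b ^ (i1 - 2))) * c ^ i2)) = of_nat d * of_nat (d - 1) * (a + b + c) ^ (d - 2)"
    using b2 by (simp add: case_prod_unfold mult_ac add_ac)
  show "(\<Sum>(i0, i1, i2)\<in>exponents d. T (i0, i1, i2) * (a ^ i0 * b ^ i1 * (of_nat i2 * (of_nat (i2 - 1) * c ^ (i2 - 2))))) = of_nat d * of_nat (d - 1) * (a + b + c) ^ (d - 2)"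
    using c2 by (simp add: case_prod_unfold mult_ac add_ac)
  show "(\<Sum>(i0, i1, i2)\<in>exponents d. T (i0, i1, i2) * (a ^ i0 * (of_nat i1 * b ^ (i1 - 1)) * (of_nat i2 * c ^ (i2 - 1)))) = of_nat d * of_nat (d - 1) * (a + b + c) ^ (d - 2)"
    using bc by (simp add: case_prod_unfold mult_ac add_ac)
qed

section \<open>Moments and characteristic function of the trinomial weights\<close>

definition mweight :: "nat \<Rightarrow> real \<Rightarrow> real \<Rightarrow> real \<Rightarrow> nat \<times> nat \<times> nat \<Rightarrow> real" where
  "mweight d t0 t1 t2 = (\<lambda>(i0, i1, i2). trinomial d (i0, i1, i2) * (t0 ^ i0 * t1 ^ i1 * t2 ^ i2))"

text \<open>The factorial moments are taken at the complex arguments \<open>t0\<close>,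
  \<open>t1 * x\<close>, \<open>t2\<close>; n^2 = n (n - 1) + n converts them to ordinary moments.
  For \<open>x\<close> on the unit circle these sums are the correlations of jets at two points, and
  \<open>x = 1\<close> gives the plain moments.\<close>

lemma mweight_char:
  fixes x S :: complex and t0 t1 t2 :: real
  defines "S \<equiv> complex_of_real t0 + complex_of_real t1 * x + complex_of_real t2"
  shows "(\<Sum>(i0, i1, i2)\<in>exponents d. complex_of_real (mweight d t0 t1 t2 (i0, i1, i2)) * x ^ i1) = S ^ d"
    and "(\<Sum>(i0, i1, i2)\<in>exponents d. complex_of_real (mweight d t0 t1 t2 (i0, i1, i2) * real i1) * x ^ i1)
       = of_nat d * (t1 * x) * S ^ (d - 1)"
    and "(\<Sum>(i0, i1, i2)\<in>exponents d. complex_of_real (mweight d t0 t1 t2 (i0, i1, i2) * real i2) * x ^ i1)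
       = of_nat d * t2 * S ^ (d - 1)"
    and "(\<Sum>(i0, i1, i2)\<in>exponents d. complex_of_real (mweight d t0 t1 t2 (i0, i1, i2) * (real i1 * real i1)) * x ^ i1)
       = of_nat d * of_nat (d - 1) * (t1 * x)\<^sup>2 * S ^ (d - 2) + of_nat d * (t1 * x) * S ^ (d - 1)"
    and "(\<Sum>(i0, i1, i2)\<in>exponents d. complex_of_real (mweight d t0 t1 t2 (i0, i1, i2) * (real i1 * real i2)) * x ^ i1)
       = of_nat d * of_nat (d - 1) * (t1 * x) * t2 * S ^ (d - 2)"
    and "(\<Sum>(i0, i1, i2)\<in>exponents d. complex_of_real (mweight d t0 t1 t2 (i0, i1, i2) * (real i2 * real i2)) * x ^ i1)
       = of_nat d * of_nat (d - 1) * t2\<^sup>2 * S ^ (d - 2) + of_nat d * t2 * S ^ (d - 1)"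
proof -
  let ?a = "complex_of_real t0" and ?b = "complex_of_real t1 * x" and ?c = "complex_of_real t2"
  let ?T = "\<lambda>i. complex_of_real (trinomial d i)"
  have w: "complex_of_real (mweight d t0 t1 t2 (i0, i1, i2)) * x ^ i1 = ?T (i0, i1, i2) * (?a ^ i0 * ?b ^ i1 * ?c ^ i2)" for i0 i1 i2
    by (simp add: mweight_def power_mult_distrib)
  have p1: "of_nat n * y ^ n = y * (of_nat n * y ^ (n - 1))" for n and y :: complex
    by (cases n) auto
  have p2: "of_nat n * of_nat n * y ^ n = y\<^sup>2 * (of_nat n * (of_nat (n - 1) * y ^ (n - 2))) + y * (of_nat n * y ^ (n - 1))" for n and y :: complex
  proof -
    consider "n = 0" | "n = 1" | m where "n = Suc (Suc m)" by (metis One_nat_def not0_implies_Suc)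
    then show ?thesis by cases (auto simp: power2_eq_square algebra_simps)
  qed
  show "(\<Sum>(i0, i1, i2)\<in>exponents d. complex_of_real (mweight d t0 t1 t2 (i0, i1, i2)) * x ^ i1) = S ^ d"
    unfolding w trinomial_theorem S_def ..
  have r: "complex_of_real (mweight d t0 t1 t2 (i0, i1, i2) * y) * x ^ i1 = ?T (i0, i1, i2) * (?a ^ i0 * ?b ^ i1 * ?c ^ i2) * complex_of_real y" for i0 i1 i2 y
    unfolding w[symmetric] by simp
  have "(\<Sum>(i0, i1, i2)\<in>exponents d. ?T (i0, i1, i2) * (?a ^ i0 * ?b ^ i1 * ?c ^ i2) * complex_of_real (real i1))
      = (\<Sum>(i0, i1, i2)\<in>exponents d. ?b * (?T (i0, i1, i2) * (?a ^ i0 * (of_nat i1 * ?b ^ (i1 - 1)) * ?c ^ i2)))"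
  proof (intro sum.cong refl, clarify)
    fix i0 i1 i2
    have "?T (i0, i1, i2) * (?a ^ i0 * ?b ^ i1 * ?c ^ i2) * complex_of_real (real i1) = ?T (i0, i1, i2) * (?a ^ i0 * (of_nat i1 * ?b ^ i1) * ?c ^ i2)"
      by (simp add: mult_ac)
    also have "\<dots> = ?b * (?T (i0, i1, i2) * (?a ^ i0 * (of_nat i1 * ?b ^ (i1 - 1)) * ?c ^ i2))"
      unfolding p1 by (simp only: mult_ac)
    finally show "?T (i0, i1, i2) * (?a ^ i0 * ?b ^ i1 * ?c ^ i2) * complex_of_real (real i1) = ?b * (?T (i0, i1, i2) * (?a ^ i0 * (of_nat i1 * ?b ^ (i1 - 1)) * ?c ^ i2))" .
  qed
  then show "(\<Sum>(i0, i1, i2)\<in>exponents d. complex_of_real (mweight d t0 t1 t2 (i0, i1, i2) * real i1) * x ^ i1)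
       = of_nat d * (t1 * x) * S ^ (d - 1)"
    unfolding r using trinomial_moments(1)[of d ?a ?b ?c]
    by (simp add: sum_distrib_left[symmetric] case_prod_unfold S_def)
  have "(\<Sum>(i0, i1, i2)\<in>exponents d. ?T (i0, i1, i2) * (?a ^ i0 * ?b ^ i1 * ?c ^ i2) * complex_of_real (real i2))
      = (\<Sum>(i0, i1, i2)\<in>exponents d. ?c * (?T (i0, i1, i2) * (?a ^ i0 * ?b ^ i1 * (of_nat i2 * ?c ^ (i2 - 1)))))"
  proof (intro sum.cong refl, clarify)
    fix i0 i1 i2
    have "?T (i0, i1, i2) * (?a ^ i0 * ?b ^ i1 * ?c ^ i2) * complex_of_real (real i2) = ?T (i0, i1, i2) * (?a ^ i0 * ?b ^ i1 * (of_nat i2 * ?c ^ i2))"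
      by (simp add: mult_ac)
    also have "\<dots> = ?c * (?T (i0, i1, i2) * (?a ^ i0 * ?b ^ i1 * (of_nat i2 * ?c ^ (i2 - 1))))"
      unfolding p1 by (simp only: mult_ac)
    finally show "?T (i0, i1, i2) * (?a ^ i0 * ?b ^ i1 * ?c ^ i2) * complex_of_real (real i2) = ?c * (?T (i0, i1, i2) * (?a ^ i0 * ?b ^ i1 * (of_nat i2 * ?c ^ (i2 - 1))))" .
  qed
  then show "(\<Sum>(i0, i1, i2)\<in>exponents d. complex_of_real (mweight d t0 t1 t2 (i0, i1, i2) * real i2) * x ^ i1)
       = of_nat d * t2 * S ^ (d - 1)"
    unfolding r using trinomial_moments(2)[of d ?a ?b ?c]
    by (simp add: sum_distrib_left[symmetric] case_prod_unfold S_def)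
  have "(\<Sum>(i0, i1, i2)\<in>exponents d. ?T (i0, i1, i2) * (?a ^ i0 * ?b ^ i1 * ?c ^ i2) * complex_of_real (real i1 * real i1))
      = (\<Sum>(i0, i1, i2)\<in>exponents d. ?b\<^sup>2 * (?T (i0, i1, i2) * (?a ^ i0 * (of_nat i1 * (of_nat (i1 - 1) * ?b ^ (i1 - 2))) * ?c ^ i2))
         + ?b * (?T (i0, i1, i2) * (?a ^ i0 * (of_nat i1 * ?b ^ (i1 - 1)) * ?c ^ i2)))"
  proof (intro sum.cong refl, clarify)
    fix i0 i1 i2
    have "?T (i0, i1, i2) * (?a ^ i0 * ?b ^ i1 * ?c ^ i2) * complex_of_real (real i1 * real i1)
       = ?T (i0, i1, i2) * (?a ^ i0 * (of_nat i1 * of_nat i1 * ?b ^ i1) * ?c ^ i2)" by (simp add: mult_ac)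
    also have "\<dots> = ?b\<^sup>2 * (?T (i0, i1, i2) * (?a ^ i0 * (of_nat i1 * (of_nat (i1 - 1) * ?b ^ (i1 - 2))) * ?c ^ i2))
         + ?b * (?T (i0, i1, i2) * (?a ^ i0 * (of_nat i1 * ?b ^ (i1 - 1)) * ?c ^ i2))"
      unfolding p2 by (simp only: distrib_left distrib_right mult_ac)
    finally show "?T (i0, i1, i2) * (?a ^ i0 * ?b ^ i1 * ?c ^ i2) * complex_of_real (real i1 * real i1)
      = ?b\<^sup>2 * (?T (i0, i1, i2) * (?a ^ i0 * (of_nat i1 * (of_nat (i1 - 1) * ?b ^ (i1 - 2))) * ?c ^ i2))
         + ?b * (?T (i0, i1, i2) * (?a ^ i0 * (of_nat i1 * ?b ^ (i1 - 1)) * ?c ^ i2))" .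
  qed
  also have "\<dots> = ?b\<^sup>2 * (of_nat d * of_nat (d - 1) * (?a + ?b + ?c) ^ (d - 2)) + ?b * (of_nat d * (?a + ?b + ?c) ^ (d - 1))"
    unfolding trinomial_moments(1,3)[of d ?a ?b ?c, symmetric]
    by (simp only: case_prod_unfold sum.distrib sum_distrib_left)
  finally show "(\<Sum>(i0, i1, i2)\<in>exponents d. complex_of_real (mweight d t0 t1 t2 (i0, i1, i2) * (real i1 * real i1)) * x ^ i1)
       = of_nat d * of_nat (d - 1) * (t1 * x)\<^sup>2 * S ^ (d - 2) + of_nat d * (t1 * x) * S ^ (d - 1)"
    unfolding r S_def by (simp only: mult_ac)
  have "(\<Sum>(i0, i1, i2)\<in>exponents d. ?T (i0, i1, i2) * (?a ^ i0 * ?b ^ i1 * ?c ^ i2) * complex_of_real (real i1 * real i2))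
      = (\<Sum>(i0, i1, i2)\<in>exponents d. ?b * ?c * (?T (i0, i1, i2) * (?a ^ i0 * (of_nat i1 * ?b ^ (i1 - 1)) * (of_nat i2 * ?c ^ (i2 - 1)))))"
  proof (intro sum.cong refl, clarify)
    fix i0 i1 i2
    have "?T (i0, i1, i2) * (?a ^ i0 * ?b ^ i1 * ?c ^ i2) * complex_of_real (real i1 * real i2)
       = ?T (i0, i1, i2) * (?a ^ i0 * (of_nat i1 * ?b ^ i1) * (of_nat i2 * ?c ^ i2))" by (simp add: mult_ac)
    also have "\<dots> = ?b * ?c * (?T (i0, i1, i2) * (?a ^ i0 * (of_nat i1 * ?b ^ (i1 - 1)) * (of_nat i2 * ?c ^ (i2 - 1))))"
      unfolding p1 by (simp only: mult_ac)
    finally show "?T (i0, i1, i2) * (?a ^ i0 * ?b ^ i1 * ?c ^ i2) * complex_of_real (real i1 * real i2)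
      = ?b * ?c * (?T (i0, i1, i2) * (?a ^ i0 * (of_nat i1 * ?b ^ (i1 - 1)) * (of_nat i2 * ?c ^ (i2 - 1))))" .
  qed
  also have "\<dots> = ?b * ?c * (of_nat d * of_nat (d - 1) * (?a + ?b + ?c) ^ (d - 2))"
    unfolding trinomial_moments(5)[of d ?a ?b ?c, symmetric]
    by (simp only: case_prod_unfold sum.distrib sum_distrib_left)
  finally show "(\<Sum>(i0, i1, i2)\<in>exponents d. complex_of_real (mweight d t0 t1 t2 (i0, i1, i2) * (real i1 * real i2)) * x ^ i1)
       = of_nat d * of_nat (d - 1) * (t1 * x) * t2 * S ^ (d - 2)"
    unfolding r S_def by (simp only: mult_ac)
  have "(\<Sum>(i0, i1, i2)\<in>exponents d. ?T (i0, i1, i2) * (?a ^ i0 * ?b ^ i1 * ?c ^ i2) * complex_of_real (real i2 * real i2))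
      = (\<Sum>(i0, i1, i2)\<in>exponents d. ?c\<^sup>2 * (?T (i0, i1, i2) * (?a ^ i0 * ?b ^ i1 * (of_nat i2 * (of_nat (i2 - 1) * ?c ^ (i2 - 2)))))
         + ?c * (?T (i0, i1, i2) * (?a ^ i0 * ?b ^ i1 * (of_nat i2 * ?c ^ (i2 - 1)))))"
  proof (intro sum.cong refl, clarify)
    fix i0 i1 i2
    have "?T (i0, i1, i2) * (?a ^ i0 * ?b ^ i1 * ?c ^ i2) * complex_of_real (real i2 * real i2)
       = ?T (i0, i1, i2) * (?a ^ i0 * ?b ^ i1 * (of_nat i2 * of_nat i2 * ?c ^ i2))" by (simp add: mult_ac)
    also have "\<dots> = ?c\<^sup>2 * (?T (i0, i1, i2) * (?a ^ i0 * ?b ^ i1 * (of_nat i2 * (of_nat (i2 - 1) * ?c ^ (i2 - 2)))))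
         + ?c * (?T (i0, i1, i2) * (?a ^ i0 * ?b ^ i1 * (of_nat i2 * ?c ^ (i2 - 1))))"
      unfolding p2 by (simp only: distrib_left distrib_right mult_ac)
    finally show "?T (i0, i1, i2) * (?a ^ i0 * ?b ^ i1 * ?c ^ i2) * complex_of_real (real i2 * real i2)
      = ?c\<^sup>2 * (?T (i0, i1, i2) * (?a ^ i0 * ?b ^ i1 * (of_nat i2 * (of_nat (i2 - 1) * ?c ^ (i2 - 2)))))
         + ?c * (?T (i0, i1, i2) * (?a ^ i0 * ?b ^ i1 * (of_nat i2 * ?c ^ (i2 - 1))))" .
  qed
  also have "\<dots> = ?c\<^sup>2 * (of_nat d * of_nat (d - 1) * (?a + ?b + ?c) ^ (d - 2)) + ?c * (of_nat d * (?a + ?b + ?c) ^ (d - 1))"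
    unfolding trinomial_moments(2,4)[of d ?a ?b ?c, symmetric]
    by (simp only: case_prod_unfold sum.distrib sum_distrib_left)
  finally show "(\<Sum>(i0, i1, i2)\<in>exponents d. complex_of_real (mweight d t0 t1 t2 (i0, i1, i2) * (real i2 * real i2)) * x ^ i1)
       = of_nat d * of_nat (d - 1) * t2\<^sup>2 * S ^ (d - 2) + of_nat d * t2 * S ^ (d - 1)"
    unfolding r S_def by (simp only: mult_ac of_real_power of_real_mult of_real_of_nat_eq)
qed

lemma mweight_moments:
  fixes t0 t1 t2 :: real and d :: nat
  assumes "t0 + t1 + t2 = 1"
  defines "p \<equiv> mweight d t0 t1 t2"
  shows "(\<Sum>(i0, i1, i2)\<in>exponents d. p (i0, i1, i2)) = 1"
    and "(\<Sum>(i0, i1, i2)\<in>exponents d. p (i0, i1, i2) * real i1) = d * t1"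
    and "(\<Sum>(i0, i1, i2)\<in>exponents d. p (i0, i1, i2) * real i2) = d * t2"
    and "(\<Sum>(i0, i1, i2)\<in>exponents d. p (i0, i1, i2) * (real i1 * real i1)) = d * real (d - 1) * t1\<^sup>2 + d * t1"
    and "(\<Sum>(i0, i1, i2)\<in>exponents d. p (i0, i1, i2) * (real i1 * real i2)) = d * real (d - 1) * t1 * t2"
    and "(\<Sum>(i0, i1, i2)\<in>exponents d. p (i0, i1, i2) * (real i2 * real i2)) = d * real (d - 1) * t2\<^sup>2 + d * t2"
proof -
  have S: "complex_of_real t0 + complex_of_real t1 * 1 + complex_of_real t2 = 1"
    using assms(1) by (metis mult.right_neutral of_real_1 of_real_add)
  have c: "(\<Sum>(i0, i1, i2)\<in>exponents d. complex_of_real (f (i0, i1, i2)) * 1 ^ i1) = complex_of_real y \<longleftrightarrow>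
     (\<Sum>(i0, i1, i2)\<in>exponents d. f (i0, i1, i2)) = y" for f :: "_ \<Rightarrow> real" and y
    by (simp add: case_prod_unfold flip: of_real_sum)
  note m = mweight_char[of d t0 t1 t2 1, unfolded S]
  show "(\<Sum>(i0, i1, i2)\<in>exponents d. p (i0, i1, i2)) = 1"
    using m(1) by (subst c[symmetric]) (simp add: p_def)
  show "(\<Sum>(i0, i1, i2)\<in>exponents d. p (i0, i1, i2) * real i1) = d * t1"
    using m(2) c[of "\<lambda>i. p i * real (fst (snd i))" "d * t1"] by (simp add: p_def)
  show "(\<Sum>(i0, i1, i2)\<in>exponents d. p (i0, i1, i2) * real i2) = d * t2"
    using m(3) c[of "\<lambda>i. p i * real (snd (snd i))" "d * t2"] by (simp add: p_def)
  show "(\<Sum>(i0, i1, i2)\<in>exponents d. p (i0, i1, i2) * (real i1 * real i1)) = d * real (d - 1) * t1\<^sup>2 + d * t1"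
    using m(4) c[of "\<lambda>i. p i * (real (fst (snd i)) * real (fst (snd i)))" "d * real (d - 1) * t1\<^sup>2 + d * t1"] by (simp add: p_def)
  show "(\<Sum>(i0, i1, i2)\<in>exponents d. p (i0, i1, i2) * (real i1 * real i2)) = d * real (d - 1) * t1 * t2"
    using m(5) c[of "\<lambda>i. p i * (real (fst (snd i)) * real (snd (snd i)))" "d * real (d - 1) * t1 * t2"] by (simp add: p_def)
  show "(\<Sum>(i0, i1, i2)\<in>exponents d. p (i0, i1, i2) * (real i2 * real i2)) = d * real (d - 1) * t2\<^sup>2 + d * t2"
    using m(6) c[of "\<lambda>i. p i * (real (snd (snd i)) * real (snd (snd i)))" "d * real (d - 1) * t2\<^sup>2 + d * t2"] by (simp add: p_def)
qed

section \<open>Almost independent linear forms\<close>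

definition vnorm :: "'i set \<Rightarrow> ('i \<Rightarrow> complex) \<Rightarrow> real" where
  "vnorm I u = L2_set (\<lambda>i. cmod (u i)) I"

lemma vnorm_nonneg[simp]: "vnorm I u \<ge> 0"
  by (simp add: vnorm_def L2_set_nonneg)

lemma vnorm_power2: "(vnorm I u)\<^sup>2 = (\<Sum>i\<in>I. (cmod (u i))\<^sup>2)"
  by (simp add: vnorm_def L2_set_def sum_nonneg)

lemma vnorm_power2_complex: "complex_of_real ((vnorm I u)\<^sup>2) = (\<Sum>i\<in>I. u i * cnj (u i))"
  unfolding vnorm_power2 of_real_sum by (simp only: complex_norm_square)

lemma vnorm_add_le: "vnorm I (\<lambda>i. u i + v i) \<le> vnorm I u + vnorm I v"
  unfolding vnorm_def
  by (rule order_trans[OF L2_set_mono L2_set_triangle_ineq]) (auto intro: norm_triangle_ineq)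

lemma vnorm_scale: "vnorm I (\<lambda>i. c * u i) = cmod c * vnorm I u"
  unfolding vnorm_def norm_mult by (simp add: L2_set_right_distrib)

lemma vnorm_diff_le: "vnorm I (\<lambda>i. u i - v i) \<le> vnorm I u + vnorm I v"
  using vnorm_add_le[of I u "\<lambda>i. - v i"] vnorm_scale[of I "-1" v] by simp

lemma vnorm_sum_le: "finite S \<Longrightarrow> vnorm I (\<lambda>i. \<Sum>j\<in>S. f j i) \<le> (\<Sum>j\<in>S. vnorm I (f j))"
proof (induction S rule: finite_induct)
  case empty then show ?case by (simp add: vnorm_def L2_set_def)
next
  case (insert x S)
  then show ?case using vnorm_add_le[of I "f x" "\<lambda>i. \<Sum>j\<in>S. f j i"] by simp
qed

lemma cauchy_schwarz_vnorm: "cmod (\<Sum>i\<in>I. u i * cnj (v i)) \<le> vnorm I u * vnorm I v"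
proof -
  have "cmod (\<Sum>i\<in>I. u i * cnj (v i)) \<le> (\<Sum>i\<in>I. \<bar>cmod (u i)\<bar> * \<bar>cmod (v i)\<bar>)"
    by (rule order_trans[OF norm_sum]) (simp add: norm_mult)
  also have "\<dots> \<le> vnorm I u * vnorm I v"
    unfolding vnorm_def by (rule L2_set_mult_ineq)
  finally show ?thesis .
qed

text \<open>The tolerance depends on \<open>n\<close> and \<open>\<eta>\<close> only, not on the
  index set nor on its size; this is what allows one choice for all degrees. Gram-Schmidt is run on
  vectors that are already nearly orthonormal, and each step moves the next vector by a small
  multiple of the previous errors.\<close>

lemma approx_gram_schmidt:
  fixes \<eta> :: real
  assumes "\<eta> > 0"
  shows "\<exists>\<epsilon>>0. \<forall>(I :: 'i set) v. finite I \<longrightarrow>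
      (\<forall>j<n. (\<Sum>i\<in>I. v j i * cnj (v j i)) = 1) \<longrightarrow>
      (\<forall>j<n. \<forall>k<n. j \<noteq> k \<longrightarrow> cmod (\<Sum>i\<in>I. v j i * cnj (v k i)) \<le> \<epsilon>) \<longrightarrow>
      (\<exists>w. orthonormal_on I {..<n::nat} w \<and> (\<forall>j<n. vnorm I (\<lambda>i. v j i - w j i) \<le> \<eta>))"
  using assms
proof (induction n arbitrary: \<eta>)
  case 0
  then show ?case by (intro exI[of _ 1]) (auto simp: orthonormal_on_def)
next
  case (Suc n)
  \<comment> \<open>Each of the \<open>n\<close> projections has size at most 2 eta', so together
    they stay below 1/4 and the remainder is nonzero. Projection and normalization each move the
    last vector by at most 2 n eta', in total at most \<open>\<eta>\<close>.\<close>
  define \<eta>' where "\<eta>' = min \<eta> 1 / (8 * real (Suc n))"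
  have \<eta>': "\<eta>' > 0" "\<eta>' \<le> \<eta>" "4 * real n * \<eta>' \<le> \<eta>" "2 * real n * \<eta>' \<le> 1 / 4"
  proof -
    have "\<eta>' * (8 * real (Suc n)) = min \<eta> 1" by (simp add: \<eta>'_def)
    moreover show p: "\<eta>' > 0" using Suc.prems by (simp add: \<eta>'_def)
    ultimately have e: "8 * (real n * \<eta>') + 8 * \<eta>' = min \<eta> 1" by (simp add: algebra_simps)
    have "real n * \<eta>' \<ge> 0" using p by simp
    then show "\<eta>' \<le> \<eta>" "4 * real n * \<eta>' \<le> \<eta>" "2 * real n * \<eta>' \<le> 1 / 4"
      using e p min.cobounded1[of \<eta> 1] min.cobounded2[of \<eta> 1] unfolding mult.assoc by linarith+
  qed
  obtain \<epsilon>0 where \<epsilon>0: "\<epsilon>0 > 0" "\<forall>(I :: 'i set) v. finite I \<longrightarrow>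
      (\<forall>j<n. (\<Sum>i\<in>I. v j i * cnj (v j i)) = 1) \<longrightarrow>
      (\<forall>j<n. \<forall>k<n. j \<noteq> k \<longrightarrow> cmod (\<Sum>i\<in>I. v j i * cnj (v k i)) \<le> \<epsilon>0) \<longrightarrow>
      (\<exists>w. orthonormal_on I {..<n} w \<and> (\<forall>j<n. vnorm I (\<lambda>i. v j i - w j i) \<le> \<eta>'))"
    using Suc.IH[OF \<eta>'(1)] by (elim exE conjE)
  define \<epsilon> where "\<epsilon> = min \<epsilon>0 \<eta>'"
  show ?case
  proof (intro exI[of _ \<epsilon>] conjI allI impI)
    show "\<epsilon> > 0" using \<epsilon>0(1) \<eta>'(1) by (simp add: \<epsilon>_def)
    fix I :: "'i set" and v
    assume fin: "finite I" and unit: "\<forall>j<Suc n. (\<Sum>i\<in>I. v j i * cnj (v j i)) = 1"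
      and gram: "\<forall>j<Suc n. \<forall>k<Suc n. j \<noteq> k \<longrightarrow> cmod (\<Sum>i\<in>I. v j i * cnj (v k i)) \<le> \<epsilon>"
    have "\<exists>w. orthonormal_on I {..<n} w \<and> (\<forall>j<n. vnorm I (\<lambda>i. v j i - w j i) \<le> \<eta>')"
    proof (rule \<epsilon>0(2)[THEN spec, THEN spec, THEN mp, THEN mp, THEN mp, OF fin])
      show "\<forall>j<n. (\<Sum>i\<in>I. v j i * cnj (v j i)) = 1" using unit less_SucI by blast
      show "\<forall>j<n. \<forall>k<n. j \<noteq> k \<longrightarrow> cmod (\<Sum>i\<in>I. v j i * cnj (v k i)) \<le> \<epsilon>0"
      proof (intro allI impI)
        fix j k assume "j < n" "k < n" "j \<noteq> k"
        then have "cmod (\<Sum>i\<in>I. v j i * cnj (v k i)) \<le> \<epsilon>" using gram by simp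
        then show "cmod (\<Sum>i\<in>I. v j i * cnj (v k i)) \<le> \<epsilon>0" by (simp add: \<epsilon>_def)
      qed
    qed
    then obtain w where w: "orthonormal_on I {..<n} w" "\<And>j. j < n \<Longrightarrow> vnorm I (\<lambda>i. v j i - w j i) \<le> \<eta>'" by blast
    have nv: "vnorm I (v n) = 1"
    proof -
      have "complex_of_real ((vnorm I (v n))\<^sup>2) = 1" unfolding vnorm_power2_complex using unit by simp
      then have "(vnorm I (v n))\<^sup>2 = 1" by (simp only: of_real_eq_1_iff)
      then show ?thesis using vnorm_nonneg[of I "v n"] unfolding power2_eq_1_iff by linarith
    qed
    have nw: "vnorm I (w j) = 1" if "j < n" for j
    proof -
      have "complex_of_real ((vnorm I (w j))\<^sup>2) = 1"
        unfolding vnorm_power2_complex using w(1) that by (simp add: orthonormal_on_def)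
      then have "(vnorm I (w j))\<^sup>2 = 1" by (simp only: of_real_eq_1_iff)
      then show ?thesis using vnorm_nonneg[of I "w j"] unfolding power2_eq_1_iff by linarith
    qed
    define c where "c j = (\<Sum>i\<in>I. v n i * cnj (w j i))" for j
    \<comment> \<open>One eta' from the assumed Gram entry with \<open>v j\<close>, one from
      replacing \<open>v j\<close> by \<open>w j\<close>.\<close>
    have c: "cmod (c j) \<le> 2 * \<eta>'" if j: "j < n" for j
    proof -
      have "c j = (\<Sum>i\<in>I. v n i * cnj (v j i)) - (\<Sum>i\<in>I. v n i * cnj (v j i - w j i))"
        by (simp add: c_def sum_subtractf[symmetric] algebra_simps)
      then have "cmod (c j) \<le> cmod (\<Sum>i\<in>I. v n i * cnj (v j i)) + cmod (\<Sum>i\<in>I. v n i * cnj (v j i - w j i))"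
        by (metis norm_triangle_ineq4)
      also have "\<dots> \<le> \<epsilon> + vnorm I (v n) * vnorm I (\<lambda>i. v j i - w j i)"
        using gram j by (intro add_mono cauchy_schwarz_vnorm) auto
      also have "\<dots> \<le> \<eta>' + 1 * \<eta>'"
        unfolding nv using w(2)[OF j] by (intro add_mono) (auto simp: \<epsilon>_def)
      finally show ?thesis by simp
    qed
    define s where "s i = (\<Sum>j<n. c j * w j i)" for i
    define u where "u i = v n i - s i" for i
    have ns: "vnorm I s \<le> 2 * real n * \<eta>'"
    proof -
      have "vnorm I s \<le> (\<Sum>j<n. vnorm I (\<lambda>i. c j * w j i))" unfolding s_def by (rule vnorm_sum_le) simp
      also have "\<dots> = (\<Sum>j<n. cmod (c j))" using nw by (simp add: vnorm_scale)
      also have "\<dots> \<le> (\<Sum>j<n. 2 * \<eta>')" by (intro sum_mono c) simp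
      finally show ?thesis by simp
    qed
    have nu: "1 - 2 * real n * \<eta>' \<le> vnorm I u" "vnorm I u \<le> 1 + 2 * real n * \<eta>'"
    proof -
      have "vnorm I u \<le> vnorm I (v n) + vnorm I s" unfolding u_def by (rule vnorm_diff_le)
      then show "vnorm I u \<le> 1 + 2 * real n * \<eta>'" using nv ns by simp
      have "vnorm I (v n) \<le> vnorm I u + vnorm I s"
        using vnorm_add_le[of I u s] by (simp add: u_def)
      then show "1 - 2 * real n * \<eta>' \<le> vnorm I u" using nv ns by simp
    qed
    have upos: "vnorm I u > 0" using nu(1) \<eta>'(4) by linarith
    have orth: "(\<Sum>i\<in>I. u i * cnj (w k i)) = 0" if k: "k < n" for k
    proof -
      have "(\<Sum>i\<in>I. s i * cnj (w k i)) = (\<Sum>i\<in>I. \<Sum>j<n. c j * (w j i * cnj (w k i)))"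
        by (simp add: s_def sum_distrib_right mult.assoc)
      also have "\<dots> = (\<Sum>j<n. c j * (\<Sum>i\<in>I. w j i * cnj (w k i)))"
        by (subst sum.swap) (simp add: sum_distrib_left)
      also have "\<dots> = (\<Sum>j<n. c j * (if j = k then 1 else 0))"
        using w(1) k by (intro sum.cong) (auto simp: orthonormal_on_def)
      also have "\<dots> = c k" using k by (simp add: if_distrib cong: if_cong)
      finally show ?thesis by (simp add: u_def left_diff_distrib sum_subtractf c_def)
    qed
    define W where "W j = (if j < n then w j else (\<lambda>i. complex_of_real (1 / vnorm I u) * u i))" for j
    have Wn: "W n = (\<lambda>i. complex_of_real (1 / vnorm I u) * u i)" by (simp add: W_def)
    have Wj: "j < n \<Longrightarrow> W j = w j" for j by (simp add: W_def)
    have nn: "(\<Sum>i\<in>I. W n i * cnj (W n i)) = 1"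
    proof -
      have "vnorm I (W n) = 1" unfolding Wn vnorm_scale using upos by (simp add: norm_divide)
      then show ?thesis unfolding vnorm_power2_complex[symmetric] by simp
    qed
    have nk: "(\<Sum>i\<in>I. W n i * cnj (W k i)) = 0" "(\<Sum>i\<in>I. W k i * cnj (W n i)) = 0" if k: "k < n" for k
    proof -
      show 1: "(\<Sum>i\<in>I. W n i * cnj (W k i)) = 0"
        unfolding Wn Wj[OF k] mult.assoc sum_distrib_left[symmetric] orth[OF k] by simp
      have "(\<Sum>i\<in>I. W k i * cnj (W n i)) = cnj (\<Sum>i\<in>I. W n i * cnj (W k i))"
        by (simp add: mult.commute)
      then show "(\<Sum>i\<in>I. W k i * cnj (W n i)) = 0" unfolding 1 by simp
    qed
    have "orthonormal_on I {..<Suc n} W"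
      unfolding orthonormal_on_def
    proof (intro ballI)
      fix j k assume "j \<in> {..<Suc n}" "k \<in> {..<Suc n}"
      then consider "j < n" "k < n" | "j = n" "k = n" | "j = n" "k < n" | "j < n" "k = n" by fastforce
      then show "(\<Sum>i\<in>I. W j i * cnj (W k i)) = (if j = k then 1 else 0)"
        using w(1) nn nk by cases (auto simp: Wj orthonormal_on_def)
    qed
    moreover have "vnorm I (\<lambda>i. v j i - W j i) \<le> \<eta>" if "j < Suc n" for j
    proof (cases "j < n")
      case True
      then show ?thesis using w(2)[OF True] \<eta>'(2) by (simp add: Wj)
    next
      case False
      then have j: "j = n" using that by simp
      have "(\<lambda>i. v n i - W n i) = (\<lambda>i. s i + complex_of_real (1 - 1 / vnorm I u) * u i)"
        by (auto simp: Wn u_def fun_eq_iff algebra_simps)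
      then have "vnorm I (\<lambda>i. v n i - W n i) \<le> vnorm I s + vnorm I (\<lambda>i. complex_of_real (1 - 1 / vnorm I u) * u i)"
        by (simp only: vnorm_add_le)
      also have "vnorm I (\<lambda>i. complex_of_real (1 - 1 / vnorm I u) * u i) = \<bar>vnorm I u - 1\<bar>"
      proof -
        have "\<bar>1 - 1 / vnorm I u\<bar> * vnorm I u = \<bar>(1 - 1 / vnorm I u) * vnorm I u\<bar>"
          by (simp add: abs_mult)
        also have "(1 - 1 / vnorm I u) * vnorm I u = vnorm I u - 1" using upos by (simp add: field_simps)
        finally show ?thesis unfolding vnorm_scale norm_of_real .
      qed
      also have "\<dots> \<le> 2 * real n * \<eta>'" using nu by linarith
      finally show ?thesis using ns \<eta>'(3) j by simp
    qed
    ultimately show "\<exists>w. orthonormal_on I {..<Suc n} w \<and> (\<forall>j<Suc n. vnorm I (\<lambda>i. v j i - w j i) \<le> \<eta>)"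
      by blast
  qed
qed

section \<open>Tails and products for Gaussian linear forms\<close>

lemma nn_integral_cgauss_norm_power4: "(\<integral>\<^sup>+z. ennreal (cmod z ^ 4) \<partial>cgauss) = 2"
proof -
  have "(\<integral>\<^sup>+z. ennreal (cmod z ^ 4) \<partial>cgauss) = (\<integral>\<^sup>+z. (\<lambda>t. ennreal (t\<^sup>2)) ((cmod z)\<^sup>2) \<partial>cgauss)"
    by simp
  also have "\<dots> = (\<integral>\<^sup>+t. indicator {0..} t * ennreal (exp (- t)) * ennreal (t\<^sup>2) \<partial>lborel)"
    by (rule nn_integral_cgauss_radial) simp
  also have "\<dots> = (\<integral>\<^sup>+t. ennreal (indicator {0..} t * t powr (3 - 1) / exp t) \<partial>lborel)"
    by (intro nn_integral_cong)
       (auto simp: indicator_def ennreal_mult[symmetric] exp_minus field_simps)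
  also have "\<dots> = ennreal (Gamma 3)"
    by (rule Gamma_conv_nn_integral_real[symmetric]) simp
  also have "Gamma (3::real) = 2"
    using Gamma_fact[of 2, where ?'a = real] by (simp add: numeral_2_eq_2)
  finally show ?thesis by simp
qed

text \<open>Divided by its norm the form is one standard complex Gaussian, and Markov's inequality
  is applied to the fourth power, whose mean is 2. The fourth power is what later outweighs the
  number of attempts.\<close>

lemma gauss_linear_tail:
  assumes I: "finite I" and \<delta>: "\<delta> > 0"
  shows "emeasure (gauss_PiM I) {a \<in> space (gauss_PiM I). \<delta> \<le> cmod (\<Sum>i\<in>I. a i * u i)} \<le> ennreal (2 * vnorm I u ^ 4 / \<delta> ^ 4)"
proof (cases "vnorm I u = 0")
  case True
  then have "(\<Sum>i\<in>I. (cmod (u i))\<^sup>2) = 0" using vnorm_power2[of I u] by simp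
  then have "u i = 0" if "i \<in> I" for i using that I by (simp add: sum_nonneg_eq_0_iff)
  then have e: "{a \<in> space (gauss_PiM I). \<delta> \<le> cmod (\<Sum>i\<in>I. a i * u i)} = {}" using \<delta> by auto
  show ?thesis unfolding e by simp
next
  case False
  define s where "s = vnorm I u"
  have s: "s > 0" using False by (auto simp: s_def less_le)
  define w where "w = (\<lambda>(_::unit) i. complex_of_real (1 / s) * u i)"
  have on: "orthonormal_on I UNIV w"
  proof -
    have "vnorm I (w ()) = 1" unfolding w_def vnorm_scale using s by (simp add: s_def[symmetric] norm_divide)
    then have "(\<Sum>i\<in>I. w () i * cnj (w () i)) = 1"
      unfolding vnorm_power2_complex[symmetric] by simp
    then show ?thesis by (simp add: orthonormal_on_def)
  qed
  define g where "g = (\<lambda>z. indicator {z. \<delta> / s \<le> cmod z} z :: ennreal)"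
  have S: "{z. \<delta> / s \<le> cmod z} \<in> sets borel" by (intro borel_closed closed_Collect_le continuous_intros)
  have g: "g \<in> borel_measurable cgauss" using S by (simp add: g_def cong: measurable_cong_sets)
  have gP: "(\<lambda>y. g (y ())) \<in> borel_measurable (gauss_PiM (UNIV :: unit set))"
    by (rule measurable_compose[OF _ g]) simp
  have "{a \<in> space (gauss_PiM I). \<delta> \<le> cmod (\<Sum>i\<in>I. a i * u i)} \<in> sets (gauss_PiM I)" by measurable
  then have "emeasure (gauss_PiM I) {a \<in> space (gauss_PiM I). \<delta> \<le> cmod (\<Sum>i\<in>I. a i * u i)}
     = (\<integral>\<^sup>+a. indicator {a \<in> space (gauss_PiM I). \<delta> \<le> cmod (\<Sum>i\<in>I. a i * u i)} a \<partial>gauss_PiM I)" by simp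
  also have "\<dots> = (\<integral>\<^sup>+a. g ((\<lambda>j\<in>UNIV. \<Sum>i\<in>I. a i * w j i) ()) \<partial>gauss_PiM I)"
  proof (rule nn_integral_cong)
    fix a assume a: "a \<in> space (gauss_PiM I)"
    have "(\<Sum>i\<in>I. a i * w () i) = complex_of_real (1 / s) * (\<Sum>i\<in>I. a i * u i)"
      by (simp add: w_def sum_distrib_left mult_ac)
    then have "cmod (\<Sum>i\<in>I. a i * w () i) = cmod (\<Sum>i\<in>I. a i * u i) / s"
      using s by (simp add: norm_divide norm_mult)
    then show "indicator {a \<in> space (gauss_PiM I). \<delta> \<le> cmod (\<Sum>i\<in>I. a i * u i)} a = g ((\<lambda>j\<in>UNIV. \<Sum>i\<in>I. a i * w j i) ())"
      using a s by (simp add: g_def indicator_def divide_le_cancel)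
  qed
  also have "\<dots> = (\<integral>\<^sup>+y. g (y ()) \<partial>gauss_PiM (UNIV :: unit set))"
    by (rule nn_integral_gauss_orthonormal[OF _ I on gP]) simp
  also have "\<dots> = (\<integral>\<^sup>+z. g z \<partial>cgauss)"
    unfolding UNIV_unit by (rule gauss_PiM.product_nn_integral_singleton[OF g])
  also have "\<dots> \<le> (\<integral>\<^sup>+z. ennreal (s ^ 4 / \<delta> ^ 4) * ennreal (cmod z ^ 4) \<partial>cgauss)"
  proof (rule nn_integral_mono)
    fix z
    show "g z \<le> ennreal (s ^ 4 / \<delta> ^ 4) * ennreal (cmod z ^ 4)"
    proof (cases "\<delta> / s \<le> cmod z")
      case True
      have "1 = s ^ 4 / \<delta> ^ 4 * (\<delta> / s) ^ 4" using s \<delta> by (simp add: power_divide)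
      also have "\<dots> \<le> s ^ 4 / \<delta> ^ 4 * cmod z ^ 4"
        using True s \<delta> by (intro mult_left_mono power_mono) auto
      finally have "ennreal 1 \<le> ennreal (s ^ 4 / \<delta> ^ 4 * cmod z ^ 4)" by (rule ennreal_leI)
      then show ?thesis using True s \<delta> by (simp add: g_def ennreal_mult[symmetric])
    qed (simp add: g_def)
  qed
  also have "\<dots> = ennreal (s ^ 4 / \<delta> ^ 4) * 2"
    by (subst nn_integral_cmult) (simp_all add: nn_integral_cgauss_norm_power4)
  also have "\<dots> = ennreal (2 * vnorm I u ^ 4 / \<delta> ^ 4)"
    using s \<delta> by (simp add: s_def[symmetric] ennreal_mult'[symmetric] mult.commute flip: ennreal_numeral)
  finally show ?thesis .
qed

lemma nn_integral_gauss_PiM_triples: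
  fixes h :: "complex \<times> complex \<times> complex \<Rightarrow> ennreal"
  assumes h: "h \<in> borel_measurable (borel \<Otimes>\<^sub>M (borel \<Otimes>\<^sub>M borel))"
  shows "(\<integral>\<^sup>+y. (\<Prod>k<m. h (y (3 * k), y (3 * k + 1), y (3 * k + 2))) \<partial>gauss_PiM {..<3 * m})
    = (\<integral>\<^sup>+u. \<integral>\<^sup>+v. \<integral>\<^sup>+w. h (u, v, w) \<partial>cgauss \<partial>cgauss \<partial>cgauss) ^ m"
proof (induction m)
  case 0
  show ?case by (simp add: prob_space.emeasure_space_1[OF prob_space_gauss_PiM])
next
  case (Suc m)
  define P where "P y = (\<Prod>k<m. h (y (3 * k), y (3 * k + 1), y (3 * k + 2)))" for y :: "nat \<Rightarrow> complex"
  define c where "c = (\<integral>\<^sup>+u. \<integral>\<^sup>+v. \<integral>\<^sup>+w. h (u, v, w) \<partial>cgauss \<partial>cgauss \<partial>cgauss)"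
  have comp: "(\<lambda>y. y i) \<in> borel_measurable (gauss_PiM J)" if "i \<in> J" for i and J :: "nat set"
    using measurable_component_singleton[OF that, of "\<lambda>_. cgauss"] by (simp cong: measurable_cong_sets)
  have hm: "(\<lambda>y. h (f y, g y, k y)) \<in> borel_measurable M"
    if "f \<in> borel_measurable M" "g \<in> borel_measurable M" "k \<in> borel_measurable M" for f g k and M :: "(nat \<Rightarrow> complex) measure"
    by (intro measurable_compose[OF _ h] measurable_Pair that)
  have Pm: "P \<in> borel_measurable (gauss_PiM J)" if "{..<3 * m} \<subseteq> J" for J
    unfolding P_def using that by (intro borel_measurable_prod_ennreal hm comp) auto
  have upd: "P (y(3 * m := u)) = P y" "P (y(3 * m + 1 := u)) = P y" "P (y(3 * m + 2 := u)) = P y" for y u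
    unfolding P_def by (intro prod.cong; auto)+
  let ?J0 = "{..<3 * m}" and ?J1 = "insert (3 * m) {..<3 * m}" and ?J2 = "insert (3 * m + 1) (insert (3 * m) {..<3 * m})"
  have J3: "{..<3 * Suc m} = insert (3 * m + 2) ?J2" by auto
  have "(\<integral>\<^sup>+y. (\<Prod>k<Suc m. h (y (3 * k), y (3 * k + 1), y (3 * k + 2))) \<partial>gauss_PiM {..<3 * Suc m})
     = (\<integral>\<^sup>+y. P y * h (y (3 * m), y (3 * m + 1), y (3 * m + 2)) \<partial>gauss_PiM (insert (3 * m + 2) ?J2))"
    unfolding J3 by (simp add: P_def)
  also have "\<dots> = (\<integral>\<^sup>+w. \<integral>\<^sup>+y. P y * h (y (3 * m), y (3 * m + 1), w) \<partial>gauss_PiM ?J2 \<partial>cgauss)"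
    by (subst gauss_PiM.product_nn_integral_insert_rev)
       (auto simp: upd upd[simplified] intro!: borel_measurable_times_ennreal Pm hm comp)
  also have "\<dots> = (\<integral>\<^sup>+w. \<integral>\<^sup>+v. \<integral>\<^sup>+y. P y * h (y (3 * m), v, w) \<partial>gauss_PiM ?J1 \<partial>cgauss \<partial>cgauss)"
    by (intro nn_integral_cong, subst gauss_PiM.product_nn_integral_insert_rev)
       (auto simp: upd[simplified] intro!: borel_measurable_times_ennreal Pm hm comp)
  also have "\<dots> = (\<integral>\<^sup>+w. \<integral>\<^sup>+v. \<integral>\<^sup>+u. \<integral>\<^sup>+y. P y * h (u, v, w) \<partial>gauss_PiM ?J0 \<partial>cgauss \<partial>cgauss \<partial>cgauss)"
    by (intro nn_integral_cong, subst gauss_PiM.product_nn_integral_insert_rev)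
       (auto simp: upd intro!: borel_measurable_times_ennreal Pm hm comp)
  also have "\<dots> = (\<integral>\<^sup>+w. \<integral>\<^sup>+v. \<integral>\<^sup>+u. c ^ m * h (u, v, w) \<partial>cgauss \<partial>cgauss \<partial>cgauss)"
  proof -
    have "(\<integral>\<^sup>+y. P y \<partial>gauss_PiM ?J0) = c ^ m" using Suc.IH by (simp only: P_def c_def)
    then show ?thesis using Pm[of ?J0] by (simp add: nn_integral_multc)
  qed
  also have "\<dots> = c ^ m * (\<integral>\<^sup>+w. \<integral>\<^sup>+v. \<integral>\<^sup>+u. h (u, v, w) \<partial>cgauss \<partial>cgauss \<partial>cgauss)"
  proof -
    interpret P: pair_prob_space cgauss cgauss ..
    have m1: "(\<lambda>u. h (u, v, w)) \<in> borel_measurable cgauss" for v w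
      by (intro measurable_compose[OF _ h] measurable_Pair measurable_const) simp_all
    have m2: "(\<lambda>v. \<integral>\<^sup>+u. h (u, v, w) \<partial>cgauss) \<in> borel_measurable cgauss" for w
    proof (rule cgauss.borel_measurable_nn_integral)
      show "(\<lambda>(v, u). h (u, v, w)) \<in> borel_measurable (cgauss \<Otimes>\<^sub>M cgauss)"
        unfolding case_prod_unfold by (intro measurable_compose[OF _ h] measurable_Pair measurable_const) measurable
    qed
    have m3: "(\<lambda>w. \<integral>\<^sup>+v. \<integral>\<^sup>+u. h (u, v, w) \<partial>cgauss \<partial>cgauss) \<in> borel_measurable cgauss"
    proof (intro cgauss.borel_measurable_nn_integral)
      have "(\<lambda>p. \<integral>\<^sup>+u. h (u, snd p, fst p) \<partial>cgauss) \<in> borel_measurable (cgauss \<Otimes>\<^sub>M cgauss)"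
      proof (rule cgauss.borel_measurable_nn_integral)
        show "(\<lambda>(p, u). h (u, snd p, fst p)) \<in> borel_measurable ((cgauss \<Otimes>\<^sub>M cgauss) \<Otimes>\<^sub>M cgauss)"
          unfolding case_prod_unfold by (intro measurable_compose[OF _ h] measurable_Pair) measurable
      qed
      then show "(\<lambda>(w, v). \<integral>\<^sup>+u. h (u, v, w) \<partial>cgauss) \<in> borel_measurable (cgauss \<Otimes>\<^sub>M cgauss)"
        by (simp add: case_prod_unfold)
    qed
    show ?thesis using m1 m2 m3 by (simp add: nn_integral_cmult)
  qed
  \<comment> \<open>Coordinates were removed from the last one on, so the three integrals appear in
    reverse order; passing through the product measure reorders them.\<close>
  also have "(\<integral>\<^sup>+w. \<integral>\<^sup>+v. \<integral>\<^sup>+u. h (u, v, w) \<partial>cgauss \<partial>cgauss \<partial>cgauss) = c"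
  proof -
    have hp: "(\<lambda>y. h (y 2, y 1, y 0)) \<in> borel_measurable (gauss_PiM {0, 1, 2::nat})"
      by (intro hm comp) auto
    have "(\<lambda>p. h (snd (snd p), fst (snd p), fst p)) \<in> borel_measurable (borel \<Otimes>\<^sub>M (borel \<Otimes>\<^sub>M borel))"
      by (intro measurable_compose[OF _ h] measurable_Pair) measurable
    from nn_integral_gauss_PiM_3[OF this]
    have "(\<integral>\<^sup>+w. \<integral>\<^sup>+v. \<integral>\<^sup>+u. h (u, v, w) \<partial>cgauss \<partial>cgauss \<partial>cgauss) = (\<integral>\<^sup>+y. h (y 2, y 1, y 0) \<partial>gauss_PiM {0, 1, 2::nat})"
      by simp
    also have "\<dots> = (\<integral>\<^sup>+w. \<integral>\<^sup>+y. h (w, y 1, y 0) \<partial>gauss_PiM {0, 1::nat} \<partial>cgauss)"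
    proof -
      have "{0, 1, 2::nat} = insert 2 {0, 1}" by auto
      then show ?thesis
        using gauss_PiM.product_nn_integral_insert_rev[of "{0, 1}" "2::nat" "\<lambda>y. h (y 2, y 1, y 0)"] hp by simp
    qed
    also have "\<dots> = (\<integral>\<^sup>+w. \<integral>\<^sup>+v. \<integral>\<^sup>+y. h (w, v, y 0) \<partial>gauss_PiM {0::nat} \<partial>cgauss \<partial>cgauss)"
    proof (rule nn_integral_cong)
      fix w
      have "{0, 1::nat} = insert 1 {0}" by auto
      moreover have "(\<lambda>y. h (w, y 1, y 0)) \<in> borel_measurable (gauss_PiM (insert 1 {0::nat}))"
        by (intro hm comp measurable_const) auto
      ultimately show "(\<integral>\<^sup>+y. h (w, y 1, y 0) \<partial>gauss_PiM {0, 1::nat}) = (\<integral>\<^sup>+v. \<integral>\<^sup>+y. h (w, v, y 0) \<partial>gauss_PiM {0::nat} \<partial>cgauss)"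
        using gauss_PiM.product_nn_integral_insert_rev[of "{0}" "1::nat" "\<lambda>y. h (w, y 1, y 0)"] by simp
    qed
    also have "\<dots> = c"
      unfolding c_def
      by (intro nn_integral_cong gauss_PiM.product_nn_integral_singleton measurable_compose[OF _ h] measurable_Pair measurable_const) measurable
    finally show ?thesis .
  qed
  finally show ?case unfolding c_def by (simp add: mult.commute)
qed

section \<open>Zeros forced by a jet\<close>

lemma power_le_fact_exp:
  fixes x :: real assumes "x \<ge> 0" shows "x ^ n \<le> fact n * exp x"
proof -
  have s: "(\<lambda>k. x ^ k /\<^sub>R fact k) sums exp x" by (rule exp_converges)
  have "(\<Sum>k\<in>{n}. x ^ k /\<^sub>R fact k) \<le> exp x"
    unfolding sums_unique[OF s] by (rule sum_le_suminf) (use s assms in \<open>auto simp: sums_iff\<close>)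
  then show ?thesis by (simp add: field_simps)
qed

lemma fact_double_le: "fact (2 * j) \<le> (4 ^ j * (fact j)\<^sup>2 :: real)"
proof (induction j)
  case (Suc j)
  have "fact (2 * Suc j) = (2 * real j + 2) * (2 * real j + 1) * fact (2 * j)"
    by (simp add: algebra_simps)
  also have "\<dots> \<le> ((2 * real j + 2) * (2 * real j + 2)) * (4 ^ j * (fact j)\<^sup>2)"
    using Suc.IH by (intro mult_mono) auto
  also have "\<dots> = 4 ^ Suc j * (fact (Suc j))\<^sup>2"
    by (simp add: power2_eq_square algebra_simps)
  finally show ?case .
qed simp

text \<open>Up to the unit factor \<open>\<i> ^ (j + l)\<close>, the mixed partial derivative of the
  field at \<open>z\<close>, of order \<open>j\<close> in the real and \<open>l\<close> in the
  imaginary direction.\<close>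

definition taylor_coeff where
  "taylor_coeff I r \<alpha> \<beta> a z j l = (\<Sum>i\<in>I. a i * (wave r \<alpha> \<beta> z i * complex_of_real (\<alpha> i ^ j * \<beta> i ^ l)))"

lemma cis_taylor_term:
  "(\<i> * complex_of_real (x * s + y * t)) ^ n / fact n
    = (\<Sum>j\<le>n. \<i> ^ n * complex_of_real (s ^ j * t ^ (n - j) / (fact j * fact (n - j))) * complex_of_real (x ^ j * y ^ (n - j)))"
proof -
  have "(\<i> * complex_of_real (x * s + y * t)) ^ n / fact n
     = \<i> ^ n * complex_of_real ((x * s + y * t) ^ n / fact n)"
    by (simp add: power_mult_distrib)
  also have "(x * s + y * t) ^ n / fact n = (\<Sum>j\<le>n. s ^ j * t ^ (n - j) / (fact j * fact (n - j)) * (x ^ j * y ^ (n - j)))"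
  proof -
    have "(x * s + y * t) ^ n = (\<Sum>j\<le>n. real (n choose j) * (x * s) ^ j * (y * t) ^ (n - j))"
      by (rule binomial_ring)
    then have "(x * s + y * t) ^ n / fact n = (\<Sum>j\<le>n. real (n choose j) * (x * s) ^ j * (y * t) ^ (n - j) / fact n)"
      by (simp add: sum_divide_distrib)
    also have "\<dots> = (\<Sum>j\<le>n. s ^ j * t ^ (n - j) / (fact j * fact (n - j)) * (x ^ j * y ^ (n - j)))"
      by (intro sum.cong refl) (simp add: binomial_fact power_mult_distrib mult_ac)
    finally show ?thesis .
  qed
  finally show ?thesis by (simp add: sum_distrib_left mult_ac)
qed

text \<open>The term of order n is a sum of n + 1 monomials, each at most rho^n y / 4^n, and n + 1
  \<le> 2^n leaves rho^n y / 2^n. From order 2 on, rho \<le> 1 allows rho^2 to be taken out and a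
  geometric series remains.\<close>

lemma wave_field_taylor:
  assumes I: "finite I" and y: "y \<ge> 0" and \<rho>: "0 \<le> \<rho>" "\<rho> \<le> 1" and s: "cmod s \<le> \<rho>"
    and G: "\<And>n j. j \<le> n \<Longrightarrow> cmod (taylor_coeff I r \<alpha> \<beta> a z j (n - j)) \<le> fact j * fact (n - j) * (y / 4 ^ n)"
  shows "cmod (wave_field I r \<alpha> \<beta> a (z + s) - (wave_field I r \<alpha> \<beta> a z
    + (Re s *\<^sub>R wave_field_dx I r \<alpha> \<beta> a z + Im s *\<^sub>R wave_field_dy I r \<alpha> \<beta> a z))) \<le> y * \<rho>\<^sup>2 / 2"
proof -
  define T where "T n = (\<Sum>i\<in>I. a i * (wave r \<alpha> \<beta> z i * ((\<i> * complex_of_real (\<alpha> i * Re s + \<beta> i * Im s)) ^ n / fact n)))" for n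
  have T_sums: "T sums wave_field I r \<alpha> \<beta> a (z + s)"
  proof -
    have "(\<lambda>n. (\<i> * complex_of_real (\<alpha> i * Re s + \<beta> i * Im s)) ^ n / fact n) sums cis (\<alpha> i * Re s + \<beta> i * Im s)" for i
      using exp_converges[of "\<i> * complex_of_real (\<alpha> i * Re s + \<beta> i * Im s)"]
      by (simp add: cis_conv_exp scaleR_conv_of_real divide_inverse mult.commute)
    then have "T sums (\<Sum>i\<in>I. a i * (wave r \<alpha> \<beta> z i * cis (\<alpha> i * Re s + \<beta> i * Im s)))"
      unfolding T_def[abs_def] by (intro sums_sum sums_mult)
    also have "(\<Sum>i\<in>I. a i * (wave r \<alpha> \<beta> z i * cis (\<alpha> i * Re s + \<beta> i * Im s))) = wave_field I r \<alpha> \<beta> a (z + s)"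
      unfolding wave_field_def wave_def by (simp add: cis_mult algebra_simps)
    finally show ?thesis .
  qed
  have T0: "T 0 = wave_field I r \<alpha> \<beta> a z" by (simp add: T_def wave_field_def)
  have T1: "T 1 = Re s *\<^sub>R wave_field_dx I r \<alpha> \<beta> a z + Im s *\<^sub>R wave_field_dy I r \<alpha> \<beta> a z"
    unfolding T_def wave_field_dx_def wave_field_dy_def scaleR_sum_right sum.distrib[symmetric]
    by (intro sum.cong refl) (simp add: scaleR_conv_of_real algebra_simps)
  have Tn: "cmod (T n) \<le> \<rho> ^ n * (y / 2 ^ n)" for n
  proof -
    have "T n = (\<Sum>i\<in>I. \<Sum>j\<le>n. \<i> ^ n * complex_of_real (Re s ^ j * Im s ^ (n - j) / (fact j * fact (n - j))) *
        (a i * (wave r \<alpha> \<beta> z i * complex_of_real (\<alpha> i ^ j * \<beta> i ^ (n - j)))))"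
      unfolding T_def cis_taylor_term by (simp add: sum_distrib_left mult_ac)
    also have "\<dots> = (\<Sum>j\<le>n. \<i> ^ n * complex_of_real (Re s ^ j * Im s ^ (n - j) / (fact j * fact (n - j))) * taylor_coeff I r \<alpha> \<beta> a z j (n - j))"
      unfolding taylor_coeff_def by (subst sum.swap) (simp add: sum_distrib_left)
    finally have "cmod (T n) \<le> (\<Sum>j\<le>n. cmod (\<i> ^ n * complex_of_real (Re s ^ j * Im s ^ (n - j) / (fact j * fact (n - j))) * taylor_coeff I r \<alpha> \<beta> a z j (n - j)))"
      by (simp only: norm_sum)
    also have "\<dots> \<le> (\<Sum>j\<le>n. \<rho> ^ n * (y / 4 ^ n))"
    proof (rule sum_mono)
      fix j assume "j \<in> {..n}"
      then have j: "j \<le> n" by simp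
      have "cmod (\<i> ^ n * complex_of_real (Re s ^ j * Im s ^ (n - j) / (fact j * fact (n - j))) * taylor_coeff I r \<alpha> \<beta> a z j (n - j))
         = \<bar>Re s\<bar> ^ j * \<bar>Im s\<bar> ^ (n - j) / (fact j * fact (n - j)) * cmod (taylor_coeff I r \<alpha> \<beta> a z j (n - j))"
        by (simp add: norm_mult norm_power norm_divide abs_mult power_abs)
      also have "\<dots> \<le> \<rho> ^ j * \<rho> ^ (n - j) / (fact j * fact (n - j)) * (fact j * fact (n - j) * (y / 4 ^ n))"
      proof (intro mult_mono divide_right_mono power_mono)
        show "\<bar>Re s\<bar> \<le> \<rho>" "\<bar>Im s\<bar> \<le> \<rho>"
          using s abs_Re_le_cmod[of s] abs_Im_le_cmod[of s] by linarith+
      qed (use G[OF j] \<rho> in auto)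
      also have "\<dots> = \<rho> ^ n * (y / 4 ^ n)" using j by (simp add: power_add[symmetric])
      finally show "cmod (\<i> ^ n * complex_of_real (Re s ^ j * Im s ^ (n - j) / (fact j * fact (n - j))) * taylor_coeff I r \<alpha> \<beta> a z j (n - j)) \<le> \<rho> ^ n * (y / 4 ^ n)" .
    qed
    also have "\<dots> = \<rho> ^ n * (real (Suc n) * (y / 4 ^ n))" by simp
    also have "\<dots> \<le> \<rho> ^ n * (2 ^ n * (y / 4 ^ n))"
    proof (intro mult_left_mono mult_right_mono)
      have "Suc n \<le> 2 ^ n" by (simp add: Suc_leI)
      then have "real (Suc n) \<le> real (2 ^ n)" by (rule of_nat_mono)
      then show "real (Suc n) \<le> 2 ^ n" by simp
    qed (use y \<rho> in auto)
    also have "2 ^ n * (y / 4 ^ n) = y / (2 ^ n :: real)"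
      using power_mult_distrib[of "2::real" 2 n] by (simp add: field_simps)
    finally show ?thesis .
  qed
  have "(\<lambda>n. T (n + 2)) sums (wave_field I r \<alpha> \<beta> a (z + s) - (\<Sum>n<2. T n))"
    by (rule sums_split_initial_segment[OF T_sums])
  also have "(\<Sum>n<2. T n) = T 0 + T 1" by (simp add: numeral_2_eq_2)
  finally have tail: "(\<lambda>n. T (n + 2)) sums (wave_field I r \<alpha> \<beta> a (z + s) - (T 0 + T 1))" .
  have bd: "cmod (T (n + 2)) \<le> y * \<rho>\<^sup>2 / 4 * (1 / 2) ^ n" for n
  proof -
    have "cmod (T (n + 2)) \<le> \<rho> ^ (n + 2) * (y / 2 ^ (n + 2))" by (rule Tn)
    also have "\<dots> \<le> \<rho> ^ 2 * (y / 2 ^ (n + 2))"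
      using \<rho> y by (intro mult_right_mono power_decreasing) auto
    finally have "cmod (T (n + 2)) \<le> \<rho> ^ 2 * (y / 2 ^ (n + 2))" .
    then show ?thesis by (simp add: power_add power_one_over field_simps)
  qed
  have geo: "(\<lambda>n. y * \<rho>\<^sup>2 / 4 * (1 / 2) ^ n) sums (y * \<rho>\<^sup>2 / 4 * 2)"
    using sums_mult[OF geometric_sums[of "1 / 2 :: real"], of "y * \<rho>\<^sup>2 / 4"] by simp
  have "cmod (wave_field I r \<alpha> \<beta> a (z + s) - (T 0 + T 1)) \<le> y * \<rho>\<^sup>2 / 4 * 2"
    by (rule norm_sums_le[OF tail geo bd])
  then show ?thesis unfolding T0 T1 by simp
qed

text \<open>Zeros are detected by the jet at a single point: if the field is close to the identity map to
  first order on a small disc, then the field has a zero there by Brouwer's theorem.\<close>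

lemma wave_field_zero_brouwer:
  assumes I: "finite I" and \<rho>: "0 < \<rho>" "\<rho> \<le> 1"
    and Y: "cmod (wave_field I r \<alpha> \<beta> a z) \<le> \<rho> / 4"
    and U: "cmod (wave_field_dx I r \<alpha> \<beta> a z - 1) \<le> 1 / 8"
    and V: "cmod (wave_field_dy I r \<alpha> \<beta> a z - \<i>) \<le> 1 / 8"
    and G: "\<And>n j. j \<le> n \<Longrightarrow> cmod (taylor_coeff I r \<alpha> \<beta> a z j (n - j)) \<le> fact j * fact (n - j) * ((1 / (2 * \<rho>)) / 4 ^ n)"
  shows "\<exists>x. wave_field I r \<alpha> \<beta> a x = 0"
proof -
  let ?f = "wave_field I r \<alpha> \<beta> a"
  let ?U = "wave_field_dx I r \<alpha> \<beta> a z" and ?V = "wave_field_dy I r \<alpha> \<beta> a z"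
  \<comment> \<open>A fixed point of this map is a zero of the field. The displacement has three
    parts of size at most rho / 4: the Taylor remainder, with y = 1 / (2 rho), the value at the
    centre, and the deviation of the derivative from the identity.\<close>
  have maps: "s - ?f (z + s) \<in> cball 0 \<rho>" if s: "s \<in> cball 0 \<rho>" for s
  proof -
    have s': "cmod s \<le> \<rho>" using s by simp
    define E where "E = ?f (z + s) - (?f z + (Re s *\<^sub>R ?U + Im s *\<^sub>R ?V))"
    have E: "cmod E \<le> (1 / (2 * \<rho>)) * \<rho>\<^sup>2 / 2"
      unfolding E_def by (rule wave_field_taylor[OF I _ _ _ s' G]) (use \<rho> in auto)
    have sRI: "s = Re s *\<^sub>R 1 + Im s *\<^sub>R \<i>" by (simp add: complex_eq_iff)
    have "?f (z + s) - (Re s *\<^sub>R 1 + Im s *\<^sub>R \<i>) = E + ?f z + (Re s *\<^sub>R (?U - 1) + Im s *\<^sub>R (?V - \<i>))"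
      by (simp add: E_def algebra_simps)
    then have "?f (z + s) - s = E + ?f z + (Re s *\<^sub>R (?U - 1) + Im s *\<^sub>R (?V - \<i>))"
      unfolding sRI[symmetric] .
    then have "cmod (?f (z + s) - s) \<le> cmod E + cmod (?f z) + cmod (Re s *\<^sub>R (?U - 1) + Im s *\<^sub>R (?V - \<i>))"
      by (metis norm_triangle_le norm_triangle_ineq add_right_mono)
    also have "cmod (Re s *\<^sub>R (?U - 1) + Im s *\<^sub>R (?V - \<i>)) \<le> \<bar>Re s\<bar> * cmod (?U - 1) + \<bar>Im s\<bar> * cmod (?V - \<i>)"
      by (rule order_trans[OF norm_triangle_ineq]) simp
    also have "\<dots> \<le> \<rho> * (1 / 8) + \<rho> * (1 / 8)"
      using U V s' abs_Re_le_cmod[of s] abs_Im_le_cmod[of s] \<rho> by (intro add_mono mult_mono) auto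
    finally have "cmod (?f (z + s) - s) \<le> (1 / (2 * \<rho>)) * \<rho>\<^sup>2 / 2 + \<rho> / 4 + (\<rho> * (1 / 8) + \<rho> * (1 / 8))"
      using E Y by linarith
    also have "(1 / (2 * \<rho>)) * \<rho>\<^sup>2 / 2 = \<rho> / 4" using \<rho> by (simp add: power2_eq_square)
    finally have "cmod (?f (z + s) - s) \<le> \<rho>" using \<rho> by simp
    then show ?thesis by (simp add: norm_minus_commute)
  qed
  obtain s where "s - ?f (z + s) = s"
  proof (rule brouwer[of "cball 0 \<rho>" "\<lambda>s. s - ?f (z + s)"])
    show "continuous_on (cball 0 \<rho>) (\<lambda>s. s - ?f (z + s))"
      by (intro continuous_intros continuous_on_compose2[OF continuous_on_wave_field(1)[of UNIV]]) auto
  qed (use \<rho> maps in auto)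
  then show ?thesis by (intro exI[of _ "z + s"]) simp
qed

text \<open>A single exponential moment controls all derivatives at once: even powers of a frequency
  are bounded by factorials times \<open>exp (16 * |x|)\<close>, which makes the squared norm of a
  Taylor coefficient at most C (j! l!)^2 / 64^(j + l). The fourth-moment tail then decays
  geometrically in the order, and the union bound converges.\<close>

lemma taylor_coeff_tail:
  fixes r \<alpha> \<beta> :: "'i \<Rightarrow> real" and y C :: real and I :: "'i set" and z :: complex
  assumes I: "finite I" and y: "y > 0" and C: "C \<ge> 0"
    and mgf: "(\<Sum>i\<in>I. (r i)\<^sup>2 * exp (16 * (\<bar>\<alpha> i\<bar> + \<bar>\<beta> i\<bar>))) \<le> C"
  defines "S \<equiv> {a \<in> space (gauss_PiM I). \<exists>n. \<exists>j\<le>n.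
      fact j * fact (n - j) * (y / 4 ^ n) \<le> cmod (taylor_coeff I r \<alpha> \<beta> a z j (n - j))}"
  shows "S \<in> sets (gauss_PiM I)" "emeasure (gauss_PiM I) S \<le> ennreal (4 * C\<^sup>2 / y ^ 4)"
proof -
  define u where "u j l i = wave r \<alpha> \<beta> z i * complex_of_real (\<alpha> i ^ j * \<beta> i ^ l)" for j l i
  define B where "B n j = {a \<in> space (gauss_PiM I). fact j * fact (n - j) * (y / 4 ^ n) \<le> cmod (\<Sum>i\<in>I. a i * u j (n - j) i)}" for n j
  have Bm: "B n j \<in> sets (gauss_PiM I)" for n j unfolding B_def by measurable
  have V: "(vnorm I (u j l))\<^sup>2 \<le> C * (fact j * fact l)\<^sup>2 / 64 ^ (j + l)" for j l
  proof -
    have "(vnorm I (u j l))\<^sup>2 = (\<Sum>i\<in>I. (r i)\<^sup>2 * ((\<alpha> i)\<^sup>2 ^ j * (\<beta> i)\<^sup>2 ^ l))"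
      unfolding vnorm_power2
    proof (intro sum.cong refl)
      fix i
      have pw: "(\<bar>x\<bar> ^ k)\<^sup>2 = x\<^sup>2 ^ k" for x :: real and k
        by (metis mult.commute power2_abs power_mult)
      have "cmod (u j l i) = \<bar>r i\<bar> * (\<bar>\<alpha> i\<bar> ^ j * \<bar>\<beta> i\<bar> ^ l)"
        by (simp add: u_def wave_def norm_mult norm_power)
      then show "(cmod (u j l i))\<^sup>2 = (r i)\<^sup>2 * ((\<alpha> i)\<^sup>2 ^ j * (\<beta> i)\<^sup>2 ^ l)"
        by (simp only: power_mult_distrib pw power2_abs)
    qed
    also have "\<dots> \<le> (\<Sum>i\<in>I. (r i)\<^sup>2 * exp (16 * (\<bar>\<alpha> i\<bar> + \<bar>\<beta> i\<bar>)) * ((fact j * fact l)\<^sup>2 / 64 ^ (j + l)))"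
    proof (rule sum_mono)
      fix i
      \<comment> \<open>Here (16 |x|)^(2 j) is at most (2 j)! times the exponential, and (2 j)! is
        at most 4^j (j!)^2; the quotient of 256^j by 4^j is 64^j.\<close>
      have p: "x\<^sup>2 ^ j \<le> exp (16 * \<bar>x\<bar>) * ((fact j)\<^sup>2 / 64 ^ j)" for x :: real and j :: nat
      proof -
        have "(16 * \<bar>x\<bar>) ^ (2 * j) = ((16 * \<bar>x\<bar>)\<^sup>2) ^ j" by (rule power_mult)
        also have "(16 * \<bar>x\<bar>)\<^sup>2 = 256 * x\<^sup>2" by (simp add: power_mult_distrib)
        finally have "256 ^ j * x\<^sup>2 ^ j = (16 * \<bar>x\<bar>) ^ (2 * j)" by (simp only: power_mult_distrib)
        also have "\<dots> \<le> fact (2 * j) * exp (16 * \<bar>x\<bar>)" by (rule power_le_fact_exp) simp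
        also have "\<dots> \<le> (4 ^ j * (fact j)\<^sup>2) * exp (16 * \<bar>x\<bar>)" by (intro mult_right_mono fact_double_le) simp
        finally have "256 ^ j * x\<^sup>2 ^ j \<le> (4 ^ j * (fact j)\<^sup>2) * exp (16 * \<bar>x\<bar>)" .
        moreover have "(256::real) ^ j = 4 ^ j * 64 ^ j" by (simp add: power_mult_distrib[symmetric])
        ultimately have "4 ^ j * (64 ^ j * x\<^sup>2 ^ j) \<le> 4 ^ j * ((fact j)\<^sup>2 * exp (16 * \<bar>x\<bar>))" by (simp add: mult.assoc)
        then have "64 ^ j * x\<^sup>2 ^ j \<le> (fact j)\<^sup>2 * exp (16 * \<bar>x\<bar>)" by simp
        then show ?thesis by (simp add: field_simps)
      qed
      have "(r i)\<^sup>2 * ((\<alpha> i)\<^sup>2 ^ j * (\<beta> i)\<^sup>2 ^ l) \<le> (r i)\<^sup>2 * ((exp (16 * \<bar>\<alpha> i\<bar>) * ((fact j)\<^sup>2 / 64 ^ j)) * (exp (16 * \<bar>\<beta> i\<bar>) * ((fact l)\<^sup>2 / 64 ^ l)))"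
        by (intro mult_left_mono mult_mono p) auto
      also have "\<dots> = (r i)\<^sup>2 * exp (16 * (\<bar>\<alpha> i\<bar> + \<bar>\<beta> i\<bar>)) * ((fact j * fact l)\<^sup>2 / 64 ^ (j + l))"
        by (simp add: distrib_left exp_add power_add power_mult_distrib)
      finally show "(r i)\<^sup>2 * ((\<alpha> i)\<^sup>2 ^ j * (\<beta> i)\<^sup>2 ^ l) \<le> (r i)\<^sup>2 * exp (16 * (\<bar>\<alpha> i\<bar> + \<bar>\<beta> i\<bar>)) * ((fact j * fact l)\<^sup>2 / 64 ^ (j + l))" .
    qed
    also have "\<dots> = (\<Sum>i\<in>I. (r i)\<^sup>2 * exp (16 * (\<bar>\<alpha> i\<bar> + \<bar>\<beta> i\<bar>))) * ((fact j * fact l)\<^sup>2 / 64 ^ (j + l))"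
      by (rule sum_distrib_right[symmetric])
    also have "\<dots> \<le> C * ((fact j * fact l)\<^sup>2 / 64 ^ (j + l))"
      by (intro mult_right_mono mgf) auto
    finally show ?thesis by simp
  qed
  have Bn: "emeasure (gauss_PiM I) (B n j) \<le> ennreal (2 * C\<^sup>2 / y ^ 4 * (1 / 16) ^ n)" if j: "j \<le> n" for n j
  proof -
    let ?F = "fact j * fact (n - j) :: real"
    have "emeasure (gauss_PiM I) (B n j) \<le> ennreal (2 * vnorm I (u j (n - j)) ^ 4 / (?F * (y / 4 ^ n)) ^ 4)"
      unfolding B_def by (rule gauss_linear_tail[OF I]) (use y in simp)
    also have "\<dots> \<le> ennreal (2 * C\<^sup>2 / y ^ 4 * (1 / 16) ^ n)"
    proof (rule ennreal_leI)
      have "vnorm I (u j (n - j)) ^ 4 = ((vnorm I (u j (n - j)))\<^sup>2)\<^sup>2" by simp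
      also have "\<dots> \<le> (C * ?F\<^sup>2 / 64 ^ n)\<^sup>2"
        using V[of j "n - j"] j by (intro power_mono) auto
      finally have "2 * vnorm I (u j (n - j)) ^ 4 / (?F * (y / 4 ^ n)) ^ 4 \<le> 2 * (C * ?F\<^sup>2 / 64 ^ n)\<^sup>2 / (?F * (y / 4 ^ n)) ^ 4"
        using y by (intro divide_right_mono) auto
      \<comment> \<open>The factorials cancel. The base 64 of the norm bound, squared, beats the
        fourth power of the base 4 in the threshold: 256 / 4096 = 1 / 16.\<close>
      also have "\<dots> = 2 * C\<^sup>2 / y ^ 4 * ((4 ^ n) ^ 4 / (64 ^ n)\<^sup>2)"
      proof -
        have g: "2 * (C * F\<^sup>2 / q)\<^sup>2 / (F * (y / p)) ^ 4 = 2 * C\<^sup>2 / y ^ 4 * (p ^ 4 / q\<^sup>2)"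
          if "F \<noteq> 0" "p \<noteq> 0" "q \<noteq> 0" for F p q :: real
          using that y by (simp add: power_mult_distrib power_divide field_simps)
        show ?thesis by (rule g) auto
      qed
      also have "(4 ^ n) ^ 4 / (64 ^ n)\<^sup>2 = ((1 / 16) ^ n :: real)"
      proof -
        have "((4::real) ^ n) ^ 4 = 256 ^ n" "((64::real) ^ n)\<^sup>2 = 4096 ^ n"
        proof -
          have "((4::real) ^ n) ^ 4 = (4 ^ 4) ^ n" "((64::real) ^ n)\<^sup>2 = (64\<^sup>2) ^ n"
            by (simp_all only: power_mult[symmetric] mult.commute)
          then show "((4::real) ^ n) ^ 4 = 256 ^ n" "((64::real) ^ n)\<^sup>2 = 4096 ^ n" by simp_all
        qed
        then show ?thesis by (simp add: power_divide[symmetric])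
      qed
      finally show "2 * vnorm I (u j (n - j)) ^ 4 / (?F * (y / 4 ^ n)) ^ 4 \<le> 2 * C\<^sup>2 / y ^ 4 * (1 / 16) ^ n" .
    qed
    finally show ?thesis .
  qed
  have eq: "S = (\<Union>n. \<Union>j\<in>{..n}. B n j)"
    by (auto simp: S_def B_def taylor_coeff_def u_def)
  show "S \<in> sets (gauss_PiM I)"
    unfolding eq by (intro sets.countable_UN sets.finite_UN subsetI) (use Bm in auto)
  have "emeasure (gauss_PiM I) (\<Union>n. \<Union>j\<in>{..n}. B n j) \<le> (\<Sum>n. emeasure (gauss_PiM I) (\<Union>j\<in>{..n}. B n j))"
    by (rule emeasure_subadditive_countably) (use Bm in auto)
  also have "\<dots> \<le> (\<Sum>n. ennreal (2 * C\<^sup>2 / y ^ 4 * (1 / 2) ^ n))"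
  proof (rule suminf_le)
    fix n
    have "emeasure (gauss_PiM I) (\<Union>j\<in>{..n}. B n j) \<le> (\<Sum>j\<in>{..n}. emeasure (gauss_PiM I) (B n j))"
      by (rule emeasure_subadditive_finite) (use Bm in auto)
    also have "\<dots> \<le> (\<Sum>j\<in>{..n}. ennreal (2 * C\<^sup>2 / y ^ 4 * (1 / 16) ^ n))"
      by (intro sum_mono Bn) simp
    also have "\<dots> = ennreal (real (Suc n) * (2 * C\<^sup>2 / y ^ 4 * (1 / 16) ^ n))"
      using y by (subst sum_ennreal) auto
    also have "\<dots> \<le> ennreal (2 * C\<^sup>2 / y ^ 4 * (1 / 2) ^ n)"
    proof (rule ennreal_leI)
      have "Suc n \<le> 2 ^ n" by (simp add: Suc_leI)
      then have "real (Suc n) \<le> real (2 ^ n)" by (rule of_nat_mono)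
      then have "real (Suc n) * (1 / 16) ^ n \<le> 2 ^ n * (1 / 16) ^ n" by (intro mult_right_mono) auto
      also have "\<dots> = (1 / 8 :: real) ^ n" by (simp add: power_mult_distrib[symmetric])
      also have "\<dots> \<le> (1 / 2) ^ n" by (intro power_mono) auto
      finally have "2 * C\<^sup>2 / y ^ 4 * (real (Suc n) * (1 / 16) ^ n) \<le> 2 * C\<^sup>2 / y ^ 4 * (1 / 2) ^ n"
        using y by (intro mult_left_mono) auto
      then show "real (Suc n) * (2 * C\<^sup>2 / y ^ 4 * (1 / 16) ^ n) \<le> 2 * C\<^sup>2 / y ^ 4 * (1 / 2) ^ n"
        by (simp add: mult_ac)
    qed
    finally show "emeasure (gauss_PiM I) (\<Union>j\<in>{..n}. B n j) \<le> ennreal (2 * C\<^sup>2 / y ^ 4 * (1 / 2) ^ n)" .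
  qed auto
  also have "\<dots> = ennreal (4 * C\<^sup>2 / y ^ 4)"
  proof -
    have "(\<lambda>n. 2 * C\<^sup>2 / y ^ 4 * (1 / 2) ^ n) sums (2 * C\<^sup>2 / y ^ 4 * 2)"
      using sums_mult[OF geometric_sums[of "1 / 2 :: real"], of "2 * C\<^sup>2 / y ^ 4"] by simp
    then have "(\<Sum>n. ennreal (2 * C\<^sup>2 / y ^ 4 * (1 / 2) ^ n)) = ennreal (2 * C\<^sup>2 / y ^ 4 * 2)"
      by (intro suminf_ennreal_eq) simp
    also have "2 * C\<^sup>2 / y ^ 4 * 2 = 4 * C\<^sup>2 / y ^ 4" by simp
    finally show ?thesis .
  qed
  finally show "emeasure (gauss_PiM I) S \<le> ennreal (4 * C\<^sup>2 / y ^ 4)" unfolding eq .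
qed

section \<open>Many almost independent jets\<close>

lemma emeasure_cgauss_cball_ge:
  assumes "\<rho> \<ge> 0"
  shows "ennreal (\<rho>\<^sup>2 * exp (- (cmod w + \<rho>)\<^sup>2)) \<le> emeasure cgauss (cball w \<rho>)"
proof -
  have "ennreal (\<rho>\<^sup>2 * exp (- (cmod w + \<rho>)\<^sup>2)) = ennreal (exp (- (cmod w + \<rho>)\<^sup>2) / pi) * ennreal (pi * \<rho>\<^sup>2)"
    using assms by (subst ennreal_mult[symmetric]) (auto simp: mult.commute)
  also have "ennreal (pi * \<rho>\<^sup>2) = emeasure lborel (cball w \<rho>)"
    using assms by (simp add: emeasure_cball unit_ball_vol_2)
  also have "ennreal (exp (- (cmod w + \<rho>)\<^sup>2) / pi) * emeasure lborel (cball w \<rho>)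
      = (\<integral>\<^sup>+z. ennreal (exp (- (cmod w + \<rho>)\<^sup>2) / pi) * indicator (cball w \<rho>) z \<partial>lborel)"
    by (simp add: nn_integral_cmult_indicator)
  also have "\<dots> \<le> (\<integral>\<^sup>+z. ennreal (exp (- (cmod z)\<^sup>2) / pi) * indicator (cball w \<rho>) z \<partial>lborel)"
  proof (rule nn_integral_mono)
    fix z
    have "(cmod z)\<^sup>2 \<le> (cmod w + \<rho>)\<^sup>2" if "z \<in> cball w \<rho>"
      using that norm_triangle_sub[of z w] by (intro power_mono) (auto simp: dist_norm norm_minus_commute)
    then show "ennreal (exp (- (cmod w + \<rho>)\<^sup>2) / pi) * indicator (cball w \<rho>) z \<le> ennreal (exp (- (cmod z)\<^sup>2) / pi) * indicator (cball w \<rho>) z"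
      by (auto simp: indicator_def intro!: ennreal_leI divide_right_mono)
  qed
  also have "\<dots> = (\<integral>\<^sup>+z. indicator (cball w \<rho>) z \<partial>cgauss)"
    by (rule nn_integral_cgauss[symmetric]) (intro borel_measurable_indicator borel_closed closed_cball)
  also have "\<dots> = emeasure cgauss (cball w \<rho>)" by simp
  finally show ?thesis .
qed

text \<open>A neighbourhood of the jet of the identity map, with half the tolerances of the Brouwer
  criterion; the other half covers the distance between the true jet and its orthonormal
  replacement.\<close>

definition jet_box :: "real \<Rightarrow> (complex \<times> complex \<times> complex) set" where
  "jet_box \<rho> = cball 0 (\<rho> / 8) \<times> cball 1 (1 / 16) \<times> cball \<i> (1 / 16)"

lemma jet_box_measurable: "jet_box \<rho> \<in> sets (borel \<Otimes>\<^sub>M (borel \<Otimes>\<^sub>M borel))"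
  unfolding jet_box_def by (intro pair_measureI) auto

text \<open>Only the factor for the value shrinks with rho, and a disc of radius rho / 8 has
  Gaussian mass of order rho^2; the two derivative factors are constants.\<close>

lemma jet_box_probability:
  obtains c0 :: real where "c0 > 0" "c0 \<le> 1"
    "\<And>\<rho>. 0 < \<rho> \<Longrightarrow> \<rho> \<le> 1 \<Longrightarrow>
      (\<integral>\<^sup>+u. \<integral>\<^sup>+v. \<integral>\<^sup>+w. indicator (- jet_box \<rho>) (u, v, w) \<partial>cgauss \<partial>cgauss \<partial>cgauss) \<le> ennreal (1 - c0 * \<rho>\<^sup>2)"
proof -
  define q where "q = (1 / 16)\<^sup>2 * exp (- (1 + 1 / 16)\<^sup>2 :: real)"
  define c0 where "c0 = 1 / 64 * exp (- 1) * (q * q)"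
  have q: "q > 0" "q \<le> 1"
  proof -
    show "q > 0" by (simp add: q_def)
    have "q \<le> 1 * 1" unfolding q_def by (intro mult_mono) (auto simp: power2_eq_square)
    then show "q \<le> 1" by simp
  qed
  have "c0 > 0" using q by (simp add: c0_def)
  moreover have "c0 \<le> 1"
  proof -
    have "c0 \<le> 1 * 1 * (1 * 1)" unfolding c0_def using q by (intro mult_mono) auto
    then show ?thesis by simp
  qed
  moreover have "(\<integral>\<^sup>+u. \<integral>\<^sup>+v. \<integral>\<^sup>+w. indicator (- jet_box \<rho>) (u, v, w) \<partial>cgauss \<partial>cgauss \<partial>cgauss) \<le> ennreal (1 - c0 * \<rho>\<^sup>2)"
    if \<rho>: "0 < \<rho>" "\<rho> \<le> 1" for \<rho>
  proof -
    interpret P2: pair_prob_space cgauss cgauss ..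
    interpret P3: pair_prob_space cgauss "cgauss \<Otimes>\<^sub>M cgauss" ..
    let ?M = "cgauss \<Otimes>\<^sub>M (cgauss \<Otimes>\<^sub>M cgauss)"
    have sM: "sets ?M = sets (borel \<Otimes>\<^sub>M (borel \<Otimes>\<^sub>M borel))" by (intro sets_pair_measure_cong) auto
    have spM: "space ?M = UNIV" by (simp add: space_pair_measure)
    have jb: "jet_box \<rho> \<in> sets ?M" unfolding sM by (rule jet_box_measurable)
    have jc: "- jet_box \<rho> \<in> sets ?M" using sets.compl_sets[OF jb] unfolding spM by (simp add: Compl_eq_Diff_UNIV)
    have ind: "(\<lambda>p. indicator (- jet_box \<rho>) p :: ennreal) \<in> borel_measurable ?M" using jc by simp
    have inner: "(\<integral>\<^sup>+v. \<integral>\<^sup>+w. indicator (- jet_box \<rho>) (u, v, w) \<partial>cgauss \<partial>cgauss) = (\<integral>\<^sup>+p. indicator (- jet_box \<rho>) (u, p) \<partial>(cgauss \<Otimes>\<^sub>M cgauss))" for u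
      using cgauss.nn_integral_fst[of "\<lambda>p. indicator (- jet_box \<rho>) (u, p)" cgauss]
        measurable_compose[OF measurable_Pair1'[of u cgauss "cgauss \<Otimes>\<^sub>M cgauss"] ind] by simp
    have "(\<integral>\<^sup>+u. \<integral>\<^sup>+v. \<integral>\<^sup>+w. indicator (- jet_box \<rho>) (u, v, w) \<partial>cgauss \<partial>cgauss \<partial>cgauss) = (\<integral>\<^sup>+p. indicator (- jet_box \<rho>) p \<partial>?M)"
      unfolding inner using P2.nn_integral_fst[OF ind] by simp
    also have "\<dots> = emeasure ?M (- jet_box \<rho>)" using jc by simp
    also have "\<dots> = emeasure ?M (space ?M - jet_box \<rho>)" unfolding spM by (simp add: Compl_eq_Diff_UNIV)
    also have "\<dots> = 1 - emeasure ?M (jet_box \<rho>)"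
      using jb by (subst emeasure_compl) (auto simp: P3.emeasure_space_1)
    also have "emeasure ?M (jet_box \<rho>) = emeasure cgauss (cball 0 (\<rho> / 8)) * (emeasure cgauss (cball 1 (1 / 16)) * emeasure cgauss (cball \<i> (1 / 16)))"
      unfolding jet_box_def by (simp add: P2.emeasure_pair_measure_Times cgauss.emeasure_pair_measure_Times)
    also have "1 - (emeasure cgauss (cball 0 (\<rho> / 8)) * (emeasure cgauss (cball 1 (1 / 16)) * emeasure cgauss (cball \<i> (1 / 16)))) \<le> 1 - ennreal (c0 * \<rho>\<^sup>2)"
    proof (rule ennreal_minus_mono[OF order_refl])
      have "ennreal (c0 * \<rho>\<^sup>2) = ennreal ((\<rho> / 8)\<^sup>2 * exp (- 1)) * (ennreal q * ennreal q)"
        using q by (simp add: c0_def ennreal_mult[symmetric] power_divide mult_ac)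
      also have "\<dots> \<le> emeasure cgauss (cball 0 (\<rho> / 8)) * (emeasure cgauss (cball 1 (1 / 16)) * emeasure cgauss (cball \<i> (1 / 16)))"
      proof (intro mult_mono)
        have "ennreal ((\<rho> / 8)\<^sup>2 * exp (- 1)) \<le> ennreal ((\<rho> / 8)\<^sup>2 * exp (- (cmod 0 + \<rho> / 8)\<^sup>2))"
        proof (intro ennreal_leI mult_left_mono)
          have "(cmod 0 + \<rho> / 8)\<^sup>2 \<le> 1\<^sup>2" using \<rho> by (intro power_mono) auto
          then show "exp (- 1) \<le> exp (- (cmod 0 + \<rho> / 8)\<^sup>2)" by simp
        qed simp
        also have "\<dots> \<le> emeasure cgauss (cball 0 (\<rho> / 8))" using \<rho> by (intro emeasure_cgauss_cball_ge) simp
        finally show "ennreal ((\<rho> / 8)\<^sup>2 * exp (- 1)) \<le> emeasure cgauss (cball 0 (\<rho> / 8))" .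
        show "ennreal q \<le> emeasure cgauss (cball 1 (1 / 16))" "ennreal q \<le> emeasure cgauss (cball \<i> (1 / 16))"
          using emeasure_cgauss_cball_ge[of "1 / 16" 1] emeasure_cgauss_cball_ge[of "1 / 16" \<i>] by (simp_all add: q_def)
      qed auto
      finally show "ennreal (c0 * \<rho>\<^sup>2) \<le> emeasure cgauss (cball 0 (\<rho> / 8)) * (emeasure cgauss (cball 1 (1 / 16)) * emeasure cgauss (cball \<i> (1 / 16)))" .
    qed
    also have "1 - ennreal (c0 * \<rho>\<^sup>2) = ennreal (1 - c0 * \<rho>\<^sup>2)"
      using \<open>c0 > 0\<close> by (subst ennreal_minus[symmetric]) auto
    finally show ?thesis .
  qed
  ultimately show ?thesis using that by blast
qed

text \<open>The real factor by which a wave is multiplied in component \<open>l\<close> of the jet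
  (value and two derivatives); the factor \<open>\<i>\<close> of the derivatives is left out, since
  it does not change the modulus of a correlation.\<close>

definition jet_coeff :: "('i \<Rightarrow> real) \<Rightarrow> ('i \<Rightarrow> real) \<Rightarrow> nat \<Rightarrow> 'i \<Rightarrow> real" where
  "jet_coeff \<alpha> \<beta> l i = (if l = 0 then 1 else if l = 1 then \<alpha> i else \<beta> i)"

text \<open>If there is no zero, then either all \<open>m\<close> replacement jets miss the box
  (event \<open>A\<close>, of probability at most \<open>(1 - p) ^ m\<close> by exact independence),
  or at some point the true jet is far from its replacement (\<open>D3\<close>, three tails of 2
  kappa^4), or some Taylor coefficient there is too large (\<open>T\<close>). The last two enter
  through a union bound over the points.\<close>

lemma no_zero_probability_jets:
  fixes r \<alpha> \<beta> :: "'i \<Rightarrow> real" and w :: "nat \<Rightarrow> 'i \<Rightarrow> complex" and z :: "nat \<Rightarrow> complex"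
  assumes I: "finite I" and \<rho>: "0 < \<rho>" "\<rho> \<le> 1" and C: "C \<ge> 0" and p: "0 \<le> p" "p \<le> 1" and \<kappa>: "0 \<le> \<kappa>"
    and hit: "(\<integral>\<^sup>+u. \<integral>\<^sup>+v. \<integral>\<^sup>+w. indicator (- jet_box \<rho>) (u, v, w) \<partial>cgauss \<partial>cgauss \<partial>cgauss) \<le> ennreal (1 - p)"
    and mgf: "(\<Sum>i\<in>I. (r i)\<^sup>2 * exp (16 * (\<bar>\<alpha> i\<bar> + \<bar>\<beta> i\<bar>))) \<le> C"
    and w: "orthonormal_on I {..<3 * m} w"
    and near: "\<And>k. k < m \<Longrightarrow> vnorm I (\<lambda>i. wave r \<alpha> \<beta> (z k) i - w (3 * k) i) \<le> \<kappa> * (\<rho> / 16)"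
      "\<And>k. k < m \<Longrightarrow> vnorm I (\<lambda>i. \<i> * complex_of_real (\<alpha> i) * wave r \<alpha> \<beta> (z k) i - w (3 * k + 1) i) \<le> \<kappa> * (\<rho> / 16)"
      "\<And>k. k < m \<Longrightarrow> vnorm I (\<lambda>i. \<i> * complex_of_real (\<beta> i) * wave r \<alpha> \<beta> (z k) i - w (3 * k + 2) i) \<le> \<kappa> * (\<rho> / 16)"
  shows "emeasure (gauss_PiM I) {a \<in> space (gauss_PiM I). \<forall>x. wave_field I r \<alpha> \<beta> a x \<noteq> 0}
    \<le> ennreal ((1 - p) ^ m + real m * (6 * \<kappa> ^ 4 + 64 * C\<^sup>2 * \<rho> ^ 4))"
proof -
  let ?P = "gauss_PiM I"
  define b where "b a j = (\<Sum>i\<in>I. a i * w j i)" for a j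
  define A where "A = {a \<in> space ?P. \<forall>k<m. (b a (3 * k), b a (3 * k + 1), b a (3 * k + 2)) \<notin> jet_box \<rho>}"
  define D where "D u j = {a \<in> space ?P. \<rho> / 16 \<le> cmod (\<Sum>i\<in>I. a i * (u i - w j i))}" for u j
  define D3 where "D3 k = D (wave r \<alpha> \<beta> (z k)) (3 * k) \<union> D (\<lambda>i. \<i> * complex_of_real (\<alpha> i) * wave r \<alpha> \<beta> (z k) i) (3 * k + 1)
     \<union> D (\<lambda>i. \<i> * complex_of_real (\<beta> i) * wave r \<alpha> \<beta> (z k) i) (3 * k + 2)" for k
  define T where "T k = {a \<in> space ?P. \<exists>n. \<exists>j\<le>n.
      fact j * fact (n - j) * ((1 / (2 * \<rho>)) / 4 ^ n) \<le> cmod (taylor_coeff I r \<alpha> \<beta> a (z k) j (n - j))}" for k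
  have bm[measurable]: "(\<lambda>a. b a j) \<in> borel_measurable ?P" for j unfolding b_def by measurable
  have ypos: "1 / (2 * \<rho>) > 0" using \<rho> by simp
  have Tm: "T k \<in> sets ?P" for k unfolding T_def by (rule taylor_coeff_tail(1)[OF I ypos C mgf])
  have Te: "emeasure ?P (T k) \<le> ennreal (64 * C\<^sup>2 * \<rho> ^ 4)" for k
  proof -
    have "4 * C\<^sup>2 / (1 / (2 * \<rho>)) ^ 4 = 64 * C\<^sup>2 * \<rho> ^ 4" using \<rho> by (simp add: power_divide power_mult_distrib)
    then show ?thesis using taylor_coeff_tail(2)[OF I ypos C mgf, of "z k"] unfolding T_def by simp
  qed
  have Dm: "D u j \<in> sets ?P" for u j unfolding D_def by measurable
  have De: "emeasure ?P (D u j) \<le> ennreal (2 * \<kappa> ^ 4)" if "vnorm I (\<lambda>i. u i - w j i) \<le> \<kappa> * (\<rho> / 16)" for u j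
  proof -
    have "emeasure ?P (D u j) \<le> ennreal (2 * vnorm I (\<lambda>i. u i - w j i) ^ 4 / (\<rho> / 16) ^ 4)"
      unfolding D_def by (rule gauss_linear_tail[OF I]) (use \<rho> in simp)
    also have "\<dots> \<le> ennreal (2 * (\<kappa> * (\<rho> / 16)) ^ 4 / (\<rho> / 16) ^ 4)"
      using that \<rho> by (intro ennreal_leI divide_right_mono mult_left_mono power_mono) auto
    also have "2 * (\<kappa> * (\<rho> / 16)) ^ 4 / (\<rho> / 16) ^ 4 = 2 * \<kappa> ^ 4"
    proof -
      have "2 * (\<kappa> * x) ^ 4 / x ^ 4 = 2 * \<kappa> ^ 4" if "x \<noteq> 0" for x :: real
        using that by (simp add: power_mult_distrib)
      from this[of "\<rho> / 16"] show ?thesis using \<rho> by simp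
    qed
    finally show ?thesis .
  qed
  have D3m: "D3 k \<in> sets ?P" for k unfolding D3_def using Dm by auto
  have D3e: "emeasure ?P (D3 k) \<le> ennreal (6 * \<kappa> ^ 4)" if k: "k < m" for k
  proof -
    have "emeasure ?P (D3 k) \<le> emeasure ?P (D (wave r \<alpha> \<beta> (z k)) (3 * k))
       + emeasure ?P (D (\<lambda>i. \<i> * complex_of_real (\<alpha> i) * wave r \<alpha> \<beta> (z k) i) (3 * k + 1))
       + emeasure ?P (D (\<lambda>i. \<i> * complex_of_real (\<beta> i) * wave r \<alpha> \<beta> (z k) i) (3 * k + 2))"
      unfolding D3_def using Dm
      by (intro order_trans[OF emeasure_subadditive] add_mono emeasure_subadditive order_refl sets.Un) auto
    also have "\<dots> \<le> ennreal (2 * \<kappa> ^ 4) + ennreal (2 * \<kappa> ^ 4) + ennreal (2 * \<kappa> ^ 4)"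
      by (intro add_mono De near k)
    also have "\<dots> = ennreal (6 * \<kappa> ^ 4)" using \<kappa> by (simp flip: ennreal_plus)
    finally show ?thesis .
  qed
  have Am: "A \<in> sets ?P"
  proof -
    have "(\<lambda>a. (b a (3 * k), b a (3 * k + 1), b a (3 * k + 2))) \<in> ?P \<rightarrow>\<^sub>M borel \<Otimes>\<^sub>M (borel \<Otimes>\<^sub>M borel)" for k
      by (intro measurable_Pair bm)
    from measurable_sets[OF this jet_box_measurable[of \<rho>]]
    have s: "{a \<in> space ?P. (b a (3 * k), b a (3 * k + 1), b a (3 * k + 2)) \<in> jet_box \<rho>} \<in> sets ?P" for k
      by (simp add: vimage_def Int_def conj_commute)
    have "A = space ?P - (\<Union>k<m. {a \<in> space ?P. (b a (3 * k), b a (3 * k + 1), b a (3 * k + 2)) \<in> jet_box \<rho>})"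
      unfolding A_def by auto
    also have "\<dots> \<in> sets ?P" using s by auto
    finally show ?thesis .
  qed
  have Ae: "emeasure ?P A \<le> ennreal ((1 - p) ^ m)"
  proof -
    define h where "h = (indicator (- jet_box \<rho>) :: complex \<times> complex \<times> complex \<Rightarrow> ennreal)"
    have hm: "h \<in> borel_measurable (borel \<Otimes>\<^sub>M (borel \<Otimes>\<^sub>M borel))"
      unfolding h_def using jet_box_measurable[of \<rho>]
      by (intro borel_measurable_indicator) (simp add: Compl_eq_Diff_UNIV sets.compl_sets[of _ "borel \<Otimes>\<^sub>M (borel \<Otimes>\<^sub>M borel)", unfolded space_pair_measure, simplified])
    define g where "g y = (\<Prod>k<m. h (y (3 * k), y (3 * k + 1), y (3 * k + 2)))" for y :: "nat \<Rightarrow> complex"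
    have comp: "(\<lambda>y. y i) \<in> borel_measurable (gauss_PiM J)" if "i \<in> J" for i and J :: "nat set"
      using measurable_component_singleton[OF that, of "\<lambda>_. cgauss"] by (simp cong: measurable_cong_sets)
    have gm: "g \<in> borel_measurable (gauss_PiM {..<3 * m})"
      unfolding g_def by (intro borel_measurable_prod_ennreal measurable_compose[OF _ hm] measurable_Pair comp) auto
    have "emeasure ?P A = (\<integral>\<^sup>+a. indicator A a \<partial>?P)" using Am by simp
    also have "\<dots> = (\<integral>\<^sup>+a. g (\<lambda>j\<in>{..<3 * m}. \<Sum>i\<in>I. a i * w j i) \<partial>?P)"
    proof (rule nn_integral_cong)
      fix a assume a: "a \<in> space ?P"
      have "g (\<lambda>j\<in>{..<3 * m}. \<Sum>i\<in>I. a i * w j i) = (\<Prod>k<m. h (b a (3 * k), b a (3 * k + 1), b a (3 * k + 2)))"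
        unfolding g_def by (intro prod.cong refl) (simp add: b_def)
      also have "\<dots> = indicator A a"
      proof (cases "a \<in> A")
        case True
        then have "(\<Prod>k<m. h (b a (3 * k), b a (3 * k + 1), b a (3 * k + 2))) = (\<Prod>k<m. 1)"
          by (intro prod.cong refl) (auto simp: A_def h_def)
        then show ?thesis using True by simp
      next
        case False
        then obtain k where "k < m" "(b a (3 * k), b a (3 * k + 1), b a (3 * k + 2)) \<in> jet_box \<rho>"
          using a by (auto simp: A_def)
        then have "(\<Prod>k<m. h (b a (3 * k), b a (3 * k + 1), b a (3 * k + 2))) = 0"
          by (intro prod_zero bexI[of _ k]) (auto simp: h_def)
        then show ?thesis using False by simp
      qed
      finally show "indicator A a = g (\<lambda>j\<in>{..<3 * m}. \<Sum>i\<in>I. a i * w j i)" by simp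
    qed
    also have "\<dots> = (\<integral>\<^sup>+y. g y \<partial>gauss_PiM {..<3 * m})"
      by (rule nn_integral_gauss_orthonormal[OF _ I w gm]) simp
    also have "\<dots> = (\<integral>\<^sup>+u. \<integral>\<^sup>+v. \<integral>\<^sup>+w. h (u, v, w) \<partial>cgauss \<partial>cgauss \<partial>cgauss) ^ m"
      unfolding g_def by (rule nn_integral_gauss_PiM_triples[OF hm])
    also have "\<dots> \<le> ennreal (1 - p) ^ m" unfolding h_def by (intro power_mono hit) simp
    also have "\<dots> = ennreal ((1 - p) ^ m)" using p by (intro ennreal_power) simp
    finally show ?thesis .
  qed
  have sub: "{a \<in> space ?P. \<forall>x. wave_field I r \<alpha> \<beta> a x \<noteq> 0} \<subseteq> A \<union> (\<Union>k<m. D3 k \<union> T k)"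
  proof (rule subsetI, rule ccontr)
    fix a assume a: "a \<in> {a \<in> space ?P. \<forall>x. wave_field I r \<alpha> \<beta> a x \<noteq> 0}"
      and "a \<notin> A \<union> (\<Union>k<m. D3 k \<union> T k)"
    then obtain k where k: "k < m" "(b a (3 * k), b a (3 * k + 1), b a (3 * k + 2)) \<in> jet_box \<rho>" "a \<notin> D3 k" "a \<notin> T k" and sp: "a \<in> space ?P"
      by (auto simp: A_def)
    have dist: "cmod ((\<Sum>i\<in>I. a i * u i) - b a j) \<le> \<rho> / 16" if "a \<notin> D u j" for u j
      using that sp unfolding D_def b_def by (simp add: right_diff_distrib sum_subtractf not_le)
    have d0: "cmod (wave_field I r \<alpha> \<beta> a (z k) - b a (3 * k)) \<le> \<rho> / 16"
      using dist[of "wave r \<alpha> \<beta> (z k)" "3 * k"] k(3) by (simp add: wave_field_def D3_def)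
    have d1: "cmod (wave_field_dx I r \<alpha> \<beta> a (z k) - b a (3 * k + 1)) \<le> \<rho> / 16"
      unfolding wave_field_dx_def by (rule dist) (use k(3) in \<open>simp add: D3_def\<close>)
    have d2: "cmod (wave_field_dy I r \<alpha> \<beta> a (z k) - b a (3 * k + 2)) \<le> \<rho> / 16"
      unfolding wave_field_dy_def by (rule dist) (use k(3) in \<open>simp add: D3_def\<close>)
    have bx: "cmod (b a (3 * k)) \<le> \<rho> / 8" "cmod (b a (3 * k + 1) - 1) \<le> 1 / 16" "cmod (b a (3 * k + 2) - \<i>) \<le> 1 / 16"
      using k(2) by (auto simp: jet_box_def dist_norm norm_minus_commute)
    have tri: "cmod (x - y) \<le> cmod (x - t) + cmod (t - y)" for x y t :: complex
      using norm_triangle_ineq[of "x - t" "t - y"] by simp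
    have "\<exists>x. wave_field I r \<alpha> \<beta> a x = 0"
    proof (rule wave_field_zero_brouwer[OF I \<rho>])
      show "cmod (wave_field I r \<alpha> \<beta> a (z k)) \<le> \<rho> / 4"
        using tri[of "wave_field I r \<alpha> \<beta> a (z k)" 0 "b a (3 * k)"] d0 bx(1) \<rho> by simp
      show "cmod (wave_field_dx I r \<alpha> \<beta> a (z k) - 1) \<le> 1 / 8"
        using tri[of "wave_field_dx I r \<alpha> \<beta> a (z k)" 1 "b a (3 * k + 1)"] d1 bx(2) \<rho> by simp
      show "cmod (wave_field_dy I r \<alpha> \<beta> a (z k) - \<i>) \<le> 1 / 8"
        using tri[of "wave_field_dy I r \<alpha> \<beta> a (z k)" \<i> "b a (3 * k + 2)"] d2 bx(3) \<rho> by simp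
      show "cmod (taylor_coeff I r \<alpha> \<beta> a (z k) j (n - j)) \<le> fact j * fact (n - j) * ((1 / (2 * \<rho>)) / 4 ^ n)" if "j \<le> n" for n j
      proof (rule ccontr)
        assume "\<not> ?thesis"
        then have "fact j * fact (n - j) * ((1 / (2 * \<rho>)) / 4 ^ n) \<le> cmod (taylor_coeff I r \<alpha> \<beta> a (z k) j (n - j))"
          by linarith
        then have "a \<in> T k" unfolding T_def using sp that by blast
        with k(4) show False ..
      qed
    qed
    with a show False by blast
  qed
  have "emeasure ?P {a \<in> space ?P. \<forall>x. wave_field I r \<alpha> \<beta> a x \<noteq> 0} \<le> emeasure ?P (A \<union> (\<Union>k<m. D3 k \<union> T k))"
    by (rule emeasure_mono[OF sub]) (use Am D3m Tm in auto)
  also have "\<dots> \<le> emeasure ?P A + emeasure ?P (\<Union>k<m. D3 k \<union> T k)"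
    by (rule emeasure_subadditive) (use Am D3m Tm in auto)
  also have "emeasure ?P (\<Union>k<m. D3 k \<union> T k) \<le> (\<Sum>k<m. emeasure ?P (D3 k \<union> T k))"
    by (rule emeasure_subadditive_finite) (use D3m Tm in auto)
  also have "(\<Sum>k<m. emeasure ?P (D3 k \<union> T k)) \<le> (\<Sum>k<m. ennreal (6 * \<kappa> ^ 4 + 64 * C\<^sup>2 * \<rho> ^ 4))"
  proof (rule sum_mono)
    fix k assume "k \<in> {..<m}"
    then have "emeasure ?P (D3 k) + emeasure ?P (T k) \<le> ennreal (6 * \<kappa> ^ 4) + ennreal (64 * C\<^sup>2 * \<rho> ^ 4)"
      by (intro add_mono D3e Te) simp
    moreover have "emeasure ?P (D3 k \<union> T k) \<le> emeasure ?P (D3 k) + emeasure ?P (T k)"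
      by (rule emeasure_subadditive[OF D3m Tm])
    ultimately show "emeasure ?P (D3 k \<union> T k) \<le> ennreal (6 * \<kappa> ^ 4 + 64 * C\<^sup>2 * \<rho> ^ 4)"
      using \<kappa> \<rho> by (subst ennreal_plus) (auto intro: order_trans)
  qed
  also have "(\<Sum>k<m. ennreal (6 * \<kappa> ^ 4 + 64 * C\<^sup>2 * \<rho> ^ 4)) = ennreal (real m * (6 * \<kappa> ^ 4 + 64 * C\<^sup>2 * \<rho> ^ 4))"
    using \<kappa> \<rho> by (subst sum_ennreal) auto
  also have "emeasure ?P A + ennreal (real m * (6 * \<kappa> ^ 4 + 64 * C\<^sup>2 * \<rho> ^ 4)) \<le> ennreal ((1 - p) ^ m) + ennreal (real m * (6 * \<kappa> ^ 4 + 64 * C\<^sup>2 * \<rho> ^ 4))"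
    by (intro add_right_mono Ae)
  also have "\<dots> = ennreal ((1 - p) ^ m + real m * (6 * \<kappa> ^ 4 + 64 * C\<^sup>2 * \<rho> ^ 4))"
    using p \<kappa> \<rho> by (intro ennreal_plus[symmetric]) auto
  finally show ?thesis by (auto intro: add_left_mono)
qed

section \<open>The probability of a zero from below\<close>

text \<open>The value and both derivatives at a point are orthonormal, and the frequencies have the
  exponential moment of order 16 on which the control of Taylor coefficients rests.\<close>

definition white_waves :: "'i set \<Rightarrow> ('i \<Rightarrow> real) \<Rightarrow> ('i \<Rightarrow> real) \<Rightarrow> ('i \<Rightarrow> real) \<Rightarrow> real \<Rightarrow> bool" where
  "white_waves I r \<alpha> \<beta> C \<longleftrightarrow> finite I \<and>
    (\<Sum>i\<in>I. (r i)\<^sup>2) = 1 \<and> (\<Sum>i\<in>I. (r i)\<^sup>2 * \<alpha> i) = 0 \<and> (\<Sum>i\<in>I. (r i)\<^sup>2 * \<beta> i) = 0 \<and>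
    (\<Sum>i\<in>I. (r i)\<^sup>2 * (\<alpha> i * \<alpha> i)) = 1 \<and> (\<Sum>i\<in>I. (r i)\<^sup>2 * (\<alpha> i * \<beta> i)) = 0 \<and> (\<Sum>i\<in>I. (r i)\<^sup>2 * (\<beta> i * \<beta> i)) = 1 \<and>
    (\<Sum>i\<in>I. (r i)\<^sup>2 * exp (16 * (\<bar>\<alpha> i\<bar> + \<bar>\<beta> i\<bar>))) \<le> C"

text \<open>The sums are, up to unit factors, the covariances between components of the jets at two
  distinct points among \<open>z 0, ..., z (m - 1)\<close>.\<close>

definition decorrelated_at :: "'i set \<Rightarrow> ('i \<Rightarrow> real) \<Rightarrow> ('i \<Rightarrow> real) \<Rightarrow> ('i \<Rightarrow> real) \<Rightarrow> nat \<Rightarrow> (nat \<Rightarrow> complex) \<Rightarrow> real \<Rightarrow> bool" where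
  "decorrelated_at I r \<alpha> \<beta> m z \<epsilon> \<longleftrightarrow> (\<forall>k<m. \<forall>k'<m. k \<noteq> k' \<longrightarrow> (\<forall>l<3. \<forall>l'<3.
     cmod (\<Sum>i\<in>I. complex_of_real ((r i)\<^sup>2 * (jet_coeff \<alpha> \<beta> l i * jet_coeff \<alpha> \<beta> l' i)) *
       cis (\<alpha> i * (Re (z k) - Re (z k')) + \<beta> i * (Im (z k) - Im (z k')))) \<le> \<epsilon>))"

lemma white_waves_gram:
  assumes "white_waves I r \<alpha> \<beta> C" "l < 3" "l' < 3"
  shows "(\<Sum>i\<in>I. (r i)\<^sup>2 * (jet_coeff \<alpha> \<beta> l i * jet_coeff \<alpha> \<beta> l' i)) = (if l = l' then 1 else 0)"
proof -
  have "l = 0 \<or> l = 1 \<or> l = 2" "l' = 0 \<or> l' = 1 \<or> l' = 2" using assms(2,3) by auto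
  then show ?thesis
    using assms(1) by (auto simp: white_waves_def jet_coeff_def mult.commute[of "\<beta> _" "\<alpha> _"])
qed

text \<open>The failure probability is split into three thirds of \<open>\<eta>\<close>, and the
  parameters are fixed in the order \<open>K\<close>, \<open>\<rho>\<close>, \<open>m\<close>,
  \<open>\<kappa>\<close>, \<open>\<epsilon>\<close>, each from the previous ones. None depends on
  the index set or on the field, hence none on the degree in the application.\<close>

theorem no_zero_probability_small:
  fixes \<eta> C :: real
  assumes \<eta>: "\<eta> > 0" and C: "C \<ge> 0"
  shows "\<exists>m>0. \<exists>\<epsilon>>0. \<forall>(I :: 'i set) r \<alpha> \<beta> z. white_waves I r \<alpha> \<beta> C \<longrightarrow> decorrelated_at I r \<alpha> \<beta> m z \<epsilon> \<longrightarrow>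
    emeasure (gauss_PiM I) {a \<in> space (gauss_PiM I). \<forall>x. wave_field I r \<alpha> \<beta> a x \<noteq> 0} \<le> ennreal \<eta>"
proof -
  obtain c0 where c0: "c0 > 0" "c0 \<le> 1"
    "\<And>\<rho>. 0 < \<rho> \<Longrightarrow> \<rho> \<le> 1 \<Longrightarrow>
      (\<integral>\<^sup>+u. \<integral>\<^sup>+v. \<integral>\<^sup>+w. indicator (- jet_box \<rho>) (u, v, w) \<partial>cgauss \<partial>cgauss \<partial>cgauss) \<le> ennreal (1 - c0 * \<rho>\<^sup>2)"
    using jet_box_probability by blast
  define K where "K = 3 / \<eta>"
  have K: "K > 0" "exp (- K) \<le> \<eta> / 3"
  proof -
    show "K > 0" using \<eta> by (simp add: K_def)
    have "K \<le> exp K" using exp_ge_add_one_self[of K] by linarith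
    then have "1 / exp K \<le> 1 / K" using \<open>K > 0\<close> by (intro divide_left_mono) auto
    then show "exp (- K) \<le> \<eta> / 3" by (simp add: exp_minus inverse_eq_divide K_def)
  qed
  \<comment> \<open>With about (K + 1) / (c0 rho^2) points, the Taylor failures cost 64 C^2 rho^4
    each and hence a constant times rho^2 in all; 192 = 3 * 64 brings this below eta / 3.\<close>
  define \<rho> where "\<rho> = min 1 (sqrt (\<eta> * c0 / (192 * (C\<^sup>2 + 1) * (K + 1))))"
  have arg: "\<eta> * c0 / (192 * (C\<^sup>2 + 1) * (K + 1)) > 0"
    using \<eta> c0(1) K(1) by (intro divide_pos_pos mult_pos_pos) (auto intro: add_nonneg_pos)
  have \<rho>: "0 < \<rho>" "\<rho> \<le> 1" using arg by (auto simp: \<rho>_def)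
  have \<rho>2: "\<rho>\<^sup>2 \<le> \<eta> * c0 / (192 * (C\<^sup>2 + 1) * (K + 1))"
  proof -
    have "\<rho>\<^sup>2 \<le> (sqrt (\<eta> * c0 / (192 * (C\<^sup>2 + 1) * (K + 1))))\<^sup>2" using \<rho> by (intro power_mono) (auto simp: \<rho>_def)
    then show ?thesis using arg by simp
  qed
  define p where "p = c0 * \<rho>\<^sup>2"
  have p: "0 < p" "p \<le> 1"
  proof -
    show "0 < p" using c0 \<rho> by (simp add: p_def)
    have "c0 * \<rho>\<^sup>2 \<le> 1 * 1" using c0 \<rho> by (intro mult_mono) (auto intro: power_le_one)
    then show "p \<le> 1" by (simp add: p_def)
  qed
  \<comment> \<open>Enough attempts for \<open>(1 - p) ^ m\<close> to be at most exp (- K), and not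
    more than (K + 1) / p.\<close>
  define m where "m = nat \<lceil>K / p\<rceil>"
  have Kp: "K / p > 0" using K(1) p(1) by simp
  have m: "K / p \<le> real m" "real m \<le> (K + 1) / p" "m > 0"
  proof -
    have e: "real m = of_int \<lceil>K / p\<rceil>" unfolding m_def using Kp by simp
    show 1: "K / p \<le> real m" unfolding e by (rule le_of_int_ceiling)
    have "real m \<le> K / p + 1" unfolding e by linarith
    also have "\<dots> \<le> K / p + 1 / p" using p by simp
    finally show "real m \<le> (K + 1) / p" by (simp add: add_divide_distrib)
    show "m > 0" using 1 Kp by (cases "m = 0") auto
  qed
  have pm: "(1 - p) ^ m \<le> \<eta> / 3"
  proof -
    have "(1 - p) ^ m \<le> exp (- p) ^ m" using p exp_ge_add_one_self[of "- p"] by (intro power_mono) auto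
    also have "\<dots> = exp (- (p * real m))" by (simp add: exp_of_nat_mult[symmetric] mult.commute)
    also have "\<dots> \<le> exp (- K)" using m(1) p(1) by (simp add: field_simps)
    also have "\<dots> \<le> \<eta> / 3" by (rule K)
    finally show ?thesis .
  qed
  have m2: "real m * (64 * C\<^sup>2 * \<rho> ^ 4) \<le> \<eta> / 3"
  proof -
    have "real m * (64 * C\<^sup>2 * \<rho> ^ 4) \<le> (K + 1) / p * (64 * (C\<^sup>2 + 1) * \<rho> ^ 4)"
      using m(2) K p \<rho> by (intro mult_mono) auto
    also have "\<dots> = (64 * (C\<^sup>2 + 1) * (K + 1) / c0) * \<rho>\<^sup>2"
    proof -
      have "\<rho> ^ 4 = \<rho>\<^sup>2 * \<rho>\<^sup>2" by (simp add: power_add[symmetric])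
      then show ?thesis using c0(1) \<rho>(1) by (simp add: p_def field_simps)
    qed
    also have "\<dots> \<le> (64 * (C\<^sup>2 + 1) * (K + 1) / c0) * (\<eta> * c0 / (192 * (C\<^sup>2 + 1) * (K + 1)))"
      using K c0 by (intro mult_left_mono \<rho>2 divide_nonneg_pos mult_nonneg_nonneg) auto
    also have "\<dots> = \<eta> / 3"
    proof -
      have "C\<^sup>2 + 1 \<noteq> 0" "K + 1 \<noteq> 0" "c0 \<noteq> 0" using K(1) c0(1) by (auto simp: add_nonneg_eq_0_iff)
      then show ?thesis by (simp add: divide_simps)
    qed
    finally show ?thesis .
  qed
  \<comment> \<open>As kappa \<le> 1, its fourth power is at most kappa, so \<open>m\<close>
    replacement failures of 6 kappa^4 cost at most eta / 3.\<close>
  define \<kappa> where "\<kappa> = min 1 (\<eta> / (18 * real m))"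
  have \<kappa>: "0 < \<kappa>" "\<kappa> \<le> 1" "\<kappa> \<le> \<eta> / (18 * real m)" using \<eta> m(3) by (auto simp: \<kappa>_def)
  have m3: "real m * (6 * \<kappa> ^ 4) \<le> \<eta> / 3"
  proof -
    have "\<kappa> ^ 4 \<le> \<kappa> ^ 1" using \<kappa> by (intro power_decreasing) auto
    then have "real m * (6 * \<kappa> ^ 4) \<le> real m * (6 * (\<eta> / (18 * real m)))"
      using \<kappa>(3) by (intro mult_left_mono) auto
    also have "\<dots> = \<eta> / 3" using m(3) by simp
    finally show ?thesis .
  qed
  have "\<kappa> * (\<rho> / 16) > 0" using \<kappa> \<rho> by simp
  from approx_gram_schmidt[OF this, of "3 * m"] obtain \<epsilon> where \<epsilon>: "\<epsilon> > 0"
    and gs: "\<forall>(I :: 'i set) v. finite I \<longrightarrow>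
      (\<forall>j<3 * m. (\<Sum>i\<in>I. v j i * cnj (v j i)) = 1) \<longrightarrow>
      (\<forall>j<3 * m. \<forall>k<3 * m. j \<noteq> k \<longrightarrow> cmod (\<Sum>i\<in>I. v j i * cnj (v k i)) \<le> \<epsilon>) \<longrightarrow>
      (\<exists>w. orthonormal_on I {..<3 * m} w \<and> (\<forall>j<3 * m. vnorm I (\<lambda>i. v j i - w j i) \<le> \<kappa> * (\<rho> / 16)))"
    by (elim exE conjE)
  show ?thesis
  proof (rule exI[of _ m], rule conjI[OF m(3)], rule exI[of _ \<epsilon>], rule conjI[OF \<epsilon>], intro allI impI)
    fix I :: "'i set" and r \<alpha> \<beta> z
    assume white: "white_waves I r \<alpha> \<beta> C" and dec: "decorrelated_at I r \<alpha> \<beta> m z \<epsilon>"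
    then have I: "finite I" and mgf: "(\<Sum>i\<in>I. (r i)\<^sup>2 * exp (16 * (\<bar>\<alpha> i\<bar> + \<bar>\<beta> i\<bar>))) \<le> C"
      by (auto simp: white_waves_def)
    define ph :: "nat \<Rightarrow> complex" where "ph l = (if l = 0 then 1 else \<i>)" for l
    have ph: "cmod (ph l) = 1" "ph l * cnj (ph l) = 1" for l by (auto simp: ph_def)
    \<comment> \<open>The index encodes the point as \<open>j div 3\<close> and the component of the
      jet as \<open>j mod 3\<close>. Vectors of the same point are exactly orthonormal; those of
      different points are nearly so by decorrelation.\<close>
    define v where "v j i = ph (j mod 3) * (complex_of_real (jet_coeff \<alpha> \<beta> (j mod 3) i) * wave r \<alpha> \<beta> (z (j div 3)) i)" for j i
    have inner: "(\<Sum>i\<in>I. v j i * cnj (v j' i)) = ph (j mod 3) * cnj (ph (j' mod 3)) *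
        (\<Sum>i\<in>I. complex_of_real ((r i)\<^sup>2 * (jet_coeff \<alpha> \<beta> (j mod 3) i * jet_coeff \<alpha> \<beta> (j' mod 3) i)) *
       cis (\<alpha> i * (Re (z (j div 3)) - Re (z (j' div 3))) + \<beta> i * (Im (z (j div 3)) - Im (z (j' div 3)))))" for j j'
      unfolding sum_distrib_left
    proof (rule sum.cong[OF refl])
      fix i
      have c: "cis x * cnj (cis y) = cis (x - y)" for x y by (simp add: cis_cnj cis_mult)
      have "wave r \<alpha> \<beta> (z (j div 3)) i * cnj (wave r \<alpha> \<beta> (z (j' div 3)) i) = complex_of_real ((r i)\<^sup>2) *
         (cis (\<alpha> i * Re (z (j div 3)) + \<beta> i * Im (z (j div 3))) * cnj (cis (\<alpha> i * Re (z (j' div 3)) + \<beta> i * Im (z (j' div 3)))))"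
        by (simp add: wave_def power2_eq_square)
      also have "\<dots> = complex_of_real ((r i)\<^sup>2) * cis (\<alpha> i * (Re (z (j div 3)) - Re (z (j' div 3))) + \<beta> i * (Im (z (j div 3)) - Im (z (j' div 3))))"
        unfolding c by (simp add: algebra_simps)
      finally have w: "wave r \<alpha> \<beta> (z (j div 3)) i * cnj (wave r \<alpha> \<beta> (z (j' div 3)) i) = complex_of_real ((r i)\<^sup>2) *
          cis (\<alpha> i * (Re (z (j div 3)) - Re (z (j' div 3))) + \<beta> i * (Im (z (j div 3)) - Im (z (j' div 3))))" .
      have "v j i * cnj (v j' i) = ph (j mod 3) * cnj (ph (j' mod 3)) * (complex_of_real (jet_coeff \<alpha> \<beta> (j mod 3) i * jet_coeff \<alpha> \<beta> (j' mod 3) i) *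
          (wave r \<alpha> \<beta> (z (j div 3)) i * cnj (wave r \<alpha> \<beta> (z (j' div 3)) i)))"
        by (simp add: v_def mult_ac)
      then show "v j i * cnj (v j' i) = ph (j mod 3) * cnj (ph (j' mod 3)) *
        (complex_of_real ((r i)\<^sup>2 * (jet_coeff \<alpha> \<beta> (j mod 3) i * jet_coeff \<alpha> \<beta> (j' mod 3) i)) *
         cis (\<alpha> i * (Re (z (j div 3)) - Re (z (j' div 3))) + \<beta> i * (Im (z (j div 3)) - Im (z (j' div 3)))))"
        unfolding w by (simp add: mult_ac)
    qed
    have same: "(\<Sum>i\<in>I. v j i * cnj (v j' i)) = ph (j mod 3) * cnj (ph (j' mod 3)) * (if j mod 3 = j' mod 3 then 1 else 0)"
      if "j div 3 = j' div 3" for j j'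
    proof -
      have "(\<Sum>i\<in>I. v j i * cnj (v j' i)) = ph (j mod 3) * cnj (ph (j' mod 3)) * complex_of_real
        (\<Sum>i\<in>I. (r i)\<^sup>2 * (jet_coeff \<alpha> \<beta> (j mod 3) i * jet_coeff \<alpha> \<beta> (j' mod 3) i))"
        unfolding inner that by simp
      then show ?thesis by (simp add: white_waves_gram[OF white] del: of_real_sum)
    qed
    have "\<exists>w. orthonormal_on I {..<3 * m} w \<and> (\<forall>j<3 * m. vnorm I (\<lambda>i. v j i - w j i) \<le> \<kappa> * (\<rho> / 16))"
    proof (rule gs[THEN spec, THEN spec, THEN mp, THEN mp, THEN mp, OF I])
      show "\<forall>j<3 * m. (\<Sum>i\<in>I. v j i * cnj (v j i)) = 1" by (simp add: same ph)
      show "\<forall>j<3 * m. \<forall>k<3 * m. j \<noteq> k \<longrightarrow> cmod (\<Sum>i\<in>I. v j i * cnj (v k i)) \<le> \<epsilon>"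
      proof (intro allI impI)
        fix j k assume jk: "j < 3 * m" "k < 3 * m" "j \<noteq> k"
        show "cmod (\<Sum>i\<in>I. v j i * cnj (v k i)) \<le> \<epsilon>"
        proof (cases "j div 3 = k div 3")
          case True
          then have "j mod 3 \<noteq> k mod 3" using jk(3) by (metis div_mult_mod_eq)
          then show ?thesis using same[OF True] \<epsilon> by simp
        next
          case False
          have "j div 3 < m" "k div 3 < m" using jk by auto
          then show ?thesis
            using dec False unfolding inner norm_mult decorrelated_at_def by (simp add: ph)
        qed
      qed
    qed
    then obtain w where w: "orthonormal_on I {..<3 * m} w" "\<And>j. j < 3 * m \<Longrightarrow> vnorm I (\<lambda>i. v j i - w j i) \<le> \<kappa> * (\<rho> / 16)" by blast
    have v0: "v (3 * k) = wave r \<alpha> \<beta> (z k)" for k by (simp add: v_def ph_def jet_coeff_def fun_eq_iff)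
    have v1: "v (3 * k + 1) = (\<lambda>i. \<i> * complex_of_real (\<alpha> i) * wave r \<alpha> \<beta> (z k) i)" for k
    proof -
      have "(3 * k + 1) mod 3 = 1" "(3 * k + 1) div 3 = k" by presburger+
      then show ?thesis by (simp add: v_def ph_def jet_coeff_def fun_eq_iff del: add_Suc_right One_nat_def)
    qed
    have v2: "v (3 * k + 2) = (\<lambda>i. \<i> * complex_of_real (\<beta> i) * wave r \<alpha> \<beta> (z k) i)" for k
    proof -
      have "(3 * k + 2) mod 3 = 2" "(3 * k + 2) div 3 = k" by presburger+
      then show ?thesis by (simp add: v_def ph_def jet_coeff_def fun_eq_iff del: add_Suc_right)
    qed
    have "emeasure (gauss_PiM I) {a \<in> space (gauss_PiM I). \<forall>x. wave_field I r \<alpha> \<beta> a x \<noteq> 0}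
       \<le> ennreal ((1 - p) ^ m + real m * (6 * \<kappa> ^ 4 + 64 * C\<^sup>2 * \<rho> ^ 4))"
    proof (rule no_zero_probability_jets[OF I \<rho> C _ _ _ _ mgf w(1)])
      show "(\<integral>\<^sup>+u. \<integral>\<^sup>+v. \<integral>\<^sup>+w. indicator (- jet_box \<rho>) (u, v, w) \<partial>cgauss \<partial>cgauss \<partial>cgauss) \<le> ennreal (1 - p)"
        unfolding p_def by (rule c0(3)[OF \<rho>])
      fix k assume k: "k < m"
      show "vnorm I (\<lambda>i. wave r \<alpha> \<beta> (z k) i - w (3 * k) i) \<le> \<kappa> * (\<rho> / 16)"
        using w(2)[of "3 * k"] k unfolding v0 by simp
      show "vnorm I (\<lambda>i. \<i> * complex_of_real (\<alpha> i) * wave r \<alpha> \<beta> (z k) i - w (3 * k + 1) i) \<le> \<kappa> * (\<rho> / 16)"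
        using w(2)[of "3 * k + 1"] k unfolding v1 by simp
      show "vnorm I (\<lambda>i. \<i> * complex_of_real (\<beta> i) * wave r \<alpha> \<beta> (z k) i - w (3 * k + 2) i) \<le> \<kappa> * (\<rho> / 16)"
        using w(2)[of "3 * k + 2"] k unfolding v2 by simp
    qed (use p \<kappa> in auto)
    also have "\<dots> \<le> ennreal \<eta>"
      using pm m2 m3 by (intro ennreal_leI) (simp add: distrib_left)
    finally show "emeasure (gauss_PiM I) {a \<in> space (gauss_PiM I). \<forall>x. wave_field I r \<alpha> \<beta> a x \<noteq> 0} \<le> ennreal \<eta>" .
  qed
qed

section \<open>Trinomial frequencies\<close>

lemma exp_le_quadratic:
  fixes u :: real assumes "\<bar>u\<bar> \<le> 1" shows "exp u \<le> 1 + u + u\<^sup>2"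
proof (cases "u \<ge> 0")
  case True
  then show ?thesis using exp_bound[of u] assms by simp
next
  case False
  define v where "v = - u"
  have v: "0 < v" "v \<le> 1" using False assms by (auto simp: v_def)
  have "1 + v \<le> exp v" by (rule exp_ge_add_one_self)
  then have "1 / exp v \<le> 1 / (1 + v)" using v by (intro divide_left_mono) auto
  also have "\<dots> \<le> 1 - v + v\<^sup>2"
  proof -
    have "(1 - v + v\<^sup>2) * (1 + v) = 1 + v * v\<^sup>2" by (simp add: algebra_simps power2_eq_square)
    also have "\<dots> \<ge> 1" using v by simp
    finally show ?thesis using v by (simp add: divide_le_eq)
  qed
  finally show ?thesis by (simp add: v_def exp_minus inverse_eq_divide)
qed

lemma mweight_genfun:
  "(\<Sum>(i0, i1, i2)\<in>exponents d. mweight d t0 t1 t2 (i0, i1, i2) * (x ^ i1 * y ^ i2)) = (t0 + t1 * x + t2 * y) ^ d"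
proof -
  have "complex_of_real (\<Sum>(i0, i1, i2)\<in>exponents d. mweight d t0 t1 t2 (i0, i1, i2) * (x ^ i1 * y ^ i2))
     = (\<Sum>(i0, i1, i2)\<in>exponents d. complex_of_real (trinomial d (i0, i1, i2)) * (complex_of_real t0 ^ i0 * complex_of_real (t1 * x) ^ i1 * complex_of_real (t2 * y) ^ i2))"
    by (simp add: mweight_def case_prod_unfold power_mult_distrib mult_ac)
  also have "\<dots> = complex_of_real ((t0 + t1 * x + t2 * y) ^ d)"
    unfolding trinomial_theorem by simp
  finally show ?thesis by (simp only: of_real_eq_iff)
qed

lemma mweight_nonneg: "t0 \<ge> 0 \<Longrightarrow> t1 \<ge> 0 \<Longrightarrow> t2 \<ge> 0 \<Longrightarrow> mweight d t0 t1 t2 i \<ge> 0"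
  by (auto simp: mweight_def trinomial_def split: prod.split)

text \<open>A sub-Gaussian bound for a centred binomial variable measured in units of
  \<open>s\<close>, the square root of its mean. While |c| \<le> s the quadratic bound on the
  exponential applies; its linear term cancels the centring and its quadratic term gives
  c^2.\<close>

lemma binomial_mgf_bound:
  assumes t: "0 < t" "t \<le> 1" and s: "s > 0" "s\<^sup>2 = real d * t" and l: "\<bar>c\<bar> \<le> s"
  shows "exp (- c * s) * (1 + t * (exp (c / s) - 1)) ^ d \<le> exp (c\<^sup>2)"
proof -
  define u where "u = c / s"
  have u: "\<bar>u\<bar> \<le> 1" using l s(1) by (simp add: u_def)
  have "1 + t * (exp u - 1) \<le> 1 + t * (u + u\<^sup>2)" using exp_le_quadratic[OF u] t by simp
  also have "\<dots> \<le> exp (t * (u + u\<^sup>2))" by (rule exp_ge_add_one_self)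
  finally have a: "1 + t * (exp u - 1) \<le> exp (t * (u + u\<^sup>2))" .
  have "1 + t * (exp u - 1) = (1 - t) + t * exp u" by (simp add: algebra_simps)
  moreover have "(1 - t) + t * exp u \<ge> 0" using t by (intro add_nonneg_nonneg) auto
  ultimately have "1 + t * (exp u - 1) \<ge> 0" by linarith
  then have "(1 + t * (exp u - 1)) ^ d \<le> exp (t * (u + u\<^sup>2)) ^ d" using a by (intro power_mono)
  also have "\<dots> = exp (real d * t * (u + u\<^sup>2))" by (simp add: exp_of_nat_mult[symmetric] mult.assoc)
  also have "real d * t * (u + u\<^sup>2) = c * s + c\<^sup>2"
    unfolding s(2)[symmetric] u_def using s(1) by (simp add: field_simps power2_eq_square)
  finally have "exp (- c * s) * (1 + t * (exp u - 1)) ^ d \<le> exp (- c * s) * exp (c * s + c\<^sup>2)"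
    by (intro mult_left_mono) auto
  then show ?thesis by (simp add: exp_add[symmetric] u_def)
qed

lemma mweight_quadratic:
  fixes c0 c1 c2 c11 c12 c22 :: real
  assumes "t0 + t1 + t2 = 1"
  shows "(\<Sum>(i0, i1, i2)\<in>exponents d. mweight d t0 t1 t2 (i0, i1, i2) *
      (c0 + c1 * real i1 + c2 * real i2 + c11 * (real i1 * real i1) + c12 * (real i1 * real i2) + c22 * (real i2 * real i2)))
    = c0 + c1 * (d * t1) + c2 * (d * t2) + c11 * (d * real (d - 1) * t1\<^sup>2 + d * t1) + c12 * (d * real (d - 1) * t1 * t2)
      + c22 * (d * real (d - 1) * t2\<^sup>2 + d * t2)"
proof -
  let ?p = "\<lambda>i0 i1 i2. mweight d t0 t1 t2 (i0, i1, i2)"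
  have eq: "(\<Sum>(i0, i1, i2)\<in>exponents d. ?p i0 i1 i2 *
      (c0 + c1 * real i1 + c2 * real i2 + c11 * (real i1 * real i1) + c12 * (real i1 * real i2) + c22 * (real i2 * real i2)))
    = c0 * (\<Sum>(i0, i1, i2)\<in>exponents d. ?p i0 i1 i2)
    + c1 * (\<Sum>(i0, i1, i2)\<in>exponents d. ?p i0 i1 i2 * real i1)
    + c2 * (\<Sum>(i0, i1, i2)\<in>exponents d. ?p i0 i1 i2 * real i2)
    + c11 * (\<Sum>(i0, i1, i2)\<in>exponents d. ?p i0 i1 i2 * (real i1 * real i1))
    + c12 * (\<Sum>(i0, i1, i2)\<in>exponents d. ?p i0 i1 i2 * (real i1 * real i2))
    + c22 * (\<Sum>(i0, i1, i2)\<in>exponents d. ?p i0 i1 i2 * (real i2 * real i2))"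
    unfolding sum_distrib_left sum.distrib[symmetric] case_prod_unfold
    by (intro sum.cong refl) (simp add: algebra_simps)
  show ?thesis unfolding eq mweight_moments[OF assms, of d] by simp
qed

text \<open>Each sum contains at least the power \<open>d - 2\<close> of the modulus
  \<open>S\<close>, and its prefactor is at most d^2. The six terms contribute 1 + 1 + 1 + 2 + 1 + 2
  = 8.\<close>

lemma mweight_quadratic_char_le:
  fixes c0 c1 c2 c11 c12 c22 b :: real and x :: complex
  assumes t: "t0 \<ge> 0" "t1 \<ge> 0" "t2 \<ge> 0" "t0 + t1 + t2 = 1" and x: "cmod x = 1" and d: "d \<ge> 2"
    and c: "\<bar>c0\<bar> \<le> b" "\<bar>c1\<bar> \<le> b" "\<bar>c2\<bar> \<le> b" "\<bar>c11\<bar> \<le> b" "\<bar>c12\<bar> \<le> b" "\<bar>c22\<bar> \<le> b"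
  defines "S \<equiv> cmod (complex_of_real t0 + complex_of_real t1 * x + complex_of_real t2)"
  shows "cmod (\<Sum>(i0, i1, i2)\<in>exponents d. complex_of_real (mweight d t0 t1 t2 (i0, i1, i2) *
      (c0 + c1 * real i1 + c2 * real i2 + c11 * (real i1 * real i1) + c12 * (real i1 * real i2) + c22 * (real i2 * real i2))) * x ^ i1)
    \<le> 8 * b * (real d)\<^sup>2 * S ^ (d - 2)"
proof -
  let ?p = "\<lambda>i0 i1 i2. mweight d t0 t1 t2 (i0, i1, i2)"
  let ?s = "complex_of_real t0 + complex_of_real t1 * x + complex_of_real t2"
  note ch = mweight_char[of d t0 t1 t2 x]
  have S1: "S \<le> 1"
  proof -
    have "S \<le> cmod (complex_of_real t0) + cmod (complex_of_real t1 * x) + cmod (complex_of_real t2)"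
      unfolding S_def by (intro order_trans[OF norm_triangle_ineq] add_right_mono norm_triangle_ineq)
    also have "\<dots> = 1" using t x by (simp add: norm_mult)
    finally show ?thesis .
  qed
  have S0: "S \<ge> 0" by (simp add: S_def)
  have b0: "b \<ge> 0" using c(1) by linarith
  have t1: "t1 \<le> 1" "t2 \<le> 1" "t1\<^sup>2 \<le> 1" "t2\<^sup>2 \<le> 1" "t1 * t2 \<le> 1"
    using t by (auto intro: power_le_one mult_le_one)
  have Sd: "S ^ d \<le> S ^ (d - 2)" "S ^ (d - 1) \<le> S ^ (d - 2)"
    using S0 S1 by (auto intro: power_decreasing)
  let ?R = "S ^ (d - 2)"
  have R0: "?R \<ge> 0" using S0 by simp
  have dd: "1 \<le> real d" "real d \<le> (real d)\<^sup>2" "1 \<le> (real d)\<^sup>2" "real d * real (d - 1) \<le> (real d)\<^sup>2"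
  proof -
    show 1: "1 \<le> real d" using d by simp
    then show "real d \<le> (real d)\<^sup>2" "real d * real (d - 1) \<le> (real d)\<^sup>2"
      by (auto simp: power2_eq_square intro: mult_left_mono)
    with 1 show "1 \<le> (real d)\<^sup>2" by linarith
  qed
  have eq: "(\<Sum>(i0, i1, i2)\<in>exponents d. complex_of_real (?p i0 i1 i2 *
      (c0 + c1 * real i1 + c2 * real i2 + c11 * (real i1 * real i1) + c12 * (real i1 * real i2) + c22 * (real i2 * real i2))) * x ^ i1)
    = complex_of_real c0 * (\<Sum>(i0, i1, i2)\<in>exponents d. complex_of_real (?p i0 i1 i2) * x ^ i1)
    + complex_of_real c1 * (\<Sum>(i0, i1, i2)\<in>exponents d. complex_of_real (?p i0 i1 i2 * real i1) * x ^ i1)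
    + complex_of_real c2 * (\<Sum>(i0, i1, i2)\<in>exponents d. complex_of_real (?p i0 i1 i2 * real i2) * x ^ i1)
    + complex_of_real c11 * (\<Sum>(i0, i1, i2)\<in>exponents d. complex_of_real (?p i0 i1 i2 * (real i1 * real i1)) * x ^ i1)
    + complex_of_real c12 * (\<Sum>(i0, i1, i2)\<in>exponents d. complex_of_real (?p i0 i1 i2 * (real i1 * real i2)) * x ^ i1)
    + complex_of_real c22 * (\<Sum>(i0, i1, i2)\<in>exponents d. complex_of_real (?p i0 i1 i2 * (real i2 * real i2)) * x ^ i1)"
    unfolding sum_distrib_left sum.distrib[symmetric] case_prod_unfold
    by (intro sum.cong refl) (simp add: algebra_simps)
  have trm: "cmod (complex_of_real c * y) \<le> b * (k * ((real d)\<^sup>2 * ?R))"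
    if "\<bar>c\<bar> \<le> b" "cmod y \<le> k * ((real d)\<^sup>2 * ?R)" for c y k
    using that b0 unfolding norm_mult norm_of_real by (intro mult_mono) auto
  have e0: "cmod (?s ^ d) \<le> 1 * ((real d)\<^sup>2 * ?R)"
    using Sd(1) dd(3) R0 mult_mono[of 1 "(real d)\<^sup>2" "S ^ d" ?R] S0 by (simp add: norm_power S_def)
  have e1: "cmod (of_nat d * (complex_of_real t1 * x) * ?s ^ (d - 1)) \<le> 1 * ((real d)\<^sup>2 * ?R)"
  proof -
    have "cmod (of_nat d * (complex_of_real t1 * x) * ?s ^ (d - 1)) = (real d * t1) * S ^ (d - 1)"
      using x t by (simp add: norm_mult norm_power S_def)
    also have "\<dots> \<le> (real d * 1) * ?R" using t1 Sd S0 t by (intro mult_mono) auto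
    also have "\<dots> \<le> (real d)\<^sup>2 * ?R" using dd R0 by (intro mult_right_mono) auto
    finally show ?thesis by simp
  qed
  have e2: "cmod (of_nat d * complex_of_real t2 * ?s ^ (d - 1)) \<le> 1 * ((real d)\<^sup>2 * ?R)"
  proof -
    have "cmod (of_nat d * complex_of_real t2 * ?s ^ (d - 1)) = (real d * t2) * S ^ (d - 1)"
      using x t by (simp add: norm_mult norm_power S_def)
    also have "\<dots> \<le> (real d * 1) * ?R" using t1 Sd S0 t by (intro mult_mono) auto
    also have "\<dots> \<le> (real d)\<^sup>2 * ?R" using dd R0 by (intro mult_right_mono) auto
    finally show ?thesis by simp
  qed
  have f11: "cmod (of_nat d * of_nat (d - 1) * (complex_of_real t1 * x)\<^sup>2 * ?s ^ (d - 2)) \<le> (real d)\<^sup>2 * ?R"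
  proof -
    have "cmod (of_nat d * of_nat (d - 1) * (complex_of_real t1 * x)\<^sup>2 * ?s ^ (d - 2)) = (real d * real (d - 1)) * t1\<^sup>2 * ?R"
      using x t by (simp add: norm_mult norm_power S_def)
    also have "\<dots> \<le> (real d)\<^sup>2 * 1 * ?R" using t1 R0 dd by (intro mult_mono) auto
    finally show ?thesis by simp
  qed
  have f12: "cmod (of_nat d * of_nat (d - 1) * (complex_of_real t1 * x) * complex_of_real t2 * ?s ^ (d - 2)) \<le> 1 * ((real d)\<^sup>2 * ?R)"
  proof -
    have "cmod (of_nat d * of_nat (d - 1) * (complex_of_real t1 * x) * complex_of_real t2 * ?s ^ (d - 2)) = (real d * real (d - 1)) * (t1 * t2) * ?R"
      using x t by (simp add: norm_mult norm_power S_def)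
    also have "\<dots> \<le> (real d)\<^sup>2 * 1 * ?R" using t1 t R0 dd by (intro mult_mono) auto
    finally show ?thesis by simp
  qed
  have f22: "cmod (of_nat d * of_nat (d - 1) * (complex_of_real t2)\<^sup>2 * ?s ^ (d - 2)) \<le> (real d)\<^sup>2 * ?R"
  proof -
    have "cmod (of_nat d * of_nat (d - 1) * (complex_of_real t2)\<^sup>2 * ?s ^ (d - 2)) = (real d * real (d - 1)) * t2\<^sup>2 * ?R"
      using x t by (simp add: norm_mult norm_power S_def)
    also have "\<dots> \<le> (real d)\<^sup>2 * 1 * ?R" using t1 R0 dd by (intro mult_mono) auto
    finally show ?thesis by simp
  qed
  have e11: "cmod (of_nat d * of_nat (d - 1) * (complex_of_real t1 * x)\<^sup>2 * ?s ^ (d - 2) + of_nat d * (complex_of_real t1 * x) * ?s ^ (d - 1)) \<le> 2 * ((real d)\<^sup>2 * ?R)"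
    using f11 e1 by (intro order_trans[OF norm_triangle_ineq]) linarith
  have e22: "cmod (of_nat d * of_nat (d - 1) * (complex_of_real t2)\<^sup>2 * ?s ^ (d - 2) + of_nat d * complex_of_real t2 * ?s ^ (d - 1)) \<le> 2 * ((real d)\<^sup>2 * ?R)"
    using f22 e2 by (intro order_trans[OF norm_triangle_ineq]) linarith
  have tri: "cmod (a1 + a2 + a3 + a4 + a5 + a6) \<le> cmod a1 + cmod a2 + cmod a3 + cmod a4 + cmod a5 + cmod a6" for a1 a2 a3 a4 a5 a6
    by (intro order_trans[OF norm_triangle_ineq] add_right_mono order_refl)
  show ?thesis
    unfolding eq ch
    using trm[OF c(1) e0] trm[OF c(2) e1] trm[OF c(3) e2] trm[OF c(4) e11] trm[OF c(5) f12] trm[OF c(6) e22]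
    by (intro order_trans[OF tri]) (simp add: mult.assoc)
qed

text \<open>Used to permute the three homogeneous coordinates so that the large weight comes first,
  while the random coefficients keep their indices.\<close>

lemma white_waves_reindex:
  assumes "bij_betw \<pi> I I" "white_waves I r \<alpha> \<beta> C"
  shows "white_waves I (\<lambda>i. r (\<pi> i)) (\<lambda>i. \<alpha> (\<pi> i)) (\<lambda>i. \<beta> (\<pi> i)) C"
proof -
  have R: "(\<Sum>i\<in>I. F (\<pi> i)) = (\<Sum>i\<in>I. F i)" for F :: "'a \<Rightarrow> real"
    by (rule sum.reindex_bij_betw[OF assms(1)])
  show ?thesis
    using assms(2) unfolding white_waves_def
    by (simp only: R[of "\<lambda>i. (r i)\<^sup>2"] R[of "\<lambda>i. (r i)\<^sup>2 * \<alpha> i"] R[of "\<lambda>i. (r i)\<^sup>2 * \<beta> i"]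
      R[of "\<lambda>i. (r i)\<^sup>2 * (\<alpha> i * \<alpha> i)"] R[of "\<lambda>i. (r i)\<^sup>2 * (\<alpha> i * \<beta> i)"] R[of "\<lambda>i. (r i)\<^sup>2 * (\<beta> i * \<beta> i)"]
      R[of "\<lambda>i. (r i)\<^sup>2 * exp (16 * (\<bar>\<alpha> i\<bar> + \<bar>\<beta> i\<bar>))"])
qed

lemma decorrelated_at_reindex:
  assumes "bij_betw \<pi> I I" "decorrelated_at I r \<alpha> \<beta> m z \<epsilon>"
  shows "decorrelated_at I (\<lambda>i. r (\<pi> i)) (\<lambda>i. \<alpha> (\<pi> i)) (\<lambda>i. \<beta> (\<pi> i)) m z \<epsilon>"
proof -
  have "(\<Sum>i\<in>I. complex_of_real ((r (\<pi> i))\<^sup>2 * (jet_coeff (\<lambda>i. \<alpha> (\<pi> i)) (\<lambda>i. \<beta> (\<pi> i)) l i * jet_coeff (\<lambda>i. \<alpha> (\<pi> i)) (\<lambda>i. \<beta> (\<pi> i)) l' i)) *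
       cis (\<alpha> (\<pi> i) * x + \<beta> (\<pi> i) * y)) =
     (\<Sum>i\<in>I. complex_of_real ((r i)\<^sup>2 * (jet_coeff \<alpha> \<beta> l i * jet_coeff \<alpha> \<beta> l' i)) * cis (\<alpha> i * x + \<beta> i * y))" for l l' x y
    using sum.reindex_bij_betw[OF assms(1), of "\<lambda>i. complex_of_real ((r i)\<^sup>2 * (jet_coeff \<alpha> \<beta> l i * jet_coeff \<alpha> \<beta> l' i)) * cis (\<alpha> i * x + \<beta> i * y)"]
    by (simp add: jet_coeff_def)
  then show ?thesis using assms(2) unfolding decorrelated_at_def by simp
qed

text \<open>\<open>t0\<close> is bounded below in this chart, so that the covariance matrix of the two frequencies is
  nondegenerate after rescaling; \<open>chart_x\<close> and \<open>chart_y\<close> are the result of Gram-Schmidt. The bound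
  \<open>65536 = 256\<^sup>2\<close> makes the exponential moments of order up to \<open>256\<close> of the frequencies, divided by
  their standard deviations, behave as for a Gaussian.\<close>

locale chart =
  fixes d :: nat and t0 t1 t2 :: real
  assumes t: "t0 \<ge> 1 / 3" "t1 > 0" "t2 > 0" "t0 + t1 + t2 = 1"
    and big: "real d * t1 \<ge> 65536" "real d * t2 \<ge> 65536"
begin

text \<open>\<open>A\<close> is the variance of the first frequency, \<open>- \<kappa>\<close> the
  regression coefficient of the second on the first, and \<open>Q\<close> the residual variance. The
  bound t0 \<ge> 1/3 keeps \<open>Q\<close> comparable with d t2.\<close>

definition "A = d * t1 * (1 - t1)"
definition "Q = d * t2 * t0 / (1 - t1)"
definition "\<kappa> = t2 / (1 - t1)"
definition "p = mweight d t0 t1 t2"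
definition "chart_x i = (real (fst (snd i)) - d * t1) / sqrt A"
definition "chart_y i = (real (snd (snd i)) + \<kappa> * real (fst (snd i)) - (d * t2 + \<kappa> * (d * t1))) / sqrt Q"

lemma t_bounds: "1 - t1 \<ge> 1 / 3" "1 - t1 \<le> 1" "t0 \<le> 1" "t1 \<le> 1" "t2 \<le> 1" "t0 > 0"
  using t by linarith+

lemma d_bounds: "real d \<ge> 65536" "d \<ge> 4"
proof -
  have "real d * t1 \<le> real d * 1" using t_bounds by (intro mult_left_mono) auto
  then show "real d \<ge> 65536" using big by simp
  then show "d \<ge> 4" by linarith
qed

lemma kappa_bounds: "0 \<le> \<kappa>" "\<kappa> \<le> 1" "\<kappa> \<le> 3 * t2" "\<kappa> * (1 - t1) = t2"
proof -
  show "0 \<le> \<kappa>" "\<kappa> \<le> 1" "\<kappa> * (1 - t1) = t2" using t t_bounds by (auto simp: \<kappa>_def)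
  have "t2 * (1 / (1 - t1)) \<le> t2 * 3" using t t_bounds by (intro mult_left_mono) (auto simp: divide_le_eq)
  then show "\<kappa> \<le> 3 * t2" by (simp add: \<kappa>_def)
qed

lemma A_Q_bounds: "A \<ge> d * t1 / 4" "Q \<ge> d * t2 / 4" "A \<ge> 1" "Q \<ge> 1"
proof -
  have "d * t1 * (1 / 4) \<le> d * t1 * (1 - t1)" using t t_bounds by (intro mult_left_mono) auto
  then show A: "A \<ge> d * t1 / 4" by (simp add: A_def)
  have "t0 / 1 \<le> t0 / (1 - t1)" using t t_bounds by (intro divide_left_mono) auto
  then have "d * t2 * (1 / 4) \<le> d * t2 * (t0 / (1 - t1))" using t t_bounds by (intro mult_left_mono) auto
  then show Q: "Q \<ge> d * t2 / 4" by (simp add: Q_def)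
  show "A \<ge> 1" "Q \<ge> 1" using A Q big by auto
qed

lemma p_nonneg: "p i \<ge> 0"
  unfolding p_def using t t_bounds by (intro mweight_nonneg) auto

lemma mweight_second_order:
  "(\<Sum>i\<in>exponents d. p i * (c0 + c1 * real (fst (snd i)) + c2 * real (snd (snd i)) + c11 * (real (fst (snd i)) * real (fst (snd i)))
     + c12 * (real (fst (snd i)) * real (snd (snd i))) + c22 * (real (snd (snd i)) * real (snd (snd i)))))
    = c0 + c1 * (d * t1) + c2 * (d * t2) + c11 * (d * (real d - 1) * t1\<^sup>2 + d * t1) + c12 * (d * (real d - 1) * t1 * t2)
      + c22 * (d * (real d - 1) * t2\<^sup>2 + d * t2)"
proof -
  have "real (d - 1) = real d - 1" using d_bounds by (simp add: of_nat_diff)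
  then show ?thesis
    using mweight_quadratic[OF t(4), of d c0 c1 c2 c11 c12 c22] by (simp add: p_def case_prod_unfold)
qed

lemma mgf_first_le:
  assumes c: "\<bar>c\<bar> \<le> 256"
  shows "(\<Sum>i\<in>exponents d. p i * exp (c * ((real (fst (snd i)) - d * t1) / sqrt (d * t1)))) \<le> exp (c\<^sup>2)"
proof -
  define s where "s = sqrt (d * t1)"
  have s: "s > 0" "s\<^sup>2 = d * t1" using big by (auto simp: s_def)
  have "256\<^sup>2 \<le> s\<^sup>2" using big s by simp
  then have "256 \<le> s" by (rule power2_le_imp_le) (use s(1) in simp)
  then have cs: "\<bar>c\<bar> \<le> s" using c by linarith
  have "exp (c * ((real n - d * t1) / s)) = exp (- c * s) * (exp (c / s) ^ n * 1 ^ k)" for n k :: nat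
  proof -
    have "c * ((real n - d * t1) / s) = - c * s + real n * (c / s)"
      unfolding s(2)[symmetric] using s(1) by (simp add: field_simps power2_eq_square)
    then show ?thesis unfolding exp_of_nat_mult[symmetric] by (simp only: exp_add power_one mult_1_right)
  qed
  then have "(\<Sum>i\<in>exponents d. p i * exp (c * ((real (fst (snd i)) - d * t1) / s)))
     = exp (- c * s) * (\<Sum>(i0, i1, i2)\<in>exponents d. p (i0, i1, i2) * (exp (c / s) ^ i1 * 1 ^ i2))"
    by (simp add: sum_distrib_left case_prod_unfold mult_ac)
  also have "\<dots> = exp (- c * s) * (1 + t1 * (exp (c / s) - 1)) ^ d"
  proof -
    have "t0 + t1 * exp (c / s) + t2 * 1 = 1 + t1 * (exp (c / s) - 1)" using t(4) by (simp add: algebra_simps)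
    then show ?thesis unfolding p_def mweight_genfun by simp
  qed
  also have "\<dots> \<le> exp (c\<^sup>2)" by (rule binomial_mgf_bound) (use t t_bounds s cs in auto)
  finally show ?thesis by (simp add: s_def)
qed

lemma mgf_second_le:
  assumes c: "\<bar>c\<bar> \<le> 256"
  shows "(\<Sum>i\<in>exponents d. p i * exp (c * ((real (snd (snd i)) - d * t2) / sqrt (d * t2)))) \<le> exp (c\<^sup>2)"
proof -
  define s where "s = sqrt (d * t2)"
  have s: "s > 0" "s\<^sup>2 = d * t2" using big by (auto simp: s_def)
  have "256\<^sup>2 \<le> s\<^sup>2" using big s by simp
  then have "256 \<le> s" by (rule power2_le_imp_le) (use s(1) in simp)
  then have cs: "\<bar>c\<bar> \<le> s" using c by linarith
  have "exp (c * ((real n - d * t2) / s)) = exp (- c * s) * (1 ^ k * exp (c / s) ^ n)" for n k :: nat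
  proof -
    have "c * ((real n - d * t2) / s) = - c * s + real n * (c / s)"
      unfolding s(2)[symmetric] using s(1) by (simp add: field_simps power2_eq_square)
    then show ?thesis unfolding exp_of_nat_mult[symmetric] by (simp only: exp_add power_one mult_1)
  qed
  then have "(\<Sum>i\<in>exponents d. p i * exp (c * ((real (snd (snd i)) - d * t2) / s)))
     = exp (- c * s) * (\<Sum>(i0, i1, i2)\<in>exponents d. p (i0, i1, i2) * (1 ^ i1 * exp (c / s) ^ i2))"
    by (simp add: sum_distrib_left case_prod_unfold mult_ac)
  also have "\<dots> = exp (- c * s) * (1 + t2 * (exp (c / s) - 1)) ^ d"
  proof -
    have "t0 + t1 * 1 + t2 * exp (c / s) = 1 + t2 * (exp (c / s) - 1)" using t(4) by (simp add: algebra_simps)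
    then show ?thesis unfolding p_def mweight_genfun by simp
  qed
  also have "\<dots> \<le> exp (c\<^sup>2)" by (rule binomial_mgf_bound) (use t t_bounds s cs in auto)
  finally show ?thesis by (simp add: s_def)
qed

text \<open>Reduces the joint exponential moment to moments of one frequency at a time. In units u,
  v of deviation over sqrt(d t1) and sqrt(d t2), the chart coordinates are at most 2 u and 2 v + 6
  u.\<close>

lemma chart_exp_bound:
  "exp (16 * (\<bar>chart_x i\<bar> + \<bar>chart_y i\<bar>)) \<le>
     exp (256 * ((real (fst (snd i)) - d * t1) / sqrt (d * t1))) + exp (- 256 * ((real (fst (snd i)) - d * t1) / sqrt (d * t1)))
   + (exp (256 * ((real (snd (snd i)) - d * t2) / sqrt (d * t2))) + exp (- 256 * ((real (snd (snd i)) - d * t2) / sqrt (d * t2))))"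
proof -
  define s1 s2 where "s1 = sqrt (d * t1)" and "s2 = sqrt (d * t2)"
  define X Y where "X = real (fst (snd i)) - d * t1" and "Y = real (snd (snd i)) - d * t2"
  have s: "s1 > 0" "s2 > 0" "s1\<^sup>2 = d * t1" "s2\<^sup>2 = d * t2" using big by (auto simp: s1_def s2_def)
  have rA: "sqrt A \<ge> s1 / 2"
  proof (rule real_le_rsqrt)
    show "(s1 / 2)\<^sup>2 \<le> A" using A_Q_bounds(1) s by (simp add: power_divide)
  qed
  have rQ: "sqrt Q \<ge> s2 / 2"
  proof (rule real_le_rsqrt)
    show "(s2 / 2)\<^sup>2 \<le> Q" using A_Q_bounds(2) s by (simp add: power_divide)
  qed
  \<comment> \<open>The regression coefficient is at most 3 t2, so the share of the first frequency
    in the second chart coordinate stays bounded even if t1 is much larger than t2.\<close>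
  have ts: "t2 * s1 \<le> s2"
  proof (rule power2_le_imp_le)
    have "(t2 * s1)\<^sup>2 = t2 * t1 * (d * t2)" unfolding power_mult_distrib s by (simp add: power2_eq_square)
    also have "\<dots> \<le> 1 * (d * t2)" using t t_bounds by (intro mult_right_mono mult_le_one) auto
    finally show "(t2 * s1)\<^sup>2 \<le> s2\<^sup>2" using s by simp
  qed (use s in simp)
  have x: "\<bar>chart_x i\<bar> \<le> 2 * (\<bar>X\<bar> / s1)"
  proof -
    have "\<bar>X\<bar> / sqrt A \<le> \<bar>X\<bar> / (s1 / 2)" using rA s A_Q_bounds by (intro divide_left_mono) auto
    then show ?thesis using A_Q_bounds(3) by (simp add: chart_x_def X_def mult.commute)
  qed
  have y: "\<bar>chart_y i\<bar> \<le> 2 * (\<bar>Y\<bar> / s2) + 6 * (\<bar>X\<bar> / s1)"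
  proof -
    have "\<bar>chart_y i\<bar> = \<bar>Y + \<kappa> * X\<bar> / sqrt Q" using A_Q_bounds by (simp add: chart_y_def X_def Y_def algebra_simps)
    also have "\<dots> \<le> (\<bar>Y\<bar> + \<kappa> * \<bar>X\<bar>) / sqrt Q"
      using kappa_bounds(1) A_Q_bounds by (intro divide_right_mono order_trans[OF abs_triangle_ineq]) (auto simp: abs_mult)
    also have "\<dots> \<le> (\<bar>Y\<bar> + \<kappa> * \<bar>X\<bar>) / (s2 / 2)"
      using rQ s A_Q_bounds kappa_bounds(1) by (intro divide_left_mono) auto
    also have "\<dots> = 2 * (\<bar>Y\<bar> / s2) + 2 * (\<kappa> * \<bar>X\<bar> / s2)" using s by (simp add: field_simps)
    also have "\<kappa> * \<bar>X\<bar> / s2 \<le> 3 * (\<bar>X\<bar> / s1)"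
    proof -
      have "\<kappa> * s1 \<le> 3 * t2 * s1" using kappa_bounds(3) s by (intro mult_right_mono) auto
      also have "\<dots> \<le> 3 * s2" using ts by simp
      finally have "\<kappa> / s2 \<le> 3 / s1" using s by (simp add: field_simps)
      from mult_right_mono[OF this, of "\<bar>X\<bar>"] show ?thesis by simp
    qed
    finally show ?thesis by simp
  qed
  define u v where "u = \<bar>X\<bar> / s1" and "v = \<bar>Y\<bar> / s2"
  have uv: "u \<ge> 0" "v \<ge> 0" using s by (auto simp: u_def v_def)
  \<comment> \<open>The left side is at most 128 u + 32 v, hence at most 160 times the maximum.
    Passing to the maximum separates the two frequencies without Cauchy-Schwarz.\<close>
  have "16 * (\<bar>chart_x i\<bar> + \<bar>chart_y i\<bar>) \<le> max (256 * u) (256 * v)"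
    using x y uv unfolding u_def[symmetric] v_def[symmetric] by (auto simp: max_def)
  then have "exp (16 * (\<bar>chart_x i\<bar> + \<bar>chart_y i\<bar>)) \<le> exp (max (256 * u) (256 * v))" by simp
  also have "\<dots> \<le> exp (256 * u) + exp (256 * v)" by (simp add: max_def add_increasing add_increasing2)
  also have "exp (256 * u) \<le> exp (256 * (X / s1)) + exp (- 256 * (X / s1))"
    by (cases "X \<ge> 0") (auto simp: u_def add_increasing add_increasing2)
  also have "exp (256 * v) \<le> exp (256 * (Y / s2)) + exp (- 256 * (Y / s2))"
    by (cases "Y \<ge> 0") (auto simp: v_def add_increasing add_increasing2)
  finally show ?thesis by (simp add: X_def Y_def s1_def s2_def)
qed

text \<open>All covariances reduce to second moments of the trinomial law, with
  \<open>\<kappa> * A = d * t1 * t2\<close> as the orthogonality relation. The constant consists of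
  four exponential moments of order 256 in absolute value, each at most exp (256^2).\<close>

lemma white_waves_chart: "white_waves (exponents d) (\<lambda>i. sqrt (p i)) chart_x chart_y (4 * exp 65536)"
proof -
  have r2: "(sqrt (p i))\<^sup>2 = p i" for i using p_nonneg by simp
  define a b e where "a = 1 / sqrt A" and "b = 1 / sqrt Q" and "e = d * t2 + \<kappa> * (d * t1)"
  have a2: "a * a * A = 1" and b2: "b * b * Q = 1" using A_Q_bounds by (auto simp: a_def b_def)
  have cx: "chart_x i = a * real (fst (snd i)) - a * (d * t1)" for i
    by (simp add: chart_x_def a_def diff_divide_distrib)
  have cy: "chart_y i = b * real (snd (snd i)) + b * \<kappa> * real (fst (snd i)) - b * e" for i
    by (simp add: chart_y_def b_def e_def diff_divide_distrib add_divide_distrib)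
  have m0: "(\<Sum>i\<in>exponents d. p i) = 1" using mweight_second_order[of 1 0 0 0 0 0] by simp
  have m1: "(\<Sum>i\<in>exponents d. p i * chart_x i) = 0"
    using mweight_second_order[of "- a * (d * t1)" a 0 0 0 0] by (simp add: cx algebra_simps)
  have m2: "(\<Sum>i\<in>exponents d. p i * chart_y i) = 0"
    using mweight_second_order[of "- b * e" "b * \<kappa>" b 0 0 0] by (simp add: cy e_def algebra_simps)
  have m11: "(\<Sum>i\<in>exponents d. p i * (chart_x i * chart_x i)) = 1"
  proof -
    have "(\<Sum>i\<in>exponents d. p i * (chart_x i * chart_x i)) =
      (a * (d * t1)) * (a * (d * t1)) + (- 2 * a * a * (d * t1)) * (d * t1) + (a * a) * (d * (real d - 1) * t1\<^sup>2 + d * t1)"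
      using mweight_second_order[of "(a * (d * t1)) * (a * (d * t1))" "- 2 * a * a * (d * t1)" 0 "a * a" 0 0]
      by (simp add: cx algebra_simps)
    also have "\<dots> = a * a * A" by (simp add: A_def algebra_simps power2_eq_square)
    finally show ?thesis using a2 by simp
  qed
  have \<kappa>A: "\<kappa> * A = d * t1 * t2" unfolding A_def using kappa_bounds(4) by (metis mult.assoc mult.left_commute)
  have m12: "(\<Sum>i\<in>exponents d. p i * (chart_x i * chart_y i)) = 0"
  proof -
    have "(\<Sum>i\<in>exponents d. p i * (chart_x i * chart_y i)) =
      a * b * (d * t1) * e + (- a * b * e - a * b * \<kappa> * (d * t1)) * (d * t1) + (- a * b * (d * t1)) * (d * t2)
       + (a * b * \<kappa>) * (d * (real d - 1) * t1\<^sup>2 + d * t1) + (a * b) * (d * (real d - 1) * t1 * t2)"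
      using mweight_second_order[of "a * b * (d * t1) * e" "- a * b * e - a * b * \<kappa> * (d * t1)" "- a * b * (d * t1)" "a * b * \<kappa>" "a * b" 0]
      by (simp add: cx cy algebra_simps)
    also have "\<dots> = a * b * (\<kappa> * A - d * t1 * t2)" by (simp add: A_def e_def algebra_simps power2_eq_square)
    finally show ?thesis using \<kappa>A by simp
  qed
  have m22: "(\<Sum>i\<in>exponents d. p i * (chart_y i * chart_y i)) = 1"
  proof -
    have "(\<Sum>i\<in>exponents d. p i * (chart_y i * chart_y i)) =
      b * b * e * e + (- 2 * b * b * \<kappa> * e) * (d * t1) + (- 2 * b * b * e) * (d * t2)
       + (b * b * \<kappa> * \<kappa>) * (d * (real d - 1) * t1\<^sup>2 + d * t1) + (2 * b * b * \<kappa>) * (d * (real d - 1) * t1 * t2)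
       + (b * b) * (d * (real d - 1) * t2\<^sup>2 + d * t2)"
      using mweight_second_order[of "b * b * e * e" "- 2 * b * b * \<kappa> * e" "- 2 * b * b * e" "b * b * \<kappa> * \<kappa>" "2 * b * b * \<kappa>" "b * b"]
      by (simp add: cy algebra_simps)
    also have "\<dots> = b * b * (d * t2 * (1 - t2) - 2 * \<kappa> * (d * t1 * t2) + \<kappa> * (\<kappa> * A))"
      by (simp add: A_def e_def algebra_simps power2_eq_square)
    also have "d * t2 * (1 - t2) - 2 * \<kappa> * (d * t1 * t2) + \<kappa> * (\<kappa> * A) = Q"
    proof -
      have "t0 = 1 - t1 - t2" using t(4) by simp
      then have Q': "Q = d * t2 * (1 - t1 - t2) / (1 - t1)" unfolding Q_def by (rule arg_cong)
      have nz: "1 - t1 \<noteq> 0" using t_bounds by auto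
      have "d * t2 * (1 - t2) - 2 * \<kappa> * (d * t1 * t2) + \<kappa> * (\<kappa> * A) = d * t2 * (1 - t2) - \<kappa> * (d * t1 * t2)"
        unfolding \<kappa>A by simp
      also have "\<dots> = Q" unfolding Q' \<kappa>_def using nz by (simp add: field_simps)
      finally show ?thesis .
    qed
    finally show ?thesis using b2 by simp
  qed
  have mgf: "(\<Sum>i\<in>exponents d. p i * exp (16 * (\<bar>chart_x i\<bar> + \<bar>chart_y i\<bar>))) \<le> 4 * exp 65536"
  proof -
    have "(\<Sum>i\<in>exponents d. p i * exp (16 * (\<bar>chart_x i\<bar> + \<bar>chart_y i\<bar>))) \<le> (\<Sum>i\<in>exponents d. p i *
     (exp (256 * ((real (fst (snd i)) - d * t1) / sqrt (d * t1))) + exp (- 256 * ((real (fst (snd i)) - d * t1) / sqrt (d * t1)))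
   + (exp (256 * ((real (snd (snd i)) - d * t2) / sqrt (d * t2))) + exp (- 256 * ((real (snd (snd i)) - d * t2) / sqrt (d * t2))))))"
      by (intro sum_mono mult_left_mono chart_exp_bound p_nonneg)
    also have "\<dots> \<le> exp 65536 + exp 65536 + (exp 65536 + exp 65536)"
      unfolding distrib_left sum.distrib using mgf_first_le[of 256] mgf_first_le[of "- 256"] mgf_second_le[of 256] mgf_second_le[of "- 256"]
      by (intro add_mono) simp_all
    finally show ?thesis by simp
  qed
  show ?thesis unfolding white_waves_def r2 using m0 m1 m2 m11 m12 m22 mgf by simp
qed

text \<open>The squared modulus equals 1 - 2 (1 - t1) t1 (1 - cos delta). With 1 - t1 \<ge> 1/3 and
  1 - u \<le> exp (- u), the modulus is at most exp (- t1 c / 3), and \<open>d - 2\<close> is at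
  least half of \<open>d\<close>.\<close>

lemma char_modulus_le:
  assumes c: "0 \<le> c" "c \<le> 1 - cos \<delta>"
  shows "cmod (complex_of_real t0 + complex_of_real t1 * cis \<delta> + complex_of_real t2) ^ (d - 2) \<le> exp (- (d * t1 * c / 6))"
proof -
  define S where "S = cmod (complex_of_real t0 + complex_of_real t1 * cis \<delta> + complex_of_real t2)"
  have t02: "t0 + t2 = 1 - t1" using t(4) by simp
  have "S\<^sup>2 = (t0 + t2 + t1 * cos \<delta>)\<^sup>2 + (t1 * sin \<delta>)\<^sup>2"
    unfolding S_def cmod_power2 by (simp add: algebra_simps)
  also have "\<dots> = (1 - t1)\<^sup>2 + 2 * (1 - t1) * t1 * cos \<delta> + t1\<^sup>2 * ((cos \<delta>)\<^sup>2 + (sin \<delta>)\<^sup>2)"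
    unfolding t02 by (simp only: power2_eq_square) algebra
  also have "\<dots> = 1 - 2 * (1 - t1) * t1 * (1 - cos \<delta>)"
    unfolding sin_cos_squared_add2 by (simp add: power2_eq_square algebra_simps)
  also have "\<dots> \<le> 1 - 2 * (1 / 3) * t1 * c"
    using t t_bounds c by (intro diff_left_mono mult_mono) auto
  also have "\<dots> \<le> exp (- (2 * (1 / 3) * t1 * c))" using exp_ge_add_one_self[of "- (2 * (1 / 3) * t1 * c)"] by simp
  also have "\<dots> = (exp (- (t1 * c / 3)))\<^sup>2" by (simp add: power2_eq_square exp_add[symmetric])
  finally have "S \<le> exp (- (t1 * c / 3))" by (rule power2_le_imp_le) simp
  then have "S ^ (d - 2) \<le> exp (- (t1 * c / 3)) ^ (d - 2)" by (intro power_mono) (auto simp: S_def)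
  also have "\<dots> = exp (- (real (d - 2) * (t1 * c / 3)))" by (simp add: exp_of_nat_mult[symmetric])
  also have "\<dots> \<le> exp (- (d * t1 * c / 6))"
  proof -
    have "real d / 2 * (t1 * c / 3) \<le> real (d - 2) * (t1 * c / 3)"
      using d_bounds t c by (intro mult_right_mono) (auto simp: of_nat_diff)
    then show ?thesis by simp
  qed
  finally show ?thesis by (simp add: S_def)
qed

text \<open>The points are equally spaced in the first angle alone, at steps of 2 pi / m, and
  \<open>sqrt A\<close> translates this into chart coordinates. Correlations thus become
  characteristic sums of the first index: a polynomial factor times a quantity exponentially small
  in d t1.\<close>

lemma decorrelated_chart:
  assumes c: "0 \<le> c" "\<And>k k'. k < m \<Longrightarrow> k' < m \<Longrightarrow> k \<noteq> k' \<Longrightarrow> c \<le> 1 - cos (2 * pi * (real k - real k') / real m)"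
    and \<epsilon>: "16 * real d ^ 4 * exp (- (d * t1 * c / 6)) \<le> \<epsilon>"
  shows "decorrelated_at (exponents d) (\<lambda>i. sqrt (p i)) chart_x chart_y m (\<lambda>k. Complex (2 * pi * real k / real m * sqrt A) 0) \<epsilon>"
  unfolding decorrelated_at_def
proof (intro allI impI)
  fix k k' l l' :: nat assume k: "k < m" "k' < m" "k \<noteq> k'" and l: "l < 3" "l' < 3"
  define \<delta> where "\<delta> = 2 * pi * (real k - real k') / real m"
  define a b e where "a = 1 / sqrt A" and "b = 1 / sqrt Q" and "e = d * t2 + \<kappa> * (d * t1)"
  have ab: "0 \<le> a" "a \<le> 1" "0 \<le> b" "b \<le> 1" using A_Q_bounds by (auto simp: a_def b_def divide_le_eq)
  have e: "0 \<le> e" "e \<le> d"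
  proof -
    show "0 \<le> e" using kappa_bounds t by (simp add: e_def)
    have "e \<le> d * t2 + 1 * (d * t1)" unfolding e_def using kappa_bounds t by (intro add_left_mono mult_right_mono) auto
    also have "\<dots> = d * (t1 + t2)" by (simp add: algebra_simps)
    also have "\<dots> \<le> real d * 1" using t t_bounds by (intro mult_left_mono) auto
    finally show "e \<le> d" by simp
  qed
  \<comment> \<open>Each jet factor is affine in the two indices with coefficients at most
    \<open>d\<close>, so a product of two is a quadratic with coefficients at most 2 d^2; this is
    the source of 16 d^4 = 8 * (2 d^2) * d^2.\<close>
  define g where "g j = (if j = (0::nat) then (1, 0, 0) else if j = 1 then (- a * (d * t1), a, 0) else (- b * e, b * \<kappa>, b))" for j
  have jg: "jet_coeff chart_x chart_y j i = fst (g j) + fst (snd (g j)) * real (fst (snd i)) + snd (snd (g j)) * real (snd (snd i))" for j i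
    by (simp add: jet_coeff_def g_def chart_x_def chart_y_def a_def b_def e_def diff_divide_distrib add_divide_distrib)
  have gb: "\<bar>fst (g j)\<bar> \<le> d \<and> \<bar>fst (snd (g j))\<bar> \<le> d \<and> \<bar>snd (snd (g j))\<bar> \<le> d" for j
  proof -
    have d1: "1 \<le> real d" using d_bounds by simp
    have "a * (real d * t1) \<le> 1 * (real d * 1)" using ab t t_bounds by (intro mult_mono) auto
    moreover have "b * e \<le> 1 * real d" using ab e by (intro mult_mono) auto
    moreover have "b * \<kappa> \<le> 1 * 1" using ab kappa_bounds by (intro mult_mono) auto
    ultimately show ?thesis using d1 ab e kappa_bounds t by (auto simp: g_def abs_mult)
  qed
  obtain a0 a1 a2 where ga: "g l = (a0, a1, a2)" by (cases "g l") auto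
  obtain b0 b1 b2 where gb': "g l' = (b0, b1, b2)" by (cases "g l'") auto
  have A: "\<bar>a0\<bar> \<le> d" "\<bar>a1\<bar> \<le> d" "\<bar>a2\<bar> \<le> d" using gb[of l] ga by auto
  have B: "\<bar>b0\<bar> \<le> d" "\<bar>b1\<bar> \<le> d" "\<bar>b2\<bar> \<le> d" using gb[of l'] gb' by auto
  have pr: "\<bar>x * y\<bar> \<le> real d ^ 2" if "\<bar>x\<bar> \<le> d" "\<bar>y\<bar> \<le> d" for x y :: real
    unfolding abs_mult power2_eq_square using that by (intro mult_mono) auto
  have pr2: "\<bar>x * y + x' * y'\<bar> \<le> 2 * real d ^ 2" if "\<bar>x\<bar> \<le> d" "\<bar>y\<bar> \<le> d" "\<bar>x'\<bar> \<le> d" "\<bar>y'\<bar> \<le> d" for x y x' y' :: real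
    using pr[of x y] pr[of x' y'] that by linarith
  have pr1: "\<bar>x * y\<bar> \<le> 2 * real d ^ 2" if "\<bar>x\<bar> \<le> d" "\<bar>y\<bar> \<le> d" for x y :: real
    using pr[OF that] zero_le_power2[of "real d"] by linarith
  have sA: "sqrt A > 0" using A_Q_bounds by simp
  have ph: "cis (chart_x i * (Re (Complex (2 * pi * real k / real m * sqrt A) 0) - Re (Complex (2 * pi * real k' / real m * sqrt A) 0))
      + chart_y i * (Im (Complex (2 * pi * real k / real m * sqrt A) 0) - Im (Complex (2 * pi * real k' / real m * sqrt A) 0)))
      = cis (- (d * t1 * \<delta>)) * cis \<delta> ^ fst (snd i)" for i :: "nat \<times> nat \<times> nat"
  proof -
    have "chart_x i * (2 * pi * real k / real m * sqrt A - 2 * pi * real k' / real m * sqrt A) = (real (fst (snd i)) - d * t1) * \<delta>"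
    proof -
      have "2 * pi * real k / real m * sqrt A - 2 * pi * real k' / real m * sqrt A = \<delta> * sqrt A"
        by (simp add: \<delta>_def algebra_simps diff_divide_distrib)
      then show ?thesis using sA by (simp add: chart_x_def)
    qed
    then have "cis (chart_x i * (2 * pi * real k / real m * sqrt A - 2 * pi * real k' / real m * sqrt A)) = cis (- (d * t1 * \<delta>)) * cis \<delta> ^ fst (snd i)"
      by (simp only: Complex.DeMoivre cis_mult) (simp add: algebra_simps)
    then show ?thesis by (simp only: complex.sel diff_self mult_zero_right add_0_right)
  qed
  let ?c0 = "a0 * b0" and ?c1 = "a0 * b1 + a1 * b0" and ?c2 = "a0 * b2 + a2 * b0" and ?c11 = "a1 * b1"
    and ?c12 = "a1 * b2 + a2 * b1" and ?c22 = "a2 * b2"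
  have "(\<Sum>i\<in>exponents d. complex_of_real ((sqrt (p i))\<^sup>2 * (jet_coeff chart_x chart_y l i * jet_coeff chart_x chart_y l' i)) *
       cis (chart_x i * (Re (Complex (2 * pi * real k / real m * sqrt A) 0) - Re (Complex (2 * pi * real k' / real m * sqrt A) 0))
      + chart_y i * (Im (Complex (2 * pi * real k / real m * sqrt A) 0) - Im (Complex (2 * pi * real k' / real m * sqrt A) 0))))
    = cis (- (d * t1 * \<delta>)) * (\<Sum>(i0, i1, i2)\<in>exponents d. complex_of_real (mweight d t0 t1 t2 (i0, i1, i2) *
      (?c0 + ?c1 * real i1 + ?c2 * real i2 + ?c11 * (real i1 * real i1) + ?c12 * (real i1 * real i2) + ?c22 * (real i2 * real i2))) * cis \<delta> ^ i1)"
    unfolding ph sum_distrib_left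
  proof (rule sum.cong[OF refl], clarify)
    fix i0 i1 i2 :: nat
    have r2: "(sqrt (p (i0, i1, i2)))\<^sup>2 = mweight d t0 t1 t2 (i0, i1, i2)" using p_nonneg[of "(i0, i1, i2)"] by (simp add: p_def)
    have j: "jet_coeff chart_x chart_y l (i0, i1, i2) * jet_coeff chart_x chart_y l' (i0, i1, i2) =
       ?c0 + ?c1 * real i1 + ?c2 * real i2 + ?c11 * (real i1 * real i1) + ?c12 * (real i1 * real i2) + ?c22 * (real i2 * real i2)"
      unfolding jg ga gb' by (simp add: algebra_simps)
    show "complex_of_real ((sqrt (p (i0, i1, i2)))\<^sup>2 * (jet_coeff chart_x chart_y l (i0, i1, i2) * jet_coeff chart_x chart_y l' (i0, i1, i2))) *
        (cis (- (d * t1 * \<delta>)) * cis \<delta> ^ fst (snd (i0, i1, i2))) =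
      cis (- (d * t1 * \<delta>)) * (complex_of_real (mweight d t0 t1 t2 (i0, i1, i2) *
      (?c0 + ?c1 * real i1 + ?c2 * real i2 + ?c11 * (real i1 * real i1) + ?c12 * (real i1 * real i2) + ?c22 * (real i2 * real i2))) * cis \<delta> ^ i1)"
      unfolding r2 j fst_conv snd_conv by (simp only: mult_ac)
  qed
  then have "cmod (\<Sum>i\<in>exponents d. complex_of_real ((sqrt (p i))\<^sup>2 * (jet_coeff chart_x chart_y l i * jet_coeff chart_x chart_y l' i)) *
       cis (chart_x i * (Re (Complex (2 * pi * real k / real m * sqrt A) 0) - Re (Complex (2 * pi * real k' / real m * sqrt A) 0))
      + chart_y i * (Im (Complex (2 * pi * real k / real m * sqrt A) 0) - Im (Complex (2 * pi * real k' / real m * sqrt A) 0))))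
    = cmod (\<Sum>(i0, i1, i2)\<in>exponents d. complex_of_real (mweight d t0 t1 t2 (i0, i1, i2) *
      (?c0 + ?c1 * real i1 + ?c2 * real i2 + ?c11 * (real i1 * real i1) + ?c12 * (real i1 * real i2) + ?c22 * (real i2 * real i2))) * cis \<delta> ^ i1)"
    by (simp only: norm_mult norm_cis mult_1)
  also have "\<dots> \<le> 8 * (2 * real d ^ 2) * (real d)\<^sup>2 * cmod (complex_of_real t0 + complex_of_real t1 * cis \<delta> + complex_of_real t2) ^ (d - 2)"
    by (rule mweight_quadratic_char_le) (use t t_bounds d_bounds A B in \<open>auto intro: pr1 pr2\<close>)
  also have "\<dots> \<le> 8 * (2 * real d ^ 2) * (real d)\<^sup>2 * exp (- (d * t1 * c / 6))"
    using c k by (intro mult_left_mono char_modulus_le) (auto simp: \<delta>_def)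
  also have "\<dots> = 16 * real d ^ 4 * exp (- (d * t1 * c / 6))" by (simp add: power_add[symmetric])
  also have "\<dots> \<le> \<epsilon>" by (rule \<epsilon>)
  finally show "cmod (\<Sum>i\<in>exponents d. complex_of_real ((sqrt (p i))\<^sup>2 * (jet_coeff chart_x chart_y l i * jet_coeff chart_x chart_y l' i)) *
       cis (chart_x i * (Re (Complex (2 * pi * real k / real m * sqrt A) 0) - Re (Complex (2 * pi * real k' / real m * sqrt A) 0))
      + chart_y i * (Im (Complex (2 * pi * real k / real m * sqrt A) 0) - Im (Complex (2 * pi * real k' / real m * sqrt A) 0)))) \<le> \<epsilon>" .
qed

end

section \<open>From the chart to the symmetric description of the torus\<close>

definition torus_wave :: "nat \<Rightarrow> real \<Rightarrow> real \<Rightarrow> real \<Rightarrow> real \<Rightarrow> real \<Rightarrow> real \<Rightarrow> nat \<times> nat \<times> nat \<Rightarrow> complex" where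
  "torus_wave d t0 t1 t2 \<theta>0 \<theta>1 \<theta>2 = (\<lambda>(i0, i1, i2).
     complex_of_real (sqrt (mweight d t0 t1 t2 (i0, i1, i2))) * cis (\<theta>0 * real i0 + \<theta>1 * real i1 + \<theta>2 * real i2))"

text \<open>Three angles rather than two: the diagonal one only multiplies by a phase, but keeping
  it makes permutations of the homogeneous coordinates act by permuting arguments.\<close>

definition torus_poly :: "nat \<Rightarrow> real \<Rightarrow> real \<Rightarrow> real \<Rightarrow> hpoly \<Rightarrow> real \<Rightarrow> real \<Rightarrow> real \<Rightarrow> complex" where
  "torus_poly d t0 t1 t2 a \<theta>0 \<theta>1 \<theta>2 = (\<Sum>i\<in>exponents d. a i * torus_wave d t0 t1 t2 \<theta>0 \<theta>1 \<theta>2 i)"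

lemma cos_separation:
  "\<exists>c>0. \<forall>k<m. \<forall>k'<m. k \<noteq> k' \<longrightarrow> c \<le> 1 - cos (2 * pi * (real k - real k') / real m)"
proof -
  define S where "S = insert 1 ((\<lambda>(k, k'). 1 - cos (2 * pi * (real k - real k') / real m)) ` {(k, k'). k < m \<and> k' < m \<and> k \<noteq> k'})"
  have "finite {(k, k'). k < m \<and> k' < m \<and> k \<noteq> k'}"
    by (rule finite_subset[of _ "{..<m} \<times> {..<m}"]) auto
  then have fin: "finite S" by (simp add: S_def)
  have "cos (2 * pi * (real k - real k') / real m) \<noteq> 1" if k: "k < m" "k' < m" "k \<noteq> k'" for k k'
  proof
    assume "cos (2 * pi * (real k - real k') / real m) = 1"
    then obtain n :: int where "2 * pi * (real k - real k') / real m = of_int n * 2 * pi"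
      unfolding cos_one_2pi_int by blast
    then have "pi * (real k - real k') = pi * (of_int n * real m)" using k by (simp add: field_simps)
    then have "real k - real k' = of_int n * real m" by simp
    then have "real_of_int (int k - int k') = real_of_int (n * int m)" by simp
    then have e: "int k - int k' = n * int m" by (simp only: of_int_eq_iff)
    have "\<bar>int k - int k'\<bar> < int m" using k by linarith
    then have "\<bar>n\<bar> * int m < 1 * int m" unfolding e by (simp add: abs_mult)
    then have "\<bar>n\<bar> < 1" by (rule mult_right_less_imp_less) simp
    then show False using e k by simp
  qed
  then have "\<forall>x\<in>S. x > 0" using cos_le_one by (auto simp: S_def less_le)
  then have "Min S > 0" using fin by (subst Min_gr_iff) (auto simp: S_def)
  moreover have "Min S \<le> 1 - cos (2 * pi * (real k - real k') / real m)" if "k < m" "k' < m" "k \<noteq> k'" for k k'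
    using fin that by (intro Min_le) (auto simp: S_def)
  ultimately show ?thesis by blast
qed

text \<open>The chart changes the frequencies linearly, so the angles change by the transposed
  inverse, and recentring costs an overall phase. The map from angles to chart coordinates is onto,
  hence both sides have zeros together.\<close>

lemma (in chart) wave_field_eq_torus_poly:
  assumes "\<And>i. i \<in> exponents d \<Longrightarrow> \<pi> i \<in> exponents d"
  shows "(\<forall>z. wave_field (exponents d) (\<lambda>i. sqrt (p (\<pi> i))) (\<lambda>i. chart_x (\<pi> i)) (\<lambda>i. chart_y (\<pi> i)) a z \<noteq> 0) \<longleftrightarrow>
    (\<forall>\<theta>0 \<theta>1 \<theta>2. (\<Sum>i\<in>exponents d. a i * torus_wave d t0 t1 t2 \<theta>0 \<theta>1 \<theta>2 (\<pi> i)) \<noteq> 0)"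
proof -
  define x y where "x \<theta>0 \<theta>1 \<theta>2 = ((\<theta>1 - \<theta>0) - \<kappa> * (\<theta>2 - \<theta>0)) * sqrt A" and "y \<theta>0 \<theta>2 = (\<theta>2 - \<theta>0) * sqrt Q"
    for \<theta>0 \<theta>1 \<theta>2 :: real
  define ph where "ph \<theta>0 \<theta>1 \<theta>2 = \<theta>0 * real d + ((\<theta>1 - \<theta>0) - \<kappa> * (\<theta>2 - \<theta>0)) * (d * t1) + (\<theta>2 - \<theta>0) * (d * t2 + \<kappa> * (d * t1))"
    for \<theta>0 \<theta>1 \<theta>2 :: real
  have sq: "sqrt A > 0" "sqrt Q > 0" using A_Q_bounds by auto
  have tw: "torus_wave d t0 t1 t2 \<theta>0 \<theta>1 \<theta>2 j = cis (ph \<theta>0 \<theta>1 \<theta>2) * wave (\<lambda>i. sqrt (p i)) chart_x chart_y (Complex (x \<theta>0 \<theta>1 \<theta>2) (y \<theta>0 \<theta>2)) j"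
    if j: "j \<in> exponents d" for j \<theta>0 \<theta>1 \<theta>2
  proof -
    obtain i0 i1 i2 where ij: "j = (i0, i1, i2)" by (cases j) auto
    then have i0: "real d = real i0 + real i1 + real i2" using j by (auto simp: exponents_def)
    have "chart_x j * x \<theta>0 \<theta>1 \<theta>2 = (real i1 - d * t1) * ((\<theta>1 - \<theta>0) - \<kappa> * (\<theta>2 - \<theta>0))"
      using sq by (simp add: chart_x_def x_def ij)
    moreover have "chart_y j * y \<theta>0 \<theta>2 = (real i2 + \<kappa> * real i1 - (d * t2 + \<kappa> * (d * t1))) * (\<theta>2 - \<theta>0)"
      using sq by (simp add: chart_y_def y_def ij)
    ultimately have "\<theta>0 * real i0 + \<theta>1 * real i1 + \<theta>2 * real i2 = ph \<theta>0 \<theta>1 \<theta>2 + (chart_x j * x \<theta>0 \<theta>1 \<theta>2 + chart_y j * y \<theta>0 \<theta>2)"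
      unfolding ph_def by (simp only:) (simp add: i0 algebra_simps)
    then have "cis (\<theta>0 * real i0 + \<theta>1 * real i1 + \<theta>2 * real i2) = cis (ph \<theta>0 \<theta>1 \<theta>2) * cis (chart_x j * x \<theta>0 \<theta>1 \<theta>2 + chart_y j * y \<theta>0 \<theta>2)"
      by (simp only: cis_mult)
    then show ?thesis
      by (simp only: torus_wave_def wave_def ij p_def prod.case complex.sel mult_ac)
  qed
  have eq: "(\<Sum>i\<in>exponents d. a i * torus_wave d t0 t1 t2 \<theta>0 \<theta>1 \<theta>2 (\<pi> i)) = cis (ph \<theta>0 \<theta>1 \<theta>2) *
    wave_field (exponents d) (\<lambda>i. sqrt (p (\<pi> i))) (\<lambda>i. chart_x (\<pi> i)) (\<lambda>i. chart_y (\<pi> i)) a (Complex (x \<theta>0 \<theta>1 \<theta>2) (y \<theta>0 \<theta>2))" for \<theta>0 \<theta>1 \<theta>2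
    unfolding wave_field_def sum_distrib_left using tw assms by (intro sum.cong) (simp_all add: wave_def)
  have surj: "\<exists>\<theta>1 \<theta>2. z = Complex (x 0 \<theta>1 \<theta>2) (y 0 \<theta>2)" for z
  proof (intro exI)
    show "z = Complex (x 0 (Re z / sqrt A + \<kappa> * (Im z / sqrt Q)) (Im z / sqrt Q)) (y 0 (Im z / sqrt Q))"
      using sq by (simp add: x_def y_def complex_eq_iff)
  qed
  show ?thesis unfolding eq using surj by (metis cis_neq_zero mult_eq_0_iff)
qed

text \<open>The lower bound d^e / 3 on d t1 and d t2 plays two parts for large \<open>d\<close>: it
  exceeds 65536, so the chart applies, and exp (- c' d^e) with c' = c / 18 outweighs the factor d^4
  in the correlations.\<close>

lemma no_zero_probability_chart:
  fixes e \<eta> :: real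
  assumes e: "e > 0" and \<eta>: "\<eta> > 0"
  shows "\<exists>d0. \<forall>d\<ge>d0. \<forall>t0 t1 t2 \<pi>. t0 \<ge> 1 / 3 \<longrightarrow> t0 + t1 + t2 = 1 \<longrightarrow> real d * t1 \<ge> real d powr e / 3 \<longrightarrow> real d * t2 \<ge> real d powr e / 3 \<longrightarrow>
     bij_betw \<pi> (exponents d) (exponents d) \<longrightarrow>
     emeasure (gauss_PiM (exponents d)) {a \<in> space (gauss_PiM (exponents d)).
       \<forall>\<theta>0 \<theta>1 \<theta>2. (\<Sum>i\<in>exponents d. a i * torus_wave d t0 t1 t2 \<theta>0 \<theta>1 \<theta>2 (\<pi> i)) \<noteq> 0} \<le> ennreal \<eta>"
proof -
  have ge: "0 \<le> 4 * exp (65536 :: real)" by simp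
  obtain m \<epsilon> where m: "m > 0" "\<epsilon> > 0" and small: "\<And>(I :: (nat \<times> nat \<times> nat) set) r \<alpha> \<beta> z. white_waves I r \<alpha> \<beta> (4 * exp 65536) \<Longrightarrow>
      decorrelated_at I r \<alpha> \<beta> m z \<epsilon> \<Longrightarrow>
      emeasure (gauss_PiM I) {a \<in> space (gauss_PiM I). \<forall>x. wave_field I r \<alpha> \<beta> a x \<noteq> 0} \<le> ennreal \<eta>"
    using no_zero_probability_small[OF \<eta> ge, where 'i = "nat \<times> nat \<times> nat"] by (elim exE conjE) blast
  obtain c where c: "c > 0" "\<And>k k'. k < m \<Longrightarrow> k' < m \<Longrightarrow> k \<noteq> k' \<Longrightarrow> c \<le> 1 - cos (2 * pi * (real k - real k') / real m)"
    using cos_separation by metis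
  define c' where "c' = c / 18"
  have c': "c' > 0" using c by (simp add: c'_def)
  have "(\<lambda>d. 16 * real d ^ 4 * exp (- (real d powr e * c'))) \<longlonglongrightarrow> 0"
    using e c' by real_asymp
  then have ev1: "eventually (\<lambda>d. 16 * real d ^ 4 * exp (- (real d powr e * c')) < \<epsilon>) sequentially"
    by (rule order_tendstoD) (rule m)
  have "filterlim (\<lambda>d. real d powr e) at_top sequentially" using e by real_asymp
  then have ev2: "eventually (\<lambda>d. real d powr e \<ge> 3 * 65536) sequentially" by (simp add: filterlim_at_top)
  have ev3: "eventually (\<lambda>d. d > 0) sequentially" by (rule eventually_gt_at_top)
  obtain d0 where d0: "\<And>d. d \<ge> d0 \<Longrightarrow> 16 * real d ^ 4 * exp (- (real d powr e * c')) < \<epsilon> \<and> real d powr e \<ge> 3 * 65536 \<and> d > 0"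
    using eventually_conj[OF ev1 eventually_conj[OF ev2 ev3]] unfolding eventually_sequentially by blast
  show ?thesis
  proof (intro exI[of _ d0] allI impI)
    fix d t0 t1 t2 \<pi>
    assume d: "d0 \<le> d" and tt: "t0 \<ge> 1 / 3" "t0 + t1 + t2 = 1" "real d * t1 \<ge> real d powr e / 3" "real d * t2 \<ge> real d powr e / 3"
      and \<pi>: "bij_betw \<pi> (exponents d) (exponents d)"
    note dd = d0[OF d]
    have big: "real d * t1 \<ge> 65536" "real d * t2 \<ge> 65536" using tt dd by auto
    then have pos: "0 < real d * t1" "0 < real d * t2" by linarith+
    interpret chart d t0 t1 t2
      by standard (use tt big pos in \<open>simp_all add: zero_less_mult_iff\<close>)
    have "16 * real d ^ 4 * exp (- (d * t1 * c / 6)) \<le> 16 * real d ^ 4 * exp (- (real d powr e * c'))"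
    proof -
      have "(real d powr e / 3) * (c / 6) \<le> (d * t1) * (c / 6)" using tt c by (intro mult_right_mono) auto
      then show ?thesis by (intro mult_left_mono) (auto simp: c'_def)
    qed
    also have "\<dots> \<le> \<epsilon>" using dd by simp
    finally have "decorrelated_at (exponents d) (\<lambda>i. sqrt (p i)) chart_x chart_y m (\<lambda>k. Complex (2 * pi * real k / real m * sqrt A) 0) \<epsilon>"
      using c by (intro decorrelated_chart) auto
    from small[OF white_waves_reindex[OF \<pi> white_waves_chart] decorrelated_at_reindex[OF \<pi> this]]
    show "emeasure (gauss_PiM (exponents d)) {a \<in> space (gauss_PiM (exponents d)).
       \<forall>\<theta>0 \<theta>1 \<theta>2. (\<Sum>i\<in>exponents d. a i * torus_wave d t0 t1 t2 \<theta>0 \<theta>1 \<theta>2 (\<pi> i)) \<noteq> 0} \<le> ennreal \<eta>"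
      by (subst (asm) wave_field_eq_torus_poly) (use \<pi> in \<open>auto dest: bij_betwE\<close>)
  qed
qed

text \<open>Some weight is at least 1/3. A transposition of coordinates, which preserves trinomial
  coefficients, moves it to the first place.\<close>

lemma no_zero_probability_torus:
  fixes e \<eta> :: real
  assumes e: "e > 0" and \<eta>: "\<eta> > 0"
  shows "\<exists>d0. \<forall>d\<ge>d0. \<forall>t0 t1 t2. t0 + t1 + t2 = 1 \<longrightarrow> real d * t0 \<ge> real d powr e / 3 \<longrightarrow> real d * t1 \<ge> real d powr e / 3 \<longrightarrow>
     real d * t2 \<ge> real d powr e / 3 \<longrightarrow>
     emeasure (gauss_PiM (exponents d)) {a \<in> space (gauss_PiM (exponents d)). \<forall>\<theta>0 \<theta>1 \<theta>2. torus_poly d t0 t1 t2 a \<theta>0 \<theta>1 \<theta>2 \<noteq> 0} \<le> ennreal \<eta>"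
proof -
  obtain d0 where d0: "\<And>d t0 t1 t2 \<pi>. d0 \<le> d \<Longrightarrow> t0 \<ge> 1 / 3 \<Longrightarrow> t0 + t1 + t2 = 1 \<Longrightarrow> real d * t1 \<ge> real d powr e / 3 \<Longrightarrow>
     real d * t2 \<ge> real d powr e / 3 \<Longrightarrow> bij_betw \<pi> (exponents d) (exponents d) \<Longrightarrow>
     emeasure (gauss_PiM (exponents d)) {a \<in> space (gauss_PiM (exponents d)).
       \<forall>\<theta>0 \<theta>1 \<theta>2. (\<Sum>i\<in>exponents d. a i * torus_wave d t0 t1 t2 \<theta>0 \<theta>1 \<theta>2 (\<pi> i)) \<noteq> 0} \<le> ennreal \<eta>"
    using no_zero_probability_chart[OF e \<eta>] by (elim exE) blast
  show ?thesis
  proof (intro exI[of _ d0] allI impI)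
    fix d t0 t1 t2
    assume d: "d0 \<le> d" and t: "t0 + t1 + t2 = 1" "real d * t0 \<ge> real d powr e / 3" "real d * t1 \<ge> real d powr e / 3"
      "real d * t2 \<ge> real d powr e / 3"
    have w1: "torus_wave d t1 t0 t2 \<theta>1 \<theta>0 \<theta>2 (i1, i0, i2) = torus_wave d t0 t1 t2 \<theta>0 \<theta>1 \<theta>2 (i0, i1, i2)"
      and w2: "torus_wave d t2 t1 t0 \<theta>2 \<theta>1 \<theta>0 (i2, i1, i0) = torus_wave d t0 t1 t2 \<theta>0 \<theta>1 \<theta>2 (i0, i1, i2)" for \<theta>0 \<theta>1 \<theta>2 i0 i1 i2
      by (simp_all only: torus_wave_def mweight_def trinomial_def prod.case mult_ac add_ac)
    consider "t0 \<ge> 1 / 3" | "t1 \<ge> 1 / 3" | "t2 \<ge> 1 / 3" using t(1) by linarith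
    then show "emeasure (gauss_PiM (exponents d)) {a \<in> space (gauss_PiM (exponents d)). \<forall>\<theta>0 \<theta>1 \<theta>2. torus_poly d t0 t1 t2 a \<theta>0 \<theta>1 \<theta>2 \<noteq> 0} \<le> ennreal \<eta>"
    proof cases
      case 1
      have bij: "bij_betw (\<lambda>i. i) (exponents d) (exponents d)" by (simp add: bij_betw_def)
      from d0[OF d 1 t(1,3,4) bij] show ?thesis unfolding torus_poly_def .
    next
      case 2
      define \<pi> :: "nat \<times> nat \<times> nat \<Rightarrow> nat \<times> nat \<times> nat" where "\<pi> = (\<lambda>(i0, i1, i2). (i1, i0, i2))"
      have bij: "bij_betw \<pi> (exponents d) (exponents d)"
        by (rule bij_betw_byWitness[of _ \<pi>]) (auto simp: \<pi>_def exponents_def)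
      have "(\<Sum>i\<in>exponents d. a i * torus_wave d t1 t0 t2 \<theta>1 \<theta>0 \<theta>2 (\<pi> i)) = torus_poly d t0 t1 t2 a \<theta>0 \<theta>1 \<theta>2" for a \<theta>0 \<theta>1 \<theta>2
        unfolding torus_poly_def by (intro sum.cong refl) (auto simp: \<pi>_def w1)
      then have eq: "{a \<in> space (gauss_PiM (exponents d)). \<forall>\<theta>0 \<theta>1 \<theta>2. (\<Sum>i\<in>exponents d. a i * torus_wave d t1 t0 t2 \<theta>0 \<theta>1 \<theta>2 (\<pi> i)) \<noteq> 0}
        = {a \<in> space (gauss_PiM (exponents d)). \<forall>\<theta>0 \<theta>1 \<theta>2. torus_poly d t0 t1 t2 a \<theta>0 \<theta>1 \<theta>2 \<noteq> 0}" by auto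
      have "t1 + t0 + t2 = 1" using t(1) by simp
      from d0[OF d 2 this t(2,4) bij] show ?thesis unfolding eq .
    next
      case 3
      define \<pi> :: "nat \<times> nat \<times> nat \<Rightarrow> nat \<times> nat \<times> nat" where "\<pi> = (\<lambda>(i0, i1, i2). (i2, i1, i0))"
      have bij: "bij_betw \<pi> (exponents d) (exponents d)"
        by (rule bij_betw_byWitness[of _ \<pi>]) (auto simp: \<pi>_def exponents_def)
      have "(\<Sum>i\<in>exponents d. a i * torus_wave d t2 t1 t0 \<theta>2 \<theta>1 \<theta>0 (\<pi> i)) = torus_poly d t0 t1 t2 a \<theta>0 \<theta>1 \<theta>2" for a \<theta>0 \<theta>1 \<theta>2
        unfolding torus_poly_def by (intro sum.cong refl) (auto simp: \<pi>_def w2)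
      then have eq: "{a \<in> space (gauss_PiM (exponents d)). \<forall>\<theta>0 \<theta>1 \<theta>2. (\<Sum>i\<in>exponents d. a i * torus_wave d t2 t1 t0 \<theta>0 \<theta>1 \<theta>2 (\<pi> i)) \<noteq> 0}
        = {a \<in> space (gauss_PiM (exponents d)). \<forall>\<theta>0 \<theta>1 \<theta>2. torus_poly d t0 t1 t2 a \<theta>0 \<theta>1 \<theta>2 \<noteq> 0}" by auto
      have "t2 + t1 + t0 = 1" using t(1) by simp
      from d0[OF d 3 this t(3,2) bij] show ?thesis unfolding eq .
    qed
  qed
qed

text \<open>\<open>s1\<close> and \<open>s2\<close> are free because recentring the frequencies only
  changes a global phase. The means d t1, d t2 serve the covariance computation, and 0 serves the
  reduction to two angles.\<close>

lemma torus_poly_eq_wave_field: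
  "torus_poly d t0 t1 t2 a \<theta>0 \<theta>1 \<theta>2 = cis (\<theta>0 * real d + (\<theta>1 - \<theta>0) * s1 + (\<theta>2 - \<theta>0) * s2) *
    wave_field (exponents d) (\<lambda>i. sqrt (mweight d t0 t1 t2 i)) (\<lambda>i. real (fst (snd i)) - s1) (\<lambda>i. real (snd (snd i)) - s2) a
      (Complex (\<theta>1 - \<theta>0) (\<theta>2 - \<theta>0))"
  unfolding torus_poly_def wave_field_def sum_distrib_left
proof (rule sum.cong[OF refl], clarify)
  fix i0 i1 i2 assume "(i0, i1, i2) \<in> exponents d"
  then have d: "real d = real i0 + real i1 + real i2" by (auto simp: exponents_def)
  have "\<theta>0 * real i0 + \<theta>1 * real i1 + \<theta>2 * real i2 =
    (\<theta>0 * real d + (\<theta>1 - \<theta>0) * s1 + (\<theta>2 - \<theta>0) * s2) + ((real i1 - s1) * (\<theta>1 - \<theta>0) + (real i2 - s2) * (\<theta>2 - \<theta>0))"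
    unfolding d by (simp add: algebra_simps)
  then have "cis (\<theta>0 * real i0 + \<theta>1 * real i1 + \<theta>2 * real i2) =
    cis (\<theta>0 * real d + (\<theta>1 - \<theta>0) * s1 + (\<theta>2 - \<theta>0) * s2) * cis ((real i1 - s1) * (\<theta>1 - \<theta>0) + (real i2 - s2) * (\<theta>2 - \<theta>0))"
    by (simp only: cis_mult)
  then show "a (i0, i1, i2) * torus_wave d t0 t1 t2 \<theta>0 \<theta>1 \<theta>2 (i0, i1, i2) =
    cis (\<theta>0 * real d + (\<theta>1 - \<theta>0) * s1 + (\<theta>2 - \<theta>0) * s2) * (a (i0, i1, i2) * wave (\<lambda>i. sqrt (mweight d t0 t1 t2 i))
      (\<lambda>i. real (fst (snd i)) - s1) (\<lambda>i. real (snd (snd i)) - s2) (Complex (\<theta>1 - \<theta>0) (\<theta>2 - \<theta>0)) (i0, i1, i2))"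
    by (simp only: torus_wave_def wave_def prod.case fst_conv snd_conv complex.sel mult_ac)
qed

lemma torus_poly_zero_iff:
  "(\<exists>\<theta>0 \<theta>1 \<theta>2. torus_poly d t0 t1 t2 a \<theta>0 \<theta>1 \<theta>2 = 0) \<longleftrightarrow>
   (\<exists>z. wave_field (exponents d) (\<lambda>i. sqrt (mweight d t0 t1 t2 i)) (\<lambda>i. real (fst (snd i)) - s1) (\<lambda>i. real (snd (snd i)) - s2) a z = 0)"
  (is "_ \<longleftrightarrow> (\<exists>z. ?F z = 0)")
proof -
  have eq: "torus_poly d t0 t1 t2 a \<theta>0 \<theta>1 \<theta>2 = 0 \<longleftrightarrow> ?F (Complex (\<theta>1 - \<theta>0) (\<theta>2 - \<theta>0)) = 0" for \<theta>0 \<theta>1 \<theta>2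
    unfolding torus_poly_eq_wave_field[where ?s1.0 = s1 and ?s2.0 = s2] by simp
  show ?thesis
  proof
    assume "\<exists>z. ?F z = 0"
    then obtain z where "?F z = 0" by blast
    then have "torus_poly d t0 t1 t2 a 0 (Re z) (Im z) = 0" unfolding eq by simp
    then show "\<exists>\<theta>0 \<theta>1 \<theta>2. torus_poly d t0 t1 t2 a \<theta>0 \<theta>1 \<theta>2 = 0" by blast
  qed (use eq in blast)
qed

text \<open>The covariance matrix of the last two indices of the trinomial law has determinant d^2
  t0 t1 t2. The frequencies become integers after adding back their means, as the bound for periodic
  fields requires.\<close>

lemma torus_zero_probability_le:
  assumes d: "d > 0" and t: "t0 > 0" "t1 > 0" "t2 > 0" "t0 + t1 + t2 = 1"
  shows "{a \<in> space (gauss_PiM (exponents d)). \<exists>\<theta>0 \<theta>1 \<theta>2. torus_poly d t0 t1 t2 a \<theta>0 \<theta>1 \<theta>2 = 0} \<in> sets (gauss_PiM (exponents d))"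
    and "emeasure (gauss_PiM (exponents d)) {a \<in> space (gauss_PiM (exponents d)). \<exists>\<theta>0 \<theta>1 \<theta>2. torus_poly d t0 t1 t2 a \<theta>0 \<theta>1 \<theta>2 = 0}
      \<le> ennreal (pi * (real d * sqrt (t0 * t1 * t2)))"
proof -
  define p where "p = mweight d t0 t1 t2"
  define \<alpha> \<beta> :: "nat \<times> nat \<times> nat \<Rightarrow> real" where "\<alpha> i = real (fst (snd i)) - d * t1" and "\<beta> i = real (snd (snd i)) - d * t2" for i
  have p_nonneg: "p i \<ge> 0" for i unfolding p_def using t by (intro mweight_nonneg) auto
  have r2: "(sqrt (p i))\<^sup>2 = p i" for i using p_nonneg by simp
  have d1: "real (d - 1) = real d - 1" using d by (simp add: of_nat_diff)
  have quad: "(\<Sum>i\<in>exponents d. p i * (c0 + c1 * real (fst (snd i)) + c2 * real (snd (snd i)) + c11 * (real (fst (snd i)) * real (fst (snd i)))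
     + c12 * (real (fst (snd i)) * real (snd (snd i))) + c22 * (real (snd (snd i)) * real (snd (snd i)))))
    = c0 + c1 * (d * t1) + c2 * (d * t2) + c11 * (d * (real d - 1) * t1\<^sup>2 + d * t1) + c12 * (d * (real d - 1) * t1 * t2)
      + c22 * (d * (real d - 1) * t2\<^sup>2 + d * t2)" for c0 c1 c2 c11 c12 c22
    using mweight_quadratic[OF t(4), of d c0 c1 c2 c11 c12 c22] unfolding d1 by (simp add: p_def case_prod_unfold)
  define A B C where "A = d * t1 * (1 - t1)" and "B = - (d * t1 * t2)" and "C = d * t2 * (1 - t2)"
  have m0: "(\<Sum>i\<in>exponents d. p i) = 1" using quad[of 1 0 0 0 0 0] by simp
  have m1: "(\<Sum>i\<in>exponents d. p i * \<alpha> i) = 0"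
    using quad[of "- (d * t1)" 1 0 0 0 0] by (simp add: \<alpha>_def)
  have m2: "(\<Sum>i\<in>exponents d. p i * \<beta> i) = 0"
    using quad[of "- (d * t2)" 0 1 0 0 0] by (simp add: \<beta>_def)
  have m11: "(\<Sum>i\<in>exponents d. p i * (\<alpha> i)\<^sup>2) = A"
    using quad[of "(d * t1) * (d * t1)" "- 2 * (d * t1)" 0 1 0 0]
    by (simp add: \<alpha>_def A_def power2_eq_square algebra_simps)
  have m12: "(\<Sum>i\<in>exponents d. p i * (\<alpha> i * \<beta> i)) = B"
    using quad[of "(d * t1) * (d * t2)" "- (d * t2)" "- (d * t1)" 0 1 0]
    by (simp add: \<alpha>_def \<beta>_def B_def power2_eq_square algebra_simps)
  have m22: "(\<Sum>i\<in>exponents d. p i * (\<beta> i)\<^sup>2) = C"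
    using quad[of "(d * t2) * (d * t2)" 0 "- 2 * (d * t2)" 0 0 1]
    by (simp add: \<beta>_def C_def power2_eq_square algebra_simps)
  have t0: "t0 = 1 - t1 - t2" using t(4) by simp
  have det: "A * C - B\<^sup>2 = (real d)\<^sup>2 * (t0 * t1 * t2)"
    unfolding t0 A_def B_def C_def by (simp add: power2_eq_square algebra_simps)
  have "1 - t1 > 0" using t by simp
  then have A: "A > 0" unfolding A_def using d t by (intro mult_pos_pos) auto
  have D: "A * C - B\<^sup>2 > 0" unfolding det using d t by simp
  interpret wave_covariance "exponents d" "\<lambda>i. sqrt (p i)" \<alpha> \<beta> A B C
    by standard (simp_all only: r2 finite_exponents m0 m1 m2 m11 m12 m22 A D)
  have int: "\<alpha> i + d * t1 \<in> \<int>" "\<beta> i + d * t2 \<in> \<int>" for i by (simp_all add: \<alpha>_def \<beta>_def)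
  have eq: "{a \<in> space (gauss_PiM (exponents d)). \<exists>\<theta>0 \<theta>1 \<theta>2. torus_poly d t0 t1 t2 a \<theta>0 \<theta>1 \<theta>2 = 0} =
     {a \<in> space (gauss_PiM (exponents d)). \<exists>z. wave_field (exponents d) (\<lambda>i. sqrt (p i)) \<alpha> \<beta> a z = 0}"
    unfolding torus_poly_zero_iff[where ?s1.0 = "d * t1" and ?s2.0 = "d * t2"] p_def \<alpha>_def[abs_def] \<beta>_def[abs_def] ..
  show "{a \<in> space (gauss_PiM (exponents d)). \<exists>\<theta>0 \<theta>1 \<theta>2. torus_poly d t0 t1 t2 a \<theta>0 \<theta>1 \<theta>2 = 0} \<in> sets (gauss_PiM (exponents d))"
    unfolding eq by (rule zero_probability_le(1)[OF int])
  have "sqrt (A * C - B\<^sup>2) = real d * sqrt (t0 * t1 * t2)" unfolding det by (simp add: real_sqrt_mult)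
  then show "emeasure (gauss_PiM (exponents d)) {a \<in> space (gauss_PiM (exponents d)). \<exists>\<theta>0 \<theta>1 \<theta>2. torus_poly d t0 t1 t2 a \<theta>0 \<theta>1 \<theta>2 = 0}
      \<le> ennreal (pi * (real d * sqrt (t0 * t1 * t2)))"
    unfolding eq using zero_probability_le(2)[OF int] by simp
qed

section \<open>The expected area as an integral of zero probabilities\<close>

lemma gauss_PiM_eq_density:
  fixes I :: "'i set"
  assumes I: "finite I"
  shows "gauss_PiM I = density (\<Pi>\<^sub>M i\<in>I. lborel) (\<lambda>a. \<Prod>i\<in>I. ennreal (exp (- (cmod (a i))\<^sup>2) / pi))"
    (is "_ = density ?L (\<lambda>a. \<Prod>i\<in>I. ?g (a i))")
proof -
  interpret L: product_sigma_finite "\<lambda>_::'i. lborel :: complex measure" by standard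
  have [measurable]: "?g \<in> borel_measurable borel" by measurable
  have S: "sets ?L = sets (gauss_PiM I)" by (rule sets_PiM_cong) auto
  show ?thesis
  proof (rule gauss_PiM.PiM_eqI[OF I, symmetric])
    show "sets (density ?L (\<lambda>a. \<Prod>i\<in>I. ?g (a i))) = sets (gauss_PiM I)" using S by simp
    fix X :: "'i \<Rightarrow> complex set" assume "\<And>i. i \<in> I \<Longrightarrow> X i \<in> sets cgauss"
    then have X[measurable]: "\<And>i. i \<in> I \<Longrightarrow> X i \<in> sets borel" by simp
    have PX: "Pi\<^sub>E I X \<in> sets ?L" using I by (intro sets_PiM_I_finite) auto
    have "emeasure (density ?L (\<lambda>a. \<Prod>i\<in>I. ?g (a i))) (Pi\<^sub>E I X) =
      (\<integral>\<^sup>+a. (\<Prod>i\<in>I. ?g (a i)) * indicator (Pi\<^sub>E I X) a \<partial>?L)"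
    proof (rule emeasure_density[OF _ PX])
      show "(\<lambda>a. \<Prod>i\<in>I. ?g (a i)) \<in> borel_measurable ?L" by measurable
    qed
    also have "\<dots> = (\<integral>\<^sup>+a. (\<Prod>i\<in>I. ?g (a i) * indicator (X i) (a i)) \<partial>?L)"
    proof (rule nn_integral_cong)
      fix a assume a: "a \<in> space ?L"
      have "indicator (Pi\<^sub>E I X) a = (\<Prod>i\<in>I. indicator (X i) (a i) :: ennreal)"
      proof (cases "a \<in> Pi\<^sub>E I X")
        case False
        then obtain i where "i \<in> I" "a i \<notin> X i" using a by (auto simp: space_PiM PiE_def Pi_def)
        then have "(\<Prod>i\<in>I. indicator (X i) (a i) :: ennreal) = 0"
          using I by (intro prod_zero) (auto intro!: bexI[of _ i])
        then show ?thesis using False by simp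
      qed (auto simp: PiE_def Pi_def)
      then show "(\<Prod>i\<in>I. ?g (a i)) * indicator (Pi\<^sub>E I X) a = (\<Prod>i\<in>I. ?g (a i) * indicator (X i) (a i))"
        by (simp add: prod.distrib)
    qed
    also have "\<dots> = (\<Prod>i\<in>I. \<integral>\<^sup>+z. ?g z * indicator (X i) z \<partial>lborel)"
      using I by (intro L.product_nn_integral_prod) auto
    also have "\<dots> = (\<Prod>i\<in>I. emeasure cgauss (X i))"
      unfolding cgauss_def using X by (intro prod.cong refl emeasure_density[symmetric]) auto
    finally show "emeasure (density ?L (\<lambda>a. \<Prod>i\<in>I. ?g (a i))) (Pi\<^sub>E I X) = (\<Prod>i\<in>I. emeasure cgauss (X i))" .
  qed
qed

section \<open>Random polynomials in orthonormal coordinates\<close>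

lemma monomial_norm2_pos: "monomial_norm2 d i > 0"
  by (cases i) (auto simp: monomial_norm2_def)

text \<open>The isometry of \<open>hpoly_lborel\<close>: from coordinates in the basis of normalized
  monomials to coefficients.\<close>

definition monomial_coords :: "nat \<Rightarrow> hpoly \<Rightarrow> hpoly" where
  "monomial_coords d a = (\<lambda>i\<in>exponents d. a i / complex_of_real (sqrt (monomial_norm2 d i)))"

lemma hpoly_norm_monomial_coords: "(hpoly_norm d (monomial_coords d a))\<^sup>2 = (\<Sum>i\<in>exponents d. (cmod (a i))\<^sup>2)"
proof -
  have eq: "hpoly_inner d (monomial_coords d a) (monomial_coords d a) = complex_of_real (\<Sum>i\<in>exponents d. (cmod (a i))\<^sup>2)"
    unfolding hpoly_inner_def of_real_sum
  proof (rule sum.cong[OF refl])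
    fix i assume i: "i \<in> exponents d"
    have n: "monomial_norm2 d i > 0" by (rule monomial_norm2_pos)
    have "complex_of_real (sqrt (monomial_norm2 d i)) * complex_of_real (sqrt (monomial_norm2 d i)) = complex_of_real (monomial_norm2 d i)"
      using n by (simp flip: of_real_mult)
    moreover have "complex_of_real (monomial_norm2 d i) \<noteq> 0" using n by simp
    ultimately show "monomial_coords d a i * cnj (monomial_coords d a i) * complex_of_real (monomial_norm2 d i) = complex_of_real ((cmod (a i))\<^sup>2)"
      using i by (simp add: monomial_coords_def flip: complex_norm_square)
  qed
  show ?thesis unfolding hpoly_norm_def eq by (simp add: sum_nonneg)
qed

lemma measurable_monomial_coords[measurable]:
  "monomial_coords d \<in> (\<Pi>\<^sub>M i\<in>exponents d. lborel) \<rightarrow>\<^sub>M (\<Pi>\<^sub>M i\<in>exponents d. borel)"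
  "monomial_coords d \<in> gauss_PiM (exponents d) \<rightarrow>\<^sub>M (\<Pi>\<^sub>M i\<in>exponents d. borel)"
  unfolding monomial_coords_def[abs_def] by measurable

text \<open>The density is a function of the norm, which in orthonormal coordinates is a sum of
  squares, so it splits into one factor per monomial; the count of exponents matches the power of
  pi.\<close>

lemma hpoly_gaussian_eq_distr:
  "hpoly_gaussian d = distr (gauss_PiM (exponents d)) (\<Pi>\<^sub>M i\<in>exponents d. borel) (monomial_coords d)"
proof -
  let ?L = "\<Pi>\<^sub>M i\<in>exponents d. (lborel :: complex measure)" and ?B = "\<Pi>\<^sub>M i\<in>exponents d. (borel :: complex measure)"
  let ?g = "\<lambda>P. ennreal (exp (- (hpoly_norm d P)\<^sup>2) / pi ^ hpoly_dim d)"
  have meas: "?g \<in> borel_measurable ?B"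
  proof -
    have "(\<lambda>P. P i * cnj (P i) * complex_of_real (monomial_norm2 d i)) \<in> borel_measurable ?B" if "i \<in> exponents d" for i
      using that by (intro borel_measurable_times borel_measurable_const measurable_component_singleton
        measurable_compose[OF _ borel_measurable_continuous_onI[OF continuous_on_cnj[OF continuous_on_id]]])
    then have [measurable]: "(\<lambda>P. hpoly_inner d P P) \<in> borel_measurable ?B"
      unfolding hpoly_inner_def by (rule borel_measurable_sum)
    have "(\<lambda>P. hpoly_norm d P) \<in> borel_measurable ?B" unfolding hpoly_norm_def by measurable
    then show ?thesis by measurable
  qed
  have "hpoly_gaussian d = density (distr ?L ?B (monomial_coords d)) ?g"
    unfolding hpoly_gaussian_def hpoly_lborel_def monomial_coords_def[abs_def] ..
  also have "\<dots> = distr (density ?L (\<lambda>a. ?g (monomial_coords d a))) ?B (monomial_coords d)"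
    by (rule density_distr[OF meas measurable_monomial_coords(1)])
  also have "density ?L (\<lambda>a. ?g (monomial_coords d a)) = gauss_PiM (exponents d)"
  proof -
    have "?g (monomial_coords d a) = (\<Prod>i\<in>exponents d. ennreal (exp (- (cmod (a i))\<^sup>2) / pi))" for a
    proof -
      have "exp (- (hpoly_norm d (monomial_coords d a))\<^sup>2) / pi ^ hpoly_dim d = (\<Prod>i\<in>exponents d. exp (- (cmod (a i))\<^sup>2) / pi)"
        unfolding hpoly_norm_monomial_coords hpoly_dim_def card_exponents[symmetric]
        by (simp add: prod_dividef exp_sum sum_negf[symmetric])
      then show ?thesis by (simp only: prod_ennreal[OF divide_nonneg_pos[OF exp_ge_zero pi_gt_zero]])
    qed
    then show ?thesis unfolding gauss_PiM_eq_density[OF finite_exponents] by simp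
  qed
  finally show ?thesis .
qed

section \<open>The amoeba as a zero event\<close>

lemma hpoly_eval_scale:
  "hpoly_eval d P (t * x0, t * x1, t * x2) = t ^ d * hpoly_eval d P (x0, x1, x2)"
  unfolding hpoly_eval_def prod.case sum_distrib_left
  by (rule sum.cong[OF refl]) (auto simp: exponents_def power_mult_distrib power_add)

lemma affine_chart_in_zero_locus_iff:
  "affine_chart (z1, z2) \<in> zero_locus d P \<longleftrightarrow> hpoly_eval d P (1, z1, z2) = 0"
proof -
  have C: "affine_chart (z1, z2) \<in> CP2"
    unfolding affine_chart_def CP2_def prod.case by (intro CollectI exI[of _ "(1, z1, z2)"]) simp
  have m: "(1, z1, z2) \<in> affine_chart (z1, z2)"
    unfolding affine_chart_def proj_point_def prod.case by (intro CollectI exI[of _ 1]) simp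
  have "hpoly_eval d P x = 0" if "x \<in> affine_chart (z1, z2)" "hpoly_eval d P (1, z1, z2) = 0" for x
    using that unfolding affine_chart_def proj_point_def prod.case by (auto simp: hpoly_eval_scale simp del: mult_1_right)
  then show ?thesis using C m by (auto simp: zero_locus_def)
qed

text \<open>Restricting the arguments to a compact square is what makes the event of a zero
  measurable, jointly in the point and the polynomial.\<close>

lemma amoeba_iff:
  "x \<in> amoeba d P \<longleftrightarrow> (\<exists>\<theta>\<in>cbox (0, 0) (2 * pi, 2 * pi).
     hpoly_eval d P (1, complex_of_real (exp (fst x)) * cis (fst \<theta>), complex_of_real (exp (snd x)) * cis (snd \<theta>)) = 0)"
proof
  assume "x \<in> amoeba d P"
  then obtain z1 z2 where z: "z1 \<noteq> 0" "z2 \<noteq> 0" "hpoly_eval d P (1, z1, z2) = 0" and x: "x = (ln (cmod z1), ln (cmod z2))"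
    unfolding amoeba_def affine_chart_in_zero_locus_iff by (auto simp: Log_map_def)
  have pol: "z = complex_of_real (exp (ln (cmod z))) * cis (Arg2pi z)" if "z \<noteq> 0" for z :: complex
    using that Arg2pi_eq[of z] by (simp add: cis_conv_exp exp_of_real)
  have "(Arg2pi z1, Arg2pi z2) \<in> cbox (0, 0) (2 * pi, 2 * pi)"
    using Arg2pi_ge_0[of z1] Arg2pi_ge_0[of z2] Arg2pi_lt_2pi[of z1] Arg2pi_lt_2pi[of z2] by (simp add: cbox_Pair_eq)
  moreover have "hpoly_eval d P (1, complex_of_real (exp (fst x)) * cis (Arg2pi z1), complex_of_real (exp (snd x)) * cis (Arg2pi z2)) = 0"
    using z(3) pol[OF z(1)] pol[OF z(2)] unfolding x fst_conv snd_conv by metis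
  ultimately show "\<exists>\<theta>\<in>cbox (0, 0) (2 * pi, 2 * pi). hpoly_eval d P (1, complex_of_real (exp (fst x)) * cis (fst \<theta>), complex_of_real (exp (snd x)) * cis (snd \<theta>)) = 0"
    by (metis fst_conv snd_conv)
next
  assume "\<exists>\<theta>\<in>cbox (0, 0) (2 * pi, 2 * pi). hpoly_eval d P (1, complex_of_real (exp (fst x)) * cis (fst \<theta>), complex_of_real (exp (snd x)) * cis (snd \<theta>)) = 0"
  then obtain \<theta> where e: "hpoly_eval d P (1, complex_of_real (exp (fst x)) * cis (fst \<theta>), complex_of_real (exp (snd x)) * cis (snd \<theta>)) = 0" by blast
  have "x = Log_map (complex_of_real (exp (fst x)) * cis (fst \<theta>), complex_of_real (exp (snd x)) * cis (snd \<theta>))"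
    by (cases x) (simp add: Log_map_def norm_mult)
  then show "x \<in> amoeba d P"
    unfolding amoeba_def affine_chart_in_zero_locus_iff using e by (intro image_eqI) auto
qed

lemma amoeba_joint_measurable:
  "{q \<in> space (lborel \<Otimes>\<^sub>M (\<Pi>\<^sub>M i\<in>exponents d. borel)). fst q \<in> amoeba d (snd q)} \<in> sets (lborel \<Otimes>\<^sub>M (\<Pi>\<^sub>M i\<in>exponents d. borel))"
  unfolding amoeba_iff
proof (rule measurable_ex_zero_compact)
  show "compact (cbox (0, 0) (2 * pi, 2 * pi) :: (real \<times> real) set)" by (rule compact_cbox)
  show "continuous_on (cbox (0, 0) (2 * pi, 2 * pi)) (\<lambda>\<theta>. hpoly_eval d (snd q)
     (1, complex_of_real (exp (fst (fst q))) * cis (fst \<theta>), complex_of_real (exp (snd (fst q))) * cis (snd \<theta>)))" for q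
    unfolding hpoly_eval_def prod.case case_prod_unfold by (intro continuous_intros)
  have m1: "(\<lambda>q. fst (fst q)) \<in> borel_measurable (lborel \<Otimes>\<^sub>M (\<Pi>\<^sub>M i\<in>exponents d. borel))"
    and m2: "(\<lambda>q. snd (fst q)) \<in> borel_measurable (lborel \<Otimes>\<^sub>M (\<Pi>\<^sub>M i\<in>exponents d. borel))"
    by (rule measurable_compose[OF measurable_fst], simp add: borel_measurable_continuous_onI continuous_on_fst continuous_on_snd continuous_on_id)+
  have ex: "(\<lambda>y. complex_of_real (exp y)) \<in> borel_measurable borel"
    by (intro borel_measurable_continuous_onI continuous_intros)
  note e = measurable_compose[OF m1 ex] measurable_compose[OF m2 ex]
  show "(\<lambda>q. hpoly_eval d (snd q) (1, complex_of_real (exp (fst (fst q))) * cis (fst \<theta>), complex_of_real (exp (snd (fst q))) * cis (snd \<theta>)))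
     \<in> borel_measurable (lborel \<Otimes>\<^sub>M (\<Pi>\<^sub>M i\<in>exponents d. borel))" for \<theta>
    unfolding hpoly_eval_def case_prod_unfold fst_conv snd_conv prod.collapse
    by (intro borel_measurable_sum borel_measurable_times borel_measurable_power borel_measurable_const e
      measurable_compose[OF measurable_snd measurable_component_singleton])
qed

text \<open>With \<open>moment1\<close> and \<open>moment2\<close>, the moment map of the torus
  action on the projective plane, in logarithmic coordinates; its values are the trinomial
  weights.\<close>

definition "moment0 x = 1 / (1 + exp (2 * fst x) + exp (2 * snd x))" for x :: "real \<times> real"
definition "moment1 x = exp (2 * fst x) * moment0 x" for x :: "real \<times> real"
definition "moment2 x = exp (2 * snd x) * moment0 x" for x :: "real \<times> real"

lemma moment_simplex: "moment0 x > 0" "moment1 x > 0" "moment2 x > 0" "moment0 x + moment1 x + moment2 x = 1"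
proof -
  have "1 + exp (2 * fst x) + exp (2 * snd x) > 0" by (simp add: add_pos_pos)
  then show "moment0 x > 0" "moment1 x > 0" "moment2 x > 0" "moment0 x + moment1 x + moment2 x = 1"
    by (simp_all add: moment0_def moment1_def moment2_def add_divide_distrib[symmetric])
qed

text \<open>Up to the factor 2 / ((d + 1) (d + 2)), squared monomial norms are the reciprocals of
  trinomial coefficients, and by homogeneity the point can be rescaled by the square root of
  \<open>moment0\<close>. Both corrections are one positive constant, common to all
  monomials.\<close>

lemma hpoly_eval_monomial_coords:
  "\<exists>c>0. \<forall>a \<theta>1 \<theta>2. torus_poly d (moment0 x) (moment1 x) (moment2 x) a 0 \<theta>1 \<theta>2 =
     complex_of_real c * hpoly_eval d (monomial_coords d a) (1, complex_of_real (exp (fst x)) * cis \<theta>1, complex_of_real (exp (snd x)) * cis \<theta>2)"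
proof -
  define u where "u = sqrt (moment0 x)"
  define K where "K = sqrt (2 / (real (d + 1) * real (d + 2)))"
  have u: "u > 0" and K: "K > 0" using moment_simplex(1)[of x] by (auto simp: u_def K_def)
  have s1: "sqrt (moment1 x) = exp (fst x) * u" "sqrt (moment2 x) = exp (snd x) * u"
  proof -
    have e: "exp (2 * y) = (exp y)\<^sup>2" for y :: real by (simp add: power2_eq_square exp_add[symmetric])
    show "sqrt (moment1 x) = exp (fst x) * u" "sqrt (moment2 x) = exp (snd x) * u"
      unfolding moment1_def moment2_def e real_sqrt_mult by (simp_all add: u_def)
  qed
  have sm: "sqrt (mweight d (moment0 x) (moment1 x) (moment2 x) (i0, i1, i2)) =
     K * u ^ d * (1 / sqrt (monomial_norm2 d (i0, i1, i2)) * exp (fst x) ^ i1 * exp (snd x) ^ i2)"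
    if "(i0, i1, i2) \<in> exponents d" for i0 i1 i2
  proof -
    have d: "d = i0 + i1 + i2" using that by (simp add: exponents_def)
    have "trinomial d (i0, i1, i2) = 2 / (real (d + 1) * real (d + 2)) * (1 / monomial_norm2 d (i0, i1, i2))"
    proof -
      have "(fact (d + 2) :: real) = real (d + 1) * real (d + 2) * fact d" by (simp add: algebra_simps)
      then have "monomial_norm2 d (i0, i1, i2) = 2 / (real (d + 1) * real (d + 2)) * (fact i0 * fact i1 * fact i2 / fact d)"
        by (simp only: monomial_norm2_def prod.case) (simp add: mult_ac)
      then show ?thesis by (simp only: trinomial_def prod.case) simp
    qed
    then have "sqrt (trinomial d (i0, i1, i2)) = K * (1 / sqrt (monomial_norm2 d (i0, i1, i2)))"
      unfolding K_def by (simp only: real_sqrt_mult real_sqrt_divide real_sqrt_one)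
    moreover have "sqrt (moment0 x ^ i0 * moment1 x ^ i1 * moment2 x ^ i2) = u ^ d * (exp (fst x) ^ i1 * exp (snd x) ^ i2)"
      unfolding real_sqrt_mult real_sqrt_power s1 u_def[symmetric] d by (simp add: power_add power_mult_distrib)
    ultimately show ?thesis unfolding mweight_def prod.case real_sqrt_mult[of "trinomial d _"] by simp
  qed
  show ?thesis
  proof (intro exI[of _ "K * u ^ d"] conjI allI)
    show "K * u ^ d > 0" using u K by simp
    fix a \<theta>1 \<theta>2
    show "torus_poly d (moment0 x) (moment1 x) (moment2 x) a 0 \<theta>1 \<theta>2 =
     complex_of_real (K * u ^ d) * hpoly_eval d (monomial_coords d a) (1, complex_of_real (exp (fst x)) * cis \<theta>1, complex_of_real (exp (snd x)) * cis \<theta>2)"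
      unfolding torus_poly_def hpoly_eval_def prod.case sum_distrib_left
    proof (rule sum.cong[OF refl], clarify)
      fix i0 i1 i2 assume i: "(i0, i1, i2) \<in> exponents d"
      have c: "cis (0 * real i0 + \<theta>1 * real i1 + \<theta>2 * real i2) = cis \<theta>1 ^ i1 * cis \<theta>2 ^ i2"
        by (simp add: Complex.DeMoivre cis_mult mult.commute)
      show "a (i0, i1, i2) * torus_wave d (moment0 x) (moment1 x) (moment2 x) 0 \<theta>1 \<theta>2 (i0, i1, i2) =
        complex_of_real (K * u ^ d) * (monomial_coords d a (i0, i1, i2) * 1 ^ i0 * (complex_of_real (exp (fst x)) * cis \<theta>1) ^ i1
         * (complex_of_real (exp (snd x)) * cis \<theta>2) ^ i2)"
        unfolding torus_wave_def prod.case sm[OF i] c using i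
        by (simp add: monomial_coords_def power_mult_distrib)
    qed
  qed
qed

lemma amoeba_monomial_coords_iff:
  "x \<in> amoeba d (monomial_coords d a) \<longleftrightarrow>
    (\<exists>\<theta>0 \<theta>1 \<theta>2. torus_poly d (moment0 x) (moment1 x) (moment2 x) a \<theta>0 \<theta>1 \<theta>2 = 0)"
proof -
  obtain c where c: "c > 0" and eq: "\<And>\<theta>1 \<theta>2. torus_poly d (moment0 x) (moment1 x) (moment2 x) a 0 \<theta>1 \<theta>2 =
     complex_of_real c * hpoly_eval d (monomial_coords d a) (1, complex_of_real (exp (fst x)) * cis \<theta>1, complex_of_real (exp (snd x)) * cis \<theta>2)"
    using hpoly_eval_monomial_coords[of d x] by blast
  have "x = Log_map (complex_of_real (exp (fst x)) * cis \<theta>1, complex_of_real (exp (snd x)) * cis \<theta>2)" for \<theta>1 \<theta>2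
    by (cases x) (simp add: Log_map_def norm_mult)
  then have 1: "x \<in> amoeba d (monomial_coords d a)" if "torus_poly d (moment0 x) (moment1 x) (moment2 x) a 0 \<theta>1 \<theta>2 = 0" for \<theta>1 \<theta>2
    unfolding amoeba_def affine_chart_in_zero_locus_iff using that c
    by (intro image_eqI[of _ _ "(complex_of_real (exp (fst x)) * cis \<theta>1, complex_of_real (exp (snd x)) * cis \<theta>2)"]) (auto simp: eq)
  have 2: "torus_poly d (moment0 x) (moment1 x) (moment2 x) a 0 (\<theta>1 - \<theta>0) (\<theta>2 - \<theta>0) = 0"
    if "torus_poly d (moment0 x) (moment1 x) (moment2 x) a \<theta>0 \<theta>1 \<theta>2 = 0" for \<theta>0 \<theta>1 \<theta>2
    using that unfolding torus_poly_eq_wave_field[where ?s1.0 = 0 and ?s2.0 = 0] by simp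
  show ?thesis
  proof
    assume "x \<in> amoeba d (monomial_coords d a)"
    then obtain \<theta> where "hpoly_eval d (monomial_coords d a) (1, complex_of_real (exp (fst x)) * cis (fst \<theta>), complex_of_real (exp (snd x)) * cis (snd \<theta>)) = 0"
      unfolding amoeba_iff by blast
    then have "torus_poly d (moment0 x) (moment1 x) (moment2 x) a 0 (fst \<theta>) (snd \<theta>) = 0" unfolding eq by simp
    then show "\<exists>\<theta>0 \<theta>1 \<theta>2. torus_poly d (moment0 x) (moment1 x) (moment2 x) a \<theta>0 \<theta>1 \<theta>2 = 0" by blast
  qed (use 1 2 in blast)
qed

theorem expected_amoeba_area_eq:
  "expected_amoeba_area d = (\<integral>\<^sup>+x. emeasure (gauss_PiM (exponents d)) {a \<in> space (gauss_PiM (exponents d)).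
     \<exists>\<theta>0 \<theta>1 \<theta>2. torus_poly d (moment0 x) (moment1 x) (moment2 x) a \<theta>0 \<theta>1 \<theta>2 = 0} \<partial>lborel)"
proof -
  let ?B = "\<Pi>\<^sub>M i\<in>exponents d. (borel :: complex measure)" and ?G = "gauss_PiM (exponents d)"
  let ?S = "{q \<in> space (lborel \<Otimes>\<^sub>M ?B). fst q \<in> amoeba d (snd q)}"
  have S[measurable]: "?S \<in> sets (lborel \<Otimes>\<^sub>M ?B)" by (rule amoeba_joint_measurable)
  interpret H: prob_space "hpoly_gaussian d"
    unfolding hpoly_gaussian_eq_distr
    by (rule prob_space.prob_space_distr[OF prob_space_gauss_PiM measurable_monomial_coords(2)])
  have sH[measurable_cong]: "sets (hpoly_gaussian d) = sets ?B" by (simp add: hpoly_gaussian_eq_distr)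
  have spH: "space (hpoly_gaussian d) = space ?B" by (rule sets_eq_imp_space_eq[OF sH])
  interpret P: pair_sigma_finite "lborel :: (real \<times> real) measure" "hpoly_gaussian d" ..
  have S': "?S \<in> sets (lborel \<Otimes>\<^sub>M hpoly_gaussian d)" using S by (simp add: sets_pair_measure_cong[OF refl sH])
  have area: "amoeba_area d Q = (\<integral>\<^sup>+x. indicator ?S (x, Q) \<partial>lborel)" if Q: "Q \<in> space (hpoly_gaussian d)" for Q
  proof -
    have m: "(\<lambda>x. (x, Q)) \<in> lborel \<rightarrow>\<^sub>M lborel \<Otimes>\<^sub>M ?B" using Q spH by (intro measurable_Pair2') auto
    have eq: "amoeba d Q = (\<lambda>x. (x, Q)) -` ?S \<inter> space lborel" using Q spH by (auto simp: space_pair_measure)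
    then have am: "amoeba d Q \<in> sets lborel" using measurable_sets[OF m S] by simp
    \<comment> \<open>The area is defined by the completed measure; on a Borel section the two
      measures agree, so Tonelli for Borel measures applies.\<close>
    have "amoeba_area d Q = emeasure lborel (amoeba d Q)" unfolding amoeba_area_def using am by simp
    also have "\<dots> = (\<integral>\<^sup>+x. indicator (amoeba d Q) x \<partial>lborel)" using am by simp
    also have "\<dots> = (\<integral>\<^sup>+x. indicator ?S (x, Q) \<partial>lborel)"
      using Q spH by (intro nn_integral_cong) (auto simp: indicator_def space_pair_measure)
    finally show ?thesis .
  qed
  have "expected_amoeba_area d = (\<integral>\<^sup>+Q. \<integral>\<^sup>+x. indicator ?S (x, Q) \<partial>lborel \<partial>hpoly_gaussian d)"
    unfolding expected_amoeba_area_def using area by (intro nn_integral_cong) auto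
  also have "\<dots> = (\<integral>\<^sup>+x. \<integral>\<^sup>+Q. indicator ?S (x, Q) \<partial>hpoly_gaussian d \<partial>lborel)"
    using S' by (intro P.Fubini') (simp add: case_prod_unfold)
  also have "\<dots> = (\<integral>\<^sup>+x. emeasure ?G {a \<in> space ?G. \<exists>\<theta>0 \<theta>1 \<theta>2. torus_poly d (moment0 x) (moment1 x) (moment2 x) a \<theta>0 \<theta>1 \<theta>2 = 0} \<partial>lborel)"
  proof (rule nn_integral_cong)
    fix x :: "real \<times> real"
    have m: "(\<lambda>Q. (x, Q)) \<in> ?B \<rightarrow>\<^sub>M lborel \<Otimes>\<^sub>M ?B" by (intro measurable_Pair1') auto
    have ms: "(\<lambda>Q. (x, Q)) -` ?S \<inter> space ?B \<in> sets ?B" by (rule measurable_sets[OF m S])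
    have "(\<integral>\<^sup>+Q. indicator ?S (x, Q) \<partial>hpoly_gaussian d) = (\<integral>\<^sup>+Q. indicator ((\<lambda>Q. (x, Q)) -` ?S \<inter> space ?B) Q \<partial>hpoly_gaussian d)"
      using spH by (intro nn_integral_cong) (auto simp: indicator_def)
    also have "\<dots> = emeasure (hpoly_gaussian d) ((\<lambda>Q. (x, Q)) -` ?S \<inter> space ?B)"
      using ms sH by (intro nn_integral_indicator) simp
    also have "\<dots> = emeasure ?G (monomial_coords d -` ((\<lambda>Q. (x, Q)) -` ?S \<inter> space ?B) \<inter> space ?G)"
      unfolding hpoly_gaussian_eq_distr by (rule emeasure_distr[OF measurable_monomial_coords(2) ms])
    also have "monomial_coords d -` ((\<lambda>Q. (x, Q)) -` ?S \<inter> space ?B) \<inter> space ?G =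
      {a \<in> space ?G. \<exists>\<theta>0 \<theta>1 \<theta>2. torus_poly d (moment0 x) (moment1 x) (moment2 x) a \<theta>0 \<theta>1 \<theta>2 = 0}"
      unfolding amoeba_monomial_coords_iff[symmetric]
      using measurable_space[OF measurable_monomial_coords(2)[of d]] by (auto simp: space_pair_measure)
    finally show "(\<integral>\<^sup>+Q. indicator ?S (x, Q) \<partial>hpoly_gaussian d) =
      emeasure ?G {a \<in> space ?G. \<exists>\<theta>0 \<theta>1 \<theta>2. torus_poly d (moment0 x) (moment1 x) (moment2 x) a \<theta>0 \<theta>1 \<theta>2 = 0}" .
  qed
  finally show ?thesis .
qed

section \<open>The upper bound\<close>

text \<open>Machin's formula with arctan (1/5) \<le> 1/5, dropping the negative term in arctan
  (1/239).\<close>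

lemma pi_le_16_5: "pi \<le> 16 / 5"
proof -
  have "0 - arctan 0 \<le> 1 / 5 - arctan (1 / 5 :: real)"
  proof (rule DERIV_nonneg_imp_nondecreasing[where f = "\<lambda>x. x - arctan x"])
    fix x :: real
    have "inverse (1 + x\<^sup>2) \<le> 1" by (simp add: inverse_le_1_iff)
    then show "\<exists>y. ((\<lambda>x. x - arctan x) has_real_derivative y) (at x) \<and> 0 \<le> y"
      by (intro exI[of _ "1 - inverse (1 + x\<^sup>2)"]) (auto intro!: derivative_eq_intros)
  qed simp
  moreover have "0 \<le> arctan (1 / 239 :: real)" by simp
  ultimately show ?thesis using machin unfolding arctan_zero_zero by linarith
qed

text \<open>The cube of 37/25, a lower bound for exp (2/5), already exceeds 16/5. The estimate
  decides whether the final constants fit below 9.\<close>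

lemma ln_pi_bounds: "0 \<le> ln pi" "ln pi \<le> 6 / 5"
proof -
  show "0 \<le> ln pi" using pi_gt3 by simp
  have "1 + 2 / 5 + (2 / 5)\<^sup>2 / 2 \<le> exp (2 / 5 :: real)" by (rule exp_lower_Taylor_quadratic) simp
  then have "(37 / 25) ^ 3 \<le> exp (2 / 5 :: real) ^ 3" by (intro power_mono) (simp_all add: power2_eq_square)
  also have "exp (2 / 5 :: real) ^ 3 = exp (6 / 5)" by (simp add: exp_of_nat_mult[symmetric])
  finally have "pi \<le> exp (6 / 5)" using pi_le_16_5 by (simp add: power3_eq_cube)
  then show "ln pi \<le> 6 / 5" using ln_le_cancel_iff[of pi "exp (6 / 5)"] by simp
qed

lemma nn_integral_exp_tail:
  fixes D a :: real
  assumes D: "D \<ge> 0"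
  shows "(\<integral>\<^sup>+v. ennreal (D * exp (- v)) * indicator {a..} v \<partial>lborel) = ennreal (D * exp (- a))"
proof -
  have lim: "((\<lambda>v. - (D * exp (- v))) \<longlongrightarrow> - (D * 0)) at_top"
    by (intro tendsto_intros filterlim_compose[OF exp_at_bot] filterlim_uminus_at_bot_at_top)
  have "(\<integral>\<^sup>+v. ennreal (D * exp (- v)) * indicator {a..} v \<partial>lborel) = ennreal (- (D * 0) - (- (D * exp (- a))))"
    by (rule nn_integral_FTC_atLeast[OF _ _ _ lim]) (use D in \<open>auto intro!: derivative_eq_intros\<close>)
  then show ?thesis by simp
qed

definition capped_exp :: "real \<Rightarrow> real \<Rightarrow> ennreal" where
  "capped_exp D s = min 1 (ennreal (D * exp (- s)))"

lemma measurable_capped_exp[measurable]: "capped_exp D \<in> borel_measurable borel"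
  unfolding capped_exp_def[abs_def] by measurable

text \<open>With L = ln D, the triangle u + v \<le> L on which the cap is used has area L^2 / 2.
  Beyond it every slice with u \<le> L has an exponential tail of mass 1, in total L, and the slices
  with u > L add 1.\<close>

lemma capped_exp_quadrant:
  assumes D: "D \<ge> 1"
  shows "(\<integral>\<^sup>+u. \<integral>\<^sup>+v. capped_exp D (u + v) * indicator {0..} u * indicator {0..} v \<partial>lborel \<partial>lborel) \<le> ennreal ((ln D)\<^sup>2 / 2 + ln D + 1)"
proof -
  define L where "L = ln D"
  have L: "L \<ge> 0" "exp L = D" using D by (auto simp: L_def)
  have inner: "(\<integral>\<^sup>+v. capped_exp D (u + v) * indicator {0..} u * indicator {0..} v \<partial>lborel) \<le>
     ennreal (L - u + 1) * indicator {0..L} u + ennreal (D * exp (- u)) * indicator {L..} u" for u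
  proof (cases "0 \<le> u")
    case u: True
    show ?thesis
    proof (cases "u \<le> L")
      case True
      have "(\<integral>\<^sup>+v. capped_exp D (u + v) * indicator {0..} u * indicator {0..} v \<partial>lborel) \<le>
        (\<integral>\<^sup>+v. indicator {0..L - u} v + ennreal (D * exp (- u) * exp (- v)) * indicator {L - u..} v \<partial>lborel)"
      proof (rule nn_integral_mono)
        fix v
        have "capped_exp D (u + v) \<le> 1" "capped_exp D (u + v) \<le> ennreal (D * exp (- u) * exp (- v))"
          by (auto simp: capped_exp_def mult_exp_exp algebra_simps intro!: min.coboundedI2)
        then show "capped_exp D (u + v) * indicator {0..} u * indicator {0..} v \<le>
           indicator {0..L - u} v + ennreal (D * exp (- u) * exp (- v)) * indicator {L - u..} v"
          by (auto simp: indicator_def add_increasing2)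
      qed
      also have "\<dots> = (\<integral>\<^sup>+v. indicator {0..L - u} v \<partial>lborel) + (\<integral>\<^sup>+v. ennreal (D * exp (- u) * exp (- v)) * indicator {L - u..} v \<partial>lborel)"
        by (rule nn_integral_add) measurable
      also have "(\<integral>\<^sup>+v. indicator {0..L - u} v \<partial>lborel) = ennreal (L - u)" using True by simp
      also have "(\<integral>\<^sup>+v. ennreal (D * exp (- u) * exp (- v)) * indicator {L - u..} v \<partial>lborel) = ennreal (D * exp (- u) * exp (- (L - u)))"
        using D by (intro nn_integral_exp_tail) simp
      also have "D * exp (- u) * exp (- (L - u)) = 1"
        unfolding L(2)[symmetric] by (simp add: mult_exp_exp)
      finally have "(\<integral>\<^sup>+v. capped_exp D (u + v) * indicator {0..} u * indicator {0..} v \<partial>lborel) \<le> ennreal (L - u + 1)"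
        using True by (simp add: ennreal_plus)
      then show ?thesis using True u by (simp add: add_increasing2)
    next
      case False
      have "(\<integral>\<^sup>+v. capped_exp D (u + v) * indicator {0..} u * indicator {0..} v \<partial>lborel) \<le>
        (\<integral>\<^sup>+v. ennreal (D * exp (- u) * exp (- v)) * indicator {0..} v \<partial>lborel)"
      proof (rule nn_integral_mono)
        fix v
        have "capped_exp D (u + v) \<le> ennreal (D * exp (- u) * exp (- v))"
          by (auto simp: capped_exp_def mult_exp_exp algebra_simps intro!: min.coboundedI2)
        then show "capped_exp D (u + v) * indicator {0..} u * indicator {0..} v \<le> ennreal (D * exp (- u) * exp (- v)) * indicator {0..} v"
          by (auto simp: indicator_def)
      qed
      also have "\<dots> = ennreal (D * exp (- u) * exp (- 0))" using D by (intro nn_integral_exp_tail) simp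
      finally show ?thesis using False by simp
    qed
  qed simp
  have "(\<integral>\<^sup>+u. \<integral>\<^sup>+v. capped_exp D (u + v) * indicator {0..} u * indicator {0..} v \<partial>lborel \<partial>lborel) \<le>
     (\<integral>\<^sup>+u. ennreal (L - u + 1) * indicator {0..L} u + ennreal (D * exp (- u)) * indicator {L..} u \<partial>lborel)"
    by (intro nn_integral_mono inner)
  also have "\<dots> = (\<integral>\<^sup>+u. ennreal (L - u + 1) * indicator {0..L} u \<partial>lborel) + (\<integral>\<^sup>+u. ennreal (D * exp (- u)) * indicator {L..} u \<partial>lborel)"
    by (rule nn_integral_add) measurable
  also have "(\<integral>\<^sup>+u. ennreal (L - u + 1) * indicator {0..L} u \<partial>lborel) = ennreal ((L * L - L\<^sup>2 / 2 + L) - (L * 0 - 0\<^sup>2 / 2 + 0))"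
    by (rule nn_integral_FTC_Icc[where F = "\<lambda>u. L * u - u\<^sup>2 / 2 + u"]) (use L in \<open>auto intro!: derivative_eq_intros\<close>)
  also have "(\<integral>\<^sup>+u. ennreal (D * exp (- u)) * indicator {L..} u \<partial>lborel) = ennreal (D * exp (- L))"
    using D by (intro nn_integral_exp_tail) simp
  also have "D * exp (- L) = 1" unfolding L(2)[symmetric] by (simp add: mult_exp_exp)
  also have "ennreal ((L * L - L\<^sup>2 / 2 + L) - (L * 0 - 0\<^sup>2 / 2 + 0)) + ennreal 1 = ennreal (L\<^sup>2 / 2 + L + 1)"
    using L by (subst ennreal_plus[symmetric]) (auto simp: power2_eq_square)
  finally show ?thesis by (simp add: L_def)
qed

text \<open>The sum 1 + exp (2 x1) + exp (2 x2) is at least its largest term exp (2 M), and the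
  product of the weights is exp (2 x1 + 2 x2) times the cube of \<open>moment0\<close>.\<close>

lemma sqrt_moment_le:
  "sqrt (moment0 x * moment1 x * moment2 x) \<le> exp (- (3 * max 0 (max (fst x) (snd x)) - fst x - snd x))"
proof (rule real_le_lsqrt)
  define M where "M = max 0 (max (fst x) (snd x))"
  have M: "exp (2 * M) \<le> 1 + exp (2 * fst x) + exp (2 * snd x)"
  proof -
    have "M = 0 \<or> M = fst x \<or> M = snd x" by (auto simp: M_def max_def)
    then show ?thesis
      using exp_gt_zero[of "2 * fst x"] exp_gt_zero[of "2 * snd x"] by (elim disjE) (hypsubst, simp add: add_nonneg_nonneg)+
  qed
  have "moment0 x \<le> 1 / exp (2 * M)"
    unfolding moment0_def using M by (intro divide_left_mono) (auto intro!: mult_pos_pos add_pos_pos)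
  then have m0: "moment0 x \<le> exp (- (2 * M))" by (simp add: exp_minus field_simps)
  have "moment0 x * moment1 x * moment2 x = exp (2 * fst x) * exp (2 * snd x) * moment0 x ^ 3"
    by (simp add: moment1_def moment2_def power3_eq_cube)
  also have "\<dots> \<le> exp (2 * fst x) * exp (2 * snd x) * exp (- (2 * M)) ^ 3"
    using moment_simplex(1)[of x] m0 by (intro mult_left_mono power_mono) auto
  also have "\<dots> = (exp (- (3 * M - fst x - snd x)))\<^sup>2"
    by (simp add: exp_of_nat_mult[symmetric] mult_exp_exp power2_eq_square)
  finally show "moment0 x * moment1 x * moment2 x \<le> (exp (- (3 * max 0 (max (fst x) (snd x)) - fst x - snd x)))\<^sup>2"
    unfolding M_def .
qed (use moment_simplex[of x] in auto)

text \<open>With M the maximum of 0, x1, x2, the exponent 3 M - x1 - x2 is the sum of the two gaps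
  from M to the other entries. On each chamber these gaps are coordinates on a quadrant with
  determinant 1 or -1, so the three chambers give the same integral.\<close>

lemma expected_amoeba_area_upper:
  assumes d: "d > 0"
  shows "expected_amoeba_area d \<le> ennreal (3 * ((ln (pi * d))\<^sup>2 / 2 + ln (pi * d) + 1))"
proof -
  define D where "D = pi * real d"
  have D: "D \<ge> 1"
  proof -
    have "1 * 1 \<le> pi * real d" using d pi_gt3 by (intro mult_mono) auto
    then show ?thesis by (simp add: D_def)
  qed
  let ?q = "\<lambda>u v. capped_exp D (u + v) * indicator {0..} u * indicator {0..} v"
  let ?J = "\<integral>\<^sup>+u. \<integral>\<^sup>+v. ?q u v \<partial>lborel \<partial>lborel"
  have le: "emeasure (gauss_PiM (exponents d)) {a \<in> space (gauss_PiM (exponents d)).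
     \<exists>\<theta>0 \<theta>1 \<theta>2. torus_poly d (moment0 x) (moment1 x) (moment2 x) a \<theta>0 \<theta>1 \<theta>2 = 0} \<le>
     ?q (- fst x) (- snd x) + (?q (fst x) (fst x - snd x) + ?q (snd x) (snd x - fst x))" (is "?P \<le> _") for x
  proof -
    interpret G: prob_space "gauss_PiM (exponents d)" by (rule prob_space_gauss_PiM)
    let ?g = "3 * max 0 (max (fst x) (snd x)) - fst x - snd x"
    have "?P \<le> ennreal (pi * (real d * sqrt (moment0 x * moment1 x * moment2 x)))"
      by (rule torus_zero_probability_le(2)[OF d moment_simplex])
    also have "\<dots> \<le> ennreal (D * exp (- ?g))"
      using mult_left_mono[OF sqrt_moment_le[of x], of D] D by (intro ennreal_leI) (simp add: D_def mult.assoc)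
    finally have P: "?P \<le> capped_exp D ?g" unfolding capped_exp_def using G.emeasure_le_1 by simp
    consider "fst x \<le> 0" "snd x \<le> 0" | "0 \<le> fst x" "snd x \<le> fst x" | "0 \<le> snd x" "fst x \<le> snd x" by linarith
    then show ?thesis
    proof cases
      case 1
      then have "?g = - fst x + - snd x" by (simp add: max_def)
      with P 1 show ?thesis by (simp add: add_increasing2)
    next
      case 2
      then have "?g = fst x + (fst x - snd x)" by (simp add: max_def)
      with P 2 have "?P \<le> ?q (fst x) (fst x - snd x)" by simp
      then show ?thesis by (simp add: add_increasing add_increasing2)
    next
      case 3
      then have "?g = snd x + (snd x - fst x)" by (simp add: max_def)
      with P 3 have "?P \<le> ?q (snd x) (snd x - fst x)" by simp
      then show ?thesis by (simp add: add_increasing)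
    qed
  qed
  have refl: "(\<integral>\<^sup>+y. f (t - y) \<partial>lborel) = (\<integral>\<^sup>+y. f y \<partial>lborel)" if "f \<in> borel_measurable borel" for f :: "real \<Rightarrow> ennreal" and t
    using nn_integral_real_affine[OF that, of "- 1" t] by simp
  have plane: "(\<integral>\<^sup>+x. f (fst x) (snd x) \<partial>lborel) = (\<integral>\<^sup>+y. \<integral>\<^sup>+z. f y z \<partial>lborel \<partial>lborel)"
    if "(\<lambda>x. f (fst x) (snd x)) \<in> borel_measurable borel" for f :: "real \<Rightarrow> real \<Rightarrow> ennreal"
  proof -
    have "(\<lambda>x. f (fst x) (snd x)) \<in> borel_measurable (lborel \<Otimes>\<^sub>M lborel)" using that by (simp add: lborel_prod)
    from lborel.nn_integral_fst[OF this] show ?thesis by (simp add: lborel_prod)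
  qed
  have [measurable]: "fst \<in> borel_measurable (borel :: (real \<times> real) measure)" "snd \<in> borel_measurable (borel :: (real \<times> real) measure)"
    by (intro borel_measurable_continuous_onI continuous_intros)+
  have m1: "(\<lambda>x. ?q (- fst x) (- snd x)) \<in> borel_measurable (borel :: (real \<times> real) measure)"
    and m2: "(\<lambda>x. ?q (fst x) (fst x - snd x)) \<in> borel_measurable (borel :: (real \<times> real) measure)"
    and m3: "(\<lambda>x. ?q (snd x) (snd x - fst x)) \<in> borel_measurable (borel :: (real \<times> real) measure)"
    by measurable
  have mq: "?q u \<in> borel_measurable borel" for u by measurable
  have mJ: "(\<lambda>u. \<integral>\<^sup>+v. ?q u v \<partial>lborel) \<in> borel_measurable borel" by measurable
  have i1: "(\<integral>\<^sup>+x. ?q (- fst x) (- snd x) \<partial>lborel) = ?J"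
  proof -
    have "(\<integral>\<^sup>+z. ?q (- y) (- z) \<partial>lborel) = (\<integral>\<^sup>+z. ?q (- y) z \<partial>lborel)" for y
      using refl[OF mq, of "- y" 0] by (simp only: diff_0)
    moreover have "(\<integral>\<^sup>+y. \<integral>\<^sup>+z. ?q (- y) z \<partial>lborel \<partial>lborel) = ?J"
      using refl[OF mJ, of 0] by (simp only: diff_0)
    ultimately show ?thesis unfolding plane[OF m1] by (simp only:)
  qed
  have i2: "(\<integral>\<^sup>+x. ?q (fst x) (fst x - snd x) \<partial>lborel) = ?J"
    unfolding plane[OF m2] by (simp only: refl[OF mq])
  have i3: "(\<integral>\<^sup>+x. ?q (snd x) (snd x - fst x) \<partial>lborel) = ?J"
  proof -
    have "(\<integral>\<^sup>+x. ?q (snd x) (snd x - fst x) \<partial>lborel) = (\<integral>\<^sup>+y. \<integral>\<^sup>+z. ?q z (z - y) \<partial>lborel \<partial>lborel)"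
      by (rule plane[OF m3])
    also have "\<dots> = (\<integral>\<^sup>+z. \<integral>\<^sup>+y. ?q z (z - y) \<partial>lborel \<partial>lborel)"
      by (rule lborel_pair.Fubini') measurable
    finally show ?thesis by (simp only: refl[OF mq])
  qed
  have "expected_amoeba_area d \<le> (\<integral>\<^sup>+x. ?q (- fst x) (- snd x) + (?q (fst x) (fst x - snd x) + ?q (snd x) (snd x - fst x)) \<partial>lborel)"
    unfolding expected_amoeba_area_eq by (intro nn_integral_mono le)
  also have "\<dots> = ?J + (?J + ?J)"
  proof -
    have m: "f \<in> borel_measurable lborel" if "f \<in> borel_measurable borel" for f :: "real \<times> real \<Rightarrow> ennreal"
      using that by simp
    show ?thesis
      unfolding nn_integral_add[OF m[OF m1] borel_measurable_add[OF m[OF m2] m[OF m3]]] nn_integral_add[OF m[OF m2] m[OF m3]] i1 i2 i3 ..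
  qed
  also have "\<dots> \<le> ennreal ((ln D)\<^sup>2 / 2 + ln D + 1) + (ennreal ((ln D)\<^sup>2 / 2 + ln D + 1) + ennreal ((ln D)\<^sup>2 / 2 + ln D + 1))"
    by (intro add_mono capped_exp_quadrant D)
  also have "\<dots> = ennreal (3 * ((ln D)\<^sup>2 / 2 + ln D + 1))"
    using D by (simp flip: ennreal_plus)
  finally show ?thesis by (simp add: D_def)
qed

text \<open>Expanding ln (pi d), the linear coefficient is 3 + 3 ln pi and the constant 3 + 3 ln pi
  + 3/2 (ln pi)^2; with ln pi \<le> 6/5 they are at most 33/5 and 219/25, both below 9.\<close>

lemma expected_amoeba_area_le:
  assumes d: "d > 0"
  shows "expected_amoeba_area d \<le> ennreal (3 / 2 * (ln (real d))\<^sup>2 + 9 * ln (real d) + 9)"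
proof -
  define l p where "l = ln (real d)" and "p = ln pi"
  have l: "l \<ge> 0" using d by (simp add: l_def)
  have p: "0 \<le> p" "p \<le> 6 / 5" using ln_pi_bounds by (auto simp: p_def)
  have "ln (pi * d) = p + l" using d by (simp add: ln_mult l_def p_def)
  moreover have "3 * ((p + l)\<^sup>2 / 2 + (p + l) + 1) \<le> 3 / 2 * l\<^sup>2 + 9 * l + 9"
  proof -
    have "p * p \<le> 6 / 5 * (6 / 5)" using p by (intro mult_mono) auto
    moreover have "p * l \<le> 6 / 5 * l" using p l by (intro mult_right_mono) auto
    moreover have "3 * ((p + l)\<^sup>2 / 2 + (p + l) + 1) = 3 / 2 * l\<^sup>2 + 3 * (p * l) + 3 / 2 * (p * p) + 3 * p + 3 * l + 3"
      by (simp add: power2_eq_square algebra_simps)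
    ultimately show ?thesis using p l by linarith
  qed
  ultimately show ?thesis
    unfolding l_def[symmetric] using expected_amoeba_area_upper[OF d] by (metis ennreal_leI order_trans)
qed

section \<open>The lower bound\<close>

text \<open>The points at which 0, x1, x2, half the logarithms of the weights up to a common
  constant, differ pairwise by at most \<open>L\<close>.\<close>

definition hexagon :: "real \<Rightarrow> (real \<times> real) set" where
  "hexagon L = {x. \<bar>fst x\<bar> \<le> L \<and> \<bar>snd x\<bar> \<le> L \<and> \<bar>fst x - snd x\<bar> \<le> L}"

lemma hexagon_closed: "closed (hexagon L)"
  unfolding hexagon_def by (intro closed_Collect_conj closed_Collect_le continuous_intros)

lemma emeasure_hexagon:
  assumes L: "L \<ge> 0"
  shows "emeasure lborel (hexagon L) = ennreal (3 * L\<^sup>2)"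
proof -
  have meas: "hexagon L \<in> sets (lborel \<Otimes>\<^sub>M lborel)"
    unfolding lborel_prod using borel_closed[OF hexagon_closed] by simp
  have "emeasure lborel (hexagon L) = emeasure (lborel \<Otimes>\<^sub>M lborel) (hexagon L)" by (simp only: lborel_prod)
  also have "\<dots> = (\<integral>\<^sup>+y. emeasure lborel (Pair y -` hexagon L) \<partial>lborel)"
    by (rule lborel.emeasure_pair_measure_alt[OF meas])
  also have "\<dots> = (\<integral>\<^sup>+y. ennreal (2 * L + y) * indicator {- L..0} y + ennreal (2 * L - y) * indicator {0..L} y \<partial>lborel)"
  \<comment> \<open>The two pieces of the slice length overlap at y = 0, where their sum counts the
    slice twice; that point is a null set.\<close>
  proof (rule nn_integral_cong_AE, rule eventually_mono[OF AE_lborel_singleton[of 0]])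
    fix y :: real assume y: "y \<noteq> 0"
    show "emeasure lborel (Pair y -` hexagon L) = ennreal (2 * L + y) * indicator {- L..0} y + ennreal (2 * L - y) * indicator {0..L} y"
    proof (cases "\<bar>y\<bar> \<le> L")
      case False
      then have "Pair y -` hexagon L = {}" by (auto simp: hexagon_def)
      then show ?thesis using False by (auto simp: indicator_def)
    next
      case True
      then have eq: "Pair y -` hexagon L = {max (- L) (y - L)..min L (y + L)}" by (auto simp: hexagon_def)
      consider "y < 0" | "y > 0" using y by linarith
      then show ?thesis
      proof cases
        case 1
        then show ?thesis using True by (simp add: eq indicator_def max_def min_def)
      next
        case 2
        then show ?thesis using True by (simp add: eq indicator_def max_def min_def)
      qed
    qed
  qed
  also have "\<dots> = (\<integral>\<^sup>+y. ennreal (2 * L + y) * indicator {- L..0} y \<partial>lborel) + (\<integral>\<^sup>+y. ennreal (2 * L - y) * indicator {0..L} y \<partial>lborel)"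
    by (rule nn_integral_add) measurable
  also have "(\<integral>\<^sup>+y. ennreal (2 * L + y) * indicator {- L..0} y \<partial>lborel) = ennreal ((2 * L * 0 + 0\<^sup>2 / 2) - (2 * L * (- L) + (- L)\<^sup>2 / 2))"
    by (rule nn_integral_FTC_Icc[where F = "\<lambda>y. 2 * L * y + y\<^sup>2 / 2"]) (use L in \<open>auto intro!: derivative_eq_intros\<close>)
  also have "(\<integral>\<^sup>+y. ennreal (2 * L - y) * indicator {0..L} y \<partial>lborel) = ennreal ((2 * L * L - L\<^sup>2 / 2) - (2 * L * 0 - 0\<^sup>2 / 2))"
    by (rule nn_integral_FTC_Icc[where F = "\<lambda>y. 2 * L * y - y\<^sup>2 / 2"]) (use L in \<open>auto intro!: derivative_eq_intros\<close>)
  also have "ennreal ((2 * L * 0 + 0\<^sup>2 / 2) - (2 * L * (- L) + (- L)\<^sup>2 / 2)) + ennreal ((2 * L * L - L\<^sup>2 / 2) - (2 * L * 0 - 0\<^sup>2 / 2))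
     = ennreal (3 * L\<^sup>2)"
    using L by (subst ennreal_plus[symmetric]) (auto simp: power2_eq_square)
  finally show ?thesis .
qed

text \<open>The denominator is at most three times its largest term, and on the hexagon that term
  exceeds any other by a factor of at most exp (2 L).\<close>

lemma moment_hexagon_ge:
  assumes x: "x \<in> hexagon L"
  shows "moment0 x \<ge> exp (- (2 * L)) / 3" "moment1 x \<ge> exp (- (2 * L)) / 3" "moment2 x \<ge> exp (- (2 * L)) / 3"
proof -
  define S where "S = 1 + exp (2 * fst x) + exp (2 * snd x)"
  have S: "S > 0" by (simp add: S_def add_pos_pos)
  have xs: "0 \<le> 2 * L" "2 * fst x \<le> 2 * L" "2 * snd x \<le> 2 * L" "0 \<le> 2 * L + 2 * fst x" "2 * snd x \<le> 2 * L + 2 * fst x"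
     "0 \<le> 2 * L + 2 * snd x" "2 * fst x \<le> 2 * L + 2 * snd x" "2 * fst x \<le> 2 * L + 2 * fst x" "2 * snd x \<le> 2 * L + 2 * snd x"
    using x by (auto simp: hexagon_def)
  have le3: "S \<le> 3 * exp y" if "0 \<le> y" "2 * fst x \<le> y" "2 * snd x \<le> y" for y
  proof -
    have "1 \<le> exp y" "exp (2 * fst x) \<le> exp y" "exp (2 * snd x) \<le> exp y"
      using that by (simp_all only: one_le_exp_iff exp_le_cancel_iff)
    then show ?thesis unfolding S_def by linarith
  qed
  have ge: "exp (- (2 * L)) / 3 \<le> exp z / S" if "S \<le> 3 * exp (2 * L + z)" for z
  proof -
    have "exp (- (2 * L)) * S \<le> exp (- (2 * L)) * (3 * exp (2 * L + z))" using that by (intro mult_left_mono) auto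
    also have "\<dots> = 3 * exp z" by (simp add: mult_exp_exp)
    finally show ?thesis using S by (simp add: field_simps)
  qed
  show "moment0 x \<ge> exp (- (2 * L)) / 3" using ge[of 0] le3[of "2 * L"] xs by (simp add: moment0_def S_def)
  show "moment1 x \<ge> exp (- (2 * L)) / 3"
    using ge[of "2 * fst x"] le3[of "2 * L + 2 * fst x"] xs by (simp add: moment1_def moment0_def S_def)
  show "moment2 x \<ge> exp (- (2 * L)) / 3"
    using ge[of "2 * snd x"] le3[of "2 * L + 2 * snd x"] xs by (simp add: moment2_def moment0_def S_def)
qed

text \<open>The same \<open>e\<close> is the exponent of the hexagon and the tolerated probability
  of no zero: the area contributes (1 - e)^2 and the probability the third factor 1 - e.\<close>

lemma expected_amoeba_area_ge:
  fixes e :: real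
  assumes e: "0 < e" "e < 1"
  shows "eventually (\<lambda>d. ennreal (3 / 4 * (1 - e) ^ 3 * (ln (real d))\<^sup>2) \<le> expected_amoeba_area d) sequentially"
proof -
  obtain d0 where d0: "\<And>d t0 t1 t2. d0 \<le> d \<Longrightarrow> t0 + t1 + t2 = 1 \<Longrightarrow> real d * t0 \<ge> real d powr e / 3 \<Longrightarrow> real d * t1 \<ge> real d powr e / 3 \<Longrightarrow>
     real d * t2 \<ge> real d powr e / 3 \<Longrightarrow>
     emeasure (gauss_PiM (exponents d)) {a \<in> space (gauss_PiM (exponents d)). \<forall>\<theta>0 \<theta>1 \<theta>2. torus_poly d t0 t1 t2 a \<theta>0 \<theta>1 \<theta>2 \<noteq> 0} \<le> ennreal e"
    using no_zero_probability_torus[OF e(1) e(1)] by (elim exE) blast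
  show ?thesis
  proof (rule eventually_mono[OF eventually_ge_at_top[of "max d0 1"]])
    fix d assume d: "d \<ge> max d0 1"
    then have dp: "d > 0" by simp
    let ?G = "gauss_PiM (exponents d)"
    interpret G: prob_space ?G by (rule prob_space_gauss_PiM)
    \<comment> \<open>Chosen so that d exp (- 2 L) = d^e, hence each d times weight is at least d^e
      / 3 on the hexagon.\<close>
    define L where "L = (1 - e) * ln (real d) / 2"
    have L: "L \<ge> 0" using e dp by (simp add: L_def)
    have dL: "real d * (exp (- (2 * L)) / 3) = real d powr e / 3"
    proof -
      have "real d = exp (ln (real d))" using dp by simp
      then have "real d * exp (- (2 * L)) = exp (ln (real d) + - (2 * L))" unfolding exp_add by (simp only:)
      also have "ln (real d) + - (2 * L) = e * ln (real d)" by (simp add: L_def field_simps)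
      finally show ?thesis using dp by (simp add: powr_def)
    qed
    have P: "ennreal (1 - e) * indicator (hexagon L) x \<le> emeasure ?G {a \<in> space ?G.
        \<exists>\<theta>0 \<theta>1 \<theta>2. torus_poly d (moment0 x) (moment1 x) (moment2 x) a \<theta>0 \<theta>1 \<theta>2 = 0}" (is "_ \<le> emeasure ?G ?Z") for x
    proof (cases "x \<in> hexagon L")
      case True
      let ?N = "{a \<in> space ?G. \<forall>\<theta>0 \<theta>1 \<theta>2. torus_poly d (moment0 x) (moment1 x) (moment2 x) a \<theta>0 \<theta>1 \<theta>2 \<noteq> 0}"
      have Z: "?Z \<in> sets ?G" by (rule torus_zero_probability_le(1)[OF dp moment_simplex])
      have N: "?N = space ?G - ?Z" by auto
      have t: "real d * moment0 x \<ge> real d powr e / 3" "real d * moment1 x \<ge> real d powr e / 3" "real d * moment2 x \<ge> real d powr e / 3"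
        unfolding dL[symmetric] by (intro mult_left_mono moment_hexagon_ge[OF True] of_nat_0_le_iff)+
      have "emeasure ?G ?N \<le> ennreal e" using d t by (intro d0 moment_simplex) auto
      then have "1 - ennreal e \<le> 1 - emeasure ?G ?N" by (rule ennreal_mono_minus)
      also have "1 - emeasure ?G ?N = emeasure ?G (space ?G - ?N)"
        using Z unfolding N by (subst emeasure_compl) (auto simp: G.emeasure_space_1)
      also have "space ?G - ?N = ?Z" by auto
      finally have le: "1 - ennreal e \<le> emeasure ?G ?Z" .
      have "1 - ennreal e = ennreal (1 - e)" using e by (simp add: ennreal_minus flip: ennreal_1)
      with le show ?thesis using True by simp
    qed simp
    have "ennreal (3 / 4 * (1 - e) ^ 3 * (ln (real d))\<^sup>2) = ennreal (1 - e) * ennreal (3 * L\<^sup>2)"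
      using e by (subst ennreal_mult[symmetric]) (auto simp: L_def power2_eq_square power3_eq_cube intro!: arg_cong[where f = ennreal])
    also have "\<dots> = (\<integral>\<^sup>+x. ennreal (1 - e) * indicator (hexagon L) x \<partial>lborel)"
      unfolding emeasure_hexagon[OF L, symmetric]
      using borel_closed[OF hexagon_closed] by (subst nn_integral_cmult_indicator) auto
    also have "\<dots> \<le> expected_amoeba_area d"
      unfolding expected_amoeba_area_eq by (intro nn_integral_mono P)
    finally show "ennreal (3 / 4 * (1 - e) ^ 3 * (ln (real d))\<^sup>2) \<le> expected_amoeba_area d" .
  qed
qed

theorem theorem1p1:
  "(\<forall>d::nat. d > 0 \<longrightarrow>
      expected_amoeba_area d \<le> ennreal (3 / 2 * (ln (real d))\<^sup>2 + 9 * ln (real d) + 9))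
   \<and> liminf (\<lambda>d. expected_amoeba_area d / ennreal ((ln (real d))\<^sup>2)) \<ge> ennreal (3 / 4)"
proof (intro conjI allI impI expected_amoeba_area_le)
  let ?l = "liminf (\<lambda>d. expected_amoeba_area d / ennreal ((ln (real d))\<^sup>2))"
  have ge: "ennreal (3 / 4 * (1 - e) ^ 3) \<le> ?l" if e: "0 < e" "e < 1" for e
  proof (rule Liminf_bounded, rule eventually_mono[OF eventually_conj[OF expected_amoeba_area_ge[OF e] eventually_gt_at_top[of 1]]])
    fix d :: nat
    assume d: "ennreal (3 / 4 * (1 - e) ^ 3 * (ln (real d))\<^sup>2) \<le> expected_amoeba_area d \<and> 1 < d"
    then have l: "(ln (real d))\<^sup>2 > 0" by simp
    have "ennreal (3 / 4 * (1 - e) ^ 3) = ennreal (3 / 4 * (1 - e) ^ 3 * (ln (real d))\<^sup>2) / ennreal ((ln (real d))\<^sup>2)"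
      using l e by (subst divide_ennreal) auto
    also have "\<dots> \<le> expected_amoeba_area d / ennreal ((ln (real d))\<^sup>2)"
      using d by (intro divide_right_mono_ennreal) simp
    finally show "ennreal (3 / 4 * (1 - e) ^ 3) \<le> expected_amoeba_area d / ennreal ((ln (real d))\<^sup>2)" .
  qed
  \<comment> \<open>The lower limit does not depend on \<open>e\<close>, which now tends to 0 along
    1 / (n + 2); the shift by 2 keeps it strictly between 0 and 1.\<close>
  have "(\<lambda>n::nat. 3 / 4 * (1 - 1 / real (n + 2)) ^ 3) \<longlonglongrightarrow> 3 / 4" by real_asymp
  then have "(\<lambda>n::nat. ennreal (3 / 4 * (1 - 1 / real (n + 2)) ^ 3)) \<longlonglongrightarrow> ennreal (3 / 4)" by (rule tendsto_ennrealI)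
  then show "ennreal (3 / 4) \<le> ?l"
    by (rule LIMSEQ_le_const2) (intro exI[of _ 0] allI impI ge; simp)
qed

end
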